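(* Let $G=\mathrm{Res}_{\mathbb F_{q^d}/\mathbb F_q}\mathrm{GL}_n$. If $\mu$ is minuscule and $\gamma$ is basic (i.e. its Newton point $\nu_G(\gamma)$ is central for $G$), with $\mu$ and $\gamma$ normalized as in the context, then there is a decomposition $$X_\mu^G(\gamma)=\bigsqcup_A \mathcal L(A),$$ where $A$ ranges over all semi-modules of Hodge type $\mu$, and $\mathcal L(A)\subseteq X_\mu^G(\gamma)$ is a locally closed subset, which is finite and smooth over an affine space.
   Context: Let $q$ be a prime power, $\mathbf k$ an algebraic closure of $\mathbb F_q$, $L=\mathbf k((t))$, $\mathcal O=\mathbf k[[t]]$, and $\sigma$ the Frobenius of $L$ over $\mathbb F_q((t))$ (raising coefficients to the $q$-th power). Fix $d,n\ge 1$, $\mathbb Z_d=\mathbb Z/d\mathbb Z$. For $\tau\in\mathbb Z_d$ let $N_\tau=\bigoplus_{i=1}^n L e_{\tau,i}$, with the convention $e_{\tau,i+n}=te_{\tau,i}$ for $i\in\mathbb Z$. Then $G(L)=\prod_{\tau}\mathrm{GL}(N_\tau)$. Let $\sigma$ also denote the $\sigma$-semilinear bijection of $\bigoplus_\tau N_\tau$ with $e_{\tau,i}\mapsto e_{\tau-1,i}$ and the induced automorphism $g\mapsto \sigma g\sigma^{-1}$ of $G(L)$. A cocharacter $\mu=(\mu_\tau)_\tau\in(\mathbb Z^n)^{\mathbb Z_d}$ is dominant if each $\mu_\tau(1)\ge\dots\ge\mu_\tau(n)$; a dominant $\mu$ is minuscule if $\mu_\tau(1)-\mu_\tau(n)\le1$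 for all $\tau$. Here $\mu$ is a fixed dominant minuscule cocharacter. With $\Delta_\tau=\bigoplus_{i=1}^n\mathcal O e_{\tau,i}$ and $K=\prod_\tau \mathrm{GL}(\Delta_\tau)$, points of $G(L)/K$ are tuples $\Lambda=(\Lambda_\tau)_\tau$ of $\mathcal O$-lattices $\Lambda_\tau\subset N_\tau$ (via $gK\mapsto g\Delta$). The affine Deligne–Lusztig variety is $X_\mu^G(\gamma)=\{gK: g^{-1}\gamma\sigma(g)\in Kt^\mu K\}$, a locally closed subscheme, locally of finite type, of the affine Grassmannian. Up to isomorphism it depends only on the $\sigma$-conjugacy class of $\gamma$. The basic element $\gamma$ is taken in the following form: for some $m\in\mathbb Z_{\ge0}$, $\gamma(e_{0,i})=e_{0,i+m}$ and $\gamma(e_{\tau,i})=e_{\tau,i}$ for $\tau\ne0$. Semi-modules. Let $O=\mathbb Z_d\times\mathbb Z$, with $(\tau,i)\le(\tau',i')$ iff $\tau=\tau'$ and $i\le i'$; $(\tau,i)+k=(\tau,i+k)$; $e_{(\tau,i)}=e_{\tau,i}$. Define $f:O\to O$ by $f(1,i)=(0,i+m)$ and $f(\tau,i)=(\tau-1,i)$ for $\tau\neq1$, so $\gamma\sigma(e_a)=e_{f(a)}$. Let $h=\gcd(m,n)$; for $E\subseteq O$ put $E_\tau=E\cap(\{\tau\}\times\mathbb Z)$, $E^k=\{(\tau,j)\in E: j\equiv k \bmod h\}$, $E^k_\tau=E^k\cap E_\tau$. A semi-module is a subset $A\subseteq O$, bounded below, with $n+A\subseteq A$, $f(A)\subseteq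 A$ and $n\mathbb Z+A=O$. Put $\bar A=A\setminus(n+A)$; for $a\in A$ let $\varphi_A(a)\in\mathbb Z$ be such that $f(a)-n\varphi_A(a)\in\bar A$; let $r_A:\bar A\to\bar A$ be the bijection $b\mapsto f(b)-n\varphi_A(b)$. $A$ is of Hodge type $\mu$ if, for every $\tau$, $(\mu_\tau(i))_{1\le i\le n}$ is a permutation of $(\varphi_A(b))_{b\in\bar A_{\tau+1}}$. Strata. Let $A$ be a semi-module of Hodge type $\mu$ and $\iota\in\mathbb Z_d$. Let $Y_\iota=\{\max\bar A^k_\iota:1\le k\le h\}$, $V(A)=\{(b,j)\in\bar A\times\mathbb Z_{\ge1}: b+j\in\bar A,\ \varphi_A(b)>\varphi_A(b+j)\}$, $W(A,\iota)=\{(b,j)\in Y_\iota\times\mathbb Z_{\ge1}: b+j\notin A\}$, $D(A,\iota)=V(A)\sqcup W(A,\iota)$. For $x\in\mathbb A^{D(A,\iota)}$ there is a unique family $(v(a))_{a\in A}$ with: $v(a)=\sum_{j\ge0}\alpha_{a,j}e_{a+j}$, $\alpha_{a,j}\in\mathbf k$, $\alpha_{a,0}=1$; $v(b)=e_b+\sum_{(b,j)\in W(A,\iota)}x_{b,j}e_{b+j}+\sum_{(b,j)\in V(A)}x_{b,j}v(b+j)$ for $b\in Y_\iota$; $v(b)=t^{-\varphi_A(r_A^{-1}(b))}\gamma\sigma(v(r_A^{-1}(b)))+\sum_{(b,j)\in V(A)}x_{b,j}v(b+j)$ for $b\in\bar A\setminus Y_\iota$; $v(a)=tv(a-n)$ for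 $a\in n+A$. Let $\Lambda(x)=(\Lambda_\tau(x))_\tau$, where $\Lambda_\tau(x)$ is the $\mathcal O$-lattice spanned by $v(b)$, $b\in\bar A_\tau$. Let $\mathcal L(A,\iota)\subseteq\mathbb A^{D(A,\iota)}$ be the set of those $x$ with $t^{-\varphi_A(b)}\gamma\sigma(v(b))\in\Lambda(x)$ for all $b\in\bar A$. The map $x\mapsto\Lambda(x)$ is injective on $\mathcal L(A,\iota)$ with image in $X_\mu^G(\gamma)$; $\mathcal L(A)$ denotes $\mathcal L(A,\iota)$ regarded as a subset of $X_\mu^G(\gamma)$ in this way (it does not depend on $\iota$).
   Formalization: The formal theorem also assumes that all entries of μ are nonnegative; without this the claim fails (n=1, d=2, m=0, μ=(1,−1): the variety is nonempty, but f(A)⊆A forces φ_A≥0, so no semi-module has Hodge type μ). *)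

theory Defs
  imports
    "HOL-Analysis.Abstract_Topology"
    "HOL-Library.Cardinality"
    "HOL-Library.Disjoint_Sets"
    "HOL-Computational_Algebra.Formal_Laurent_Series"
    "HOL-Algebra.Algebraic_Closure_Type"
    "Jordan_Normal_Form.Gauss_Jordan_Elimination"
begin

section \<open>Classical algebraic geometry on affine spaces\<close>

text \<open>
  Varieties are identified with their sets of closed points, the ground field being algebraically
  closed. The coordinates are indexed by a set \<open>D\<close> (possibly infinite), and points
  are functions that vanish off \<open>D\<close>.
\<close>

definition affine_space :: "'v set \<Rightarrow> ('v \<Rightarrow> 'k::zero) set" where
  "affine_space D = {x. \<forall>i. i \<notin> D \<longrightarrow> x i = 0}"

inductive_set polyfun :: "'v set \<Rightarrow> (('v \<Rightarrow> 'k::comm_ring_1) \<Rightarrow> 'k) set" for D :: "'v set" where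
  const: "(\<lambda>x. c) \<in> polyfun D"
| var: "i \<in> D \<Longrightarrow> (\<lambda>x. x i) \<in> polyfun D"
| add: "P \<in> polyfun D \<Longrightarrow> Q \<in> polyfun D \<Longrightarrow> (\<lambda>x. P x + Q x) \<in> polyfun D"
| mult: "P \<in> polyfun D \<Longrightarrow> Q \<in> polyfun D \<Longrightarrow> (\<lambda>x. P x * Q x) \<in> polyfun D"

text \<open>
  The partial derivative of a polynomial function is the formal one, read off from the univariate
  polynomial obtained by varying one coordinate; that polynomial is unique over an infinite field.
\<close>

definition partial_deriv :: "'v \<Rightarrow> (('v \<Rightarrow> 'k::field) \<Rightarrow> 'k) \<Rightarrow> ('v \<Rightarrow> 'k) \<Rightarrow> 'k" where
  "partial_deriv i P x = poly (pderiv (THE p. \<forall>s. poly p s = P (x(i := s)))) (x i)"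

definition algebraic_set :: "'v set \<Rightarrow> ('v \<Rightarrow> 'k::comm_ring_1) set \<Rightarrow> bool" where
  "algebraic_set D Y \<longleftrightarrow> (\<exists>S \<subseteq> polyfun D. Y = {x \<in> affine_space D. \<forall>P\<in>S. P x = 0})"

definition regular_map ::
  "'v set \<Rightarrow> 'w set \<Rightarrow> ('v \<Rightarrow> 'k::comm_ring_1) set \<Rightarrow> (('v \<Rightarrow> 'k) \<Rightarrow> 'w \<Rightarrow> 'k) \<Rightarrow> bool" where
  "regular_map D E Y \<pi> \<longleftrightarrow>
     \<pi> ` Y \<subseteq> affine_space E \<and> (\<forall>i\<in>E. \<exists>P\<in>polyfun D. \<forall>y\<in>Y. \<pi> y i = P y)"

text \<open>
  For an algebraic set \<open>Y\<close>, finiteness of \<open>\<pi>\<close> says that \<open>k[Y]\<close> is generated by finitely many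
  elements as a module over the coordinate ring of the target affine space.
\<close>

definition finite_map ::
  "'v set \<Rightarrow> 'w set \<Rightarrow> ('v \<Rightarrow> 'k::comm_ring_1) set \<Rightarrow> (('v \<Rightarrow> 'k) \<Rightarrow> 'w \<Rightarrow> 'k) \<Rightarrow> bool" where
  "finite_map D E Y \<pi> \<longleftrightarrow>
     (\<exists>B. finite B \<and> B \<subseteq> polyfun D \<and>
        (\<forall>P\<in>polyfun D. \<exists>c. (\<forall>b\<in>B. c b \<in> polyfun E) \<and>
           (\<forall>y\<in>Y. P y = (\<Sum>b\<in>B. c b (\<pi> y) * b y))))"

text \<open>
  Smoothness in the form of Bosch--Luetkebohmert--Raynaud, Neron Models, Section 2.2: embed \<open>Y\<close>
  over the target into the relative affine space by the graph of \<open>\<pi>\<close> (target coordinates \<open>Inl\<close>, fibre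
  coordinates \<open>Inr\<close>); at each point \<open>z\<close> of the graph the ideal of the graph is
  generated, locally at \<open>z\<close>, by \<open>f 0, \<dots>, f (c - 1)\<close> whose differentials in the fibre directions are
  linearly independent at \<open>z\<close>. The ideal is the full vanishing ideal, that is, \<open>Y\<close> carries its
  reduced structure. It suffices to test closed points, as the smooth locus is open.
\<close>

definition graph_point :: "(('v \<Rightarrow> 'k) \<Rightarrow> 'w \<Rightarrow> 'k) \<Rightarrow> ('v \<Rightarrow> 'k) \<Rightarrow> ('w + 'v \<Rightarrow> 'k)" where
  "graph_point \<pi> y = case_sum (\<pi> y) y"

definition graph_ideal ::
  "'v set \<Rightarrow> 'w set \<Rightarrow> ('v \<Rightarrow> 'k::comm_ring_1) set \<Rightarrow> (('v \<Rightarrow> 'k) \<Rightarrow> 'w \<Rightarrow> 'k) \<Rightarrow>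
     (('w + 'v \<Rightarrow> 'k) \<Rightarrow> 'k) set" where
  "graph_ideal D E Y \<pi> = {P \<in> polyfun (E <+> D). \<forall>y\<in>Y. P (graph_point \<pi> y) = 0}"

definition smooth_at ::
  "'v set \<Rightarrow> 'w set \<Rightarrow> ('v \<Rightarrow> 'k::field) set \<Rightarrow> (('v \<Rightarrow> 'k) \<Rightarrow> 'w \<Rightarrow> 'k) \<Rightarrow> ('v \<Rightarrow> 'k) \<Rightarrow> bool" where
  "smooth_at D E Y \<pi> y \<longleftrightarrow>
     (let z = graph_point \<pi> y in
      \<exists>(c::nat) f. (\<forall>l<c. f l \<in> graph_ideal D E Y \<pi>) \<and>
        (\<forall>P \<in> graph_ideal D E Y \<pi>. \<exists>u \<in> polyfun (E <+> D). \<exists>g.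
           u z \<noteq> 0 \<and> (\<forall>l<c. g l \<in> polyfun (E <+> D)) \<and>
           (\<forall>x. u x * P x = (\<Sum>l<c. g l x * f l x))) \<and>
        (\<forall>r. (\<forall>i\<in>D. (\<Sum>l<c. r l * partial_deriv (Inr i) (f l) z) = 0) \<longrightarrow> (\<forall>l<c. r l = 0)))"

definition smooth_map ::
  "'v set \<Rightarrow> 'w set \<Rightarrow> ('v \<Rightarrow> 'k::field) set \<Rightarrow> (('v \<Rightarrow> 'k) \<Rightarrow> 'w \<Rightarrow> 'k) \<Rightarrow> bool" where
  "smooth_map D E Y \<pi> \<longleftrightarrow> (\<forall>y\<in>Y. smooth_at D E Y \<pi> y)"

definition finite_smooth_over_affine_space :: "'v set \<Rightarrow> ('v \<Rightarrow> 'k::field) set \<Rightarrow> bool" where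
  "finite_smooth_over_affine_space D Y \<longleftrightarrow>
     finite D \<and> algebraic_set D Y \<and>
     (\<exists>(N::nat) \<pi>. regular_map D {..<N} Y \<pi> \<and> finite_map D {..<N} Y \<pi> \<and> smooth_map D {..<N} Y \<pi>)"

definition locally_closedin :: "'a topology \<Rightarrow> 'a set \<Rightarrow> bool" where
  "locally_closedin T S \<longleftrightarrow> (\<exists>U C. openin T U \<and> closedin T C \<and> S = U \<inter> C)"


section \<open>The group and the affine Grassmannian\<close>

text \<open>
  The residues modulo \<open>d\<close> are represented by \<open>\<tau> < d\<close>. An element of \<open>N\<^sub>\<tau>\<close> is a vector of
  length \<open>n\<close> over \<open>L = k((t))\<close>, whose entry at \<open>l < n\<close> is the coefficient of \<open>e\<^sub>\<tau>\<^sub>,\<^sub>l\<^sub>+\<^sub>1\<close>.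
\<close>

definition integers_L :: "'k::field fls set" where
  "integers_L = range fps_to_fls"

definition frob :: "nat \<Rightarrow> 'k::field fls \<Rightarrow> 'k fls" where
  "frob q f = Abs_fls (\<lambda>k. fls_nth f k ^ q)"

definition evec :: "nat \<Rightarrow> int \<Rightarrow> 'k::field fls vec" where
  "evec n i = fls_X_intpow ((i - 1) div int n) \<cdot>\<^sub>v unit_vec n (nat ((i - 1) mod int n))"

text \<open>The coefficient of \<open>e\<^sub>i\<close> in the expansion of \<open>v\<close> as a (formal) sum over all \<open>i \<in> \<int>\<close>.\<close>

definition ecoeff :: "nat \<Rightarrow> 'k::field fls vec \<Rightarrow> int \<Rightarrow> 'k" where
  "ecoeff n v i = fls_nth (v $ nat ((i - 1) mod int n)) ((i - 1) div int n)"

definition minv :: "'a::field mat \<Rightarrow> 'a mat" where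
  "minv g = the (mat_inverse g)"

definition GL :: "nat \<Rightarrow> nat \<Rightarrow> (nat \<Rightarrow> 'k::field fls mat) set" where
  "GL d n = {g. \<forall>\<tau><d. g \<tau> \<in> carrier_mat n n \<and> invertible_mat (g \<tau>)}"

definition KK :: "nat \<Rightarrow> nat \<Rightarrow> (nat \<Rightarrow> 'k::field fls mat) set" where
  "KK d n = {g \<in> GL d n. \<forall>\<tau><d. elements_mat (g \<tau>) \<subseteq> integers_L \<and> elements_mat (minv (g \<tau>)) \<subseteq> integers_L}"

text \<open>As \<open>\<sigma>\<close> maps \<open>N\<^sub>\<tau>\<^sub>+\<^sub>1\<close> to \<open>N\<^sub>\<tau>\<close>, the \<open>\<tau>\<close>-component of \<open>\<sigma> g \<sigma>\<^sup>-\<^sup>1\<close> comes from \<open>g\<^sub>\<tau>\<^sub>+\<^sub>1\<close>.\<close>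

definition sigma_G :: "nat \<Rightarrow> nat \<Rightarrow> (nat \<Rightarrow> 'k::field fls mat) \<Rightarrow> nat \<Rightarrow> 'k fls mat" where
  "sigma_G q d g \<tau> = map_mat (frob q) (g ((\<tau> + 1) mod d))"

definition gamma :: "nat \<Rightarrow> nat \<Rightarrow> nat \<Rightarrow> 'k::field fls mat" where
  "gamma n m \<tau> = (if \<tau> = 0 then mat_of_cols n (map (\<lambda>l. evec n (int l + 1 + int m)) [0..<n]) else 1\<^sub>m n)"

definition t_pow :: "nat \<Rightarrow> (nat \<Rightarrow> nat \<Rightarrow> int) \<Rightarrow> nat \<Rightarrow> 'k::field fls mat" where
  "t_pow n \<mu> \<tau> = mat_diag n (\<lambda>l. fls_X_intpow (\<mu> \<tau> (l + 1)))"

definition dominant :: "nat \<Rightarrow> nat \<Rightarrow> (nat \<Rightarrow> nat \<Rightarrow> int) \<Rightarrow> bool" where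
  "dominant d n \<mu> \<longleftrightarrow> (\<forall>\<tau><d. \<forall>i j. 1 \<le> i \<and> i \<le> j \<and> j \<le> n \<longrightarrow> \<mu> \<tau> j \<le> \<mu> \<tau> i)"

definition minuscule :: "nat \<Rightarrow> nat \<Rightarrow> (nat \<Rightarrow> nat \<Rightarrow> int) \<Rightarrow> bool" where
  "minuscule d n \<mu> \<longleftrightarrow> dominant d n \<mu> \<and> (\<forall>\<tau><d. \<mu> \<tau> 1 - \<mu> \<tau> n \<le> 1)"

text \<open>The point \<open>gK\<close> of the affine Grassmannian is represented by the tuple of lattices \<open>g\<Delta>\<close>.\<close>

definition lattice_of :: "nat \<Rightarrow> nat \<Rightarrow> (nat \<Rightarrow> 'k::field fls mat) \<Rightarrow> nat \<Rightarrow> 'k fls vec set" where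
  "lattice_of d n g = (\<lambda>\<tau>\<in>{..<d}. {g \<tau> *\<^sub>v w | w. w \<in> carrier_vec n \<and> (\<forall>l<n. w $ l \<in> integers_L)})"

definition Grass :: "nat \<Rightarrow> nat \<Rightarrow> (nat \<Rightarrow> 'k::field fls vec set) set" where
  "Grass d n = lattice_of d n ` GL d n"

definition ADLV ::
  "nat \<Rightarrow> nat \<Rightarrow> nat \<Rightarrow> nat \<Rightarrow> (nat \<Rightarrow> nat \<Rightarrow> int) \<Rightarrow> (nat \<Rightarrow> 'k::field fls vec set) set" where
  "ADLV q d n m \<mu> = {lattice_of d n g | g. g \<in> GL d n \<and>
     (\<exists>h\<in>KK d n. \<exists>h'\<in>KK d n. \<forall>\<tau><d.
        minv (g \<tau>) * gamma n m \<tau> * sigma_G q d g \<tau> = h \<tau> * t_pow n \<mu> \<tau> * h' \<tau>)}"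

text \<open>
  The Zariski topology on the points of the affine Grassmannian \<open>LG / L\<^sup>+G\<close> is the quotient topology
  of the ind-topology of the loop group \<open>LG\<close>: the latter is the increasing union of the
  affine schemes \<open>LG_bounded d n N\<close>, on which \<open>g\<close> and \<open>g\<^sup>-\<^sup>1\<close> have poles of order at most \<open>N\<close>, with
  the Laurent coefficients of the entries of \<open>g\<close> and \<open>g\<^sup>-\<^sup>1\<close> as coordinates.
\<close>

definition LG_bounded :: "nat \<Rightarrow> nat \<Rightarrow> nat \<Rightarrow> (nat \<Rightarrow> 'k::field fls mat) set" where
  "LG_bounded d n N = {g \<in> GL d n. \<forall>\<tau><d. \<forall>i<n. \<forall>j<n. \<forall>k < - int N.
     fls_nth (g \<tau> $$ (i, j)) k = 0 \<and> fls_nth (minv (g \<tau>) $$ (i, j)) k = 0}"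

definition LG_index :: "nat \<Rightarrow> nat \<Rightarrow> (bool \<times> nat \<times> nat \<times> nat \<times> int) set" where
  "LG_index d n = UNIV \<times> {..<d} \<times> {..<n} \<times> {..<n} \<times> UNIV"

definition LG_coord :: "(nat \<Rightarrow> 'k::field fls mat) \<Rightarrow> bool \<times> nat \<times> nat \<times> nat \<times> int \<Rightarrow> 'k" where
  "LG_coord g = (\<lambda>(s, \<tau>, i, j, k). fls_nth ((if s then g \<tau> else minv (g \<tau>)) $$ (i, j)) k)"

definition Grass_closed :: "nat \<Rightarrow> nat \<Rightarrow> (nat \<Rightarrow> 'k::field fls vec set) set \<Rightarrow> bool" where
  "Grass_closed d n Z \<longleftrightarrow> Z \<subseteq> Grass d n \<and>
     (\<forall>N. \<exists>S \<subseteq> polyfun (LG_index d n). \<forall>g \<in> LG_bounded d n N.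
        lattice_of d n g \<in> Z \<longleftrightarrow> (\<forall>P\<in>S. P (LG_coord g) = 0))"

definition Grass_topology :: "nat \<Rightarrow> nat \<Rightarrow> (nat \<Rightarrow> 'k::field fls vec set) topology" where
  "Grass_topology d n = topology (\<lambda>U. U \<subseteq> Grass d n \<and> Grass_closed d n (Grass d n - U))"

lemma LG_bounded_lattice_of: "g \<in> LG_bounded d n N \<Longrightarrow> lattice_of d n g \<in> Grass d n"
  by (auto simp: LG_bounded_def Grass_def)

lemma Grass_closed_Un:
  assumes "Grass_closed d n Y" and "Grass_closed d n Z"
  shows "Grass_closed d n (Y \<union> Z)"
  unfolding Grass_closed_def
proof (intro conjI allI)
  show "Y \<union> Z \<subseteq> Grass d n" using assms by (auto simp: Grass_closed_def)
next
  fix N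
  obtain S where S: "S \<subseteq> polyfun (LG_index d n)"
    "\<And>g. g \<in> LG_bounded d n N \<Longrightarrow> lattice_of d n g \<in> Y \<longleftrightarrow> (\<forall>P\<in>S. P (LG_coord g) = 0)"
    using assms(1) unfolding Grass_closed_def by meson
  obtain T where T: "T \<subseteq> polyfun (LG_index d n)"
    "\<And>g. g \<in> LG_bounded d n N \<Longrightarrow> lattice_of d n g \<in> Z \<longleftrightarrow> (\<forall>P\<in>T. P (LG_coord g) = 0)"
    using assms(2) unfolding Grass_closed_def by meson
  let ?R = "{(\<lambda>x. P x * Q x) | P Q. P \<in> S \<and> Q \<in> T}"
  have "?R \<subseteq> polyfun (LG_index d n)" 
  proof
    fix R assume "R \<in> ?R"
    then obtain P Q where "P \<in> S" "Q \<in> T" and R: "R = (\<lambda>x. P x * Q x)" by blast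
    then have "P \<in> polyfun (LG_index d n)" "Q \<in> polyfun (LG_index d n)" using S(1) T(1) by blast+
    then show "R \<in> polyfun (LG_index d n)" unfolding R by (rule polyfun.mult)
  qed
  moreover have "lattice_of d n g \<in> Y \<union> Z \<longleftrightarrow> (\<forall>P\<in>?R. P (LG_coord g) = 0)"
    if "g \<in> LG_bounded d n N" for g
  proof -
    have "(\<forall>P\<in>?R. P (LG_coord g) = 0) \<longleftrightarrow> (\<forall>P\<in>S. \<forall>Q\<in>T. P (LG_coord g) * Q (LG_coord g) = 0)"
      by fast
    then show ?thesis using S(2)[OF that] T(2)[OF that] by auto
  qed
  ultimately show "\<exists>R \<subseteq> polyfun (LG_index d n). \<forall>g \<in> LG_bounded d n N.
      lattice_of d n g \<in> Y \<union> Z \<longleftrightarrow> (\<forall>P\<in>R. P (LG_coord g) = 0)"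
    by (intro exI[of _ ?R] conjI ballI)
qed

lemma Grass_closed_Inter:
  fixes F :: "(nat \<Rightarrow> 'k::field fls vec set) set set"
  assumes "\<And>Z. Z \<in> F \<Longrightarrow> Grass_closed d n Z"
  shows "Grass_closed d n (Grass d n \<inter> \<Inter>F)"
  unfolding Grass_closed_def
proof (intro conjI allI)
  show "Grass d n \<inter> \<Inter>F \<subseteq> Grass d n" by blast
next
  fix N
  have "\<forall>Z\<in>F. \<exists>S. S \<subseteq> polyfun (LG_index d n) \<and> (\<forall>g \<in> LG_bounded d n N.
      lattice_of d n g \<in> Z \<longleftrightarrow> (\<forall>P\<in>S. P (LG_coord g) = 0))"
    using assms unfolding Grass_closed_def by blast
  then obtain S where S: "\<And>Z. Z \<in> F \<Longrightarrow> S Z \<subseteq> polyfun (LG_index d n)"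
    "\<And>Z g. Z \<in> F \<Longrightarrow> g \<in> LG_bounded d n N \<Longrightarrow>
       lattice_of d n g \<in> Z \<longleftrightarrow> (\<forall>P\<in>S Z. P (LG_coord g) = 0)"
    by metis
  have "(\<Union>Z\<in>F. S Z) \<subseteq> polyfun (LG_index d n)" using S(1) by blast
  moreover have "lattice_of d n g \<in> Grass d n \<inter> \<Inter>F \<longleftrightarrow> (\<forall>P\<in>(\<Union>Z\<in>F. S Z). P (LG_coord g) = 0)"
    if "g \<in> LG_bounded d n N" for g
    using S(2)[OF _ that] LG_bounded_lattice_of[OF that] by auto
  ultimately show "\<exists>R \<subseteq> polyfun (LG_index d n). \<forall>g \<in> LG_bounded d n N.
      lattice_of d n g \<in> Grass d n \<inter> \<Inter>F \<longleftrightarrow> (\<forall>P\<in>R. P (LG_coord g) = 0)"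
    by (intro exI[of _ "\<Union>Z\<in>F. S Z"] conjI ballI)
qed

lemma Grass_closed_Grass: "Grass_closed d n (Grass d n)"
  using Grass_closed_Inter[of "{}" d n] by simp

lemma Grass_closed_empty: "Grass_closed d n {}"
  unfolding Grass_closed_def
proof (intro conjI allI)
  show "\<exists>S \<subseteq> polyfun (LG_index d n). \<forall>g \<in> LG_bounded d n N.
      (lattice_of d n g :: nat \<Rightarrow> 'b::field fls vec set) \<in> {} \<longleftrightarrow> (\<forall>P\<in>S. P (LG_coord g) = 0)" for N
    by (rule exI[of _ "{\<lambda>x. 1}"]) (auto intro: polyfun.const)
qed simp

lemma istopology_Grass: "istopology (\<lambda>U. U \<subseteq> Grass d n \<and> Grass_closed d n (Grass d n - U))"
  unfolding istopology_def
proof (intro conjI allI impI)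
  fix U V :: "(nat \<Rightarrow> 'b::field fls vec set) set"
  assume U: "U \<subseteq> Grass d n \<and> Grass_closed d n (Grass d n - U)"
    and V: "V \<subseteq> Grass d n \<and> Grass_closed d n (Grass d n - V)"
  show "U \<inter> V \<subseteq> Grass d n" using U by blast
  have "Grass d n - U \<inter> V = (Grass d n - U) \<union> (Grass d n - V)" by blast
  then show "Grass_closed d n (Grass d n - U \<inter> V)"
    using Grass_closed_Un U V by metis
next
  fix F :: "(nat \<Rightarrow> 'b::field fls vec set) set set"
  assume F: "\<forall>U\<in>F. U \<subseteq> Grass d n \<and> Grass_closed d n (Grass d n - U)"
  show "\<Union>F \<subseteq> Grass d n" using F by blast
  have "Grass d n - \<Union>F = Grass d n \<inter> \<Inter>((\<lambda>U. Grass d n - U) ` F)" by blast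
  moreover have "Grass_closed d n (Grass d n \<inter> \<Inter>((\<lambda>U. Grass d n - U) ` F))"
    using F by (intro Grass_closed_Inter) auto
  ultimately show "Grass_closed d n (Grass d n - \<Union>F)" by simp
qed

lemma openin_Grass_topology:
  "openin (Grass_topology d n) U \<longleftrightarrow> U \<subseteq> Grass d n \<and> Grass_closed d n (Grass d n - U)"
  unfolding Grass_topology_def by (simp add: istopology_Grass topology_inverse')

lemma topspace_Grass_topology: "topspace (Grass_topology d n) = Grass d n"
proof -
  have "openin (Grass_topology d n) (Grass d n)"
    by (simp add: openin_Grass_topology Grass_closed_empty)
  then show ?thesis
    unfolding topspace_def using openin_Grass_topology by blast
qed

lemma closedin_Grass_topology: "closedin (Grass_topology d n) Z \<longleftrightarrow> Grass_closed d n Z"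
proof (cases "Z \<subseteq> Grass d n")
  case True
  then show ?thesis
    by (simp add: closedin_def topspace_Grass_topology openin_Grass_topology double_diff)
next
  case False
  then show ?thesis
    by (simp add: closedin_def topspace_Grass_topology Grass_closed_def)
qed


section \<open>Semi-modules\<close>

definition Oset :: "nat \<Rightarrow> (nat \<times> int) set" where
  "Oset d = {..<d} \<times> UNIV"

definition shift :: "nat \<times> int \<Rightarrow> int \<Rightarrow> nat \<times> int" where
  "shift a k = (fst a, snd a + k)"

text \<open>The residue class of 1 is represented by \<open>1 mod d\<close>, which is 0 if \<open>d = 1\<close>.\<close>

definition ff :: "nat \<Rightarrow> nat \<Rightarrow> nat \<times> int \<Rightarrow> nat \<times> int" where
  "ff d m a = (if fst a = 1 mod d then (0, snd a + int m) else ((fst a + d - 1) mod d, snd a))"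

definition semi_module :: "nat \<Rightarrow> nat \<Rightarrow> nat \<Rightarrow> (nat \<times> int) set \<Rightarrow> bool" where
  "semi_module d n m A \<longleftrightarrow>
     A \<subseteq> Oset d \<and>
     (\<exists>c. \<forall>a\<in>A. c \<le> snd a) \<and>
     (\<lambda>a. shift a (int n)) ` A \<subseteq> A \<and>
     ff d m ` A \<subseteq> A \<and>
     {shift a (int n * k) | a k. a \<in> A} = Oset d"

definition Abar :: "nat \<Rightarrow> (nat \<times> int) set \<Rightarrow> (nat \<times> int) set" where
  "Abar n A = A - (\<lambda>a. shift a (int n)) ` A"

definition phi :: "nat \<Rightarrow> nat \<Rightarrow> nat \<Rightarrow> (nat \<times> int) set \<Rightarrow> nat \<times> int \<Rightarrow> int" where
  "phi d n m A a = (THE k. shift (ff d m a) (- (int n * k)) \<in> Abar n A)"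

definition rr :: "nat \<Rightarrow> nat \<Rightarrow> nat \<Rightarrow> (nat \<times> int) set \<Rightarrow> nat \<times> int \<Rightarrow> nat \<times> int" where
  "rr d n m A b = shift (ff d m b) (- (int n * phi d n m A b))"

definition Hodge_type :: "nat \<Rightarrow> nat \<Rightarrow> nat \<Rightarrow> (nat \<Rightarrow> nat \<Rightarrow> int) \<Rightarrow> (nat \<times> int) set \<Rightarrow> bool" where
  "Hodge_type d n m \<mu> A \<longleftrightarrow> (\<forall>\<tau><d.
     image_mset (\<mu> \<tau>) (mset_set {1..n}) =
     image_mset (phi d n m A) (mset_set {b \<in> Abar n A. fst b = (\<tau> + 1) mod d}))"


section \<open>Strata\<close>

definition Yset :: "nat \<Rightarrow> nat \<Rightarrow> (nat \<times> int) set \<Rightarrow> nat \<Rightarrow> (nat \<times> int) set" where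
  "Yset n m A \<iota> =
     {(\<iota>, Max {i. (\<iota>, i) \<in> Abar n A \<and> i mod int (gcd m n) = int k mod int (gcd m n)}) | k. k \<in> {1..gcd m n}}"

definition Vset :: "nat \<Rightarrow> nat \<Rightarrow> nat \<Rightarrow> (nat \<times> int) set \<Rightarrow> ((nat \<times> int) \<times> nat) set" where
  "Vset d n m A = {(b, j). b \<in> Abar n A \<and> 1 \<le> j \<and> shift b (int j) \<in> Abar n A \<and>
     phi d n m A b > phi d n m A (shift b (int j))}"

definition Wset :: "nat \<Rightarrow> nat \<Rightarrow> (nat \<times> int) set \<Rightarrow> nat \<Rightarrow> ((nat \<times> int) \<times> nat) set" where
  "Wset n m A \<iota> = {(b, j). b \<in> Yset n m A \<iota> \<and> 1 \<le> j \<and> shift b (int j) \<notin> A}"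

text \<open>\<open>Vset\<close> and \<open>Wset\<close> are automatically disjoint.\<close>

definition Dset :: "nat \<Rightarrow> nat \<Rightarrow> nat \<Rightarrow> (nat \<times> int) set \<Rightarrow> nat \<Rightarrow> ((nat \<times> int) \<times> nat) set" where
  "Dset d n m A \<iota> = Vset d n m A \<union> Wset n m A \<iota>"

text \<open>
  The vector \<open>\<gamma>\<sigma>(w)\<close> for \<open>w \<in> N\<^sub>\<tau>\<close>; it lies in \<open>N\<^sub>\<tau>\<^sub>-\<^sub>1\<close>.
\<close>

definition gamma_sigma ::
  "nat \<Rightarrow> nat \<Rightarrow> nat \<Rightarrow> nat \<Rightarrow> nat \<Rightarrow> 'k::field fls vec \<Rightarrow> 'k fls vec" where
  "gamma_sigma q d n m \<tau> w = gamma n m ((\<tau> + d - 1) mod d) *\<^sub>v map_vec (frob q) w"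

definition phi_gamma_sigma ::
  "nat \<Rightarrow> nat \<Rightarrow> nat \<Rightarrow> nat \<Rightarrow> (nat \<times> int) set \<Rightarrow> (nat \<times> int \<Rightarrow> 'k::field fls vec) \<Rightarrow>
     nat \<times> int \<Rightarrow> 'k fls vec" where
  "phi_gamma_sigma q d n m A v b =
     fls_X_intpow (- phi d n m A b) \<cdot>\<^sub>v gamma_sigma q d n m (fst b) (v b)"

text \<open>
  \<open>v a\<close> is understood as an element of \<open>N\<^sub>\<tau>\<close> with \<open>\<tau> = fst a\<close>. The first condition says that
  \<open>v a\<close> is the sum of \<open>e\<^sub>a\<close> and a series in the \<open>e\<^sub>a\<^sub>+\<^sub>j\<close> with \<open>j > 0\<close>.
\<close>

definition is_vfamily ::
  "nat \<Rightarrow> nat \<Rightarrow> nat \<Rightarrow> nat \<Rightarrow> (nat \<times> int) set \<Rightarrow> nat \<Rightarrow> ((nat \<times> int) \<times> nat \<Rightarrow> 'k::field) \<Rightarrow>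
     (nat \<times> int \<Rightarrow> 'k fls vec) \<Rightarrow> bool" where
  "is_vfamily q d n m A \<iota> x v \<longleftrightarrow>
     (\<forall>a\<in>A. v a \<in> carrier_vec n \<and>
        (\<forall>i < snd a. ecoeff n (v a) i = 0) \<and> ecoeff n (v a) (snd a) = 1) \<and>
     (\<forall>b \<in> Yset n m A \<iota>. \<forall>l<n.
        v b $ l = evec n (snd b) $ l
          + (\<Sum>j | (b, j) \<in> Wset n m A \<iota>. fls_const (x (b, j)) * evec n (snd b + int j) $ l)
          + (\<Sum>j | (b, j) \<in> Vset d n m A. fls_const (x (b, j)) * v (shift b (int j)) $ l)) \<and>
     (\<forall>b \<in> Abar n A - Yset n m A \<iota>. \<forall>l<n.
        v b $ l = phi_gamma_sigma q d n m A v (inv_into (Abar n A) (rr d n m A) b) $ l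
          + (\<Sum>j | (b, j) \<in> Vset d n m A. fls_const (x (b, j)) * v (shift b (int j)) $ l)) \<and>
     (\<forall>a\<in>A. v (shift a (int n)) = fls_X \<cdot>\<^sub>v v a)"

definition vfamily ::
  "nat \<Rightarrow> nat \<Rightarrow> nat \<Rightarrow> nat \<Rightarrow> (nat \<times> int) set \<Rightarrow> nat \<Rightarrow> ((nat \<times> int) \<times> nat \<Rightarrow> 'k::field) \<Rightarrow>
     nat \<times> int \<Rightarrow> 'k fls vec" where
  "vfamily q d n m A \<iota> x = (THE v. v \<in> extensional A \<and> is_vfamily q d n m A \<iota> x v)"

definition Lambda ::
  "nat \<Rightarrow> nat \<Rightarrow> nat \<Rightarrow> nat \<Rightarrow> (nat \<times> int) set \<Rightarrow> nat \<Rightarrow> ((nat \<times> int) \<times> nat \<Rightarrow> 'k::field) \<Rightarrow>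
     nat \<Rightarrow> 'k fls vec set" where
  "Lambda q d n m A \<iota> x = (\<lambda>\<tau>\<in>{..<d}.
     {vec n (\<lambda>l. \<Sum>b | b \<in> Abar n A \<and> fst b = \<tau>. c b * vfamily q d n m A \<iota> x b $ l) | c.
        \<forall>b. c b \<in> integers_L})"

text \<open>
  \<open>stratum_coords\<close> is \<open>\<L>(A, \<iota>)\<close>, a subset of affine space, and \<open>stratum\<close> is its image \<open>\<L>(A)\<close> in the
  affine Grassmannian. As a topological subspace \<open>\<L>(A)\<close> is taken inside the Grassmannian, whereas its
  structure of a variety is that of \<open>\<L>(A, \<iota>)\<close>. The latter can differ from the reduced structure
  induced by the Grassmannian: for \<open>d = 1, n = 4, m = 2\<close>, \<open>A = {0, 2, 3, 4, \<dots>}\<close> one finds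
  \<open>\<L>(A, \<iota>) = \<A>\<^sup>1\<close>, embedded by the \<open>q\<close>-th power of the coordinate.
\<close>

definition stratum_coords ::
  "nat \<Rightarrow> nat \<Rightarrow> nat \<Rightarrow> nat \<Rightarrow> (nat \<times> int) set \<Rightarrow> nat \<Rightarrow> ((nat \<times> int) \<times> nat \<Rightarrow> 'k::field) set" where
  "stratum_coords q d n m A \<iota> =
     {x \<in> affine_space (Dset d n m A \<iota>). \<forall>b \<in> Abar n A.
        phi_gamma_sigma q d n m A (vfamily q d n m A \<iota> x) b
          \<in> Lambda q d n m A \<iota> x (fst (ff d m b))}"

definition stratum ::
  "nat \<Rightarrow> nat \<Rightarrow> nat \<Rightarrow> nat \<Rightarrow> (nat \<times> int) set \<Rightarrow> nat \<Rightarrow> (nat \<Rightarrow> 'k::field fls vec set) set" where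
  "stratum q d n m A \<iota> = Lambda q d n m A \<iota> ` stratum_coords q d n m A \<iota>"

end

theory Submission
  imports Defs "Jordan_Normal_Form.Determinant"
begin

text \<open>The semi-module of a point \<open>\<Lambda>\<close> of \<open>X\<^sub>\<mu>(\<gamma>)\<close> is its set of leading indices. Minusculity bounds
  \<open>\<phi>\<close> between two consecutive values on each component, and comparing the valuations of
  determinants then fixes their multiplicities, so it is of Hodge type \<open>\<mu>\<close>. Conversely a point
  with semi-module \<open>A\<close> determines its coordinates \<open>x\<close>: they are read off successively by increasing
  order of the coefficient and, within one order, by following the orbits of \<open>r\<^sub>A\<close> from \<open>Y\<^sub>\<iota>\<close>.
  The same order makes the equations of \<open>\<L>(A, \<iota>)\<close> triangular: for each \<open>w \<in> W(A, \<iota>)\<close> there is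
  one equation \<open>x\<^sub>w\<^sup>Q - x\<^sub>w + P\<^sub>w = 0\<close>, with \<open>Q > 1\<close> a power of \<open>q\<close> and \<open>P\<^sub>w\<close> a polynomial in the
  coordinates from \<open>V(A)\<close> and earlier ones from \<open>W(A, \<iota>)\<close>. Hence \<open>\<L>(A, \<iota>)\<close> is a tower of finite
  etale covers of the affine space with coordinates \<open>V(A)\<close>. The stratum is locally closed because
  bounding the number of leading indices below a given one amounts to the vanishing of minors.\<close>

section \<open>Polynomial functions\<close>

text \<open>The equations come from closing up the orbits of r. For b outside Y the recursion that
  defines v(b) already puts t^(-\<phi>) \<gamma>\<sigma>(v(r^-1(b))) into the lattice, so only the
  points of Y impose conditions. Each step along an orbit applies the Frobenius, so a coordinate x_w
  returns to Y as x_w^Q and is compared with itself; as Q = 0 in the field, the derivative of x^Q -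
  x is -1. Smoothness refers to the full vanishing ideal, so these equations must also be shown to
  generate it: a remainder of degree below Q has Q distinct zeros over every point of the lower
  stage, hence vanishes there. Minusculity enters a second time when coordinates are sought for a
  given lattice: an index b + j of A with (b, j) outside V(A) must be the leading index of some w
  with t^(-\<phi>(b)) \<gamma>\<sigma>(w) in the lattice, and a factor t makes up for a drop of
  \<phi> because that drop is at most 1.\<close>

lemma polyfun_mono: "P \<in> polyfun S \<Longrightarrow> S \<subseteq> T \<Longrightarrow> P \<in> polyfun T"
  by (induction rule: polyfun.induct) (auto intro: polyfun.intros)

lemma polyfun_cong: "P \<in> polyfun S \<Longrightarrow> (\<And>i. i \<in> S \<Longrightarrow> x i = y i) \<Longrightarrow> P x = P y"
  by (induction rule: polyfun.induct) auto

lemma polyfun_comp: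
  "P \<in> polyfun S \<Longrightarrow> (\<And>i. i \<in> S \<Longrightarrow> (\<lambda>x. h x i) \<in> polyfun T) \<Longrightarrow> (\<lambda>x. P (h x)) \<in> polyfun T"
  by (induction rule: polyfun.induct) (auto intro: polyfun.intros)

lemma polyfun_uminus: "P \<in> polyfun S \<Longrightarrow> (\<lambda>x. - P x) \<in> polyfun S"
  using polyfun.mult[OF polyfun.const[of "-1"], of P S] by simp

lemma polyfun_diff: "P \<in> polyfun S \<Longrightarrow> Q \<in> polyfun S \<Longrightarrow> (\<lambda>x. P x - Q x) \<in> polyfun S"
  using polyfun.add[OF _ polyfun_uminus, of P S Q] by simp

lemma polyfun_sum: "(\<And>i. i \<in> I \<Longrightarrow> P i \<in> polyfun S) \<Longrightarrow> (\<lambda>x. \<Sum>i\<in>I. P i x) \<in> polyfun S"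
  by (induction I rule: infinite_finite_induct) (auto intro: polyfun.intros)

lemma polyfun_prod: "(\<And>i. i \<in> I \<Longrightarrow> P i \<in> polyfun S) \<Longrightarrow> (\<lambda>x. \<Prod>i\<in>I. P i x) \<in> polyfun S"
  by (induction I rule: infinite_finite_induct) (auto intro: polyfun.intros)

lemma polyfun_power: "P \<in> polyfun S \<Longrightarrow> (\<lambda>x. P x ^ e) \<in> polyfun S"
  by (induction e) (auto intro: polyfun.intros)

lemma polyfun_det:
  assumes "\<And>a b. a < r \<Longrightarrow> b < r \<Longrightarrow> P a b \<in> polyfun S"
  shows "(\<lambda>x. det (mat r r (\<lambda>(a, b). P a b x))) \<in> polyfun S"
proof -
  have "(\<lambda>x. \<Sum>p\<in>{p. p permutes {0..<r}}. signof p * (\<Prod>i = 0..<r. P i (p i) x)) \<in> polyfun S"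
    by (intro polyfun_sum polyfun.mult polyfun.const polyfun_prod)
       (auto intro!: assms dest: permutes_in_image)
  moreover have "det (mat r r (\<lambda>(a, b). P a b x))
      = (\<Sum>p\<in>{p. p permutes {0..<r}}. signof p * (\<Prod>i = 0..<r. P i (p i) x))" for x
  proof (subst det_def', force, intro sum.cong refl)
    fix p assume "p \<in> {p. p permutes {0..<r}}"
    then have "p i < r" if "i < r" for i
      using that permutes_in_image[of p "{0..<r}" i] by simp
    then show "signof p * (\<Prod>i = 0..<r. mat r r (\<lambda>(a, b). P a b x) $$ (i, p i))
        = signof p * (\<Prod>i = 0..<r. P i (p i) x)"
      by simp
  qed
  ultimately show ?thesis by simp
qed

section \<open>Univariate polynomials over an algebraically closed field\<close>

lemma infinite_UNIV_alg_closed_field: "infinite (UNIV :: 'k::alg_closed_field set)"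
proof
  assume fin: "finite (UNIV :: 'k set)"
  \<comment> \<open>Over a finite field this is a nonconstant polynomial with the value 1
    everywhere.\<close>
  define p :: "'k poly" where "p = (\<Prod>a\<in>UNIV. [:- a, 1:]) + 1"
  have "degree (\<Prod>a\<in>(UNIV::'k set). [:- a, 1:]) = card (UNIV :: 'k set)"
    by (subst degree_prod_eq_sum_degree) auto
  moreover have "card (UNIV :: 'k set) > 0" using fin by (simp add: card_gt_0_iff)
  ultimately have "degree p > 0" unfolding p_def by (subst degree_add_eq_left) auto
  then obtain x where "poly p x = 0" using alg_closed_imp_poly_has_root by blast
  then show False using fin by (simp add: p_def poly_prod prod_zero)
qed

lemma poly_fun_eqI:
  fixes p q :: "'k::alg_closed_field poly"
  assumes "\<And>s. poly p s = poly q s"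
  shows "p = q"
proof (rule ccontr)
  assume "p \<noteq> q"
  then have "finite {s. poly (p - q) s = 0}" by (intro poly_roots_finite) auto
  moreover have "{s. poly (p - q) s = 0} = UNIV" using assms by simp
  ultimately show False using infinite_UNIV_alg_closed_field by metis
qed

text \<open>Polynomials with the same values over an infinite field agree, so the definite
  description inside \<open>partial_deriv\<close> may be replaced by any polynomial that represents
  the restriction of \<open>P\<close> to the coordinate line.\<close>

lemma partial_deriv_eq:
  fixes P :: "('v \<Rightarrow> 'k::alg_closed_field) \<Rightarrow> 'k"
  assumes "\<And>s. P (x(i := s)) = poly p s"
  shows "partial_deriv i P x = poly (pderiv p) (x i)"
proof -
  have "(THE p. \<forall>s. poly p s = P (x(i := s))) = p"
    using assms by (intro the_equality) (auto intro!: poly_fun_eqI)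
  then show ?thesis by (simp add: partial_deriv_def)
qed

text \<open>A product of linear factors has as many roots as its degree unless a factor is repeated,
  and a repeated factor gives a common root with the derivative.\<close>

lemma card_roots_separable:
  fixes p :: "'k::alg_closed_field poly"
  assumes "p \<noteq> 0" and sep: "\<And>s. poly p s = 0 \<Longrightarrow> poly (pderiv p) s \<noteq> 0"
  shows "card {s. poly p s = 0} = degree p"
proof -
  obtain M where M: "size M = degree p" "p = smult (lead_coeff p) (\<Prod>x\<in>#M. [:- x, 1:])"
    using alg_closed_imp_factorization[OF assms(1)] by blast
  have "count M x \<le> 1" for x
  proof (rule ccontr)
    assume "\<not> count M x \<le> 1"
    then have "count M x \<ge> 2" by simp
    then have "{#x, x#} \<subseteq># M"
      by (auto simp: subseteq_mset_def)
    then obtain M' where "M = {#x, x#} + M'" by (metis subset_mset.le_iff_add)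
    then obtain r where r: "p = [:- x, 1:] * ([:- x, 1:] * r)"
      using M(2) by (metis (no_types, lifting) add_mset_add_single image_mset_add_mset
        mult.assoc mult_smult_right prod_mset.add_mset union_mset_add_mset_left add_mset_remove_trivial_eq empty_neutral(1))
    then have "poly p x = 0" "poly (pderiv p) x = 0"
      unfolding r pderiv_mult by (simp_all add: pderiv_pCons)
    then show False using sep by blast
  qed
  then have "M = mset_set (set_mset M)"
    by (intro multiset_eqI) (metis (full_types) One_nat_def count_eq_zero_iff count_mset_set(1,3) finite_set_mset le_Suc_eq le_zero_eq)
  then have "size M = card (set_mset M)" by (metis size_mset_set)
  moreover have "{s. poly p s = 0} = set_mset M"
  proof -
    have "poly p s = lead_coeff p * (\<Prod>x\<in>#M. s - x)" for s
      by (subst M(2)) (simp add: poly_prod_mset image_mset.compositionality o_def)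
    then show ?thesis using assms(1) by (auto simp: prod_mset_zero_iff)
  qed
  ultimately show ?thesis using M(1) by simp
qed

section \<open>Towers of monic separable equations\<close>

text \<open>One equation \<open>x (w i) ^ Q i - c i * x (w i) + P i x = 0\<close> for each new
  coordinate \<open>w i\<close> over the base coordinates \<open>S0\<close>. Two kinds occur:
  \<open>Q = 1\<close> with \<open>c = 0\<close> eliminates a coordinate, and \<open>c = 1\<close>
  with \<open>Q\<close> equal to 0 in the field is of Artin-Schreier type. \<open>Q_1\<close> keeps
  the equation monic of degree \<open>Q i\<close>; \<open>separable\<close> says that its derivative
  has no zero.\<close>

locale separable_tower =
  fixes S0 :: "'v set" and w :: "nat \<Rightarrow> 'v" and K :: nat and Q :: "nat \<Rightarrow> nat"
    and c :: "nat \<Rightarrow> 'k::alg_closed_field" and P :: "nat \<Rightarrow> ('v \<Rightarrow> 'k) \<Rightarrow> 'k"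
  assumes inj_w: "inj_on w {..<K}"
    and w_notin: "\<And>i. i < K \<Longrightarrow> w i \<notin> S0"
    and P_poly: "\<And>i. i < K \<Longrightarrow> P i \<in> polyfun (S0 \<union> w ` {..<i})"
    and Q_pos: "\<And>i. i < K \<Longrightarrow> Q i > 0"
    and Q_1: "\<And>i. i < K \<Longrightarrow> Q i = 1 \<Longrightarrow> c i = 0"
    and separable: "\<And>i s. i < K \<Longrightarrow> of_nat (Q i) * s ^ (Q i - 1) \<noteq> c i"
begin

definition S :: "nat \<Rightarrow> 'v set" where "S i = S0 \<union> w ` {..<i}"

definition F :: "nat \<Rightarrow> ('v \<Rightarrow> 'k) \<Rightarrow> 'k" where
  "F i x = x (w i) ^ Q i - c i * x (w i) + P i x"

lemma S_mono: "i \<le> j \<Longrightarrow> S i \<subseteq> S j" by (auto simp: S_def)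

lemma w_notin_S: "i < K \<Longrightarrow> j \<le> i \<Longrightarrow> w i \<notin> S j"
  using w_notin inj_w unfolding S_def inj_on_def by fastforce

lemma F_poly: "i < j \<Longrightarrow> i < K \<Longrightarrow> F i \<in> polyfun (S j)"
  unfolding F_def
  by (intro polyfun.add polyfun_diff polyfun.mult polyfun_power polyfun.const polyfun.var
      polyfun_mono[OF P_poly]) (auto simp: S_def)

text \<open>The equation \<open>F i\<close> in its own unknown, with \<open>a\<close> standing for
  the value of \<open>P i\<close> at the earlier coordinates.\<close>

definition univ :: "nat \<Rightarrow> 'k \<Rightarrow> 'k poly" where
  "univ i a = monom 1 (Q i) - monom (c i) 1 + [:a:]"

lemma poly_univ: "poly (univ i a) s = s ^ Q i - c i * s + a"
  by (simp add: univ_def poly_monom)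

lemma poly_pderiv_univ: "poly (pderiv (univ i a)) s = of_nat (Q i) * s ^ (Q i - 1) - c i"
  by (simp add: univ_def poly_monom pderiv_add pderiv_diff pderiv_monom pderiv_pCons)

lemma degree_univ: "i < K \<Longrightarrow> degree (univ i a) = Q i"
proof -
  assume i: "i < K"
  have "coeff (univ i a) (Q i) \<noteq> 0"
    using Q_pos[OF i] Q_1[OF i] by (auto simp: univ_def coeff_pCons split: nat.splits)
  then have "Q i \<le> degree (univ i a)" by (rule le_degree)
  moreover have "degree (univ i a) \<le> Q i"
    unfolding univ_def using Q_pos[OF i]
    by (intro degree_add_le degree_diff_le) (auto intro: order.trans[OF degree_monom_le])
  ultimately show ?thesis by simp
qed

lemma card_roots_univ: "i < K \<Longrightarrow> card {s. poly (univ i a) s = 0} = Q i"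
proof -
  assume i: "i < K"
  have "univ i a \<noteq> 0" using degree_univ[OF i, of a] Q_pos[OF i] by force
  moreover have "poly (pderiv (univ i a)) s \<noteq> 0" for s
    using separable[OF i, of s] unfolding poly_pderiv_univ by simp
  ultimately show ?thesis using card_roots_separable[of "univ i a"] degree_univ[OF i] by simp
qed

lemma F_upd: "i < K \<Longrightarrow> F i (x(w i := s)) = poly (univ i (P i x)) s"
proof -
  assume i: "i < K"
  have "P i (x(w i := s)) = P i x"
    using w_notin_S[OF i order.refl] by (intro polyfun_cong[OF P_poly[OF i]]) (auto simp: S_def)
  then show ?thesis by (simp add: F_def poly_univ)
qed

text \<open>Division with remainder by the monic \<open>F i\<close> in the coordinate
  \<open>w i\<close>. A polynomial function carries no chosen polynomial, so the proof takes the set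
  \<open>M\<close> of functions that admit such a division and shows that it is a module over
  \<open>polyfun (S i)\<close>, stable under multiplication by the coordinate
  \<open>w i\<close>.\<close>

lemma division:
  assumes i: "i < K" and R: "R \<in> polyfun (S (Suc i))"
  shows "\<exists>p g. (\<forall>e<Q i. p e \<in> polyfun (S i)) \<and> g \<in> polyfun (S K) \<and>
    (\<forall>x. R x = (\<Sum>e<Q i. p e x * x (w i) ^ e) + g x * F i x)"
proof -
  define M where "M = {R. \<exists>p g. (\<forall>e<Q i. p e \<in> polyfun (S i)) \<and> g \<in> polyfun (S K) \<and>
    (\<forall>x. R x = (\<Sum>e<Q i. p e x * x (w i) ^ e) + g x * F i x)}"
  have M_add: "(\<lambda>x. R x + T x) \<in> M" if RM: "R \<in> M" and TM: "T \<in> M" for R T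
  proof -
    obtain p g where a: "\<forall>e<Q i. p e \<in> polyfun (S i)" "g \<in> polyfun (S K)"
      "\<forall>x. R x = (\<Sum>e<Q i. p e x * x (w i) ^ e) + g x * F i x" using RM unfolding M_def by blast
    obtain p' g' where b: "\<forall>e<Q i. p' e \<in> polyfun (S i)" "g' \<in> polyfun (S K)"
      "\<forall>x. T x = (\<Sum>e<Q i. p' e x * x (w i) ^ e) + g' x * F i x" using TM unfolding M_def by blast
    show ?thesis unfolding M_def
      by (rule CollectI, rule exI[of _ "\<lambda>e x. p e x + p' e x"], rule exI[of _ "\<lambda>x. g x + g' x"])
         (use a b in \<open>auto intro: polyfun.add simp: algebra_simps sum.distrib\<close>)
  qed
  have M_mult: "(\<lambda>x. R x * T x) \<in> M" if RS: "R \<in> polyfun (S i)" and TM: "T \<in> M" for R T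
  proof -
    obtain p' g' where b: "\<forall>e<Q i. p' e \<in> polyfun (S i)" "g' \<in> polyfun (S K)"
      "\<forall>x. T x = (\<Sum>e<Q i. p' e x * x (w i) ^ e) + g' x * F i x" using TM unfolding M_def by blast
    have "R \<in> polyfun (S K)" using RS S_mono[of i K] i by (auto intro: polyfun_mono)
    then show ?thesis unfolding M_def
      by (intro CollectI exI[of _ "\<lambda>e x. R x * p' e x"] exI[of _ "\<lambda>x. R x * g' x"])
         (use RS b in \<open>auto intro: polyfun.mult simp: algebra_simps sum_distrib_left\<close>)
  qed
  have M_var: "(\<lambda>x. x (w i) * T x) \<in> M" if TM: "T \<in> M" for T
  proof -
    obtain p g where b: "\<forall>e<Q i. p e \<in> polyfun (S i)" "g \<in> polyfun (S K)"
      "\<forall>x. T x = (\<Sum>e<Q i. p e x * x (w i) ^ e) + g x * F i x" using TM unfolding M_def by blast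
    obtain q where q: "Q i = Suc q" using Q_pos[OF i] by (cases "Q i") auto
    \<comment> \<open>All coefficients move up by one degree, and the overflow \<open>p q\<close> in
      degree \<open>Q i\<close> is pushed down by the relation
      \<open>x (w i) ^ Q i = F i x + c i * x (w i) - P i x\<close>.\<close>
    define p' where "p' e x = (if e = 0 then 0 else p (e - 1) x)
        + p q x * ((if e = 1 then c i else 0) - (if e = 0 then P i x else 0))" for e x
    have "p' e \<in> polyfun (S i)" if "e < Q i" for e
    proof -
      have "p q \<in> polyfun (S i)" "(\<lambda>x. if e = 0 then 0 else p (e - 1) x) \<in> polyfun (S i)"
        using b(1) q that by (cases "e = 0"; auto intro: polyfun.const)+
      moreover have "(\<lambda>x. if e = 0 then P i x else 0) \<in> polyfun (S i)"
        using P_poly[OF i] by (cases "e = 0") (auto intro: polyfun.const simp: S_def)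
      ultimately show ?thesis unfolding p'_def
        by (intro polyfun.add polyfun.mult polyfun_diff polyfun.const)
    qed
    moreover have "(\<lambda>x. g x * x (w i) + p q x) \<in> polyfun (S K)"
      using b(1,2) q i S_mono[of i K]
      by (intro polyfun.add polyfun.mult polyfun.var) (auto simp: S_def intro: polyfun_mono)
    moreover have "x (w i) * T x = (\<Sum>e<Q i. p' e x * x (w i) ^ e) + (g x * x (w i) + p q x) * F i x" for x
    proof -
      let ?s = "x (w i)"
      have e1: "(\<Sum>e<Suc q. p' e x * ?s ^ e) = (\<Sum>e<q. p e x * ?s ^ Suc e) + p q x * (c i * ?s - P i x)"
      proof (cases q)
        \<comment> \<open>For \<open>Q i = 1\<close> there is no degree 1 left to take up the term
          with \<open>c i\<close>, which is 0 by \<open>Q_1\<close>.\<close>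
        case 0
        then show ?thesis using Q_1[OF i] q by (simp add: p'_def)
      next
        case (Suc q')
        have "(\<Sum>e<Suc q. p' e x * ?s ^ e) = p' 0 x + (\<Sum>e<q. p' (Suc e) x * ?s ^ Suc e)"
          by (subst sum.lessThan_Suc_shift) simp
        also have "(\<Sum>e<q. p' (Suc e) x * ?s ^ Suc e)
            = (\<Sum>e<q. p e x * ?s ^ Suc e) + (\<Sum>e<q. (if e = 0 then p q x * c i * ?s else 0))"
          unfolding sum.distrib[symmetric] by (intro sum.cong) (auto simp: p'_def algebra_simps)
        also have "(\<Sum>e<q. (if e = 0 then p q x * c i * ?s else 0)) = p q x * c i * ?s"
          using Suc by (simp add: sum.delta)
        finally show ?thesis by (simp add: p'_def algebra_simps)
      qed
      have e2: "?s * (\<Sum>e<Suc q. p e x * ?s ^ e) = (\<Sum>e<q. p e x * ?s ^ Suc e) + p q x * ?s ^ Suc q"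
        by (simp add: sum_distrib_left algebra_simps)
      have e3: "?s ^ Suc q = F i x + c i * ?s - P i x" by (simp add: F_def q)
      show ?thesis
        unfolding b(3)[rule_format] q distrib_left e1 e2 e3
        by (simp only: algebra_simps)
    qed
    ultimately show ?thesis unfolding M_def
      by (intro CollectI exI[of _ p'] exI[of _ "\<lambda>x. g x * x (w i) + p q x"]) auto
  qed
  \<comment> \<open>The induction runs on the statement that multiplication by \<open>R\<close>
    preserves \<open>M\<close>, because this composes under products while membership of
    \<open>R\<close> in \<open>M\<close> does not.\<close>
  have "\<forall>T\<in>M. (\<lambda>x. R x * T x) \<in> M" using R
  proof (induction rule: polyfun.induct)
    case (const a)
    then show ?case using M_mult[OF polyfun.const[of a]] by blast
  next
    case (var v)
    then consider "v \<in> S i" | "v = w i" by (auto simp: S_def less_Suc_eq)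
    then show ?case
    proof cases
      case 1
      then show ?thesis using M_mult[OF polyfun.var] by blast
    next
      case 2
      then show ?thesis using M_var by blast
    qed
  next
    case (add R T)
    show ?case
    proof
      fix U assume "U \<in> M"
      then have "(\<lambda>x. R x * U x + T x * U x) \<in> M" using add.IH M_add by blast
      then show "(\<lambda>x. (R x + T x) * U x) \<in> M" by (simp add: algebra_simps)
    qed
  next
    case (mult R T)
    show ?case
    proof
      fix U assume "U \<in> M"
      then have "(\<lambda>x. T x * U x) \<in> M" using mult.IH by blast
      then have "(\<lambda>x. R x * (T x * U x)) \<in> M" using bspec[OF mult.IH(1)] by simp
      then show "(\<lambda>x. (R x * T x) * U x) \<in> M" by (simp add: algebra_simps)
    qed
  qed
  moreover have "(\<lambda>x. 1) \<in> M"
    unfolding M_def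
    by (intro CollectI exI[of _ "\<lambda>e x. if e = 0 then 1 else 0"] exI[of _ "\<lambda>x. 0"])
       (use Q_pos[OF i] in \<open>auto intro: polyfun.const simp: if_distrib[where f = "\<lambda>y. y * _"] sum.delta cong: if_cong\<close>)
  ultimately have "(\<lambda>x. R x * 1) \<in> M" by (rule bspec)
  then show ?thesis unfolding M_def by simp
qed

text \<open>The equations generate a radical ideal. Over a common zero of the lower equations
  \<open>F i\<close> has \<open>Q i\<close> distinct roots, and all of them are zeros of the
  remainder of \<open>R\<close>, whose degree is below \<open>Q i\<close>. So its coefficients
  vanish on the lower zero set, and the induction hypothesis applies to each of them.\<close>

lemma vanishing_imp_ideal:
  assumes "i \<le> K" and "R \<in> polyfun (S i)" and "\<And>x. (\<And>l. l < i \<Longrightarrow> F l x = 0) \<Longrightarrow> R x = 0"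
  shows "\<exists>g. (\<forall>l<i. g l \<in> polyfun (S K)) \<and> (\<forall>x. R x = (\<Sum>l<i. g l x * F l x))"
  using assms
proof (induction i arbitrary: R)
  case 0
  then show ?case by simp
next
  case (Suc i)
  then have i: "i < K" by simp
  obtain p g where pg: "\<And>e. e < Q i \<Longrightarrow> p e \<in> polyfun (S i)" "g \<in> polyfun (S K)"
    "\<And>x. R x = (\<Sum>e<Q i. p e x * x (w i) ^ e) + g x * F i x"
    using division[OF i Suc.prems(2)] by blast
  have van: "p e x = 0" if e: "e < Q i" and x: "\<And>l. l < i \<Longrightarrow> F l x = 0" for e x
  proof -
    \<comment> \<open>The remainder of \<open>R\<close> in the last coordinate, with its
      coefficients evaluated at \<open>x\<close>.\<close>
    define r where "r = (\<Sum>e<Q i. monom (p e x) e)"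
    have "degree r < Q i" unfolding r_def
      by (rule degree_sum_less) (use Q_pos[OF i] in \<open>auto intro: le_less_trans[OF degree_monom_le]\<close>)
    have "poly r s = 0" if s: "poly (univ i (P i x)) s = 0" for s
    proof -
      let ?x = "x(w i := s)"
      have F: "F l ?x = 0" if "l < Suc i" for l
      proof (cases "l = i")
        case True
        then show ?thesis using s i by (simp add: F_upd)
      next
        case False
        then have "l < i" using that by simp
        then have "F l ?x = F l x"
          using w_notin_S[OF i] i by (intro polyfun_cong[OF F_poly[of l i]]) auto
        then show ?thesis using x \<open>l < i\<close> by simp
      qed
      then have "R ?x = 0" using Suc.prems(3) by blast
      then have "(\<Sum>e<Q i. p e ?x * s ^ e) = 0" using pg(3)[of ?x] F[of i] by simp
      moreover have "p e ?x = p e x" if "e < Q i" for e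
        using w_notin_S[OF i] by (intro polyfun_cong[OF pg(1)[OF that]]) auto
      ultimately show ?thesis by (simp add: r_def poly_sum poly_monom)
    qed
    then have "{s. poly (univ i (P i x)) s = 0} \<subseteq> {s. poly r s = 0}" by blast
    have "r = 0"
    proof (rule ccontr)
      assume "r \<noteq> 0"
      then have "Q i \<le> card {s. poly r s = 0}"
        using card_mono[OF poly_roots_finite \<open>_ \<subseteq> _\<close>] card_roots_univ[OF i] by metis
      then show False using card_poly_roots_bound[OF \<open>r \<noteq> 0\<close>] \<open>degree r < Q i\<close> by simp
    qed
    moreover have "coeff r e = p e x"
      using e by (simp add: r_def coeff_sum)
    ultimately show ?thesis by simp
  qed
  have "\<exists>g. (\<forall>l<i. g l \<in> polyfun (S K)) \<and> (\<forall>x. p e x = (\<Sum>l<i. g l x * F l x))" if "e < Q i" for e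
    using Suc.IH[of "p e"] pg(1)[OF that] van[OF that] i by auto
  then obtain G where G: "\<And>e l. e < Q i \<Longrightarrow> l < i \<Longrightarrow> G e l \<in> polyfun (S K)"
    "\<And>e x. e < Q i \<Longrightarrow> p e x = (\<Sum>l<i. G e l x * F l x)"
    by metis
  define g' where "g' l x = (if l = i then g x else \<Sum>e<Q i. G e l x * x (w i) ^ e)" for l x
  have "g' l \<in> polyfun (S K)" if "l < Suc i" for l
  proof (cases "l = i")
    case True
    then have "g' l = g" by (simp add: g'_def fun_eq_iff)
    then show ?thesis using pg(2) by simp
  next
    case False
    have "(\<lambda>x. \<Sum>e<Q i. G e l x * x (w i) ^ e) \<in> polyfun (S K)"
      using G(1) False that i
      by (intro polyfun_sum polyfun.mult polyfun_power polyfun.var) (auto simp: S_def)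
    moreover have "g' l = (\<lambda>x. \<Sum>e<Q i. G e l x * x (w i) ^ e)" using False by (simp add: g'_def fun_eq_iff)
    ultimately show ?thesis by simp
  qed
  moreover have "R x = (\<Sum>l<Suc i. g' l x * F l x)" for x
  proof -
    have "(\<Sum>e<Q i. p e x * x (w i) ^ e) = (\<Sum>e<Q i. \<Sum>l<i. G e l x * F l x * x (w i) ^ e)"
      using G(2) by (simp add: sum_distrib_right)
    also have "\<dots> = (\<Sum>l<i. (\<Sum>e<Q i. G e l x * x (w i) ^ e) * F l x)"
      by (subst sum.swap) (simp add: sum_distrib_left sum_distrib_right algebra_simps)
    finally show ?thesis by (simp add: pg(3) g'_def)
  qed
  ultimately show ?case by blast
qed

text \<open>The monomials in the \<open>w l\<close> with exponents below \<open>Q l\<close>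
  generate. That they avoid the coordinates in \<open>S0\<close> matters later, when they are read
  as functions of the fibre coordinates alone.\<close>

lemma finite_module:
  assumes "i \<le> K"
  shows "\<exists>B. finite B \<and> B \<subseteq> polyfun (w ` {..<i}) \<and> (\<forall>R\<in>polyfun (S i). \<exists>a. (\<forall>b\<in>B. a b \<in> polyfun S0) \<and>
    (\<forall>x. (\<forall>l<i. F l x = 0) \<longrightarrow> R x = (\<Sum>b\<in>B. a b x * b x)))"
  using assms
proof (induction i)
  case 0
  show ?case
  proof (intro exI[of _ "{\<lambda>x. 1}"] conjI ballI)
    fix R :: "('v \<Rightarrow> 'k) \<Rightarrow> 'k" assume "R \<in> polyfun (S 0)"
    then show "\<exists>a. (\<forall>b\<in>{\<lambda>x. 1}. a b \<in> polyfun S0) \<and>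
      (\<forall>x. (\<forall>l<0. F l x = 0) \<longrightarrow> R x = (\<Sum>b\<in>{\<lambda>x. 1}. a b x * b x))"
      by (intro exI[of _ "\<lambda>b. R"]) (simp add: S_def)
  qed (auto intro: polyfun.const)
next
  case (Suc i)
  then have i: "i < K" by simp
  obtain B where B: "finite B" "B \<subseteq> polyfun (w ` {..<i})"
    "\<forall>R\<in>polyfun (S i). \<exists>a. (\<forall>b\<in>B. a b \<in> polyfun S0) \<and>
      (\<forall>x. (\<forall>l<i. F l x = 0) \<longrightarrow> R x = (\<Sum>b\<in>B. a b x * b x))"
    using Suc.IH[OF Suc_leD[OF Suc.prems]] by (elim exE conjE)
  define B' where "B' = (\<lambda>(b, e) x. b x * x (w i) ^ e) ` (B \<times> {..<Q i})"
  have fin: "finite B'" unfolding B'_def using B(1) by blast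
  have "b \<in> polyfun (w ` {..<Suc i})" if bB: "b \<in> B'" for b
  proof -
    obtain b' e where b': "b' \<in> B" "b = (\<lambda>x. b' x * x (w i) ^ e)"
      using bB unfolding B'_def by auto
    have "b' \<in> polyfun (w ` {..<Suc i})"
      by (rule polyfun_mono[OF subsetD[OF B(2) b'(1)]]) auto
    then show ?thesis
      unfolding b'(2) by (rule polyfun.mult[OF _ polyfun_power[OF polyfun.var]]) auto
  qed
  define M where "M = {R. \<exists>a. (\<forall>b\<in>B'. a b \<in> polyfun S0) \<and>
    (\<forall>x. (\<forall>l<Suc i. F l x = 0) \<longrightarrow> R x = (\<Sum>b\<in>B'. a b x * b x))}"
  have M_add: "(\<lambda>x. R x + T x) \<in> M" if RM: "R \<in> M" and TM: "T \<in> M" for R T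
  proof -
    obtain a where a: "\<forall>b\<in>B'. a b \<in> polyfun S0"
      "\<forall>x. (\<forall>l<Suc i. F l x = 0) \<longrightarrow> R x = (\<Sum>b\<in>B'. a b x * b x)" using RM unfolding M_def by blast
    obtain a' where a': "\<forall>b\<in>B'. a' b \<in> polyfun S0"
      "\<forall>x. (\<forall>l<Suc i. F l x = 0) \<longrightarrow> T x = (\<Sum>b\<in>B'. a' b x * b x)" using TM unfolding M_def by blast
    show ?thesis unfolding M_def
      by (intro CollectI exI[of _ "\<lambda>b x. a b x + a' b x"])
         (use a a' in \<open>auto intro: polyfun.add simp: algebra_simps sum.distrib\<close>)
  qed
  have M_gen: "(\<lambda>x. R x * b x) \<in> M" if R: "R \<in> polyfun S0" and b: "b \<in> B'" for R b
  proof -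
    have "(\<Sum>b'\<in>B'. (if b' = b then R x else 0) * b' x) = R x * b x" for x
      using fin b by (simp add: if_distrib[where f = "\<lambda>y. y * _"] sum.delta' cong: if_cong)
    moreover have "(\<lambda>x. if b' = b then R x else 0) \<in> polyfun S0" for b'
      using R by (cases "b' = b") (auto intro: polyfun.const)
    ultimately show ?thesis unfolding M_def
      by (intro CollectI exI[of _ "\<lambda>b' x. if b' = b then R x else 0"]) auto
  qed
  have M_0: "(\<lambda>x. 0) \<in> M" unfolding M_def
    by (intro CollectI exI[of _ "\<lambda>b x. 0"]) (auto intro: polyfun.const)
  have M_sum: "(\<lambda>x. \<Sum>j\<in>J. R j x) \<in> M" if "finite J" "\<And>j. j \<in> J \<Longrightarrow> R j \<in> M" for J :: "'j set" and R
    using that by (induction J rule: finite_induct) (auto intro: M_0 M_add)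
  have "R \<in> M" if R: "R \<in> polyfun (S (Suc i))" for R
  proof -
    obtain p g where pg: "\<And>e. e < Q i \<Longrightarrow> p e \<in> polyfun (S i)" 
      "\<And>x. R x = (\<Sum>e<Q i. p e x * x (w i) ^ e) + g x * F i x"
      using division[OF i R] by blast
    have "\<forall>e\<in>{..<Q i}. \<exists>a. (\<forall>b\<in>B. a b \<in> polyfun S0) \<and>
        (\<forall>x. (\<forall>l<i. F l x = 0) \<longrightarrow> p e x = (\<Sum>b\<in>B. a b x * b x))"
      using bspec[OF B(3) pg(1)] by simp
    from bchoice[OF this] obtain a where
      a': "\<forall>e\<in>{..<Q i}. (\<forall>b\<in>B. a e b \<in> polyfun S0) \<and>
        (\<forall>x. (\<forall>l<i. F l x = 0) \<longrightarrow> p e x = (\<Sum>b\<in>B. a e b x * b x))" ..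
    have a: "\<And>e b. e < Q i \<Longrightarrow> b \<in> B \<Longrightarrow> a e b \<in> polyfun S0"
      "\<And>e x. e < Q i \<Longrightarrow> (\<forall>l<i. F l x = 0) \<Longrightarrow> p e x = (\<Sum>b\<in>B. a e b x * b x)"
      using a' by simp_all
    have "(\<lambda>x. \<Sum>e<Q i. \<Sum>b\<in>B. a e b x * (b x * x (w i) ^ e)) \<in> M"
    proof (intro M_sum)
      fix e b assume "e \<in> {..<Q i}" "b \<in> B"
      then show "(\<lambda>x. a e b x * (b x * x (w i) ^ e)) \<in> M"
        using a(1) by (intro M_gen[of _ "\<lambda>x. b x * x (w i) ^ e"]) (auto simp: B'_def)
    qed (use B in auto)
    moreover have "R x = (\<Sum>e<Q i. \<Sum>b\<in>B. a e b x * (b x * x (w i) ^ e))"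
      if "\<forall>l<Suc i. F l x = 0" for x
      using that a(2) by (simp add: pg(2) sum_distrib_right mult.assoc)
    ultimately show ?thesis unfolding M_def by simp
  qed
  then show ?case using fin \<open>\<And>b. b \<in> B' \<Longrightarrow> _\<close> unfolding M_def by (intro exI[of _ B']) blast
qed

text \<open>The Jacobian matrix in the coordinates \<open>w i\<close> is triangular, since
  \<open>F l\<close> does not involve \<open>w i\<close> for \<open>i > l\<close>, and its diagonal
  is nonzero by separability.\<close>

lemma differentials_independent:
  assumes r: "\<And>i. i < K \<Longrightarrow> (\<Sum>l<K. r l * partial_deriv (w i) (F l) z) = 0" and "l < K"
  shows "r l = 0"
proof -
  have diag: "partial_deriv (w i) (F i) z \<noteq> 0" if "i < K" for i
    using partial_deriv_eq[of "F i" z "w i", OF F_upd[OF that]] separable[OF that]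
    by (simp add: poly_pderiv_univ)
  have low: "partial_deriv (w i) (F l) z = 0" if "i < K" "l < i" for i l
  proof -
    have "F l (z(w i := s)) = poly [:F l z:] s" for s
    proof -
      have "F l (z(w i := s)) = F l z"
        using that w_notin_S[OF that(1) order.refl] by (intro polyfun_cong[OF F_poly[of l i]]) auto
      then show ?thesis by simp
    qed
    then show ?thesis using partial_deriv_eq[of "F l" z "w i" "[:F l z:]"] by (simp add: pderiv_pCons)
  qed
  \<comment> \<open>Back substitution from the last equation; \<open>j\<close> counts the
    coefficients already known to vanish.\<close>
  have "\<forall>l<K. K - j \<le> l \<longrightarrow> r l = 0" for j
  proof (induction j)
    case 0
    then show ?case by simp
  next
    case (Suc j)
    show ?case
    proof (intro allI impI)
      fix l assume l: "l < K" "K - Suc j \<le> l"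
      show "r l = 0"
      proof (cases "K - j \<le> l")
        case True
        then show ?thesis using Suc l by blast
      next
        case False
        have "(\<Sum>l'<K. r l' * partial_deriv (w l) (F l') z) = (\<Sum>l'\<in>{l}. r l' * partial_deriv (w l) (F l') z)"
        proof (intro sum.mono_neutral_right ballI)
          fix l' assume "l' \<in> {..<K} - {l}"
          then consider "l' < l" | "l < l'" "l' < K" by force
          then show "r l' * partial_deriv (w l) (F l') z = 0"
          proof cases
            case 1
            then show ?thesis using low l by simp
          next
            case 2
            then have "K - j \<le> l'" using l False by simp
            then show ?thesis using Suc 2 by simp
          qed
        qed (use l in auto)
        then show ?thesis using r[OF l(1)] diag[OF l(1)] by simp
      qed
    qed
  qed
  from this[of K] show ?thesis using \<open>l < K\<close> by simp
qed

end

text \<open>The map is the projection to the coordinates in \<open>V\<close>. Smoothness is tested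
  on its graph, so the tower lives over the target coordinates \<open>Inl\<close> and begins with
  the equations that identify each coordinate in \<open>V\<close> with its copy in the target; the
  equations for \<open>W\<close> follow in the order of \<rho>.\<close>

lemma finite_smooth_over_affine_space_triangular:
  fixes V W :: "'v set" and \<rho> :: "'v \<Rightarrow> nat" and Q :: "'v \<Rightarrow> nat"
    and P :: "'v \<Rightarrow> ('v \<Rightarrow> 'k::alg_closed_field) \<Rightarrow> 'k"
  assumes fin: "finite V" "finite W" and disj: "V \<inter> W = {}"
    and P_poly: "\<And>w. w \<in> W \<Longrightarrow> P w \<in> polyfun (V \<union> {w' \<in> W. \<rho> w' < \<rho> w})"
    and Q: "\<And>w. w \<in> W \<Longrightarrow> 2 \<le> Q w" "\<And>w. w \<in> W \<Longrightarrow> of_nat (Q w) = (0 :: 'k)"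
  shows "finite_smooth_over_affine_space (V \<union> W)
    {x \<in> affine_space (V \<union> W). \<forall>w\<in>W. x w ^ Q w - x w + P w x = 0}"
proof -
  define Y where "Y = {x \<in> affine_space (V \<union> W). \<forall>w\<in>W. x w ^ Q w - x w + P w x = 0}"
  define N where "N = card V"
  obtain e where e: "bij_betw e {..<N} V"
    using ex_bij_betw_nat_finite[OF fin(1)] by (auto simp: N_def atLeast0LessThan)
  obtain ws0 where ws0: "set ws0 = W" "distinct ws0" using finite_distinct_list[OF fin(2)] by blast
  define ws where "ws = sort_key \<rho> ws0"
  have ws: "set ws = W" "distinct ws" "sorted (map \<rho> ws)" using ws0 by (auto simp: ws_def)
  define K where "K = N + length ws"
  define w :: "nat \<Rightarrow> nat + 'v" where "w i = (if i < N then Inr (e i) else Inr (ws ! (i - N)))" for i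
  \<comment> \<open>For \<open>i < N\<close> the data encode the graph equation
    \<open>z (Inr (e i)) - z (Inl i) = 0\<close>: exponent 1, \<open>c i = 0\<close>, and
    \<open>P' i z = - z (Inl i)\<close>.\<close>
  define Q' where "Q' i = (if i < N then 1 else Q (ws ! (i - N)))" for i
  define c :: "nat \<Rightarrow> 'k" where "c i = (if i < N then 0 else 1)" for i
  define P' where "P' i z = (if i < N then - z (Inl i) else P (ws ! (i - N)) (\<lambda>v. z (Inr v)))"
    for i and z :: "nat + 'v \<Rightarrow> 'k"
  define S0 :: "(nat + 'v) set" where "S0 = Inl ` {..<N}"
  define \<pi> :: "('v \<Rightarrow> 'k) \<Rightarrow> nat \<Rightarrow> 'k" where "\<pi> x = (\<lambda>i. if i < N then x (e i) else 0)" for x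
  have eV: "e i \<in> V" if "i < N" for i using e that by (auto simp: bij_betw_def)
  have wsW: "ws ! i \<in> W" if "i < length ws" for i using ws that by auto
  have in_V: "\<exists>i<N. v = e i" if "v \<in> V" for v using e that by (auto simp: bij_betw_def)
  have in_W: "\<exists>i<length ws. v = ws ! i" if "v \<in> W" for v using ws that by (metis in_set_conv_nth)
  have w_img: "w ` {..<K} = Inr ` (V \<union> W)"
  proof
    show "w ` {..<K} \<subseteq> Inr ` (V \<union> W)" using eV wsW by (auto simp: w_def K_def)
    show "Inr ` (V \<union> W) \<subseteq> w ` {..<K}"
    proof
      fix z :: "nat + 'v" assume "z \<in> Inr ` (V \<union> W)"
      then obtain v where "v \<in> V \<or> v \<in> W" "z = Inr v" by blast
      then show "z \<in> w ` {..<K}"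
      proof (elim disjE)
        assume "v \<in> V"
        then obtain i where "i < N" "v = e i" using in_V by blast
        then show ?thesis using \<open>z = Inr v\<close> by (auto simp: w_def K_def intro!: image_eqI[of _ _ i])
      next
        assume "v \<in> W"
        then obtain i where "i < length ws" "v = ws ! i" using in_W by blast
        then show ?thesis
          using \<open>z = Inr v\<close> by (auto simp: w_def K_def intro!: image_eqI[of _ _ "N + i"])
      qed
    qed
  qed
  interpret tw: separable_tower S0 w K Q' c P'
  proof
    have ne: "e i \<noteq> ws ! j" if "i < N" "j < length ws" for i j
      using disj eV[OF that(1)] wsW[OF that(2)] by fastforce
    show "inj_on w {..<K}"
    proof (rule inj_onI)
      fix i j assume ij: "i \<in> {..<K}" "j \<in> {..<K}" "w i = w j"
      have "e i = e j \<Longrightarrow> i < N \<Longrightarrow> j < N \<Longrightarrow> i = j"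
        using e by (auto simp: bij_betw_def inj_on_def)
      moreover have "ws ! (i - N) = ws ! (j - N) \<Longrightarrow> \<not> i < N \<Longrightarrow> \<not> j < N \<Longrightarrow> i = j"
        using ws(2) ij by (auto simp: K_def nth_eq_iff_index_eq)
      moreover have "i - N < length ws" if "\<not> i < N" using that ij(1) by (simp add: K_def)
      moreover have "j - N < length ws" if "\<not> j < N" using that ij(2) by (simp add: K_def)
      ultimately show "i = j"
        using ij ne[of i "j - N"] ne[of j "i - N"] by (auto simp: w_def K_def split: if_splits)
    qed
    show "w i \<notin> S0" for i by (auto simp: w_def S0_def)
    show "P' i \<in> polyfun (S0 \<union> w ` {..<i})" if i: "i < K" for i
    proof (cases "i < N")
      case True
      then have "P' i = (\<lambda>z. - z (Inl i))" by (simp add: P'_def fun_eq_iff)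
      then show ?thesis using True by (auto intro!: polyfun_uminus polyfun.var simp: S0_def)
    next
      case False
      then have iW: "i - N < length ws" using i by (simp add: K_def)
      have "P' i = (\<lambda>z. P (ws ! (i - N)) (\<lambda>v. z (Inr v)))" using False by (simp add: P'_def fun_eq_iff)
      moreover have img: "Inr v \<in> w ` {..<i}"
        if v: "v \<in> V \<union> {w' \<in> W. \<rho> w' < \<rho> (ws ! (i - N))}" for v
      proof (cases "v \<in> V")
        case True
        then obtain j where "j < N" "v = e j" using in_V by blast
        then show ?thesis using False by (auto simp: w_def intro!: image_eqI[of _ _ j])
      next
        case vV: False
        then obtain j where j: "j < length ws" "v = ws ! j" using in_W v by blast
        have "j < i - N"
        proof (rule ccontr)
          assume "\<not> j < i - N"
          then have "\<rho> (ws ! (i - N)) \<le> \<rho> (ws ! j)"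
            using sorted_nth_mono[OF ws(3), of "i - N" j] j iW by simp
          then show False using v vV j by simp
        qed
        then show ?thesis using j by (auto simp: w_def intro!: image_eqI[of _ _ "N + j"])
      qed
      moreover have "(\<lambda>z. P (ws ! (i - N)) (\<lambda>v. z (Inr v))) \<in> polyfun (S0 \<union> w ` {..<i})"
        by (rule polyfun_comp[OF P_poly[OF wsW[OF iW]]], rule polyfun.var) (use img in blast)
      ultimately show ?thesis by simp
    qed
    have iW: "ws ! (i - N) \<in> W" if "i < K" "\<not> i < N" for i
      using that by (intro wsW) (simp add: K_def)
    show "0 < Q' i" if "i < K" for i
      using Q(1)[OF iW[of i]] that by (auto simp: Q'_def)
    show "c i = 0" if "i < K" "Q' i = 1" for i
      using Q(1)[OF iW[of i]] that by (auto simp: Q'_def c_def split: if_splits)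
    show "of_nat (Q' i) * s ^ (Q' i - 1) \<noteq> c i" if "i < K" for i s
      using Q(2)[OF iW[of i]] that by (auto simp: Q'_def c_def)
  qed
  have SK: "tw.S K = {..<N} <+> (V \<union> W)" unfolding tw.S_def w_img by (auto simp: S0_def Plus_def)
  have F_iff: "(\<forall>l<K. tw.F l z = 0) \<longleftrightarrow> (\<forall>l<N. z (Inr (e l)) = z (Inl l)) \<and>
      (\<forall>v\<in>W. z (Inr v) ^ Q v - z (Inr v) + P v (\<lambda>v. z (Inr v)) = 0)" for z
  proof -
    have "(\<forall>l<K. tw.F l z = 0) \<longleftrightarrow> (\<forall>l<N. tw.F l z = 0) \<and> (\<forall>l<length ws. tw.F (N + l) z = 0)"
    proof (intro iffI conjI allI impI)
      fix l assume *: "(\<forall>l<N. tw.F l z = 0) \<and> (\<forall>l<length ws. tw.F (N + l) z = 0)" and "l < K"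
      show "tw.F l z = 0"
      proof (cases "l < N")
        case False
        then have "l - N < length ws" "N + (l - N) = l" using \<open>l < K\<close> by (auto simp: K_def)
        then show ?thesis using * by metis
      qed (use * in blast)
    qed (auto simp: K_def)
    also have "(\<forall>l<N. tw.F l z = 0) \<longleftrightarrow> (\<forall>l<N. z (Inr (e l)) = z (Inl l))"
      by (auto simp: tw.F_def w_def Q'_def c_def P'_def)
    also have "(\<forall>l<length ws. tw.F (N + l) z = 0) \<longleftrightarrow>
        (\<forall>v\<in>W. z (Inr v) ^ Q v - z (Inr v) + P v (\<lambda>v. z (Inr v)) = 0)"
      unfolding ws(1)[symmetric] all_set_conv_all_nth by (simp add: tw.F_def w_def Q'_def c_def P'_def)
    finally show ?thesis .
  qed
  have F_gp: "tw.F l (graph_point \<pi> y) = 0" if "y \<in> Y" "l < K" for y l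
    using that F_iff[of "graph_point \<pi> y"] by (auto simp: graph_point_def Y_def \<pi>_def)
  have "algebraic_set (V \<union> W) Y"
    unfolding algebraic_set_def
  proof (intro exI[of _ "(\<lambda>w x. x w ^ Q w - x w + P w x) ` W"] conjI)
    show "(\<lambda>w x. x w ^ Q w - x w + P w x) ` W \<subseteq> polyfun (V \<union> W)"
      by (auto intro!: polyfun.add polyfun_diff polyfun_power polyfun.var polyfun_mono[OF P_poly])
  qed (auto simp: Y_def)
  moreover have "regular_map (V \<union> W) {..<N} Y \<pi>"
    unfolding regular_map_def using eV
    by (auto simp: affine_space_def \<pi>_def intro!: bexI[of _ "\<lambda>x. x (e _)"] polyfun.var)
  moreover have "finite_map (V \<union> W) {..<N} Y \<pi>"
  proof -
    obtain B where B: "finite B" "B \<subseteq> polyfun (w ` {..<K})"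
      "\<forall>R\<in>polyfun (tw.S K). \<exists>a. (\<forall>b\<in>B. a b \<in> polyfun S0) \<and>
        (\<forall>x. (\<forall>l<K. tw.F l x = 0) \<longrightarrow> R x = (\<Sum>b\<in>B. a b x * b x))"
      using tw.finite_module[OF order.refl] by (elim exE conjE)
    \<comment> \<open>The generators do not involve the target coordinates, so any value, here 0,
      may be filled in for these.\<close>
    define h :: "((nat + 'v \<Rightarrow> 'k) \<Rightarrow> 'k) \<Rightarrow> ('v \<Rightarrow> 'k) \<Rightarrow> 'k" where "h b y = b (case_sum (\<lambda>_. 0) y)" for b y
    have hB: "h b \<in> polyfun (V \<union> W)" if "b \<in> B" for b
      unfolding h_def using B(2) that w_img
      by (intro polyfun_comp[of b "w ` {..<K}" "\<lambda>y. case_sum (\<lambda>_. 0) y"]) (auto intro: polyfun.var)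
    show ?thesis
      unfolding finite_map_def
    proof (intro exI[of _ "h ` B"] conjI ballI)
      fix R :: "('v \<Rightarrow> 'k) \<Rightarrow> 'k" assume R: "R \<in> polyfun (V \<union> W)"
      have "(\<lambda>z. R (\<lambda>v. z (Inr v))) \<in> polyfun (tw.S K)"
        using R unfolding SK by (intro polyfun_comp[OF R]) (auto intro: polyfun.var)
      then obtain a where a: "\<forall>b\<in>B. a b \<in> polyfun S0"
        "\<forall>x. (\<forall>l<K. tw.F l x = 0) \<longrightarrow> R (\<lambda>v. x (Inr v)) = (\<Sum>b\<in>B. a b x * b x)"
        using bspec[OF B(3)] by blast
      \<comment> \<open>Different \<open>b\<close> may become the same function \<open>h b\<close>;
        their coefficients are added up.\<close>
      define a' where "a' b' y = (\<Sum>b\<in>{b \<in> B. h b = b'}. a b (case_sum y (\<lambda>_. 0)))"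
        for b' and y :: "nat \<Rightarrow> 'k"
      have "a' b' \<in> polyfun {..<N}" for b'
        unfolding a'_def using a(1)
        by (intro polyfun_sum polyfun_comp[of "a _" S0 "\<lambda>y. case_sum y (\<lambda>_. 0)"])
           (auto simp: S0_def intro: polyfun.var)
      moreover have "R y = (\<Sum>b'\<in>h ` B. a' b' (\<pi> y) * b' y)" if y: "y \<in> Y" for y
      proof -
        let ?z = "graph_point \<pi> y"
        have "R y = (\<Sum>b\<in>B. a b ?z * b ?z)"
          using spec[OF a(2), of ?z] F_gp[OF y] by (simp add: graph_point_def)
        also have "\<dots> = (\<Sum>b\<in>B. a b (case_sum (\<pi> y) (\<lambda>_. 0)) * h b y)"
        proof (intro sum.cong refl arg_cong2[where f = "(*)"])
          fix b assume b: "b \<in> B"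
          have ab: "a b \<in> polyfun S0" and bB: "b \<in> polyfun (w ` {..<K})" using a(1) b B(2) by auto
          show "a b ?z = a b (case_sum (\<pi> y) (\<lambda>_. 0))"
            by (rule polyfun_cong[OF ab]) (auto simp: S0_def graph_point_def)
          show "b ?z = h b y"
            unfolding h_def by (rule polyfun_cong[OF bB]) (auto simp: w_img graph_point_def)
        qed
        also have "\<dots> = (\<Sum>b'\<in>h ` B. \<Sum>b\<in>{b \<in> B. h b = b'}. a b (case_sum (\<pi> y) (\<lambda>_. 0)) * h b y)"
          by (rule sum.image_gen[OF B(1)])
        also have "\<dots> = (\<Sum>b'\<in>h ` B. a' b' (\<pi> y) * b' y)"
          by (intro sum.cong refl) (auto simp: a'_def sum_distrib_right)
        finally show ?thesis .
      qed
      ultimately show "\<exists>c. (\<forall>b\<in>h ` B. c b \<in> polyfun {..<N}) \<and>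
          (\<forall>y\<in>Y. R y = (\<Sum>b\<in>h ` B. c b (\<pi> y) * b y))"
        by (intro exI[of _ a']) auto
    qed (use B(1) hB in auto)
  qed
  moreover have "smooth_map (V \<union> W) {..<N} Y \<pi>"
    unfolding smooth_map_def
  proof
    fix y assume y: "y \<in> Y"
    have "tw.F l \<in> graph_ideal (V \<union> W) {..<N} Y \<pi>" if "l < K" for l
      using tw.F_poly[OF that that] F_gp that by (auto simp: graph_ideal_def SK)
    moreover have "\<exists>u \<in> polyfun ({..<N} <+> (V \<union> W)). \<exists>g. u (graph_point \<pi> y) \<noteq> 0 \<and>
        (\<forall>l<K. g l \<in> polyfun ({..<N} <+> (V \<union> W))) \<and> (\<forall>x. u x * R x = (\<Sum>l<K. g l x * tw.F l x))"
      if R: "R \<in> graph_ideal (V \<union> W) {..<N} Y \<pi>" for R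
    proof -
      have R': "R \<in> polyfun (tw.S K)" "\<And>y. y \<in> Y \<Longrightarrow> R (graph_point \<pi> y) = 0"
        using R by (auto simp: graph_ideal_def SK)
      have "R z = 0" if z: "\<And>l. l < K \<Longrightarrow> tw.F l z = 0" for z
      proof -
        \<comment> \<open>A zero \<open>z\<close> of the tower may be nonzero outside the index set.
          Cutting it off there gives a point of \<open>Y\<close> whose graph point agrees with
          \<open>z\<close> on \<open>tw.S K\<close>.\<close>
        define y' where "y' v = (if v \<in> V \<union> W then z (Inr v) else 0)" for v
        have zF: "\<forall>l<K. tw.F l z = 0" using z by blast
        have agree: "z i = graph_point \<pi> y' i" if "i \<in> tw.S K" for i
          using that conjunct1[OF iffD1[OF F_iff zF]] eV
          by (auto simp: SK graph_point_def \<pi>_def y'_def)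
        have "tw.F l (graph_point \<pi> y') = 0" if "l < K" for l
          using polyfun_cong[OF tw.F_poly[OF that that] agree] z[OF that] by simp
        then have "\<forall>v\<in>W. y' v ^ Q v - y' v + P v y' = 0"
          using F_iff[of "graph_point \<pi> y'"] by (simp add: graph_point_def)
        then have "y' \<in> Y" by (auto simp: Y_def affine_space_def y'_def)
        then have "R (graph_point \<pi> y') = 0" by (rule R'(2))
        then show ?thesis using polyfun_cong[OF R'(1) agree] by simp
      qed
      then obtain g where "\<forall>l<K. g l \<in> polyfun (tw.S K)" "\<forall>x. R x = (\<Sum>l<K. g l x * tw.F l x)"
        using tw.vanishing_imp_ideal[OF order.refl R'(1)] by blast
      \<comment> \<open>The equations generate the ideal of the graph globally, so the denominator
        \<open>u\<close> can be taken to be 1.\<close>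
      then show ?thesis
        by (intro bexI[of _ "\<lambda>x. 1"] exI[of _ g]) (auto simp: SK intro: polyfun.const)
    qed
    moreover have "\<forall>l<K. r l = 0"
      if r: "\<forall>i\<in>V \<union> W. (\<Sum>l<K. r l * partial_deriv (Inr i) (tw.F l) (graph_point \<pi> y)) = 0" for r
    proof -
      have "(\<Sum>l<K. r l * partial_deriv (w i) (tw.F l) (graph_point \<pi> y)) = 0" if "i < K" for i
      proof -
        have "w i \<in> Inr ` (V \<union> W)" using w_img that by blast
        then show ?thesis using r by auto
      qed
      then show ?thesis using tw.differentials_independent by blast
    qed
    ultimately show "smooth_at (V \<union> W) {..<N} Y \<pi> y"
      unfolding smooth_at_def Let_def by (intro exI[of _ K] exI[of _ tw.F]) auto
  qed
  ultimately show ?thesis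
    using fin unfolding finite_smooth_over_affine_space_def Y_def by blast
qed

section \<open>Expansions and leading indices\<close>

lemma fls_nth_sum: "fls_nth (\<Sum>i\<in>I. f i) k = (\<Sum>i\<in>I. fls_nth (f i) k)"
  by (induction I rule: infinite_finite_induct) auto

text \<open>Here \<open>a\<close> and \<open>b\<close> are lower bounds for the orders rather than
  the orders themselves, so that zero factors and vanishing first coefficients are covered.\<close>

lemma fls_mult_low:
  fixes f g :: "'k::field fls"
  assumes f: "\<And>k. k < a \<Longrightarrow> fls_nth f k = 0" and g: "\<And>k. k < b \<Longrightarrow> fls_nth g k = 0"
  shows "k < a + b \<Longrightarrow> fls_nth (f * g) k = 0" and "fls_nth (f * g) (a + b) = fls_nth f a * fls_nth g b"
proof -
  have "(k < a + b \<longrightarrow> fls_nth (f * g) k = 0) \<and> fls_nth (f * g) (a + b) = fls_nth f a * fls_nth g b"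
  proof (cases "f = 0 \<or> g = 0")
    case False
    then have sd: "a \<le> fls_subdegree f" "b \<le> fls_subdegree g"
      using f g by (auto intro: fls_subdegree_geI)
    then have "fls_nth (f * g) k = 0" if "k < a + b" for k
      using that by (intro fls_times_nth_eq0) simp
    moreover have "fls_nth (f * g) (a + b) = fls_nth f a * fls_nth g b"
    proof (cases "a = fls_subdegree f \<and> b = fls_subdegree g")
      case True
      then show ?thesis using fls_times_base[of f g] by simp
    next
      case F: False
      then have "a < fls_subdegree f \<or> b < fls_subdegree g" using sd by auto
      then have "fls_nth f a * fls_nth g b = 0" by auto
      moreover have "fls_nth (f * g) (a + b) = 0"
        using sd F by (intro fls_times_nth_eq0) linarith
      ultimately show ?thesis by simp
    qed
    ultimately show ?thesis by blast
  qed auto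
  then show "k < a + b \<Longrightarrow> fls_nth (f * g) k = 0"
    and "fls_nth (f * g) (a + b) = fls_nth f a * fls_nth g b" by auto
qed

lemma integers_L_iff: "f \<in> integers_L \<longleftrightarrow> (\<forall>k<0. fls_nth f k = 0)"
proof
  assume "\<forall>k<0. fls_nth f k = 0"
  then have "f = fps_to_fls (fls_regpart f)" by (intro fls_eqI) auto
  then show "f \<in> integers_L" by (auto simp: integers_L_def)
qed (auto simp: integers_L_def)

lemma integers_L_0: "0 \<in> integers_L" and integers_L_1: "1 \<in> integers_L"
  by (auto simp: integers_L_iff)

lemma integers_L_add: "f \<in> integers_L \<Longrightarrow> g \<in> integers_L \<Longrightarrow> f + g \<in> integers_L"
  by (auto simp: integers_L_iff)

lemma integers_L_mult: "f \<in> integers_L \<Longrightarrow> g \<in> integers_L \<Longrightarrow> f * g \<in> integers_L"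
  using fls_mult_low(1)[of 0 f 0 g] by (auto simp: integers_L_iff)

lemma integers_L_const: "fls_const a \<in> integers_L"
  by (auto simp: integers_L_iff)

lemma integers_L_uminus: "f \<in> integers_L \<Longrightarrow> - f \<in> integers_L"
  by (auto simp: integers_L_iff)

lemma integers_L_X_intpow: "0 \<le> k \<Longrightarrow> fls_X_intpow k \<in> integers_L"
  by (auto simp: integers_L_iff)

lemma integers_L_sum: "(\<And>i. i \<in> I \<Longrightarrow> f i \<in> integers_L) \<Longrightarrow> (\<Sum>i\<in>I. f i) \<in> integers_L"
  by (induction I rule: infinite_finite_induct) (auto intro: integers_L_0 integers_L_add)

lemma integers_L_prod: "(\<And>i. i \<in> I \<Longrightarrow> f i \<in> integers_L) \<Longrightarrow> (\<Prod>i\<in>I. f i) \<in> integers_L"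
  by (induction I rule: infinite_finite_induct) (auto intro: integers_L_1 integers_L_mult)

text \<open>The filtration by the index of the basis vectors \<open>e_i\<close>. Since
  \<open>e_(i+n) = t e_i\<close>, it refines the t-adic filtration by the factor
  \<open>n\<close>.\<close>

definition low :: "nat \<Rightarrow> 'k::field fls vec \<Rightarrow> int \<Rightarrow> bool" where
  "low n v c \<longleftrightarrow> v \<in> carrier_vec n \<and> (\<forall>i<c. ecoeff n v i = 0)"

definition lead :: "nat \<Rightarrow> 'k::field fls vec \<Rightarrow> int \<Rightarrow> bool" where
  "lead n v i \<longleftrightarrow> low n v i \<and> ecoeff n v i \<noteq> 0"

definition integral_vec :: "nat \<Rightarrow> 'k::field fls vec \<Rightarrow> bool" where
  "integral_vec n v \<longleftrightarrow> v \<in> carrier_vec n \<and> (\<forall>l<n. v $ l \<in> integers_L)"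

context
  fixes n :: nat
  assumes n: "n \<ge> 1"
begin

lemma ecoeff_comp: "l < n \<Longrightarrow> ecoeff n v (int n * k + int l + 1) = fls_nth (v $ l) k"
  by (simp add: ecoeff_def)

lemma index_split: "i = int n * ((i - 1) div int n) + int (nat ((i - 1) mod int n)) + 1"
  and index_mod_less: "nat ((i - 1) mod int n) < n"
  using n by (auto simp: nat_less_iff)

lemma vec_eq_if_ecoeff:
  assumes "v \<in> carrier_vec n" "w \<in> carrier_vec n" "\<And>i. ecoeff n v i = ecoeff n w i"
  shows "v = w"
proof (rule eq_vecI)
  fix l assume "l < dim_vec w"
  then have l: "l < n" using assms by simp
  show "v $ l = w $ l"
    using assms(3)[of "int n * k + int l + 1" for k] l by (intro fls_eqI) (simp add: ecoeff_comp)
qed (use assms in auto)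

lemma ecoeff_add: "v \<in> carrier_vec n \<Longrightarrow> w \<in> carrier_vec n \<Longrightarrow> ecoeff n (v + w) i = ecoeff n v i + ecoeff n w i"
  using index_mod_less by (simp add: ecoeff_def)

lemma ecoeff_minus: "v \<in> carrier_vec n \<Longrightarrow> w \<in> carrier_vec n \<Longrightarrow> ecoeff n (v - w) i = ecoeff n v i - ecoeff n w i"
  using index_mod_less by (simp add: ecoeff_def)

lemma ecoeff_const_smult: "v \<in> carrier_vec n \<Longrightarrow> ecoeff n (fls_const a \<cdot>\<^sub>v v) i = a * ecoeff n v i"
  using index_mod_less by (simp add: ecoeff_def)

lemma ecoeff_0: "ecoeff n (0\<^sub>v n) i = 0"
  using index_mod_less by (simp add: ecoeff_def)

lemma ecoeff_X_smult:
  assumes "v \<in> carrier_vec n"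
  shows "ecoeff n (fls_X_intpow k \<cdot>\<^sub>v v) i = ecoeff n v (i - int n * k)"
proof -
  have eq: "i - int n * k - 1 = (i - 1) + (- k) * int n" by (simp add: algebra_simps)
  have "(i - int n * k - 1) mod int n = (i - 1) mod int n"
    unfolding eq by (rule mod_mult_self1)
  moreover have "(i - int n * k - 1) div int n = - k + (i - 1) div int n"
    unfolding eq by (rule div_mult_self1) (use n in simp)
  ultimately have "(i - int n * k - 1) mod int n = (i - 1) mod int n"
    "(i - int n * k - 1) div int n = (i - 1) div int n - k" by simp_all
  then show ?thesis
    using assms index_mod_less[of i]
    by (simp add: ecoeff_def fls_X_intpow_times_conv_shift)
qed

lemma ecoeff_vec_sum:
  "ecoeff n (vec n (\<lambda>l. \<Sum>j\<in>J. f j $ l)) i = (\<Sum>j\<in>J. ecoeff n (f j) i)"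
  using index_mod_less by (simp add: ecoeff_def fls_nth_sum)

lemma ecoeff_mult_mat_vec:
  assumes "g \<in> carrier_mat n n" "c \<in> carrier_vec n"
  shows "ecoeff n (g *\<^sub>v c) i = (\<Sum>l<n. ecoeff n (c $ l \<cdot>\<^sub>v col g l) i)"
proof -
  have "g *\<^sub>v c = vec n (\<lambda>j. \<Sum>l\<in>{..<n}. (c $ l \<cdot>\<^sub>v col g l) $ j)"
    using assms by (intro eq_vecI) (auto simp: scalar_prod_def atLeast0LessThan mult.commute)
  then show ?thesis by (simp add: ecoeff_vec_sum)
qed

lemma ecoeff_smult_evec:
  "ecoeff n (f \<cdot>\<^sub>v evec n j) i = (if (i - j) mod int n = 0 then fls_nth f ((i - j) div int n) else 0)"
proof -
  let ?l = "nat ((i - 1) mod int n)" and ?l' = "nat ((j - 1) mod int n)"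
  have l: "?l < n" "?l' < n" using index_mod_less by auto
  have eq: "?l = ?l' \<longleftrightarrow> (i - j) mod int n = 0"
  proof -
    have "?l = ?l' \<longleftrightarrow> (i - 1) mod int n = (j - 1) mod int n" using n by (simp add: nat_eq_iff)
    also have "\<dots> \<longleftrightarrow> int n dvd (i - 1) - (j - 1)" by (simp add: mod_eq_dvd_iff)
    finally show ?thesis by (simp add: dvd_eq_mod_eq_0)
  qed
  show ?thesis
  proof (cases "(i - j) mod int n = 0")
    case True
    then obtain k where k: "i - j = int n * k" by (auto elim: dvdE simp: dvd_eq_mod_eq_0[symmetric])
    then have eq': "i - 1 = (j - 1) + k * int n" by (simp add: algebra_simps)
    have "(i - 1) div int n = k + (j - 1) div int n"
      unfolding eq' by (rule div_mult_self1) (use n in simp)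
    have "?l = ?l'" using eq True by blast
    then have "(f \<cdot>\<^sub>v evec n j) $ ?l = f * fls_X_intpow ((j - 1) div int n)"
      using l by (simp add: evec_def)
    then have "ecoeff n (f \<cdot>\<^sub>v evec n j) i = fls_nth f ((i - 1) div int n - (j - 1) div int n)"
      by (simp only: ecoeff_def fls_X_intpow_times_conv_shift) simp
    moreover have "(i - j) div int n = k" using k n by simp
    ultimately show ?thesis using True \<open>(i - 1) div int n = _\<close> by simp
  next
    case False
    then show ?thesis using l eq by (simp add: ecoeff_def evec_def)
  qed
qed

lemma evec_carrier: "evec n j \<in> carrier_vec n"
  by (simp add: evec_def)

lemma ecoeff_evec: "ecoeff n (evec n j) i = (if i = j then 1 else 0)"
proof -
  have "ecoeff n (evec n j) i = ecoeff n (1 \<cdot>\<^sub>v evec n j) i" by simp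
  also have "\<dots> = (if i = j then 1 else 0)"
    unfolding ecoeff_smult_evec using n by (auto simp: dvd_eq_mod_eq_0[symmetric] elim!: dvdE)
  finally show ?thesis .
qed

lemma ex_vec_ecoeff:
  assumes "\<And>i. i < c \<Longrightarrow> f i = 0"
  shows "\<exists>v\<in>carrier_vec n. \<forall>i. ecoeff n v i = f i"
proof
  let ?v = "vec n (\<lambda>l. Abs_fls (\<lambda>k. f (int n * k + int l + 1)))"
  show "?v \<in> carrier_vec n" by simp
  show "\<forall>i. ecoeff n ?v i = f i"
  proof
    fix i
    let ?l = "nat ((i - 1) mod int n)"
    \<comment> \<open>A crude lower bound for the order, uniform in the component: below it the
      index \<open>n * k + l + 1\<close> stays under \<open>c\<close>.\<close>
    have "\<forall>k < - \<bar>c\<bar> - 1. f (int n * k + int ?l + 1) = 0"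
    proof (intro allI impI assms)
      fix k assume k: "k < - \<bar>c\<bar> - 1"
      have "int n * k + int ?l + 1 \<le> int n * k + int n" using index_mod_less[of i] by simp
      also have "\<dots> = int n * (k + 1)" by (simp add: algebra_simps)
      also have "\<dots> \<le> 1 * (k + 1)" using k n by (intro mult_right_mono_neg) auto
      finally show "int n * k + int ?l + 1 < c" using k abs_ge_minus_self[of c] by simp
    qed
    then have "fls_nth (Abs_fls (\<lambda>k. f (int n * k + int ?l + 1))) k = f (int n * k + int ?l + 1)" for k
      by (rule nth_Abs_fls_lower_bound)
    then show "ecoeff n ?v i = f i"
      using index_split[of i] index_mod_less[of i] by (simp add: ecoeff_def)
  qed
qed

lemma lead_carrier: "lead n v i \<Longrightarrow> v \<in> carrier_vec n"
  by (auto simp: low_def lead_def)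

lemma low_mono: "low n v c \<Longrightarrow> c' \<le> c \<Longrightarrow> low n v c'"
  by (auto simp: low_def)

lemma low_Suc: "low n v c \<Longrightarrow> ecoeff n v c = 0 \<Longrightarrow> low n v (c + 1)"
  by (auto simp: low_def) (metis le_less zless_iff_Suc_zadd zle_add1_eq_le)

lemma low_minus: "low n v c \<Longrightarrow> low n w c \<Longrightarrow> low n (v - w) c"
  by (auto simp: low_def ecoeff_minus)

lemma ex_low:
  assumes "v \<in> carrier_vec n"
  shows "\<exists>c. low n v c"
proof -
  have "\<exists>b. \<forall>k<b. \<forall>l<n. fls_nth (v $ l) k = 0"
    by (rule exI[of _ "Min (insert 0 ((\<lambda>l. fls_subdegree (v $ l)) ` {..<n}))"]) (auto simp: Min_gr_iff)
  then obtain b where b: "\<And>k l. k < b \<Longrightarrow> l < n \<Longrightarrow> fls_nth (v $ l) k = 0" by blast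
  have "ecoeff n v i = 0" if "i < int n * b" for i
  proof -
    have "int n * ((i - 1) div int n) < int n * b"
      using that index_split[of i] by linarith
    then have "(i - 1) div int n < b" using n by simp
    then show ?thesis using b index_mod_less[of i] by (simp add: ecoeff_def)
  qed
  then show ?thesis using assms by (auto simp: low_def)
qed

lemma ex_lead:
  assumes v: "v \<in> carrier_vec n" "v \<noteq> 0\<^sub>v n"
  shows "\<exists>i. lead n v i"
proof -
  obtain c where c: "low n v c" using ex_low v by blast
  obtain i0 where i0: "ecoeff n v i0 \<noteq> 0"
    using vec_eq_if_ecoeff[OF v(1), of "0\<^sub>v n"] v(2) by (auto simp: ecoeff_0)
  then have "c \<le> i0" using c by (auto simp: low_def not_less[symmetric])
  define k where "k = (LEAST k. ecoeff n v (c + int k) \<noteq> 0)"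
  have "ecoeff n v (c + int (nat (i0 - c))) \<noteq> 0" using i0 \<open>c \<le> i0\<close> by simp
  then have k: "ecoeff n v (c + int k) \<noteq> 0" unfolding k_def by (rule LeastI)
  have "ecoeff n v i = 0" if "i < c + int k" for i
  proof (cases "i < c")
    case True
    then show ?thesis using c by (auto simp: low_def)
  next
    case False
    then have "nat (i - c) < k" using that by linarith
    then have "ecoeff n v (c + int (nat (i - c))) = 0" unfolding k_def by (blast dest: not_less_Least)
    then show ?thesis using False by simp
  qed
  then show ?thesis using k v(1) by (auto simp: lead_def low_def)
qed

lemma lead_unique: "lead n v i \<Longrightarrow> lead n v j \<Longrightarrow> i = j"
  by (metis lead_def low_def linorder_neqE)

lemma lead_ge: "lead n v i \<Longrightarrow> low n v c \<Longrightarrow> c \<le> i"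
  by (auto simp: lead_def low_def not_less[symmetric])

text \<open>A factor of order at least \<open>a\<close> raises the filtration by
  \<open>n * a\<close>. Each index belongs to a single component of the vector, where the claim is
  one about products of Laurent series.\<close>

lemma low_smult:
  assumes v: "low n v c" and f: "\<And>k. k < a \<Longrightarrow> fls_nth f k = 0"
  shows "low n (f \<cdot>\<^sub>v v) (c + int n * a)"
    and "ecoeff n (f \<cdot>\<^sub>v v) (c + int n * a) = fls_nth f a * ecoeff n v c"
proof -
  have vz: "fls_nth (v $ l) k = 0" if "int n * k + int l + 1 < c" "l < n" for l k
    using v that ecoeff_comp[of l v k] by (auto simp: low_def)
  have vn: "v \<in> carrier_vec n" using v by (simp add: low_def)
  show "low n (f \<cdot>\<^sub>v v) (c + int n * a)"
    unfolding low_def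
  proof (intro conjI allI impI)
    show "f \<cdot>\<^sub>v v \<in> carrier_vec n" using vn by simp
    fix i assume i: "i < c + int n * a"
    let ?l = "nat ((i - 1) mod int n)" and ?k = "(i - 1) div int n"
    have "fls_nth (v $ ?l) k = 0" if "k < ?k - a + 1" for k
    proof (rule vz[OF _ index_mod_less])
      have "int n * k \<le> int n * (?k - a)" using that n by (intro mult_left_mono) auto
      then show "int n * k + int ?l + 1 < c"
        using index_split[of i] i by (simp add: algebra_simps)
    qed
    then have "fls_nth (f * v $ ?l) ?k = 0" using f by (intro fls_mult_low(1)[of a _ "?k - a + 1"]) auto
    then show "ecoeff n (f \<cdot>\<^sub>v v) i = 0" using index_mod_less[of i] vn by (simp add: ecoeff_def)
  qed
  let ?i = "c + int n * a"
  let ?l = "nat ((?i - 1) mod int n)" and ?k = "(?i - 1) div int n"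
  have c: "c = int n * (?k - a) + int ?l + 1"
    using index_split[of ?i] by (simp add: algebra_simps)
  have "fls_nth (v $ ?l) k = 0" if "k < ?k - a" for k
  proof (rule vz[OF _ index_mod_less])
    have "int n * k < int n * (?k - a)" using that n by simp
    then show "int n * k + int ?l + 1 < c" using c by linarith
  qed
  then have "fls_nth (f * v $ ?l) (a + (?k - a)) = fls_nth f a * fls_nth (v $ ?l) (?k - a)"
    using f by (intro fls_mult_low(2)) auto
  moreover have "ecoeff n v c = fls_nth (v $ ?l) (?k - a)"
    by (subst (1) c, rule ecoeff_comp) (rule index_mod_less)
  ultimately show "ecoeff n (f \<cdot>\<^sub>v v) ?i = fls_nth f a * ecoeff n v c"
    using index_mod_less[of ?i] vn by (simp add: ecoeff_def)
qed

lemma lead_smult: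
  assumes "lead n v i" "f \<noteq> 0"
  shows "lead n (f \<cdot>\<^sub>v v) (i + int n * fls_subdegree f)"
  using low_smult[of v i "fls_subdegree f" f] assms by (auto simp: lead_def)

text \<open>The standard basis is \<open>e_1\<close>, ..., \<open>e_n\<close> and multiplication by
  \<open>t\<close> adds \<open>n\<close> to the index, so integral vectors involve exactly the
  indices from 1 on.\<close>

lemma integral_vec_iff_low: "integral_vec n v \<longleftrightarrow> low n v 1"
proof
  assume v: "low n v 1"
  have "v $ l \<in> integers_L" if l: "l < n" for l
    unfolding integers_L_iff
  proof (intro allI impI)
    fix k :: int assume "k < 0"
    then have "int n * k \<le> int n * (- 1)" by (intro mult_left_mono) auto
    then have "int n * k + int l + 1 < 1" using l by simp
    then show "fls_nth (v $ l) k = 0" using v ecoeff_comp[OF l, of v k] by (auto simp: low_def)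
  qed
  then show "integral_vec n v" using v by (auto simp: integral_vec_def low_def)
next
  assume v: "integral_vec n v"
  have "ecoeff n v i = 0" if "i < 1" for i
  proof -
    have "(i - 1) div int n < 0" using that n by (simp add: neg_imp_zdiv_neg_iff pos_imp_zdiv_neg_iff)
    then show ?thesis using v index_mod_less[of i] by (auto simp: ecoeff_def integral_vec_def integers_L_iff)
  qed
  then show "low n v 1" using v by (auto simp: low_def integral_vec_def)
qed

end

section \<open>Lattices\<close>

definition integral_mat :: "'k::field fls mat \<Rightarrow> bool" where
  "integral_mat g \<longleftrightarrow> elements_mat g \<subseteq> integers_L"

lemma integral_mat_iff: "g \<in> carrier_mat n n \<Longrightarrow> integral_mat g \<longleftrightarrow> (\<forall>i<n. \<forall>j<n. g $$ (i, j) \<in> integers_L)"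
  unfolding integral_mat_def by (blast dest: elements_matD carrier_matD)

lemma integral_mat_mult_vec:
  "g \<in> carrier_mat n n \<Longrightarrow> integral_mat g \<Longrightarrow> integral_vec n c \<Longrightarrow> integral_vec n (g *\<^sub>v c)"
  by (auto simp: integral_vec_def integral_mat_iff scalar_prod_def intro!: integers_L_sum integers_L_mult)

lemma integral_mat_if_cols:
  assumes "g \<in> carrier_mat n n" "\<And>l. l < n \<Longrightarrow> integral_vec n (col g l)"
  shows "integral_mat g"
  unfolding integral_mat_iff[OF assms(1)]
proof (intro allI impI)
  fix i j assume "i < n" "j < n"
  then show "g $$ (i, j) \<in> integers_L"
    using assms(2)[of j] assms(1) by (auto simp: integral_vec_def)
qed

lemma integral_mat_det: "g \<in> carrier_mat n n \<Longrightarrow> integral_mat g \<Longrightarrow> det g \<in> integers_L"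
proof -
  assume g: "g \<in> carrier_mat n n" "integral_mat g"
  have "signof p \<in> (integers_L :: 'a fls set)" for p
    by (cases p rule: sign_cases) (auto intro: integers_L_1 integers_L_uminus)
  moreover have "(\<Prod>i = 0..<n. g $$ (i, p i)) \<in> integers_L" if "p permutes {0..<n}" for p
    using g that by (intro integers_L_prod) (auto simp: integral_mat_iff dest: permutes_in_image[of p _ "_"])
  ultimately show ?thesis
    unfolding det_def'[OF g(1)] by (intro integers_L_sum integers_L_mult) auto
qed

lemma integral_unit_vec: "integral_vec n (unit_vec n l)"
  by (auto simp: integral_vec_def unit_vec_def intro: integers_L_0 integers_L_1)

text \<open>\<open>minv\<close> is computed by Gauss-Jordan elimination, which succeeds on the units
  of the matrix ring.\<close>

lemma minv:
  assumes "g \<in> carrier_mat n n" "invertible_mat g"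
  shows "minv g \<in> carrier_mat n n" "g * minv g = 1\<^sub>m n" "minv g * g = 1\<^sub>m n"
proof -
  obtain h where h: "g * h = 1\<^sub>m n" "h * g = 1\<^sub>m (dim_row h)"
    using assms by (auto simp: invertible_mat_def inverts_mat_def)
  have "dim_row h = n" "dim_col h = n" using arg_cong[OF h(1), of dim_col] arg_cong[OF h(2), of dim_col] assms(1) by auto
  then have "h \<in> carrier_mat n n" by auto
  then have "g \<in> Units (ring_mat TYPE('a) n ())"
    using assms(1) h by (auto simp: Units_def ring_mat_def)
  then obtain b where b: "mat_inverse g = Some b" using mat_inverse(1)[OF assms(1), where b = "()"] by (cases "mat_inverse g") auto
  then show "minv g \<in> carrier_mat n n" "g * minv g = 1\<^sub>m n" "minv g * g = 1\<^sub>m n"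
    using mat_inverse(2)[OF assms(1) b] by (auto simp: minv_def)
qed

lemma invertible_matI:
  assumes "g \<in> carrier_mat n n" "h \<in> carrier_mat n n" "g * h = 1\<^sub>m n" "h * g = 1\<^sub>m n"
  shows "invertible_mat g"
  using assms by (auto simp: invertible_mat_def inverts_mat_def square_mat.simps)

lemma minv_eqI:
  assumes "g \<in> carrier_mat n n" "h \<in> carrier_mat n n" "g * h = 1\<^sub>m n" "h * g = 1\<^sub>m n"
  shows "minv g = h"
proof -
  note m = minv[OF assms(1) invertible_matI[OF assms]]
  have "minv g = minv g * (g * h)" using assms m by simp
  also have "\<dots> = (minv g * g) * h" using assms(1,2) m(1) by (simp add: assoc_mult_mat[of _ n n _ n _ n])
  finally show ?thesis using m assms by simp
qed

lemma invertible_mat_if_kernel_trivial: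
  fixes g :: "'a::field mat"
  assumes "g \<in> carrier_mat n n" "\<And>c. c \<in> carrier_vec n \<Longrightarrow> c \<noteq> 0\<^sub>v n \<Longrightarrow> g *\<^sub>v c \<noteq> 0\<^sub>v n"
  shows "invertible_mat g"
proof -
  have "det g \<noteq> 0" using det_0_iff_vec_prod_zero_field[OF assms(1)] assms(2) by blast
  from det_non_zero_imp_unit[OF assms(1) this, of "()"]
  show ?thesis using assms(1) by (auto simp: Units_def ring_mat_def intro: invertible_matI)
qed

lemma minv_mult_vec:
  assumes "g \<in> carrier_mat n n" "invertible_mat g" "c \<in> carrier_vec n"
  shows "minv g *\<^sub>v (g *\<^sub>v c) = c" "g *\<^sub>v (minv g *\<^sub>v c) = c"
  using minv[OF assms(1,2)] assms assoc_mult_mat_vec[of g n n "minv g" n c]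
    assoc_mult_mat_vec[of "minv g" n n g n c] by auto

lemma det_minv: 
  assumes "g \<in> carrier_mat n n" "invertible_mat g"
  shows "det g * det (minv g) = 1"
  using det_mult[OF assms(1) minv(1)[OF assms]] minv(2)[OF assms] by simp

definition latt :: "nat \<Rightarrow> 'k::field fls mat \<Rightarrow> 'k fls vec set" where
  "latt n g = {g *\<^sub>v w | w. integral_vec n w}"

lemma lattice_of_eq: "\<tau> < d \<Longrightarrow> lattice_of d n g \<tau> = latt n (g \<tau>)"
  by (simp add: lattice_of_def latt_def integral_vec_def)

text \<open>Lattices are described without a basis, as modules over the integers of L that lie
  between two steps of the filtration by leading index. A basis is recovered from the leading
  indices where one is wanted.\<close>

definition olattice :: "nat \<Rightarrow> 'k::field fls vec set \<Rightarrow> bool" where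
  "olattice n \<Lambda> \<longleftrightarrow> \<Lambda> \<subseteq> carrier_vec n \<and> (\<forall>u\<in>\<Lambda>. \<forall>w\<in>\<Lambda>. u + w \<in> \<Lambda>) \<and>
     (\<forall>f\<in>integers_L. \<forall>w\<in>\<Lambda>. f \<cdot>\<^sub>v w \<in> \<Lambda>) \<and>
     (\<exists>c. \<forall>w. low n w c \<longrightarrow> w \<in> \<Lambda>) \<and> (\<exists>c. \<forall>w\<in>\<Lambda>. low n w c)"

definition leads :: "nat \<Rightarrow> 'k::field fls vec set \<Rightarrow> int set" where
  "leads n \<Lambda> = {i. \<exists>w\<in>\<Lambda>. lead n w i}"

text \<open>Incongruence modulo \<open>n\<close> prevents two columns from sharing a leading index
  after scaling, which changes leading indices by multiples of \<open>n\<close>.\<close>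

definition lead_basis :: "nat \<Rightarrow> 'k::field fls mat \<Rightarrow> (nat \<Rightarrow> int) \<Rightarrow> bool" where
  "lead_basis n g b \<longleftrightarrow> g \<in> carrier_mat n n \<and> (\<forall>l<n. lead n (col g l) (b l)) \<and>
     inj_on (\<lambda>l. b l mod int n) {..<n}"

lemma olatticeD:
  assumes "olattice n \<Lambda>"
  shows "w \<in> \<Lambda> \<Longrightarrow> w \<in> carrier_vec n" "u \<in> \<Lambda> \<Longrightarrow> w \<in> \<Lambda> \<Longrightarrow> u + w \<in> \<Lambda>"
    "f \<in> integers_L \<Longrightarrow> w \<in> \<Lambda> \<Longrightarrow> f \<cdot>\<^sub>v w \<in> \<Lambda>"
    "\<exists>c. \<forall>w. low n w c \<longrightarrow> w \<in> \<Lambda>" "\<exists>c. \<forall>w\<in>\<Lambda>. low n w c"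
  using assms by (auto simp: olattice_def)

lemma olattice_minus:
  fixes \<Lambda> :: "'k::field fls vec set"
  assumes "olattice n \<Lambda>" "u \<in> \<Lambda>" "w \<in> \<Lambda>"
  shows "u - w \<in> \<Lambda>"
proof -
  have "u - w = u + (- 1) \<cdot>\<^sub>v w" using olatticeD(1)[OF assms(1)] assms(2,3) by (intro eq_vecI) auto
  moreover have "(- 1 :: 'k fls) \<in> integers_L" by (intro integers_L_uminus integers_L_1)
  ultimately show ?thesis using olatticeD(2,3)[OF assms(1)] assms(2,3) by simp
qed

context
  fixes n :: nat
  assumes n: "n \<ge> 1"
begin

lemma olattice_vec_sum:
  fixes f :: "'j \<Rightarrow> 'k::field fls vec"
  assumes "olattice n \<Lambda>" "finite J" "\<And>j. j \<in> J \<Longrightarrow> f j \<in> \<Lambda>"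
  shows "vec n (\<lambda>l. \<Sum>j\<in>J. f j $ l) \<in> \<Lambda>"
  using assms(2,3)
proof (induction J rule: finite_induct)
  case empty
  have "vec n (\<lambda>l. \<Sum>j\<in>{}. f j $ l) = 0\<^sub>v n" by (intro eq_vecI) auto
  moreover have "0\<^sub>v n \<in> \<Lambda>" using olatticeD(4)[OF assms(1)] by (auto simp: low_def ecoeff_0[OF n])
  ultimately show ?case by simp
next
  case (insert j J)
  have "vec n (\<lambda>l. \<Sum>j\<in>insert j J. f j $ l) = f j + vec n (\<lambda>l. \<Sum>j\<in>J. f j $ l)"
    using insert olatticeD(1)[OF assms(1), of "f j"] by (intro eq_vecI) auto
  then show ?case using insert olatticeD(2)[OF assms(1)] by auto
qed

lemma olattice_mult_vec:
  assumes "olattice n \<Lambda>" "g \<in> carrier_mat n n" "\<And>l. l < n \<Longrightarrow> col g l \<in> \<Lambda>" "integral_vec n c"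
  shows "g *\<^sub>v c \<in> \<Lambda>"
proof -
  have "g *\<^sub>v c = vec n (\<lambda>j. \<Sum>l\<in>{..<n}. (c $ l \<cdot>\<^sub>v col g l) $ j)"
    using assms(2,4)
    by (intro eq_vecI) (auto simp: integral_vec_def scalar_prod_def atLeast0LessThan mult.commute)
  moreover have "c $ l \<cdot>\<^sub>v col g l \<in> \<Lambda>" if "l < n" for l
    using assms that olatticeD(3)[OF assms(1)] by (auto simp: integral_vec_def)
  ultimately show ?thesis using olattice_vec_sum[OF assms(1), of "{..<n}" "\<lambda>l. c $ l \<cdot>\<^sub>v col g l"] by simp
qed

text \<open>Continuity of a matrix for the filtration by leading index, with a uniform loss
  \<open>N\<close>. Applied to \<open>g\<close> and to its inverse it yields the two bounds in
  \<open>olattice\<close>.\<close>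

lemma low_mult_mat_vec:
  assumes g: "g \<in> carrier_mat n n"
  shows "\<exists>N. \<forall>c w. low n w c \<longrightarrow> low n (g *\<^sub>v w) (c - N)"
proof -
  have "\<exists>b. \<forall>l<n. low n (col g l) b"
  proof -
    have "\<forall>l\<in>{..<n}. \<exists>b. low n (col g l) b" using g by (auto intro!: ex_low[OF n])
    from bchoice[OF this] obtain b where b: "\<And>l. l < n \<Longrightarrow> low n (col g l) (b l)" by auto
    then have "low n (col g l) (Min (insert 0 (b ` {..<n})))" if "l < n" for l
      using that by (intro low_mono[OF n b]) auto
    then show ?thesis by blast
  qed
  then obtain b where b: "\<And>l. l < n \<Longrightarrow> low n (col g l) b" by blast
  have "low n (g *\<^sub>v w) (c - (2 * int n - b))" if w: "low n w c" for w c
    unfolding low_def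
  proof (intro conjI allI impI)
    show "g *\<^sub>v w \<in> carrier_vec n" using g w by (auto simp: low_def)
    fix i assume i: "i < c - (2 * int n - b)"
    have "ecoeff n (w $ l \<cdot>\<^sub>v col g l) i = 0" if l: "l < n" for l
    proof -
      \<comment> \<open>The ceiling of \<open>(c - 1 - l) / n\<close>: the least order possible for
        component \<open>l\<close> of a vector in step \<open>c\<close> of the filtration. Since
        \<open>n * a\<close> is at least \<open>c - 2 * n\<close>, the loss is at most
        \<open>2 * n - b\<close>.\<close>
      define a where "a = (c - 1 - int l + int n - 1) div int n"
      have a: "int n * a \<ge> c - 2 * int n"
        using l n mod_less_divisor[of n] pos_mod_bound[of "int n" "c - 1 - int l + int n - 1"]
          minus_mod_eq_mult_div[of "c - 1 - int l + int n - 1" "int n"]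
        unfolding a_def by linarith
      have "fls_nth (w $ l) k = 0" if k: "k < a" for k
      proof -
        have "int n * k \<le> int n * (a - 1)" using k by (intro mult_left_mono) auto
        also have "\<dots> \<le> c - 1 - int l - 1"
          using n pos_mod_sign[of "int n" "c - 1 - int l + int n - 1"]
            minus_mod_eq_mult_div[of "c - 1 - int l + int n - 1" "int n"]
          unfolding a_def right_diff_distrib by linarith
        finally show ?thesis using w ecoeff_comp[OF n l, of w k] by (auto simp: low_def)
      qed
      then have "low n (w $ l \<cdot>\<^sub>v col g l) (b + int n * a)"
        by (intro low_smult(1)[OF n b[OF l]]) auto
      then show ?thesis using a i by (auto simp: low_def)
    qed
    then show "ecoeff n (g *\<^sub>v w) i = 0"
      using w by (subst ecoeff_mult_mat_vec[OF n g]) (auto simp: low_def)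
  qed
  then show ?thesis by blast
qed

lemma olattice_latt:
  assumes g: "g \<in> carrier_mat n n" "invertible_mat g"
  shows "olattice n (latt n g)"
  unfolding olattice_def
proof (intro conjI)
  note iv = integral_vec_iff_low[OF n]
  show "latt n g \<subseteq> carrier_vec n" using g by (auto simp: latt_def integral_vec_def)
  show "\<forall>u\<in>latt n g. \<forall>w\<in>latt n g. u + w \<in> latt n g"
  proof (intro ballI)
    fix u w assume "u \<in> latt n g" "w \<in> latt n g"
    then obtain c c' where c: "u = g *\<^sub>v c" "w = g *\<^sub>v c'" "integral_vec n c" "integral_vec n c'"
      by (auto simp: latt_def)
    then have "u + w = g *\<^sub>v (c + c')" "integral_vec n (c + c')"
      using g by (auto simp: integral_vec_def mult_add_distrib_mat_vec intro!: integers_L_add)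
    then show "u + w \<in> latt n g" by (auto simp: latt_def)
  qed
  show "\<forall>f\<in>integers_L. \<forall>w\<in>latt n g. f \<cdot>\<^sub>v w \<in> latt n g"
  proof (intro ballI)
    fix f :: "'a fls" and w assume f: "f \<in> integers_L" and "w \<in> latt n g"
    then obtain c where c: "w = g *\<^sub>v c" "integral_vec n c" by (auto simp: latt_def)
    then have "f \<cdot>\<^sub>v w = g *\<^sub>v (f \<cdot>\<^sub>v c)" "integral_vec n (f \<cdot>\<^sub>v c)"
      using f g by (auto simp: integral_vec_def mult_mat_vec[of g n n] intro!: integers_L_mult)
    then show "f \<cdot>\<^sub>v w \<in> latt n g" by (auto simp: latt_def)
  qed
  show "\<exists>c. \<forall>w. low n w c \<longrightarrow> w \<in> latt n g"
  proof -
    obtain N where N: "\<And>c w. low n w c \<Longrightarrow> low n (minv g *\<^sub>v w) (c - N)"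
      using low_mult_mat_vec[OF minv(1)[OF g]] by blast
    have "w \<in> latt n g" if "low n w (N + 1)" for w
    proof -
      have "integral_vec n (minv g *\<^sub>v w)" using N[OF that] by (simp add: iv)
      moreover have "w = g *\<^sub>v (minv g *\<^sub>v w)" using minv_mult_vec(2)[OF g] that by (simp add: low_def)
      ultimately show ?thesis by (auto simp: latt_def)
    qed
    then show ?thesis by blast
  qed
  show "\<exists>c. \<forall>w\<in>latt n g. low n w c"
    using low_mult_mat_vec[OF g(1)] by (fastforce simp: latt_def iv)
qed

text \<open>The leading indices of the nonzero summands are pairwise incongruent modulo \<open>n\<close>, so that no
  cancellation of leading terms can occur.\<close>

lemma lead_basis_mult_vec:
  assumes B: "lead_basis n g b" and c: "c \<in> carrier_vec n" "c \<noteq> 0\<^sub>v n"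
  shows "\<exists>l<n. c $ l \<noteq> 0 \<and> lead n (g *\<^sub>v c) (b l + int n * fls_subdegree (c $ l))"
proof -
  have g: "g \<in> carrier_mat n n" and lb: "\<And>l. l < n \<Longrightarrow> lead n (col g l) (b l)"
    and inj: "inj_on (\<lambda>l. b l mod int n) {..<n}" using B by (auto simp: lead_basis_def)
  define I where "I = {l. l < n \<and> c $ l \<noteq> 0}"
  define h where "h l = b l + int n * fls_subdegree (c $ l)" for l
  have "I \<noteq> {}"
  proof
    assume "I = {}"
    then have "c = 0\<^sub>v n" using c(1) by (intro eq_vecI) (auto simp: I_def)
    then show False using c(2) by simp
  qed
  have finI: "finite I" by (simp add: I_def)
  define l0 where "l0 = arg_min_on h I"
  have l0: "l0 \<in> I" "\<And>l. l \<in> I \<Longrightarrow> h l0 \<le> h l"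
    using arg_min_if_finite[OF finI \<open>I \<noteq> {}\<close>, of h] by (auto simp: l0_def not_less)
  have leadl: "lead n (c $ l \<cdot>\<^sub>v col g l) (h l)" if "l \<in> I" for l
    using lead_smult[OF n lb, of l "c $ l"] that by (simp add: I_def h_def)
  have zero: "ecoeff n (c $ l \<cdot>\<^sub>v col g l) i = 0" if "l < n" "l \<notin> I" for l i
  proof -
    have "c $ l \<cdot>\<^sub>v col g l = 0\<^sub>v n" using that g by (intro eq_vecI) (auto simp: I_def)
    then show ?thesis by (simp add: ecoeff_0[OF n])
  qed
  have ne: "h l \<noteq> h l0" if "l \<in> I" "l \<noteq> l0" for l
  proof
    assume "h l = h l0"
    then have "b l mod int n = b l0 mod int n"
      unfolding h_def by (metis mod_mult_self2)
    then show False using inj that l0(1) by (auto simp: inj_on_def I_def)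
  qed
  have "low n (g *\<^sub>v c) (h l0)"
    unfolding low_def
  proof (intro conjI allI impI)
    fix i assume "i < h l0"
    then have "ecoeff n (c $ l \<cdot>\<^sub>v col g l) i = 0" if "l < n" for l
      using leadl[of l] zero[of l i] l0(2)[of l] that by (cases "l \<in> I") (auto simp: lead_def low_def)
    then show "ecoeff n (g *\<^sub>v c) i = 0" by (simp add: ecoeff_mult_mat_vec[OF n g c(1)])
  qed (use g c in simp)
  moreover have "ecoeff n (g *\<^sub>v c) (h l0) \<noteq> 0"
  proof -
    have "ecoeff n (g *\<^sub>v c) (h l0) = (\<Sum>l\<in>{l0}. ecoeff n (c $ l \<cdot>\<^sub>v col g l) (h l0))"
      unfolding ecoeff_mult_mat_vec[OF n g c(1)]
    proof (rule sum.mono_neutral_right)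
      show "\<forall>l\<in>{..<n} - {l0}. ecoeff n (c $ l \<cdot>\<^sub>v col g l) (h l0) = 0"
      proof
        fix l assume l: "l \<in> {..<n} - {l0}"
        show "ecoeff n (c $ l \<cdot>\<^sub>v col g l) (h l0) = 0"
        proof (cases "l \<in> I")
          case True
          then have "h l0 < h l" using l0(2)[of l] ne[of l] l by auto
          then show ?thesis using leadl[OF True] by (auto simp: lead_def low_def)
        qed (use zero l in auto)
      qed
    qed (use l0(1) in \<open>auto simp: I_def\<close>)
    then show ?thesis using leadl[OF l0(1)] by (simp add: lead_def)
  qed
  ultimately show ?thesis using l0(1) by (auto simp: lead_def I_def h_def)
qed

lemma lead_basis_invertible:
  assumes "lead_basis n g b"
  shows "invertible_mat g"
proof (rule invertible_mat_if_kernel_trivial)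
  show "g \<in> carrier_mat n n" using assms by (simp add: lead_basis_def)
  fix c :: "'a fls vec" assume "c \<in> carrier_vec n" "c \<noteq> 0\<^sub>v n"
  then obtain i where "lead n (g *\<^sub>v c) i" using lead_basis_mult_vec[OF assms] by blast
  then show "g *\<^sub>v c \<noteq> 0\<^sub>v n" by (auto simp: lead_def ecoeff_0[OF n])
qed

lemma olattice_lead_basis: "lead_basis n g b \<Longrightarrow> olattice n (latt n g)"
  using olattice_latt lead_basis_invertible by (auto simp: lead_basis_def)

lemma col_in_latt: "g \<in> carrier_mat n n \<Longrightarrow> l < n \<Longrightarrow> col g l \<in> latt n g"
proof -
  assume g: "g \<in> carrier_mat n n" and l: "l < n"
  have "col g l = g *\<^sub>v unit_vec n l" using g l by (intro eq_vecI) auto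
  then show ?thesis using integral_unit_vec by (auto simp: latt_def)
qed

lemma leads_latt:
  assumes B: "lead_basis n g b"
  shows "leads n (latt n g) = {b l + int n * k | l k. l < n \<and> 0 \<le> k}"
proof (intro equalityI subsetI)
  fix i assume "i \<in> leads n (latt n g)"
  then obtain c where c: "integral_vec n c" "lead n (g *\<^sub>v c) i" by (auto simp: leads_def latt_def)
  have cn: "c \<in> carrier_vec n" using c(1) by (simp add: integral_vec_def)
  have "g \<in> carrier_mat n n" using B by (simp add: lead_basis_def)
  then have "g *\<^sub>v 0\<^sub>v n = 0\<^sub>v n" by (intro eq_vecI) auto
  then have "c \<noteq> 0\<^sub>v n" using c(2) by (auto simp: lead_def ecoeff_0[OF n])
  then obtain l where l: "l < n" "c $ l \<noteq> 0" "lead n (g *\<^sub>v c) (b l + int n * fls_subdegree (c $ l))"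
    using lead_basis_mult_vec[OF B cn] by blast
  moreover have "0 \<le> fls_subdegree (c $ l)"
    using c(1) l by (intro fls_subdegree_geI) (auto simp: integral_vec_def integers_L_iff)
  ultimately show "i \<in> {b l + int n * k | l k. l < n \<and> 0 \<le> k}"
    using lead_unique[OF n c(2) l(3)] by auto
next
  fix i assume "i \<in> {b l + int n * k | l k. l < n \<and> 0 \<le> k}"
  then obtain l k where lk: "i = b l + int n * k" "l < n" "0 \<le> k" by blast
  have "col g l \<in> latt n g" using B lk by (auto simp: lead_basis_def intro: col_in_latt)
  then have "fls_X_intpow k \<cdot>\<^sub>v col g l \<in> latt n g"
    using olatticeD(3)[OF olattice_lead_basis[OF B]] integers_L_X_intpow[OF lk(3)] by blast
  moreover have "lead n (fls_X_intpow k \<cdot>\<^sub>v col g l) i"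
    using lead_smult[OF n, of "col g l" "b l" "fls_X_intpow k"] B lk by (auto simp: lead_basis_def)
  ultimately show "i \<in> leads n (latt n g)" by (auto simp: leads_def)
qed

text \<open>In place of a successive approximation, the coordinates of \<open>w\<close> in the
  columns of \<open>g\<close> are split into an integral and a polar part. The polar part alone
  gives an element of \<Lambda>, and if it were nonzero its leading index would be
  \<open>b l + n * k\<close> with \<open>k < 0\<close>, which \<open>sub\<close> forbids.\<close>

lemma olattice_eq_latt:
  assumes L: "olattice n \<Lambda>" and B: "lead_basis n g b" and cols: "\<And>l. l < n \<Longrightarrow> col g l \<in> \<Lambda>"
    and sub: "leads n \<Lambda> \<subseteq> {b l + int n * k | l k. l < n \<and> 0 \<le> k}"
  shows "\<Lambda> = latt n g"
proof (intro equalityI subsetI)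
  have g: "g \<in> carrier_mat n n" using B by (simp add: lead_basis_def)
  note gi = lead_basis_invertible[OF B]
  fix w assume w: "w \<in> \<Lambda>"
  define c where "c = minv g *\<^sub>v w"
  have wn: "w \<in> carrier_vec n" using olatticeD(1)[OF L w] .
  have c: "c \<in> carrier_vec n" "g *\<^sub>v c = w"
    using minv(1)[OF g gi] minv_mult_vec(2)[OF g gi wn] wn by (auto simp: c_def)
  define ci where "ci = vec n (\<lambda>l. fps_to_fls (fls_regpart (c $ l)))"
  define cn where "cn = c - ci"
  have ci: "integral_vec n ci" by (auto simp: ci_def integral_vec_def integers_L_def)
  have cn: "cn \<in> carrier_vec n" "c = ci + cn"
    using c(1) by (auto simp: cn_def ci_def)
  have cnk: "fls_nth (cn $ l) k = 0" if "l < n" "0 \<le> k" for l k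
    using that c(1) by (auto simp: cn_def ci_def)
  have "cn = 0\<^sub>v n"
  proof (rule ccontr)
    assume "cn \<noteq> 0\<^sub>v n"
    then obtain l where l: "l < n" "cn $ l \<noteq> 0" "lead n (g *\<^sub>v cn) (b l + int n * fls_subdegree (cn $ l))"
      using lead_basis_mult_vec[OF B cn(1)] by blast
    have "g *\<^sub>v cn = w - g *\<^sub>v ci"
    proof -
      have "w = g *\<^sub>v ci + g *\<^sub>v cn"
        unfolding c(2)[symmetric] cn(2) using g ci cn(1)
        by (intro mult_add_distrib_mat_vec) (auto simp: integral_vec_def)
      then show ?thesis using g ci cn(1) by (auto simp: integral_vec_def)
    qed
    then have "g *\<^sub>v cn \<in> \<Lambda>"
      using olattice_minus[OF L w] olattice_mult_vec[OF L g cols ci] by simp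
    then have "b l + int n * fls_subdegree (cn $ l) \<in> leads n \<Lambda>" using l(3) by (auto simp: leads_def)
    then obtain l' k where k: "b l + int n * fls_subdegree (cn $ l) = b l' + int n * k" "l' < n" "0 \<le> k"
      using sub by blast
    then have "b l mod int n = b l' mod int n" by (metis mod_mult_self2)
    then have "l = l'" using B l(1) k(2) by (auto simp: lead_basis_def inj_on_def)
    then have "0 \<le> fls_subdegree (cn $ l)" using k n by simp
    then have "fls_nth (cn $ l) (fls_subdegree (cn $ l)) = 0" using cnk[OF l(1)] by blast
    then show False using l(2) by simp
  qed
  then have "w = g *\<^sub>v ci" using c cn ci by (simp add: integral_vec_def)
  then show "w \<in> latt n g" using ci by (auto simp: latt_def)
next
  fix w assume "w \<in> latt n g"
  then show "w \<in> \<Lambda>"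
    using olattice_mult_vec[OF L _ cols] B by (auto simp: latt_def lead_basis_def)
qed

lemma latt_eq_integral:
  assumes g: "g \<in> carrier_mat n n" "invertible_mat g" and g': "g' \<in> carrier_mat n n"
    and eq: "latt n g' \<subseteq> latt n g"
  shows "integral_mat (minv g * g')"
proof (rule integral_mat_if_cols)
  note m = minv[OF g]
  show "minv g * g' \<in> carrier_mat n n" using m g' by simp
  fix l assume l: "l < n"
  have "col g' l \<in> latt n g" using col_in_latt[OF g' l] eq by blast
  then obtain c where c: "col g' l = g *\<^sub>v c" "integral_vec n c" by (auto simp: latt_def)
  have "col (minv g * g') l = minv g *\<^sub>v col g' l" using m(1) g' l by (rule col_mult2)
  also have "\<dots> = c" using minv_mult_vec(1)[OF g] c by (simp add: integral_vec_def)
  finally show "integral_vec n (col (minv g * g') l)" using c(2) by simp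
qed

text \<open>The change of basis is integral, so its determinant has order at least 0. Used in both
  directions, this shows that the order of the determinant depends on the lattice only.\<close>

lemma fls_subdegree_det_le:
  assumes g: "g \<in> carrier_mat n n" "invertible_mat g" and g': "g' \<in> carrier_mat n n" "invertible_mat g'"
    and eq: "latt n g' \<subseteq> latt n g"
  shows "fls_subdegree (det g) \<le> fls_subdegree (det g')"
proof -
  note m = minv[OF g]
  have "det (minv g) * det g' \<in> integers_L"
    using integral_mat_det[OF _ latt_eq_integral[OF g g'(1) eq], of n] m(1) g'(1)
    by (simp add: det_mult[of _ n])
  moreover have "det (minv g) \<noteq> 0" "det g \<noteq> 0" "det g' \<noteq> 0"
    using det_minv[OF g] det_minv[OF g'] by auto
  moreover have "fls_subdegree (det g) + fls_subdegree (det (minv g)) = 0"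
    using arg_cong[OF det_minv[OF g], of fls_subdegree] calculation by simp
  ultimately show ?thesis
    using fls_subdegree_geI[of "det (minv g) * det g'" 0] by (auto simp: integers_L_iff)
qed

end

section \<open>The Frobenius\<close>

text \<open>What is used of \<open>q\<close>: the Frobenius is additive, and \<open>q\<close>
  vanishes in the field. Finite fields appear when the locale is interpreted for an algebraic
  closure.\<close>

locale frobenius =
  fixes q :: nat and K :: "'k::alg_closed_field itself"
  assumes q_ge_2: "2 \<le> q" and add_power_q: "\<And>x y :: 'k. (x + y) ^ q = x ^ q + y ^ q"
    and of_nat_q: "of_nat q = (0 :: 'k)"
begin

lemma zero_power_q [simp]: "(0 :: 'k) ^ q = 0" using q_ge_2 by simp

lemma sum_power_q: "(\<Sum>i\<in>I. f i :: 'k) ^ q = (\<Sum>i\<in>I. f i ^ q)"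
  by (induction I rule: infinite_finite_induct) (auto simp: add_power_q)

lemma fls_nth_frob [simp]: "fls_nth (frob q (f :: 'k fls)) k = fls_nth f k ^ q"
  unfolding frob_def by (rule nth_Abs_fls_lower_bound[of "fls_subdegree f"]) simp

lemma frob_add: "frob q (f + g :: 'k fls) = frob q f + frob q g"
  by (intro fls_eqI) (simp add: add_power_q)

lemma frob_eq_0_iff: "frob q (f :: 'k fls) = 0 \<longleftrightarrow> f = 0"
  using q_ge_2 by (auto simp: fls_eq_iff)

lemma fls_subdegree_frob: "fls_subdegree (frob q (f :: 'k fls)) = fls_subdegree f"
proof (cases "f = 0")
  case False
  then show ?thesis using q_ge_2 by (intro fls_subdegree_eqI) auto
qed (simp add: frob_eq_0_iff[THEN iffD2])

lemma frob_mult: "frob q (f * g :: 'k fls) = frob q f * frob q g"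
  by (intro fls_eqI) (simp add: fls_times_nth(2) fls_subdegree_frob sum_power_q power_mult_distrib)

lemma frob_0: "frob q (0 :: 'k fls) = 0" and frob_1: "frob q (1 :: 'k fls) = 1"
  by (simp_all add: frob_eq_0_iff) (intro fls_eqI, simp)

lemma frob_X_intpow: "frob q (fls_X_intpow k :: 'k fls) = fls_X_intpow k"
  by (intro fls_eqI) simp

lemma frob_integral: "f \<in> integers_L \<Longrightarrow> frob q (f :: 'k fls) \<in> integers_L"
  by (auto simp: integers_L_iff)

text \<open>Coefficients have q-th roots in an algebraically closed field. This surjectivity is
  behind \<open>gs_surj\<close>.\<close>

lemma frob_surj_integral:
  assumes "f \<in> integers_L"
  shows "\<exists>g\<in>integers_L. frob q (g :: 'k fls) = f"
proof -
  have "\<forall>k. \<exists>y. y ^ q = fls_nth f k" using q_ge_2 by (auto intro!: nth_root_exists)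
  then obtain r where r: "\<And>k. r k ^ q = fls_nth f k" by metis
  have "r k = 0" if "k < 0" for k
    using r[of k] assms that by (auto simp: integers_L_iff)
  then have nth: "fls_nth (Abs_fls r) k = r k" for k by (intro nth_Abs_fls_lower_bound[of 0]) auto
  then have "Abs_fls r \<in> integers_L" using \<open>\<And>k. k < 0 \<Longrightarrow> r k = 0\<close> by (simp add: integers_L_iff)
  moreover have "frob q (Abs_fls r) = f" by (intro fls_eqI) (simp add: nth r)
  ultimately show ?thesis by blast
qed

lemma frob_hom: "comm_ring_hom (frob q :: 'k fls \<Rightarrow> 'k fls)"
  by unfold_locales (simp_all add: frob_add frob_mult frob_0 frob_1)

lemma frob_mult_mat_vec:
  fixes g :: "'k fls mat"
  assumes "g \<in> carrier_mat n n" "c \<in> carrier_vec n"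
  shows "map_vec (frob q) (g *\<^sub>v c) = map_mat (frob q) g *\<^sub>v map_vec (frob q) c"
proof -
  interpret comm_ring_hom "frob q :: 'k fls \<Rightarrow> 'k fls" by (rule frob_hom)
  show ?thesis using assms by (intro eq_vecI) (auto simp: scalar_prod_def hom_sum hom_mult)
qed

end

section \<open>The operator \<open>\<gamma>\<sigma>\<close>\<close>

lemma mat_of_cols_mult_vec:
  fixes c :: "'a::comm_semiring_0 vec"
  assumes "length vs = n" "set vs \<subseteq> carrier_vec n" "c \<in> carrier_vec n"
  shows "mat_of_cols n vs *\<^sub>v c = vec n (\<lambda>j. \<Sum>l<n. (c $ l \<cdot>\<^sub>v vs ! l) $ j)"
proof (intro eq_vecI)
  fix j assume "j < dim_vec (vec n (\<lambda>j. \<Sum>l<n. (c $ l \<cdot>\<^sub>v vs ! l) $ j))"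
  moreover have "dim_vec (vs ! l) = n" if "l < n" for l
    using assms that by (metis carrier_vecD nth_mem subsetD)
  ultimately show "(mat_of_cols n vs *\<^sub>v c) $ j = vec n (\<lambda>j. \<Sum>l<n. (c $ l \<cdot>\<^sub>v vs ! l) $ j) $ j"
    using assms by (auto simp: scalar_prod_def mat_of_cols_index atLeast0LessThan mult.commute
        intro!: sum.cong)
qed (use assms in auto)

locale gamma_sigma_setup = frobenius +
  fixes d n m :: nat
  assumes d: "1 \<le> d" and n: "1 \<le> n"
begin

text \<open>\<open>pred_d\<close> and \<open>offset\<close> split \<open>f\<close> into its effects
  on the component and on the index; the index moves by \<open>m\<close> only on the step out of
  component \<open>1 mod d\<close> into component 0.\<close>

definition pred_d :: "nat \<Rightarrow> nat" where "pred_d \<tau> = (\<tau> + d - 1) mod d"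

definition offset :: "nat \<Rightarrow> int" where "offset \<tau> = (if \<tau> = 1 mod d then int m else 0)"

lemma pred_d_less: "pred_d \<tau> < d" using d by (simp add: pred_d_def)

lemma pred_d_Suc: "\<tau> < d \<Longrightarrow> pred_d ((\<tau> + 1) mod d) = \<tau>"
proof -
  assume \<tau>: "\<tau> < d"
  have "pred_d ((\<tau> + 1) mod d) = ((\<tau> + 1) mod d + (d - 1)) mod d" using d by (simp add: pred_d_def)
  also have "\<dots> = (\<tau> + 1 + (d - 1)) mod d" by (rule mod_add_left_eq)
  also have "\<dots> = \<tau>" using d \<tau> by simp
  finally show ?thesis .
qed

lemma Suc_pred_d: "\<tau> < d \<Longrightarrow> (pred_d \<tau> + 1) mod d = \<tau>"
proof -
  assume \<tau>: "\<tau> < d"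
  have "(pred_d \<tau> + 1) mod d = (\<tau> + d - 1 + 1) mod d" unfolding pred_d_def by (rule mod_add_left_eq)
  then show ?thesis using d \<tau> by simp
qed

lemma pred_d_eq_0_iff: "\<tau> < d \<Longrightarrow> pred_d \<tau> = 0 \<longleftrightarrow> \<tau> = 1 mod d"
  using Suc_pred_d[of \<tau>] pred_d_Suc[of 0] d by auto

lemma ff_eq: "fst a < d \<Longrightarrow> ff d m a = (pred_d (fst a), snd a + offset (fst a))"
  using pred_d_eq_0_iff[of "fst a"] by (auto simp: ff_def offset_def pred_d_def)

abbreviation gs :: "nat \<Rightarrow> 'a fls vec \<Rightarrow> 'a fls vec" where "gs \<equiv> gamma_sigma q d n m"

lemma gamma_carrier: "gamma n m \<tau> \<in> carrier_mat n n"
  by (auto simp: gamma_def mat_of_cols_def)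

lemma gs_carrier: "gs \<tau> w \<in> carrier_vec n"
  by (intro carrier_vecI) (simp add: gamma_sigma_def carrier_matD(1)[OF gamma_carrier])

lemma ecoeff_map_frob: 
  "w \<in> carrier_vec n \<Longrightarrow> ecoeff n (map_vec (frob q) w :: 'a fls vec) i = ecoeff n w i ^ q"
  using index_mod_less[OF n, of i] by (simp add: ecoeff_def)

lemma ecoeff_gamma:
  fixes w :: "'a fls vec"
  assumes w: "w \<in> carrier_vec n"
  shows "ecoeff n (gamma n m \<tau> *\<^sub>v w) i = ecoeff n w (i - (if \<tau> = 0 then int m else 0))"
proof (cases "\<tau> = 0")
  case True
  have mod: "(i - (int l + 1 + int m)) mod int n = 0 \<longleftrightarrow> l = nat ((i - int m - 1) mod int n)"
    if l: "l < n" for l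
  proof -
    have "(i - (int l + 1 + int m)) mod int n = 0 \<longleftrightarrow> (i - int m - 1) mod int n = int l mod int n"
      by (simp add: mod_eq_dvd_iff dvd_eq_mod_eq_0[symmetric] algebra_simps)
    also have "\<dots> \<longleftrightarrow> l = nat ((i - int m - 1) mod int n)" using l n by auto
    finally show ?thesis .
  qed
  let ?l = "nat ((i - int m - 1) mod int n)"
  have l: "?l < n" by (rule index_mod_less[OF n])
  have "gamma n m \<tau> *\<^sub>v w = vec n (\<lambda>j. \<Sum>l<n. (w $ l \<cdot>\<^sub>v evec n (int l + 1 + int m)) $ j)"
    using True w by (simp add: gamma_def) (subst mat_of_cols_mult_vec, auto simp: evec_carrier[OF n])
  then have "ecoeff n (gamma n m \<tau> *\<^sub>v w) i = (\<Sum>l<n. ecoeff n (w $ l \<cdot>\<^sub>v evec n (int l + 1 + int m)) i)"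
    by (simp add: ecoeff_vec_sum[OF n])
  also have "\<dots> = (\<Sum>l\<in>{?l}. ecoeff n (w $ l \<cdot>\<^sub>v evec n (int l + 1 + int m)) i)"
    using l mod by (intro sum.mono_neutral_right) (auto simp: ecoeff_smult_evec[OF n])
  also have "\<dots> = fls_nth (w $ ?l) ((i - (int ?l + 1 + int m)) div int n)"
    using mod[OF l] by (simp add: ecoeff_smult_evec[OF n])
  also have "(i - (int ?l + 1 + int m)) div int n = (i - int m - 1) div int n"
  proof -
    have "i - (int ?l + 1 + int m) = int n * ((i - int m - 1) div int n)"
      using index_split[OF n, of "i - int m"] by linarith
    then show ?thesis using n by simp
  qed
  finally show ?thesis using True by (simp add: ecoeff_def)
next
  case False
  then show ?thesis using w by (simp add: gamma_def)
qed

text \<open>The form in which \<gamma>\<sigma> enters the arguments on leading indices: it moves the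
  basis vectors by \<open>f\<close> and acts on coefficients by an injective map that fixes
  0.\<close>

lemma ecoeff_gs:
  fixes w :: "'a fls vec"
  assumes "w \<in> carrier_vec n" "\<tau> < d"
  shows "ecoeff n (gs \<tau> w) i = ecoeff n w (i - offset \<tau>) ^ q"
  using assms pred_d_eq_0_iff[OF assms(2)]
  by (simp add: gamma_sigma_def ecoeff_gamma ecoeff_map_frob pred_d_def offset_def del: One_nat_def)

lemma gs_add:
  fixes u w :: "'a fls vec"
  assumes "u \<in> carrier_vec n" "w \<in> carrier_vec n" "\<tau> < d"
  shows "gs \<tau> (u + w) = gs \<tau> u + gs \<tau> w"
  using assms gs_carrier
  by (intro vec_eq_if_ecoeff[OF n]) (auto simp: ecoeff_gs ecoeff_add[OF n] add_power_q)

lemma gs_smult: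
  fixes w :: "'a fls vec"
  assumes "w \<in> carrier_vec n"
  shows "gs \<tau> (f \<cdot>\<^sub>v w) = frob q f \<cdot>\<^sub>v gs \<tau> w"
proof -
  have "map_vec (frob q) (f \<cdot>\<^sub>v w) = frob q f \<cdot>\<^sub>v map_vec (frob q) w"
    using assms by (intro eq_vecI) (auto simp: frob_mult)
  then show ?thesis unfolding gamma_sigma_def using assms
    by (simp add: mult_mat_vec[OF gamma_carrier])
qed

lemma lead_gs_iff:
  "w \<in> carrier_vec n \<Longrightarrow> \<tau> < d \<Longrightarrow> lead n (gs \<tau> w) (i + offset \<tau>) \<longleftrightarrow> lead n w i"
  using q_ge_2 gs_carrier[of \<tau> w]
  by (auto simp: lead_def low_def ecoeff_gs dest: spec[of _ "_ + offset \<tau>"])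

end

section \<open>Semi-modules\<close>

locale semimod =
  fixes d n m :: nat and A :: "(nat \<times> int) set"
  assumes d: "1 \<le> d" and n: "1 \<le> n" and semi_module: "semi_module d n m A"
begin

abbreviation Ab :: "(nat \<times> int) set" where "Ab \<equiv> Abar n A"
abbreviation \<phi> :: "nat \<times> int \<Rightarrow> int" where "\<phi> \<equiv> phi d n m A"
abbreviation \<rho> :: "nat \<times> int \<Rightarrow> nat \<times> int" where "\<rho> \<equiv> rr d n m A"

lemma A_fst: "a \<in> A \<Longrightarrow> fst a < d"
  using semi_module by (auto simp: semi_module_def Oset_def)

lemma A_shift: "a \<in> A \<Longrightarrow> 0 \<le> k \<Longrightarrow> shift a (int n * k) \<in> A"
proof -
  assume a: "a \<in> A" and "0 \<le> k"
  have "shift a (int n * int j) \<in> A" for j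
  proof (induction j)
    case 0
    then show ?case using a by (simp add: shift_def)
  next
    case (Suc j)
    then have "shift (shift a (int n * int j)) (int n) \<in> A"
      using semi_module by (auto simp: semi_module_def)
    then show ?case by (simp add: shift_def algebra_simps)
  qed
  from this[of "nat k"] show ?thesis using \<open>0 \<le> k\<close> by simp
qed

lemma Ab_iff: "a \<in> Ab \<longleftrightarrow> a \<in> A \<and> shift a (- int n) \<notin> A"
proof -
  have "a \<in> (\<lambda>a. shift a (int n)) ` A \<longleftrightarrow> shift a (- int n) \<in> A"
  proof
    assume "shift a (- int n) \<in> A"
    then show "a \<in> (\<lambda>a. shift a (int n)) ` A" by (intro image_eqI[of _ _ "shift a (- int n)"]) (auto simp: shift_def)
  qed (auto simp: shift_def)
  then show ?thesis by (auto simp: Abar_def)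
qed

lemma Ab_A: "a \<in> Ab \<Longrightarrow> a \<in> A" by (simp add: Abar_def)

lemma Ab_fst: "a \<in> Ab \<Longrightarrow> fst a < d" using Ab_A A_fst by blast

text \<open>In a residue class modulo \<open>n\<close> the set \<open>A\<close> is nonempty, bounded
  below and stable under adding \<open>n\<close>. So it is a half-line there, and \<open>Ab\<close>
  consists of the starting points of these half-lines.\<close>

lemma ex1_Ab:
  assumes "fst a < d"
  shows "\<exists>!k. shift a (- (int n * k)) \<in> Ab"
proof -
  note sm = semi_module[unfolded semi_module_def]
  have O: "{shift a (int n * k) | a k. a \<in> A} = Oset d" using sm by (elim conjE)
  from conjunct1[OF conjunct2[OF sm]] obtain c where "\<forall>a\<in>A. c \<le> snd a" ..
  then have c: "\<And>a. a \<in> A \<Longrightarrow> c \<le> snd a" by (rule bspec)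
  have "a \<in> Oset d" using assms by (cases a) (auto simp: Oset_def)
  then have "a \<in> {shift a (int n * k) | a k. a \<in> A}" unfolding O .
  then obtain a' k0 where k0: "a' \<in> A" "a = shift a' (int n * k0)" by blast
  define T where "T j = shift a (- (int n * (k0 - int j)))" for j
  define P where "P k \<longleftrightarrow> shift a (- (int n * k)) \<in> A" for k
  have P0: "P k0" using k0 by (simp add: P_def shift_def)
  have down: "P k'" if "P k" "k' \<le> k" for k k'
    using A_shift[of "shift a (- (int n * k))" "k - k'"] that
    by (simp add: P_def shift_def algebra_simps)
  have bound: "k \<le> \<bar>snd a - c\<bar>" if "P k" for k
  proof -
    have "int n * k \<le> snd a - c" using c[of "shift a (- (int n * k))"] that by (simp add: P_def shift_def)
    moreover have "1 * k \<le> int n * k" if "0 \<le> k" using n that by (intro mult_right_mono) auto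
    ultimately show ?thesis by (cases "0 \<le> k") auto
  qed
  \<comment> \<open>Larger \<open>k\<close> means further down; the bound \<open>k0\<close> makes
    the set finite without changing its maximum.\<close>
  define M where "M = {k. P k \<and> k0 \<le> k}"
  have M: "finite M" "M \<noteq> {}" using bound P0
    by (auto simp: M_def intro!: finite_subset[of _ "{k0..\<bar>snd a - c\<bar>}"])
  define k where "k = Max M"
  have k: "P k" "k0 \<le> k" "\<And>k'. P k' \<Longrightarrow> k0 \<le> k' \<Longrightarrow> k' \<le> k"
    using Max_in[OF M] Max_ge[OF M(1)] by (auto simp: M_def k_def)
  have Ab: "shift a (- (int n * k)) \<in> Ab \<longleftrightarrow> P k \<and> \<not> P (k + 1)" for k
    unfolding Ab_iff P_def by (simp add: shift_def algebra_simps)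
  show ?thesis
  proof (rule ex1I[of _ k])
    show "shift a (- (int n * k)) \<in> Ab" using k(1,2) k(3)[of "k + 1"] by (auto simp: Ab)
    fix k' assume "shift a (- (int n * k')) \<in> Ab"
    then have "P k'" "\<not> P (k' + 1)" by (auto simp: Ab)
    moreover have "\<not> P (k + 1)" using k(2) k(3)[of "k + 1"] by auto
    ultimately have "\<not> k + 1 \<le> k'" "\<not> k' + 1 \<le> k" using k(1) down by blast+
    then show "k' = k" by linarith
  qed
qed

text \<open>Coordinates on \<open>Oset d\<close>: \<open>a\<close> is \<open>res a\<close>, the
  element of \<open>Ab\<close> in its class modulo \<open>n\<close>, moved up by
  \<open>n * nu a\<close>. So \<open>nu\<close> is negative exactly outside \<open>A\<close>, and
  \<phi> and r are \<open>nu\<close> and \<open>res\<close> composed with \<open>f\<close>.\<close>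

definition nu :: "nat \<times> int \<Rightarrow> int" where "nu a = (THE k. shift a (- (int n * k)) \<in> Ab)"
definition res :: "nat \<times> int \<Rightarrow> nat \<times> int" where "res a = shift a (- (int n * nu a))"

lemma res_in_Ab: "fst a < d \<Longrightarrow> res a \<in> Ab"
  unfolding res_def nu_def by (rule theI'[OF ex1_Ab])

lemma nu_eqI: "fst a < d \<Longrightarrow> shift a (- (int n * k)) \<in> Ab \<Longrightarrow> nu a = k"
  unfolding nu_def by (intro the1_equality ex1_Ab)

lemma res_eqI: "fst a < d \<Longrightarrow> b \<in> Ab \<Longrightarrow> a = shift b (int n * k) \<Longrightarrow> res a = b"
  using nu_eqI[of a k] by (simp add: res_def shift_def)

lemma shift_res: "shift (res a) (int n * nu a) = a" by (simp add: res_def shift_def)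

lemma fst_res [simp]: "fst (res a) = fst a" by (simp add: res_def shift_def)

lemma fst_shift [simp]: "fst (shift a k) = fst a" by (simp add: shift_def)
lemma snd_shift [simp]: "snd (shift a k) = snd a + k" by (simp add: shift_def)

lemma snd_res: "snd (res a) = snd a - int n * nu a" by (simp add: res_def shift_def)

lemma in_A_iff: "fst a < d \<Longrightarrow> a \<in> A \<longleftrightarrow> 0 \<le> nu a"
proof
  assume a: "fst a < d" and "a \<in> A"
  show "0 \<le> nu a"
  proof (rule ccontr)
    assume "\<not> 0 \<le> nu a"
    then have "shift a (int n * (- nu a - 1)) \<in> A" using A_shift[OF \<open>a \<in> A\<close>, of "- nu a - 1"] by simp
    then have "shift (res a) (- int n) \<in> A" by (simp add: res_def shift_def algebra_simps)
    then show False using res_in_Ab[OF a] by (simp add: Ab_iff)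
  qed
next
  assume a: "fst a < d" and "0 \<le> nu a"
  then show "a \<in> A" using A_shift[OF Ab_A[OF res_in_Ab[OF a]], of "nu a"] by (simp add: shift_res)
qed

lemma Ab_eqI:
  assumes "b \<in> Ab" "b' \<in> Ab" "fst b = fst b'" "snd b mod int n = snd b' mod int n"
  shows "b = b'"
proof -
  obtain k where k: "snd b' = snd b + int n * k"
    using assms(4) by (metis mod_eqE mult.commute)
  then have b': "b' = shift b (int n * k)" using assms(3) by (simp add: shift_def prod_eq_iff)
  have "res b' = b" using res_eqI[OF Ab_fst[OF assms(2)] assms(1) b'] .
  moreover have "res b' = b'" using res_eqI[OF Ab_fst[OF assms(2)] assms(2), of 0] by (simp add: shift_def)
  ultimately show ?thesis by simp
qed

text \<open>Numbers the elements of \<open>Ab\<close> in component \<tau> like matrix columns: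
  column \<open>l\<close> belongs to the residue class of \<open>l + 1\<close>.\<close>

definition amin :: "nat \<Rightarrow> nat \<Rightarrow> nat \<times> int" where "amin \<tau> l = res (\<tau>, int l + 1)"

lemma amin_in: "\<tau> < d \<Longrightarrow> amin \<tau> l \<in> Ab" by (simp add: amin_def res_in_Ab)

lemma fst_amin [simp]: "fst (amin \<tau> l) = \<tau>" by (simp add: amin_def)

lemma snd_amin_mod: "snd (amin \<tau> l) mod int n = (int l + 1) mod int n"
  by (simp add: amin_def snd_res mod_eq_dvd_iff)

lemma amin_surj:
  assumes "b \<in> Ab"
  shows "\<exists>l<n. b = amin (fst b) l"
proof (intro exI conjI)
  let ?l = "nat ((snd b - 1) mod int n)"
  show "?l < n" by (rule index_mod_less[OF n])
  show "b = amin (fst b) ?l"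
  proof (rule Ab_eqI[OF assms amin_in[OF Ab_fst[OF assms]]])
    have "(int ?l + 1) mod int n = snd b mod int n" using n by (simp add: mod_add_left_eq)
    then show "snd b mod int n = snd (amin (fst b) ?l) mod int n" by (simp add: snd_amin_mod)
  qed simp
qed

lemma amin_inj: "l < n \<Longrightarrow> l' < n \<Longrightarrow> snd (amin \<tau> l) mod int n = snd (amin \<tau> l') mod int n \<Longrightarrow> l = l'"
proof -
  assume l: "l < n" "l' < n" and e: "snd (amin \<tau> l) mod int n = snd (amin \<tau> l') mod int n"
  have "int l mod int n = int l' mod int n"
    using e unfolding snd_amin_mod by (simp add: mod_eq_dvd_iff)
  moreover have "int l mod int n = int l" "int l' mod int n = int l'" using l by simp_all
  ultimately show "l = l'" by linarith
qed

lemma bij_amin: "\<tau> < d \<Longrightarrow> bij_betw (amin \<tau>) {..<n} {b \<in> Ab. fst b = \<tau>}"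
  unfolding bij_betw_def
proof (intro conjI equalityI subsetI)
  show "inj_on (amin \<tau>) {..<n}" by (auto simp: inj_on_def intro: amin_inj[where \<tau> = \<tau>])
  fix b assume "b \<in> {b \<in> Ab. fst b = \<tau>}"
  then show "b \<in> amin \<tau> ` {..<n}" using amin_surj[of b] by auto
next
  fix b assume "\<tau> < d" "b \<in> amin \<tau> ` {..<n}"
  then show "b \<in> {b \<in> Ab. fst b = \<tau>}" using amin_in by auto
qed

lemma finite_Ab: "finite Ab"
proof (rule finite_subset)
  show "Ab \<subseteq> (\<lambda>(\<tau>, l). amin \<tau> l) ` ({..<d} \<times> {..<n})"
    using amin_surj Ab_fst by (fastforce simp: image_iff)
qed simp

lemma A_above: "\<exists>C. \<forall>a. fst a < d \<longrightarrow> C \<le> snd a \<longrightarrow> a \<in> A"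
proof (intro exI allI impI)
  fix a :: "nat \<times> int" assume a: "fst a < d" "Max (insert 0 (snd ` Ab)) \<le> snd a"
  then have "snd (res a) \<le> snd a"
    using res_in_Ab[OF a(1)] finite_Ab by (auto intro: order.trans[OF Max_ge])
  then have "0 \<le> int n * nu a" by (simp add: snd_res)
  then show "a \<in> A" using n by (simp add: in_A_iff[OF a(1)] zero_le_mult_iff)
qed

lemma fst_ff_less: "fst (ff d m a) < d"
  using d by (auto simp: ff_def)

lemma phi_eq: "\<phi> a = nu (ff d m a)"
  by (simp add: phi_def nu_def)

lemma rr_eq: "\<rho> a = res (ff d m a)"
  by (simp add: rr_def res_def phi_eq)

lemma fst_rr: "fst (\<rho> a) = fst (ff d m a)"
  by (simp add: rr_eq)

lemma rr_in_Ab: "\<rho> a \<in> Ab"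
  by (simp add: rr_eq res_in_Ab fst_ff_less)

lemma ff_inj:
  assumes "fst a < d" "fst b < d" "fst (ff d m a) = fst (ff d m b)"
  shows "fst a = fst b \<and> snd (ff d m a) - snd (ff d m b) = snd a - snd b"
proof -
  have pd: "(fst (ff d m a) + 1) mod d = fst a" if "fst a < d" for a
  proof (cases "fst a = 1 mod d")
    case True
    then show ?thesis by (simp add: ff_def)
  next
    case False
    then have "(fst (ff d m a) + 1) mod d = (fst a + d - 1 + 1) mod d"
      by (simp only: ff_def if_False fst_conv mod_add_left_eq)
    then show ?thesis using that by simp
  qed
  have "fst a = fst b" using pd[OF assms(1)] pd[OF assms(2)] assms(3) by simp
  then show ?thesis by (auto simp: ff_def)
qed

lemma inj_rr: "inj_on \<rho> Ab"
proof (rule inj_onI)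
  fix b b' assume b: "b \<in> Ab" "b' \<in> Ab" "\<rho> b = \<rho> b'"
  then have "fst (ff d m b) = fst (ff d m b')" by (metis fst_rr)
  note * = ff_inj[OF Ab_fst[OF b(1)] Ab_fst[OF b(2)] this]
  have "snd (ff d m b) - int n * \<phi> b = snd (ff d m b') - int n * \<phi> b'"
    using arg_cong[OF b(3), of snd] by (simp add: rr_def)
  then have "snd b = snd b' + (\<phi> b - \<phi> b') * int n" using * by (simp add: algebra_simps)
  then show "b = b'" using * by (intro Ab_eqI[OF b(1,2)]) (simp_all only: mod_mult_self1)
qed

lemma bij_rr: "bij_betw \<rho> Ab Ab"
  unfolding bij_betw_def using inj_rr rr_in_Ab by (auto simp: endo_inj_surj[OF finite_Ab _ inj_rr] image_subset_iff)

abbreviation h :: nat where "h \<equiv> gcd m n"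

lemma h_pos: "0 < h" using n by simp

text \<open>r changes the index by 0 or \<open>m\<close> and by a multiple of \<open>n\<close>, all
  divisible by \<open>h\<close>, so an orbit of r stays in one class modulo
  \<open>h\<close>.\<close>

lemma snd_rr_mod_h: "snd (\<rho> b) mod int h = snd b mod int h"
proof -
  obtain c where c: "snd (\<rho> b) = snd b + c - int n * \<phi> b" "c = 0 \<or> c = int m"
    by (cases "fst b = 1 mod d") (auto simp: rr_def ff_def)
  have "int h dvd int n * \<phi> b" "int h dvd c" using c(2) by auto
  then have "int h dvd c - int n * \<phi> b" by (simp add: dvd_diff)
  then show ?thesis by (simp add: mod_eq_dvd_iff c(1))
qed

lemma rr_pow_in_Ab: "b \<in> Ab \<Longrightarrow> (\<rho> ^^ s) b \<in> Ab"
  by (cases s) (auto simp: rr_in_Ab)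

end

section \<open>The orbits of r and their points in Y\<close>

locale semimod_iota = semimod +
  fixes \<iota> :: nat
  assumes iota: "\<iota> < d"
begin

abbreviation Y :: "(nat \<times> int) set" where "Y \<equiv> Yset n m A \<iota>"

lemma Y_max_mem:
  fixes k :: int
  defines "M \<equiv> {i. (\<iota>, i) \<in> Ab \<and> i mod int h = k mod int h}"
  shows "Max M \<in> M"
proof (rule Max_in)
  have "M \<subseteq> snd ` Ab" by (force simp: M_def)
  then show "finite M" using finite_Ab finite_subset by blast
  have "snd (res (\<iota>, k)) mod int h = k mod int h"
    by (simp add: snd_res mod_eq_dvd_iff)
  moreover have "(\<iota>, snd (res (\<iota>, k))) = res (\<iota>, k)" by (simp add: prod_eq_iff)
  ultimately have "snd (res (\<iota>, k)) \<in> M" using res_in_Ab[of "(\<iota>, k)"] iota by (simp add: M_def)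
  then show "M \<noteq> {}" by blast
qed

lemma Y_Ab: "y \<in> Y \<Longrightarrow> y \<in> Ab" and Y_fst: "y \<in> Y \<Longrightarrow> fst y = \<iota>"
  using Y_max_mem by (auto simp: Yset_def)

lemma Y_ex: "\<exists>y\<in>Y. snd y mod int h = i mod int h"
proof -
  \<comment> \<open>The class of 0 is represented by \<open>h\<close>, as \<open>k\<close> has to
    lie between 1 and \<open>h\<close>.\<close>
  define k where "k = (if i mod int h = 0 then h else nat (i mod int h))"
  have k: "k \<in> {1..h}"
    using h_pos pos_mod_bound[of "int h" i] pos_mod_sign[of "int h" i] by (auto simp: k_def simp del: pos_mod_bound pos_mod_sign)
  have "int k mod int h = i mod int h" using h_pos by (auto simp: k_def)
  then show ?thesis using Y_max_mem[of "int k"] k unfolding Yset_def by (intro bexI[rotated], blast) auto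
qed

lemma Y_unique: "y \<in> Y \<Longrightarrow> y' \<in> Y \<Longrightarrow> snd y mod int h = snd y' mod int h \<Longrightarrow> y = y'"
proof -
  assume "y \<in> Y" "y' \<in> Y" and eq: "snd y mod int h = snd y' mod int h"
  then obtain k k' where
    y: "y = (\<iota>, Max {i. (\<iota>, i) \<in> Ab \<and> i mod int h = int k mod int h})"
    "y' = (\<iota>, Max {i. (\<iota>, i) \<in> Ab \<and> i mod int h = int k' mod int h})" by (auto simp: Yset_def)
  have "int k mod int h = int k' mod int h"
    using eq Y_max_mem[of "int k"] Y_max_mem[of "int k'"] by (simp add: y)
  then show "y = y'" by (simp add: y)
qed

text \<open>The point of \<open>Y\<close> on the orbit of \<open>b\<close>, found through the class
  modulo \<open>h\<close>.\<close>

definition root :: "nat \<times> int \<Rightarrow> nat \<times> int" where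
  "root b = (THE y. y \<in> Y \<and> snd y mod int h = snd b mod int h)"

lemma root: "root b \<in> Y" "snd (root b) mod int h = snd b mod int h"
proof -
  have "\<exists>!y. y \<in> Y \<and> snd y mod int h = snd b mod int h"
    using Y_ex[of "snd b"] Y_unique by metis
  from theI'[OF this] show "root b \<in> Y" "snd (root b) mod int h = snd b mod int h"
    by (auto simp: root_def)
qed

lemma root_Y: "y \<in> Y \<Longrightarrow> root y = y"
  using root Y_unique by blast

lemma root_rr: "root (\<rho> b) = root b"
  by (simp add: root_def snd_rr_mod_h)

text \<open>Adding multiples of \<open>n\<close> commutes with \<open>f\<close>, so powers of r may
  be computed with \<open>f\<close>, for which the index is explicit.\<close>

lemma snd_rr_pow: "\<exists>k. snd ((\<rho> ^^ s) b) = snd ((ff d m ^^ s) b) + int n * k \<and> fst ((\<rho> ^^ s) b) = fst ((ff d m ^^ s) b)"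
proof (induction s)
  case (Suc s)
  then obtain k where k: "snd ((\<rho> ^^ s) b) = snd ((ff d m ^^ s) b) + int n * k"
    "fst ((\<rho> ^^ s) b) = fst ((ff d m ^^ s) b)" by blast
  have "fst (ff d m ((\<rho> ^^ s) b)) = fst (ff d m ((ff d m ^^ s) b))"
    "snd (ff d m ((\<rho> ^^ s) b)) = snd (ff d m ((ff d m ^^ s) b)) + int n * k"
    using k by (auto simp: ff_def)
  then show ?case
    by (intro exI[of _ "k - \<phi> ((\<rho> ^^ s) b)"])
       (simp add: rr_def[of d n m A "(\<rho> ^^ s) b"] algebra_simps)
qed (auto intro: exI[of _ 0])

lemma fst_ff_pow: "fst a < d \<Longrightarrow> fst ((ff d m ^^ s) a) < d \<and> (fst ((ff d m ^^ s) a) + s) mod d = fst a"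
proof (induction s)
  case (Suc s)
  have pd: "(fst (ff d m x) + 1) mod d = fst x" if "fst x < d" for x
  proof (cases "fst x = 1 mod d")
    case False
    then have "(fst (ff d m x) + 1) mod d = (fst x + d - 1 + 1) mod d"
      by (simp only: ff_def if_False fst_conv mod_add_left_eq)
    then show ?thesis using that by simp
  qed (simp add: ff_def)
  let ?x = "(ff d m ^^ s) a"
  have "(fst (ff d m ?x) + Suc s) mod d = ((fst (ff d m ?x) + 1) mod d + s) mod d"
    by (simp add: mod_add_left_eq)
  also have "\<dots> = fst a" using pd[of ?x] Suc by simp
  finally show ?case using fst_ff_less by simp
qed simp

lemma snd_ff_pow: "snd ((ff d m ^^ s) a) = snd a + int m * int (card {j. j < s \<and> fst ((ff d m ^^ j) a) = 1 mod d})"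
proof (induction s)
  case (Suc s)
  have "{j. j < Suc s \<and> fst ((ff d m ^^ j) a) = 1 mod d} =
     (if fst ((ff d m ^^ s) a) = 1 mod d then {s} else {}) \<union> {j. j < s \<and> fst ((ff d m ^^ j) a) = 1 mod d}"
    by (auto simp: less_Suc_eq)
  then have "card {j. j < Suc s \<and> fst ((ff d m ^^ j) a) = 1 mod d} =
     (if fst ((ff d m ^^ s) a) = 1 mod d then 1 else 0) + card {j. j < s \<and> fst ((ff d m ^^ j) a) = 1 mod d}"
    by simp
  moreover have "snd (ff d m ((ff d m ^^ s) a)) =
      snd ((ff d m ^^ s) a) + (if fst ((ff d m ^^ s) a) = 1 mod d then int m else 0)"
    by (auto simp: ff_def)
  ultimately show ?case using Suc by (simp add: algebra_simps)
qed simp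

text \<open>A full turn visits component \<open>1 mod d\<close> exactly once, and the index grows by
  \<open>m\<close> there only.\<close>

lemma ff_pow_d:
  assumes a: "fst a < d"
  shows "(ff d m ^^ d) a = (fst a, snd a + int m)"
proof -
  have inj: "i = j" if "i < d" "j < d" "fst ((ff d m ^^ i) a) = fst ((ff d m ^^ j) a)" for i j
  proof -
    have "(fst ((ff d m ^^ i) a) + i) mod d = (fst ((ff d m ^^ i) a) + j) mod d"
      using fst_ff_pow[OF a, of i] fst_ff_pow[OF a, of j] that by simp
    then have "i mod d = j mod d" by (simp add: mod_add_cong nat_mod_eq_iff)
    then show ?thesis using that by simp
  qed
  have "(\<lambda>j. fst ((ff d m ^^ j) a)) ` {..<d} = {..<d}"
    using fst_ff_pow[OF a] inj by (intro endo_inj_surj) (auto simp: inj_on_def)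
  moreover have "1 mod d < d" using d by simp
  ultimately obtain j0 where j0: "j0 < d" "fst ((ff d m ^^ j0) a) = 1 mod d"
    by (metis (no_types, lifting) imageE lessThan_iff)
  have "{j. j < d \<and> fst ((ff d m ^^ j) a) = 1 mod d} = {j0}" using j0 inj by auto
  then have "snd ((ff d m ^^ d) a) = snd a + int m" by (simp add: snd_ff_pow)
  moreover have "fst ((ff d m ^^ d) a) = fst a" using fst_ff_pow[OF a, of d] by (metis mod_add_self2 mod_less)
  ultimately show ?thesis by (simp add: prod_eq_iff)
qed

lemma ff_pow_d_mult: "fst a < d \<Longrightarrow> (ff d m ^^ (d * u)) a = (fst a, snd a + int u * int m)"
proof (induction u)
  case (Suc u)
  then show ?case by (simp add: funpow_add ff_pow_d algebra_simps)
qed simp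

text \<open>The orbits of r exhaust the classes modulo \<open>h\<close>: going round
  \<open>u\<close> times adds \<open>u * m\<close> to the index, and modulo \<open>n\<close> the
  multiples of \<open>m\<close> are the multiples of \<open>h\<close>.\<close>

lemma ex_rr_pow_Y:
  assumes b: "b \<in> Ab"
  shows "\<exists>s. (\<rho> ^^ s) b \<in> Y"
proof -
  note bd = Ab_fst[OF b]
  \<comment> \<open>The number of steps from the component of \<open>b\<close> to \<iota>, with
    \<open>d\<close> added to stay within the natural numbers.\<close>
  define s0 where "s0 = fst b + d - \<iota>"
  define a where "a = (ff d m ^^ s0) b"
  have a: "fst a < d" "(fst a + s0) mod d = fst b" using fst_ff_pow[OF bd] by (auto simp: a_def)
  have fa: "fst a = \<iota>"
  proof -
    have "(fst a + s0) mod d = (\<iota> + s0) mod d" using a(2) bd iota by (simp add: s0_def)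
    then have "(fst a + s0 + (d * s0 - s0)) mod d = (\<iota> + s0 + (d * s0 - s0)) mod d" by (rule mod_add_cong) simp
    moreover have "s0 \<le> d * s0" using d by simp
    ultimately show ?thesis using a(1) iota by simp
  qed
  have amod: "snd a mod int h = snd b mod int h"
  proof -
    obtain k where "snd ((\<rho> ^^ s0) b) = snd a + int n * k" using snd_rr_pow unfolding a_def by blast
    moreover have "snd ((\<rho> ^^ s0) b) mod int h = snd b mod int h"
      by (induction s0) (auto simp: snd_rr_mod_h)
    ultimately have "(snd a + int n * k) mod int h = snd b mod int h" by simp
    moreover have "(snd a + int n * k) mod int h = snd a mod int h"
      by (simp add: mod_eq_dvd_iff)
    ultimately show ?thesis by simp
  qed
  obtain y where y: "y \<in> Y" "snd y mod int h = snd b mod int h" using Y_ex by blast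
  have "int h dvd snd y - snd a" using y(2) amod by (simp add: mod_eq_dvd_iff[symmetric])
  then obtain z where z: "snd y - snd a = int h * z" by (auto elim: dvdE)
  obtain u v where uv: "u * int m + v * int n = gcd (int m) (int n)" using bezout_int by blast
  \<comment> \<open>The number of turns given by Bezout's identity, reduced modulo \<open>n\<close>
    to make it nonnegative.\<close>
  define u' where "u' = nat ((u * z) mod int n)"
  have "int u' = (u * z) mod int n" using n by (simp add: u'_def)
  then obtain k where k: "u * z = int u' + int n * k" by (metis mult_div_mod_eq add.commute)
  have "snd y = snd a + (u * int m + v * int n) * z" using z uv by simp
  also have "\<dots> = snd a + int u' * int m + int n * (k * int m + v * z)"
    using arg_cong[OF k, of "\<lambda>t. t * int m"] by (simp add: algebra_simps)
  finally have ya: "snd y = snd a + int u' * int m + int n * (k * int m + v * z)" .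
  have f: "(ff d m ^^ (d * u' + s0)) b = (\<iota>, snd a + int u' * int m)"
    using ff_pow_d_mult[OF a(1), of u'] fa by (simp add: funpow_add a_def)
  obtain k' where "snd ((\<rho> ^^ (d * u' + s0)) b) = snd a + int u' * int m + int n * k'"
    "fst ((\<rho> ^^ (d * u' + s0)) b) = \<iota>" using snd_rr_pow[of "d * u' + s0" b] f by auto
  then have "(\<rho> ^^ (d * u' + s0)) b = y"
    using rr_pow_in_Ab[OF b] Y_Ab[OF y(1)] Y_fst[OF y(1)] ya
    by (intro Ab_eqI) (auto simp: mod_eq_dvd_iff algebra_simps)
  then show ?thesis using y(1) by auto
qed

lemma rr_pow_inj: "b \<in> Ab \<Longrightarrow> b' \<in> Ab \<Longrightarrow> (\<rho> ^^ s) b = (\<rho> ^^ s) b' \<Longrightarrow> b = b'"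
proof (induction s)
  case (Suc s)
  then have "(\<rho> ^^ s) b = (\<rho> ^^ s) b'" using inj_rr rr_pow_in_Ab by (auto simp: inj_on_def)
  then show ?case using Suc by blast
qed simp

text \<open>The orbits of an injective map on a finite set are cycles, so if \<open>b\<close> leads
  to \<open>Y\<close> then a point of \<open>Y\<close> leads back to \<open>b\<close>.\<close>

lemma ex_Y_rr_pow:
  assumes b: "b \<in> Ab"
  shows "\<exists>s. \<exists>y\<in>Y. (\<rho> ^^ s) y = b"
proof -
  obtain s where s: "(\<rho> ^^ s) b \<in> Y" using ex_rr_pow_Y[OF b] by blast
  have "\<not> inj_on (\<lambda>j. (\<rho> ^^ j) b) (UNIV :: nat set)"
  proof
    assume "inj_on (\<lambda>j. (\<rho> ^^ j) b) (UNIV :: nat set)"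
    moreover have "finite (range (\<lambda>j. (\<rho> ^^ j) b))"
      using rr_pow_in_Ab[OF b] finite_Ab by (auto intro: finite_subset[of _ Ab])
    ultimately show False using finite_imageD infinite_UNIV_nat by blast
  qed
  then obtain i j where ij: "i < j" "(\<rho> ^^ i) b = (\<rho> ^^ j) b"
    unfolding inj_on_def by (metis linorder_neqE_nat)
  define p where "p = j - i"
  have "(\<rho> ^^ i) b = (\<rho> ^^ i) ((\<rho> ^^ p) b)"
    using ij by (simp add: p_def funpow_add[symmetric, THEN fun_cong, simplified])
  then have "b = (\<rho> ^^ p) b" by (rule rr_pow_inj[OF b rr_pow_in_Ab[OF b]])
  then have p: "(\<rho> ^^ p) b = b" "p > 0" using ij by (simp_all add: p_def)
  have "(\<rho> ^^ (p * t)) b = b" for t by (induction t) (auto simp: funpow_add p(1))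
  from this[of s] have "(\<rho> ^^ (p * s - s + s)) b = b" using p(2) by simp
  then have "(\<rho> ^^ (p * s - s)) ((\<rho> ^^ s) b) = b" by (simp only: funpow_add o_apply)
  then show ?thesis using s by blast
qed

text \<open>The distance of \<open>b\<close> from \<open>Y\<close> along its orbit. Outside
  \<open>Y\<close> it decreases under \<open>prev\<close>, which makes the recursion for the
  coefficients well-founded.\<close>

definition dep :: "nat \<times> int \<Rightarrow> nat" where "dep b = (LEAST s. \<exists>y\<in>Y. (\<rho> ^^ s) y = b)"

definition prev :: "nat \<times> int \<Rightarrow> nat \<times> int" where "prev = inv_into Ab \<rho>"

lemma prev: "b \<in> Ab \<Longrightarrow> prev b \<in> Ab \<and> \<rho> (prev b) = b"
  unfolding prev_def using bij_rr by (metis bij_betw_imp_surj_on f_inv_into_f inv_into_into)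

lemma root_prev: "b \<in> Ab \<Longrightarrow> root (prev b) = root b"
  using prev root_rr by metis

lemma dep_prev:
  assumes b: "b \<in> Ab" "b \<notin> Y"
  shows "dep (prev b) < dep b"
proof -
  obtain y where y: "y \<in> Y" "(\<rho> ^^ dep b) y = b"
    using LeastI_ex[OF ex_Y_rr_pow[OF b(1)]] unfolding dep_def by blast
  then obtain s where s: "dep b = Suc s" using b(2) by (cases "dep b") auto
  then have "\<rho> ((\<rho> ^^ s) y) = \<rho> (prev b)" using y prev[OF b(1)] by simp
  then have "(\<rho> ^^ s) y = prev b"
    using inj_rr rr_pow_in_Ab[OF Y_Ab[OF y(1)]] prev[OF b(1)] by (auto simp: inj_on_def)
  then have "dep (prev b) \<le> s" unfolding dep_def using y(1) by (intro Least_le) blast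
  then show ?thesis using s by simp
qed

lemma dep_bound: "\<exists>S. \<forall>b\<in>Ab. dep b < S"
  using finite_Ab by (intro exI[of _ "Suc (Max (dep ` Ab))"]) (auto simp: less_Suc_eq_le)

end

section \<open>The vectors \<open>v(a)\<close>\<close>

locale strata = gamma_sigma_setup + semimod_iota
begin

abbreviation V :: "((nat \<times> int) \<times> nat) set" where "V \<equiv> Vset d n m A"
abbreviation W :: "((nat \<times> int) \<times> nat) set" where "W \<equiv> Wset n m A \<iota>"
abbreviation D :: "((nat \<times> int) \<times> nat) set" where "D \<equiv> Dset d n m A \<iota>"

lemma VD: "(b, j) \<in> V \<Longrightarrow> b \<in> Ab \<and> 1 \<le> j \<and> shift b (int j) \<in> Ab \<and> \<phi> (shift b (int j)) < \<phi> b"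
  by (simp add: Vset_def)

lemma WD: "(b, j) \<in> W \<Longrightarrow> b \<in> Y \<and> b \<in> Ab \<and> 1 \<le> j \<and> shift b (int j) \<notin> A"
  using Y_Ab by (simp add: Wset_def)

lemma VW_disjoint: "V \<inter> W = {}"
proof -
  have False if "(b, j) \<in> V" "(b, j) \<in> W" for b j
    using VD[OF that(1)] WD[OF that(2)] Ab_A by metis
  then show ?thesis by (intro equals0I) (metis IntD1 IntD2 surj_pair)
qed

lemma D_eq: "D = V \<union> W" by (simp add: Dset_def)

lemma finite_V: "finite V"
proof (rule finite_imageD)
  have "(\<lambda>(b, j). (b, shift b (int j))) ` V \<subseteq> Ab \<times> Ab"
  proof (rule image_subsetI)
    fix p assume "p \<in> V"
    then show "(\<lambda>(b, j). (b, shift b (int j))) p \<in> Ab \<times> Ab"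
      using VD[of "fst p" "snd p"] by (cases p) simp
  qed
  then show "finite ((\<lambda>(b, j). (b, shift b (int j))) ` V)"
    using finite_Ab finite_subset by blast
  show "inj_on (\<lambda>(b, j). (b, shift b (int j))) V" by (auto intro!: inj_onI simp: shift_def)
qed

text \<open>\<open>A\<close> contains everything above a certain index, so for each of the finitely
  many \<open>b\<close> the index \<open>b + j\<close> leaves \<open>A\<close> for finitely many
  \<open>j\<close> only.\<close>

lemma finite_W: "finite W"
proof -
  obtain C where C: "\<And>a. fst a < d \<Longrightarrow> C \<le> snd a \<Longrightarrow> a \<in> A" using A_above by blast
  have "W \<subseteq> Sigma Ab (\<lambda>b. {..nat (C - snd b)})"
  proof
    fix p assume "p \<in> W"
    then obtain b j where bj: "p = (b, j)" "(b, j) \<in> W" by (cases p) auto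
    then have "snd b + int j < C"
      using C[of "shift b (int j)"] WD[OF bj(2)] Ab_fst[of b] by (auto simp: not_less[symmetric])
    then show "p \<in> Sigma Ab (\<lambda>b. {..nat (C - snd b)})" using bj WD by auto
  qed
  then show ?thesis using finite_Ab finite_subset[of W] by blast
qed

lemma finite_V_at: "finite {j. (b, j) \<in> V}" and finite_W_at: "finite {j. (b, j) \<in> W}"
proof -
  have "{j. (b, j) \<in> V} \<subseteq> snd ` V" "{j. (b, j) \<in> W} \<subseteq> snd ` W" by force+
  then show "finite {j. (b, j) \<in> V}" "finite {j. (b, j) \<in> W}"
    using finite_V finite_W by (auto elim: finite_subset)
qed

text \<open>\<open>alpha x b j\<close> is the coefficient \<open>\<alpha>\<^sub>b\<^sub>,\<^sub>j\<close> of \<open>v(b)\<close>. A value at \<open>(b, j)\<close> is determined by those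
  at smaller \<open>j\<close> and at \<open>(r\<^sup>-\<^sup>1(b), j)\<close>, which is nearer to \<open>Y\<close> along the orbit of \<open>r\<close>.\<close>

function alpha :: "((nat \<times> int) \<times> nat \<Rightarrow> 'a) \<Rightarrow> nat \<times> int \<Rightarrow> nat \<Rightarrow> 'a" where
  "alpha x b j = (if j = 0 then 1 else if b \<notin> Ab then 0 else
     (if b \<in> Y then (if (b, j) \<in> W then x (b, j) else 0) else alpha x (prev b) j ^ q)
     + (\<Sum>i\<in>{i. (b, i) \<in> V \<and> i \<le> j}. x (b, i) * alpha x (shift b (int i)) (j - i)))"
  by auto
termination
  by (relation "measures [\<lambda>(x, b, j). j, \<lambda>(x, b, j). dep b]") (use dep_prev in \<open>auto dest: VD\<close>)

declare alpha.simps [simp del]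

lemma alpha_0 [simp]: "alpha x b 0 = 1"
  by (simp add: alpha.simps)

text \<open>The contribution to v(b) other than the sum over \<open>V\<close>: for \<open>b\<close>
  in \<open>Y\<close> that of e_b and the free terms, otherwise that of the transported vector
  t^(-\<phi>) \<gamma>\<sigma>(v(r^-1(b))).\<close>

definition pre :: "((nat \<times> int) \<times> nat \<Rightarrow> 'a) \<Rightarrow> nat \<times> int \<Rightarrow> nat \<Rightarrow> 'a" where
  "pre x b j = (if b \<in> Y then (if j = 0 then 1 else if (b, j) \<in> W then x (b, j) else 0) else alpha x (prev b) j ^ q)"

lemma alpha_rec:
  "b \<in> Ab \<Longrightarrow> alpha x b j = pre x b j + (\<Sum>i\<in>{i. (b, i) \<in> V \<and> i \<le> j}. x (b, i) * alpha x (shift b (int i)) (j - i))"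
proof (cases "j = 0")
  case True
  assume "b \<in> Ab"
  have "{i. (b, i) \<in> V \<and> i \<le> j} = {}" using VD True by fastforce
  then show ?thesis using True by (simp only: sum.empty) (simp add: pre_def)
qed (simp add: alpha.simps[of x b j] pre_def)

lemma vec_comp_iff:
  "(\<forall>l<n. (v :: 'a fls vec) $ l = R l) \<longleftrightarrow> (\<forall>i. ecoeff n v i = fls_nth (R (nat ((i - 1) mod int n))) ((i - 1) div int n))"
proof
  assume "\<forall>l<n. v $ l = R l"
  then show "\<forall>i. ecoeff n v i = fls_nth (R (nat ((i - 1) mod int n))) ((i - 1) div int n)"
    using index_mod_less[OF n] by (simp add: ecoeff_def)
next
  assume *: "\<forall>i. ecoeff n v i = fls_nth (R (nat ((i - 1) mod int n))) ((i - 1) div int n)"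
  show "\<forall>l<n. v $ l = R l"
  proof (intro allI impI fls_eqI)
    fix l k assume "l < n"
    then show "fls_nth (v $ l) k = fls_nth (R l) k"
      using spec[OF *, of "int n * k + int l + 1"] by (simp add: ecoeff_def)
  qed
qed

lemma is_vfamily_iff:
  fixes v :: "nat \<times> int \<Rightarrow> 'a fls vec"
  shows "is_vfamily q d n m A \<iota> x v \<longleftrightarrow>
     (\<forall>a\<in>A. v a \<in> carrier_vec n \<and>
        (\<forall>i < snd a. ecoeff n (v a) i = 0) \<and> ecoeff n (v a) (snd a) = 1) \<and>
     (\<forall>b \<in> Y. \<forall>i. ecoeff n (v b) i = (if i = snd b then 1 else 0)
          + (\<Sum>j | (b, j) \<in> W. x (b, j) * (if i = snd b + int j then 1 else 0))
          + (\<Sum>j | (b, j) \<in> V. x (b, j) * ecoeff n (v (shift b (int j))) i)) \<and>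
     (\<forall>b \<in> Ab - Y. \<forall>i. ecoeff n (v b) i = ecoeff n (phi_gamma_sigma q d n m A v (prev b)) i
          + (\<Sum>j | (b, j) \<in> V. x (b, j) * ecoeff n (v (shift b (int j))) i)) \<and>
     (\<forall>a\<in>A. v (shift a (int n)) = fls_X \<cdot>\<^sub>v v a)"
  unfolding is_vfamily_def vec_comp_iff prev_def
  by (simp add: ecoeff_def[symmetric] fls_nth_sum ecoeff_evec[OF n])

lemma snd_rr: "b \<in> Ab \<Longrightarrow> snd (\<rho> b) = snd b + offset (fst b) - int n * \<phi> b"
  by (simp add: rr_def ff_eq Ab_fst)

text \<open>The power of t is the one that sends the leading index b to r(b). So the distance to the
  leading index is kept, and the coefficient at each distance is raised to the power
  \<open>q\<close>.\<close>

lemma ecoeff_phi_gamma_sigma: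
  assumes "b \<in> Ab" "v b \<in> carrier_vec n"
  shows "ecoeff n (phi_gamma_sigma q d n m A v b :: 'a fls vec) i
    = ecoeff n (v b) (i - snd (\<rho> b) + snd b) ^ q"
proof -
  have "i - int n * (- \<phi> b) - offset (fst b) = i - snd (\<rho> b) + snd b"
    using snd_rr[OF assms(1)] by simp
  then show ?thesis
    using assms Ab_fst[OF assms(1)]
    by (simp only: phi_gamma_sigma_def ecoeff_X_smult[OF n gs_carrier] ecoeff_gs)
qed

text \<open>The family is given by its coefficients. Those at \<open>a\<close> are the ones at
  \<open>res a\<close>, since v(a) is a power of t times v(\<open>res a\<close>).\<close>

definition vv :: "((nat \<times> int) \<times> nat \<Rightarrow> 'a) \<Rightarrow> nat \<times> int \<Rightarrow> 'a fls vec" where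
  "vv x = (\<lambda>a\<in>A. SOME v. v \<in> carrier_vec n \<and>
     (\<forall>i. ecoeff n v i = (if i < snd a then 0 else alpha x (res a) (nat (i - snd a)))))"

lemma vv:
  assumes "a \<in> A"
  shows "vv x a \<in> carrier_vec n"
    and "ecoeff n (vv x a) i = (if i < snd a then 0 else alpha x (res a) (nat (i - snd a)))"
proof -
  have "\<exists>v. v \<in> carrier_vec n \<and>
      (\<forall>i. ecoeff n v i = (if i < snd a then 0 else alpha x (res a) (nat (i - snd a))))"
    using ex_vec_ecoeff[OF n, of "snd a" "\<lambda>i. if i < snd a then 0 else alpha x (res a) (nat (i - snd a))"]
    by auto
  from someI_ex[OF this] assms show "vv x a \<in> carrier_vec n"
    "ecoeff n (vv x a) i = (if i < snd a then 0 else alpha x (res a) (nat (i - snd a)))"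
    unfolding vv_def by auto
qed

lemma res_Ab: "b \<in> Ab \<Longrightarrow> res b = b"
  using res_eqI[OF Ab_fst, of b b 0] by (simp add: shift_def)

lemma sum_V_ecoeff:
  assumes "b \<in> Ab" and v: "\<And>j i. (b, j) \<in> V \<Longrightarrow> i < snd b + int j \<Longrightarrow> ecoeff n (v (shift b (int j))) i = 0"
  shows "(\<Sum>j | (b, j) \<in> V. x (b, j) * ecoeff n (v (shift b (int j))) (snd b + int J))
    = (\<Sum>j\<in>{j. (b, j) \<in> V \<and> j \<le> J}. x (b, j) * ecoeff n (v (shift b (int j))) (snd (shift b (int j)) + int (J - j)))"
proof -
  have "(\<Sum>j | (b, j) \<in> V. x (b, j) * ecoeff n (v (shift b (int j))) (snd b + int J))
    = (\<Sum>j\<in>{j. (b, j) \<in> V \<and> j \<le> J}. x (b, j) * ecoeff n (v (shift b (int j))) (snd b + int J))"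
    by (intro sum.mono_neutral_right) (simp_all add: finite_V_at v not_le subset_iff)
  also have "\<dots> = (\<Sum>j\<in>{j. (b, j) \<in> V \<and> j \<le> J}. x (b, j) * ecoeff n (v (shift b (int j))) (snd (shift b (int j)) + int (J - j)))"
    by (intro sum.cong) (auto simp: of_nat_diff)
  finally show ?thesis .
qed

lemma ecoeff_vv_Ab:
  assumes "b \<in> Ab"
  shows "ecoeff n (vv x b) (snd b + int J) = alpha x b J"
  using vv(2)[OF Ab_A[OF assms], of x "snd b + int J"] res_Ab[OF assms] by simp

lemma sum_V_alpha:
  assumes b: "b \<in> Ab"
  shows "(\<Sum>j | (b, j) \<in> V. x (b, j) * ecoeff n (vv x (shift b (int j))) (snd b + int J))
    = (\<Sum>j\<in>{j. (b, j) \<in> V \<and> j \<le> J}. x (b, j) * alpha x (shift b (int j)) (J - j))"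
proof -
  have "ecoeff n (vv x (shift b (int j))) i = 0" if "(b, j) \<in> V" "i < snd b + int j" for j i
    using vv(2)[OF Ab_A[of "shift b (int j)"], of x i] VD[OF that(1)] that(2) by simp
  then have "(\<Sum>j | (b, j) \<in> V. x (b, j) * ecoeff n (vv x (shift b (int j))) (snd b + int J))
    = (\<Sum>j\<in>{j. (b, j) \<in> V \<and> j \<le> J}. x (b, j) * ecoeff n (vv x (shift b (int j))) (snd (shift b (int j)) + int (J - j)))"
    by (rule sum_V_ecoeff[OF b])
  also have "(\<Sum>j\<in>{j. (b, j) \<in> V \<and> j \<le> J}. x (b, j) * ecoeff n (vv x (shift b (int j))) (snd (shift b (int j)) + int (J - j)))
    = (\<Sum>j\<in>{j. (b, j) \<in> V \<and> j \<le> J}. x (b, j) * alpha x (shift b (int j)) (J - j))"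
  proof (intro sum.cong refl)
    fix j assume "j \<in> {j. (b, j) \<in> V \<and> j \<le> J}"
    then have "shift b (int j) \<in> Ab" using VD by blast
    from ecoeff_vv_Ab[OF this] show "x (b, j) * ecoeff n (vv x (shift b (int j))) (snd (shift b (int j)) + int (J - j))
        = x (b, j) * alpha x (shift b (int j)) (J - j)" by simp
  qed
  finally show ?thesis .
qed

lemma sum_W_ecoeff:
  fixes x :: "(nat \<times> int) \<times> nat \<Rightarrow> 'a"
  shows "(\<Sum>j | (b, j) \<in> W. x (b, j) * (if snd b + int J = snd b + int j then 1 else 0)) = (if (b, J) \<in> W then x (b, J) else 0)"
proof -
  have "(\<Sum>j | (b, j) \<in> W. x (b, j) * (if snd b + int J = snd b + int j then 1 else 0))
      = (\<Sum>j | (b, j) \<in> W. if J = j then x (b, j) else 0)"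
    by (intro sum.cong) auto
  then show ?thesis using finite_W_at[of b] by (simp add: sum.delta)
qed

lemma fls_X_conv: "fls_X = fls_X_intpow 1"
  by (intro fls_eqI) simp

lemma is_vfamily_vv: "is_vfamily q d n m A \<iota> x (vv x)"
  unfolding is_vfamily_iff
proof (intro conjI ballI allI impI)
  fix a assume a: "a \<in> A"
  show "vv x a \<in> carrier_vec n" using vv(1)[OF a] .
  show "ecoeff n (vv x a) i = 0" if "i < snd a" for i using vv(2)[OF a] that by simp
  show "ecoeff n (vv x a) (snd a) = 1" using vv(2)[OF a] by simp
  have an: "shift a (int n) \<in> A" using A_shift[OF a, of 1] by simp
  have "res (shift a (int n)) = res a"
    using shift_res[of a] res_in_Ab[of a] A_fst[OF a]
    by (intro res_eqI[of _ _ "nu a + 1"]) (auto simp: shift_def res_def algebra_simps)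
  then show "vv x (shift a (int n)) = fls_X \<cdot>\<^sub>v vv x a"
    using vv[OF a] vv[OF an]
    by (intro vec_eq_if_ecoeff[OF n]) (auto simp: fls_X_conv ecoeff_X_smult[OF n, of _ 1] algebra_simps)
next
  fix b i assume b: "b \<in> Y"
  note bA = Ab_A[OF Y_Ab[OF b]]
  have vl: "ecoeff n (vv x (shift b (int j))) i = 0" if "(b, j) \<in> V" "i < snd b + int j" for j i
    using vv(2)[OF Ab_A[of "shift b (int j)"], of x i] VD[OF that(1)] that(2) by simp
  show "ecoeff n (vv x b) i = (if i = snd b then 1 else 0)
          + (\<Sum>j | (b, j) \<in> W. x (b, j) * (if i = snd b + int j then 1 else 0))
          + (\<Sum>j | (b, j) \<in> V. x (b, j) * ecoeff n (vv x (shift b (int j))) i)"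
  proof (cases "i < snd b")
    case True
    then show ?thesis using vv(2)[OF bA, of x i] vl by (auto intro!: sum.neutral)
  next
    case False
    define J where "J = nat (i - snd b)"
    then have J: "i = snd b + int J" using False by simp
    have w0: "(b, 0) \<notin> W" using WD by fastforce
    have "ecoeff n (vv x b) i = alpha x b J" unfolding J by (rule ecoeff_vv_Ab[OF Y_Ab[OF b]])
    also have "\<dots> = pre x b J + (\<Sum>j | (b, j) \<in> V. x (b, j) * ecoeff n (vv x (shift b (int j))) i)"
      unfolding J sum_V_alpha[OF Y_Ab[OF b]] by (rule alpha_rec[OF Y_Ab[OF b]])
    finally show ?thesis unfolding J sum_W_ecoeff using b w0 by (auto simp: pre_def)
  qed
next
  fix b i assume b: "b \<in> Ab - Y"
  then have bAb: "b \<in> Ab" by simp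
  note bA = Ab_A[OF bAb]
  have vl: "ecoeff n (vv x (shift b (int j))) i = 0" if "(b, j) \<in> V" "i < snd b + int j" for j i
    using vv(2)[OF Ab_A[of "shift b (int j)"], of x i] VD[OF that(1)] that(2) by simp
  have pb: "prev b \<in> Ab" "\<rho> (prev b) = b" using prev[OF bAb] by auto
  have pg: "ecoeff n (phi_gamma_sigma q d n m A (vv x) (prev b)) i = ecoeff n (vv x (prev b)) (i - snd b + snd (prev b)) ^ q"
    using ecoeff_phi_gamma_sigma[OF pb(1), of "vv x" i] pb vv(1)[OF Ab_A] by simp
  show "ecoeff n (vv x b) i = ecoeff n (phi_gamma_sigma q d n m A (vv x) (prev b)) i
          + (\<Sum>j | (b, j) \<in> V. x (b, j) * ecoeff n (vv x (shift b (int j))) i)"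
  proof (cases "i < snd b")
    case True
    then show ?thesis using vv(2)[OF bA, of x i] vl pg vv(2)[OF Ab_A[OF pb(1)]] by (auto intro!: sum.neutral)
  next
    case False
    define J where "J = nat (i - snd b)"
    then have J: "i = snd b + int J" using False by simp
    have "ecoeff n (vv x b) i = alpha x b J" unfolding J by (rule ecoeff_vv_Ab[OF bAb])
    also have "\<dots> = pre x b J + (\<Sum>j | (b, j) \<in> V. x (b, j) * ecoeff n (vv x (shift b (int j))) i)"
      unfolding J sum_V_alpha[OF bAb] by (rule alpha_rec[OF bAb])
    finally show ?thesis using pg J b vv(2)[OF Ab_A[OF pb(1)]] res_Ab[OF pb(1)] by (simp add: pre_def)
  qed
qed

text \<open>Compared coefficient by coefficient, the defining equations of the family are the
  recursion for \<open>alpha\<close>; hence the induction along that function, and the uniqueness of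
  the family.\<close>

lemma vfamily_alpha:
  assumes v: "is_vfamily q d n m A \<iota> x v" and "b \<in> Ab"
  shows "ecoeff n (v b) (snd b + int j) = alpha x b j"
  using assms
proof (induction x b j rule: alpha.induct)
  case (1 x b j)
  note v = 1(3)[unfolded is_vfamily_iff] and b = \<open>b \<in> Ab\<close>
  have va: "v a \<in> carrier_vec n" "\<And>i. i < snd a \<Longrightarrow> ecoeff n (v a) i = 0" "ecoeff n (v a) (snd a) = 1"
    if "a \<in> A" for a using bspec[OF conjunct1[OF v] that] by auto
  show ?case
  proof (cases "j = 0")
    case True
    then show ?thesis using va(3)[OF Ab_A[OF b]] by simp
  next
    case j: False
    have vl: "ecoeff n (v (shift b (int i))) k = 0" if "(b, i) \<in> V" "k < snd b + int i" for i k
      using va(2)[OF Ab_A[of "shift b (int i)"], of k] VD[OF that(1)] that(2) by simp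
    have "(\<Sum>i | (b, i) \<in> V. x (b, i) * ecoeff n (v (shift b (int i))) (snd b + int j))
      = (\<Sum>i\<in>{i. (b, i) \<in> V \<and> i \<le> j}. x (b, i) * ecoeff n (v (shift b (int i))) (snd (shift b (int i)) + int (j - i)))"
      by (rule sum_V_ecoeff[OF b]) (rule vl)
    also have "\<dots> = (\<Sum>i\<in>{i. (b, i) \<in> V \<and> i \<le> j}. x (b, i) * alpha x (shift b (int i)) (j - i))"
    proof (intro sum.cong refl)
      fix i assume i: "i \<in> {i. (b, i) \<in> V \<and> i \<le> j}"
      then have "shift b (int i) \<in> Ab" using VD by blast
      from 1(2)[OF j _ i 1(3) this] b show "x (b, i) * ecoeff n (v (shift b (int i))) (snd (shift b (int i)) + int (j - i))
        = x (b, i) * alpha x (shift b (int i)) (j - i)" by simp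
    qed
    finally have V: "(\<Sum>i | (b, i) \<in> V. x (b, i) * ecoeff n (v (shift b (int i))) (snd b + int j))
      = (\<Sum>i\<in>{i. (b, i) \<in> V \<and> i \<le> j}. x (b, i) * alpha x (shift b (int i)) (j - i))" .
    show ?thesis
    proof (cases "b \<in> Y")
      case True
      have "ecoeff n (v b) (snd b + int j) = (if (b, j) \<in> W then x (b, j) else 0)
        + (\<Sum>i | (b, i) \<in> V. x (b, i) * ecoeff n (v (shift b (int i))) (snd b + int j))"
        using spec[OF bspec[OF conjunct1[OF conjunct2[OF v]] True], of "snd b + int j"] j
        unfolding sum_W_ecoeff by simp
      then show ?thesis unfolding V alpha_rec[OF b] using j True by (simp add: pre_def)
    next
      case False
      have pb: "prev b \<in> Ab" "\<rho> (prev b) = b" using prev[OF b] by auto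
      have "ecoeff n (v b) (snd b + int j) = ecoeff n (phi_gamma_sigma q d n m A v (prev b)) (snd b + int j)
        + (\<Sum>i | (b, i) \<in> V. x (b, i) * ecoeff n (v (shift b (int i))) (snd b + int j))"
        using spec[OF bspec[OF conjunct1[OF conjunct2[OF conjunct2[OF v]]]], of b "snd b + int j"] b False by simp
      also have "ecoeff n (phi_gamma_sigma q d n m A v (prev b)) (snd b + int j) = alpha x (prev b) j ^ q"
        using ecoeff_phi_gamma_sigma[OF pb(1), of v "snd b + int j"] pb va(1)[OF Ab_A[OF pb(1)]]
          1(1)[OF j _ False 1(3) pb(1)] b by (simp add: add.commute)
      finally show ?thesis unfolding V alpha_rec[OF b] using False by (simp add: pre_def)
    qed
  qed
qed

lemma vfamily_shift:
  assumes v: "is_vfamily q d n m A \<iota> x v" and a: "a \<in> A"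
  shows "v (shift a (int n * int k)) = fls_X_intpow (int k) \<cdot>\<^sub>v v a"
proof (induction k)
  case 0
  have "fls_X_intpow 0 = (1 :: 'a fls)" by (intro fls_eqI) simp
  then show ?case by (simp add: shift_def)
next
  case (Suc k)
  have "shift a (int n * int (Suc k)) = shift (shift a (int n * int k)) (int n)"
    by (simp add: shift_def algebra_simps)
  moreover have "shift a (int n * int k) \<in> A" using A_shift[OF a] by simp
  ultimately have "v (shift a (int n * int (Suc k))) = fls_X \<cdot>\<^sub>v (fls_X_intpow (int k) \<cdot>\<^sub>v v a)"
    using v Suc by (simp add: is_vfamily_def)
  also have "\<dots> = (fls_X * fls_X_intpow (int k)) \<cdot>\<^sub>v v a" by (simp add: smult_smult_assoc)
  finally show ?case unfolding fls_X_conv fls_X_intpow_times_fls_X_intpow by simp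
qed

lemma vfamily_unique:
  assumes v: "is_vfamily q d n m A \<iota> x v" and a: "a \<in> A"
  shows "v a = vv x a"
proof -
  have b: "res a \<in> Ab" using A_fst[OF a] by (rule res_in_Ab)
  have "0 \<le> nu a" using a in_A_iff[OF A_fst[OF a]] by simp
  then obtain k where k: "nu a = int k" using zero_le_imp_eq_int by blast
  have "v' (res a) \<in> carrier_vec n \<and> (\<forall>i < snd (res a). ecoeff n (v' (res a)) i = 0)"
    if "is_vfamily q d n m A \<iota> x v'" for v'
    using that Ab_A[OF b] by (simp add: is_vfamily_def)
  note 1 = this[OF v] this[OF is_vfamily_vv]
  have "v (res a) = vv x (res a)"
  proof (rule vec_eq_if_ecoeff[OF n])
    fix i
    show "ecoeff n (v (res a)) i = ecoeff n (vv x (res a)) i"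
    proof (cases "i < snd (res a)")
      case False
      then have "i = snd (res a) + int (nat (i - snd (res a)))" by simp
      then show ?thesis using vfamily_alpha[OF v b] vfamily_alpha[OF is_vfamily_vv b] by metis
    qed (use 1 in simp)
  qed (use 1 in auto)
  then show ?thesis
    using vfamily_shift[OF v Ab_A[OF b], of k] vfamily_shift[OF is_vfamily_vv Ab_A[OF b], of x k]
      shift_res[of a] k by simp
qed

lemma vfamily_eq: "vfamily q d n m A \<iota> x = vv x"
  unfolding vfamily_def
proof (rule the_equality)
  show "vv x \<in> extensional A \<and> is_vfamily q d n m A \<iota> x (vv x)"
    using is_vfamily_vv by (simp add: vv_def)
  fix v assume v: "v \<in> extensional A \<and> is_vfamily q d n m A \<iota> x v"
  show "v = vv x"
  proof
    fix a
    show "v a = vv x a"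
      using vfamily_unique[of x v a] v extensional_arb[of v A a]
      by (cases "a \<in> A") (simp_all add: vv_def)
  qed
qed

end

section \<open>The lattice of a point of the parameter space\<close>

context strata
begin

lemma lead_vv: "a \<in> A \<Longrightarrow> lead n (vv x a) (snd a)"
  and ecoeff_vv_snd: "a \<in> A \<Longrightarrow> ecoeff n (vv x a) (snd a) = 1"
  by (auto simp: lead_def low_def vv)

text \<open>A representative g with g\<Delta> = \<Lambda>(x), through which \<Lambda>(x) becomes a
  point of the Grassmannian.\<close>

definition basis_mat :: "((nat \<times> int) \<times> nat \<Rightarrow> 'a) \<Rightarrow> nat \<Rightarrow> 'a fls mat" where
  "basis_mat x \<tau> = mat n n (\<lambda>(i, l). vv x (amin \<tau> l) $ i)"

lemma basis_mat_carrier: "basis_mat x \<tau> \<in> carrier_mat n n"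
  by (simp add: basis_mat_def)

lemma col_basis_mat: "\<tau> < d \<Longrightarrow> l < n \<Longrightarrow> col (basis_mat x \<tau>) l = vv x (amin \<tau> l)"
  using carrier_vecD[OF vv(1)[OF Ab_A[OF amin_in]]] by (intro eq_vecI) (auto simp: basis_mat_def)

lemma lead_basis_amin:
  assumes "\<tau> < d" "g \<in> carrier_mat n n" "\<And>l. l < n \<Longrightarrow> lead n (col g l) (snd (amin \<tau> l))"
  shows "lead_basis n g (\<lambda>l. snd (amin \<tau> l))"
  using assms amin_inj[where \<tau> = \<tau>] by (auto simp: lead_basis_def inj_on_def)

lemma lead_basis_basis_mat: "\<tau> < d \<Longrightarrow> lead_basis n (basis_mat x \<tau>) (\<lambda>l. snd (amin \<tau> l))"
  using lead_vv[OF Ab_A[OF amin_in]]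
  by (intro lead_basis_amin basis_mat_carrier) (simp_all add: col_basis_mat)

lemma amin_multiples:
  assumes \<tau>: "\<tau> < d"
  shows "{snd (amin \<tau> l) + int n * k | l k. l < n \<and> 0 \<le> k} = {i. (\<tau>, i) \<in> A}"
proof (intro equalityI subsetI)
  fix i assume "i \<in> {snd (amin \<tau> l) + int n * k | l k. l < n \<and> 0 \<le> k}"
  then obtain l k where "i = snd (amin \<tau> l) + int n * k" "0 \<le> k" by blast
  then have "(\<tau>, i) = shift (amin \<tau> l) (int n * k)" by (simp add: shift_def)
  then show "i \<in> {i. (\<tau>, i) \<in> A}" using A_shift[OF Ab_A[OF amin_in[OF \<tau>]] \<open>0 \<le> k\<close>] by simp
next
  fix i assume "i \<in> {i. (\<tau>, i) \<in> A}"
  then have i: "(\<tau>, i) \<in> A" by simp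
  have "res (\<tau>, i) \<in> Ab" using res_in_Ab[of "(\<tau>, i)"] \<tau> by simp
  then obtain l where l: "l < n" "res (\<tau>, i) = amin \<tau> l" using amin_surj[of "res (\<tau>, i)"] by auto
  moreover have "0 \<le> nu (\<tau>, i)" using i in_A_iff[of "(\<tau>, i)"] \<tau> by simp
  moreover have "i = snd (res (\<tau>, i)) + int n * nu (\<tau>, i)" by (simp add: snd_res)
  ultimately show "i \<in> {snd (amin \<tau> l) + int n * k | l k. l < n \<and> 0 \<le> k}" by fastforce
qed

abbreviation Lam :: "((nat \<times> int) \<times> nat \<Rightarrow> 'a) \<Rightarrow> nat \<Rightarrow> 'a fls vec set" where
  "Lam \<equiv> Lambda q d n m A \<iota>"

lemma Lam_eq: 
  assumes \<tau>: "\<tau> < d"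
  shows "Lam x \<tau> = latt n (basis_mat x \<tau>)"
proof -
  have comb: "basis_mat x \<tau> *\<^sub>v w = vec n (\<lambda>i. \<Sum>b | b \<in> Ab \<and> fst b = \<tau>. c b * vv x b $ i)"
    if "w \<in> carrier_vec n" "\<And>l. l < n \<Longrightarrow> w $ l = c (amin \<tau> l)" for w :: "'a fls vec" and c
  proof (intro eq_vecI)
    fix i assume "i < dim_vec (vec n (\<lambda>i. \<Sum>b | b \<in> Ab \<and> fst b = \<tau>. c b * vv x b $ i))"
    then have i: "i < n" by simp
    have "(\<Sum>b | b \<in> Ab \<and> fst b = \<tau>. c b * vv x b $ i) = (\<Sum>l<n. c (amin \<tau> l) * vv x (amin \<tau> l) $ i)"
      using sum.reindex_bij_betw[OF bij_amin[OF \<tau>], of "\<lambda>b. c b * vv x b $ i"] by simp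
    then show "(basis_mat x \<tau> *\<^sub>v w) $ i = vec n (\<lambda>i. \<Sum>b | b \<in> Ab \<and> fst b = \<tau>. c b * vv x b $ i) $ i"
      using i that by (simp add: basis_mat_def scalar_prod_def atLeast0LessThan mult.commute)
  qed (simp add: basis_mat_def)
  show ?thesis
  proof (intro equalityI subsetI)
    fix v assume "v \<in> Lam x \<tau>"
    then obtain c where c: "\<And>b. c b \<in> integers_L"
      "v = vec n (\<lambda>i. \<Sum>b | b \<in> Ab \<and> fst b = \<tau>. c b * vv x b $ i)"
      using \<tau> by (auto simp: Lambda_def vfamily_eq)
    then have "v = basis_mat x \<tau> *\<^sub>v vec n (\<lambda>l. c (amin \<tau> l))" by (subst comb[of _ c]) auto
    moreover have "integral_vec n (vec n (\<lambda>l. c (amin \<tau> l)))" using c by (simp add: integral_vec_def)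
    ultimately show "v \<in> latt n (basis_mat x \<tau>)" by (auto simp: latt_def)
  next
    fix v assume "v \<in> latt n (basis_mat x \<tau>)"
    then obtain w where w: "integral_vec n w" "v = basis_mat x \<tau> *\<^sub>v w" by (auto simp: latt_def)
    define c where "c b = (if b \<in> amin \<tau> ` {..<n} then w $ (inv_into {..<n} (amin \<tau>) b) else 0)" for b
    have "w $ l = c (amin \<tau> l)" if "l < n" for l
      using that inv_into_f_f[OF bij_betw_imp_inj_on[OF bij_amin[OF \<tau>]], of l] by (simp add: c_def)
    then have "v = vec n (\<lambda>i. \<Sum>b | b \<in> Ab \<and> fst b = \<tau>. c b * vv x b $ i)"
      using w by (auto simp: integral_vec_def intro!: comb)
    moreover have "c b \<in> integers_L" for b
      using w inv_into_into[of b "amin \<tau>" "{..<n}"] by (auto simp: c_def integral_vec_def integers_L_0)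
    ultimately show "v \<in> Lam x \<tau>" using \<tau> by (auto simp: Lambda_def vfamily_eq)
  qed
qed

lemma basis_mat_GL: "basis_mat x \<in> GL d n"
  using lead_basis_invertible[OF n lead_basis_basis_mat] basis_mat_carrier by (auto simp: GL_def)

lemma Lam_lattice_of: "Lam x = lattice_of d n (basis_mat x)"
proof
  fix \<tau>
  show "Lam x \<tau> = lattice_of d n (basis_mat x) \<tau>"
    by (cases "\<tau> < d") (simp_all add: lattice_of_eq Lam_eq, simp add: Lambda_def lattice_of_def)
qed

lemma olattice_Lam: "\<tau> < d \<Longrightarrow> olattice n (Lam x \<tau>)"
  by (simp add: Lam_eq olattice_lead_basis[OF n lead_basis_basis_mat])

lemma leads_Lam: "\<tau> < d \<Longrightarrow> leads n (Lam x \<tau>) = {i. (\<tau>, i) \<in> A}"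
  by (simp add: Lam_eq leads_latt[OF n lead_basis_basis_mat] amin_multiples)

lemma vv_in_if_Ab:
  assumes L: "olattice n \<Lambda>" and ab: "\<And>b. b \<in> Ab \<Longrightarrow> fst b = \<tau> \<Longrightarrow> vv x b \<in> \<Lambda>" and a: "a \<in> A" "fst a = \<tau>"
  shows "vv x a \<in> \<Lambda>"
proof -
  have b: "res a \<in> Ab" using A_fst[OF a(1)] by (rule res_in_Ab)
  have "0 \<le> nu a" using a in_A_iff[OF A_fst[OF a(1)]] by simp
  then obtain k where k: "nu a = int k" using zero_le_imp_eq_int by blast
  have "vv x a = fls_X_intpow (int k) \<cdot>\<^sub>v vv x (res a)"
    using vfamily_shift[OF is_vfamily_vv Ab_A[OF b], of x k] shift_res[of a] k by simp
  then show ?thesis using olatticeD(3)[OF L integers_L_X_intpow ab[OF b]] a(2) by simp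
qed

lemma vv_in_Lam:
  assumes "a \<in> A"
  shows "vv x a \<in> Lam x (fst a)"
proof (rule vv_in_if_Ab[OF olattice_Lam[OF A_fst[OF assms]] _ assms refl])
  fix b assume b: "b \<in> Ab" "fst b = fst a"
  then obtain l where "l < n" "b = amin (fst a) l" using amin_surj by metis
  then show "vv x b \<in> Lam x (fst a)"
    using col_in_latt[OF n basis_mat_carrier, of l x "fst a"] A_fst[OF assms]
    by (simp add: Lam_eq col_basis_mat)
qed

lemma Lam_eqI:
  assumes \<tau>: "\<tau> < d" and L: "olattice n \<Lambda>" and leads: "leads n \<Lambda> \<subseteq> {i. (\<tau>, i) \<in> A}"
    and ab: "\<And>b. b \<in> Ab \<Longrightarrow> fst b = \<tau> \<Longrightarrow> vv x b \<in> \<Lambda>"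
  shows "\<Lambda> = Lam x \<tau>"
  unfolding Lam_eq[OF \<tau>]
proof (rule olattice_eq_latt[OF n L lead_basis_basis_mat[OF \<tau>]])
  show "col (basis_mat x \<tau>) l \<in> \<Lambda>" if "l < n" for l
    using ab[OF amin_in[OF \<tau>]] that \<tau> by (simp add: col_basis_mat)
  show "leads n \<Lambda> \<subseteq> {snd (amin \<tau> l) + int n * k |l k. l < n \<and> 0 \<le> k}"
    using leads by (simp add: amin_multiples[OF \<tau>])
qed

text \<open>The exponent of t is tied to \<open>b\<close>, so that vectors with leading index b are
  sent to vectors with leading index r(b).\<close>

definition tgs :: "nat \<times> int \<Rightarrow> 'a fls vec \<Rightarrow> 'a fls vec" where
  "tgs b w = fls_X_intpow (- \<phi> b) \<cdot>\<^sub>v gs (fst b) w"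

lemma tgs_carrier: "tgs b w \<in> carrier_vec n"
  using gs_carrier by (simp add: tgs_def)

lemma phi_gamma_sigma_eq: "phi_gamma_sigma q d n m A v b = tgs b (v b)"
  by (simp add: phi_gamma_sigma_def tgs_def)

lemma ecoeff_tgs:
  "b \<in> Ab \<Longrightarrow> w \<in> carrier_vec n \<Longrightarrow> ecoeff n (tgs b w) i = ecoeff n w (i - snd (\<rho> b) + snd b) ^ q"
  using ecoeff_phi_gamma_sigma[of b "\<lambda>_. w" i] by (simp add: phi_gamma_sigma_eq)

lemma low_tgs: "b \<in> Ab \<Longrightarrow> low n w (snd b + j) \<Longrightarrow> low n (tgs b w) (snd (\<rho> b) + j)"
  using tgs_carrier by (auto simp: low_def ecoeff_tgs)

lemma lead_tgs:
  assumes "b \<in> Ab" "lead n w (snd b + j)"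
  shows "lead n (tgs b w) (snd (\<rho> b) + j)"
proof -
  have "w \<in> carrier_vec n" "low n w (snd b + j)" "ecoeff n w (snd b + j) \<noteq> 0"
    using assms(2) by (auto simp: lead_def low_def)
  then show ?thesis using low_tgs[OF assms(1)] ecoeff_tgs[OF assms(1), of w "snd (\<rho> b) + j"]
    by (simp add: lead_def algebra_simps)
qed

lemma stratum_coords_iff:
  "x \<in> stratum_coords q d n m A \<iota> \<longleftrightarrow>
    x \<in> affine_space D \<and> (\<forall>b\<in>Ab. tgs b (vv x b) \<in> Lam x (fst (\<rho> b)))"
  by (simp add: stratum_coords_def vfamily_eq phi_gamma_sigma_eq fst_rr)

text \<open>The part of \<open>alpha\<close> that does not involve \<open>x (b, j)\<close> itself.\<close>

definition rest :: "((nat \<times> int) \<times> nat \<Rightarrow> 'a) \<Rightarrow> nat \<times> int \<Rightarrow> nat \<Rightarrow> 'a" where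
  "rest x b j = (if b \<in> Y then (if j = 0 then 1 else 0) else alpha x (prev b) j ^ q)
     + (\<Sum>i\<in>{i. (b, i) \<in> V \<and> i < j}. x (b, i) * alpha x (shift b (int i)) (j - i))"

lemma alpha_rest:
  assumes b: "b \<in> Ab"
  shows "alpha x b j = rest x b j + (if (b, j) \<in> D then x (b, j) else 0)"
proof -
  have fin: "finite {i. (b, i) \<in> V \<and> i < j}" by simp
  have "(\<Sum>i\<in>{i. (b, i) \<in> V \<and> i \<le> j}. x (b, i) * alpha x (shift b (int i)) (j - i))
    = (if (b, j) \<in> V then x (b, j) else 0)
      + (\<Sum>i\<in>{i. (b, i) \<in> V \<and> i < j}. x (b, i) * alpha x (shift b (int i)) (j - i))"
  proof (cases "(b, j) \<in> V")
    case True
    then have "{i. (b, i) \<in> V \<and> i \<le> j} = insert j {i. (b, i) \<in> V \<and> i < j}" by auto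
    then show ?thesis using fin True by simp
  next
    case False
    then have "{i. (b, i) \<in> V \<and> i \<le> j} = {i. (b, i) \<in> V \<and> i < j}" by (auto simp: le_less)
    then show ?thesis using False by simp
  qed
  moreover have "pre x b j = (if b \<in> Y then (if j = 0 then 1 else 0) else alpha x (prev b) j ^ q)
      + (if (b, j) \<in> W then x (b, j) else 0)"
    using WD[of b j] by (auto simp: pre_def)
  moreover have "(if (b, j) \<in> D then x (b, j) else 0)
      = (if (b, j) \<in> V then x (b, j) else 0) + (if (b, j) \<in> W then x (b, j) else 0)"
    using VW_disjoint by (auto simp: D_eq)
  ultimately show ?thesis unfolding alpha_rec[OF b] rest_def by simp
qed

lemma Ab_induct [consumes 1, case_names step]:
  assumes "b \<in> Ab"
    and step: "\<And>b j. b \<in> Ab \<Longrightarrow> (b \<notin> Y \<Longrightarrow> P (prev b) j) \<Longrightarrow>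
      (\<And>i. (b, i) \<in> V \<Longrightarrow> i < j \<Longrightarrow> P (shift b (int i)) (j - i)) \<Longrightarrow> P b j"
  shows "P b j"
proof -
  have "\<forall>b\<in>Ab. P b j" for j
  proof (induction j rule: less_induct)
    case (less j)
    show ?case
    proof
      fix b assume "b \<in> Ab"
      then show "P b j"
      proof (induction "dep b" arbitrary: b rule: less_induct)
        case (less b)
        show ?case
        proof (rule step[OF less.prems])
          show "P (prev b) j" if "b \<notin> Y" using less dep_prev prev that by blast
          show "P (shift b (int i)) (j - i)" if "(b, i) \<in> V" "i < j" for i
            using \<open>\<And>y. y < j \<Longrightarrow> \<forall>b\<in>Ab. P b y\<close>[of "j - i"] VD[OF that(1)] that(2) by simp
        qed
      qed
    qed
  qed
  then show ?thesis using assms(1) by blast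
qed

text \<open>The recursion descends in \<open>(j, dep b)\<close>, ordered lexicographically. Together
  with \<open>rest_cong\<close>, where the inequality is strict, this is the order in which the
  coordinates of a point are determined.\<close>

lemma alpha_cong:
  assumes "b \<in> Ab" and "\<And>b' j'. (b', j') \<in> D \<Longrightarrow> j' < j \<or> j' = j \<and> dep b' \<le> dep b \<Longrightarrow> x (b', j') = y (b', j')"
  shows "alpha x b j = alpha y b j"
  using assms
proof (induction b j rule: Ab_induct)
  case (step b j)
  have "alpha x (prev b) j = alpha y (prev b) j" if "b \<notin> Y"
  proof (rule step.IH(1)[OF that])
    fix b' j' assume "(b', j') \<in> D" "j' < j \<or> j' = j \<and> dep b' \<le> dep (prev b)"
    then show "x (b', j') = y (b', j')" using dep_prev[OF step.hyps that] by (intro step.prems) auto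
  qed
  moreover have "x (b, i) * alpha x (shift b (int i)) (j - i) = y (b, i) * alpha y (shift b (int i)) (j - i)"
    if "(b, i) \<in> V" "i < j" for i
  proof -
    have "alpha x (shift b (int i)) (j - i) = alpha y (shift b (int i)) (j - i)"
      using VD[OF that(1)] that(2) by (intro step.IH(2)[OF that] step.prems) auto
    moreover have "x (b, i) = y (b, i)" using that by (intro step.prems) (auto simp: D_eq)
    ultimately show ?thesis by simp
  qed
  ultimately have "rest x b j = rest y b j" unfolding rest_def by (intro arg_cong2[where f = "(+)"] sum.cong) auto
  moreover have "(if (b, j) \<in> D then x (b, j) else 0) = (if (b, j) \<in> D then y (b, j) else 0)"
    using step.prems by auto
  ultimately show ?case by (simp only: alpha_rest[OF step.hyps])
qed

lemma rest_cong:
  assumes b: "b \<in> Ab" and eq: "\<And>b' j'. (b', j') \<in> D \<Longrightarrow> j' < j \<or> j' = j \<and> dep b' < dep b \<Longrightarrow> x (b', j') = y (b', j')"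
  shows "rest x b j = rest y b j"
proof -
  have "alpha x (prev b) j = alpha y (prev b) j" if "b \<notin> Y"
    using dep_prev[OF b that] prev[OF b] by (intro alpha_cong eq) auto
  moreover have "x (b, i) * alpha x (shift b (int i)) (j - i) = y (b, i) * alpha y (shift b (int i)) (j - i)"
    if "(b, i) \<in> V" "i < j" for i
  proof -
    have "alpha x (shift b (int i)) (j - i) = alpha y (shift b (int i)) (j - i)"
      using VD[OF that(1)] that(2) by (intro alpha_cong eq) auto
    moreover have "x (b, i) = y (b, i)" using that by (intro eq) (auto simp: D_eq)
    ultimately show ?thesis by simp
  qed
  ultimately show ?thesis unfolding rest_def by (intro arg_cong2[where f = "(+)"] sum.cong) auto
qed

text \<open>The coordinates allowed in the polynomial of an equation at distance \<open>j\<close>: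
  all of \<open>V\<close>, the parameters of the base, and those of \<open>W\<close> at smaller
  distance.\<close>

abbreviation earlier :: "nat \<Rightarrow> ((nat \<times> int) \<times> nat) set" where
  "earlier j \<equiv> V \<union> {w \<in> W. snd w < j}"

lemma rest_alpha_poly_aux:
  assumes "b \<in> Ab"
    and "\<And>i. (b, i) \<in> V \<Longrightarrow> i < j \<Longrightarrow> (\<lambda>x. alpha x (shift b (int i)) (j - i)) \<in> polyfun (earlier (Suc (j - i)))"
  shows "(\<lambda>x. \<Sum>i\<in>{i. (b, i) \<in> V \<and> i < j}. x (b, i) * alpha x (shift b (int i)) (j - i)) \<in> polyfun (earlier j)"
proof (rule polyfun_sum)
  fix i assume "i \<in> {i. (b, i) \<in> V \<and> i < j}"
  then have i: "(b, i) \<in> V" "i < j" by auto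
  then have "earlier (Suc (j - i)) \<subseteq> earlier j" using VD[OF i(1)] by auto
  then show "(\<lambda>x. x (b, i) * alpha x (shift b (int i)) (j - i)) \<in> polyfun (earlier j)"
    using i by (intro polyfun.mult polyfun.var polyfun_mono[OF assms(2)[OF i]]) auto
qed

text \<open>Among the coordinates of \<open>W\<close> at distance \<open>j\<close> only the one at
  the root of the orbit can enter: it appears at \<open>Y\<close>, and each step along the orbit
  raises it to the power \<open>q\<close>. The terms from \<open>V\<close> involve
  \<open>alpha\<close> at a distance \<open>j - i < j\<close>, so their coordinates of
  \<open>W\<close> are earlier.\<close>

lemma alpha_structure:
  assumes "b \<in> Ab"
  shows "\<exists>e. \<exists>P\<in>polyfun (earlier j). \<forall>x. alpha x b j = (if (root b, j) \<in> W then x (root b, j) ^ (q ^ e) else 0) + P x"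
  using assms
proof (induction b j rule: Ab_induct)
  case (step b j)
  have sum: "(\<lambda>x. \<Sum>i\<in>{i. (b, i) \<in> V \<and> i < j}. x (b, i) * alpha x (shift b (int i)) (j - i)) \<in> polyfun (earlier j)"
  proof (rule rest_alpha_poly_aux[OF step.hyps])
    fix i assume i: "(b, i) \<in> V" "i < j"
    obtain e P where P: "P \<in> polyfun (earlier (j - i))"
      "\<And>x. alpha x (shift b (int i)) (j - i) = (if (root (shift b (int i)), j - i) \<in> W then x (root (shift b (int i)), j - i) ^ (q ^ e) else 0) + P x"
      using step.IH(2)[OF i] by blast
    have "P \<in> polyfun (earlier (Suc (j - i)))" by (rule polyfun_mono[OF P(1)]) auto
    moreover have "(\<lambda>x. if (root (shift b (int i)), j - i) \<in> W then x (root (shift b (int i)), j - i) ^ (q ^ e) else 0)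
        \<in> polyfun (earlier (Suc (j - i)))"
      by (cases "(root (shift b (int i)), j - i) \<in> W") (auto intro!: polyfun_power polyfun.var polyfun.const)
    ultimately show "(\<lambda>x. alpha x (shift b (int i)) (j - i)) \<in> polyfun (earlier (Suc (j - i)))"
      unfolding P(2) by (rule polyfun.add[rotated])
  qed
  show ?case
  proof (cases "b \<in> Y")
    case True
    define P where "P x = rest x b j + (if (b, j) \<in> V then x (b, j) else 0)" for x
    have "P \<in> polyfun (earlier j)"
      unfolding P_def rest_def using True sum
      by (cases "(b, j) \<in> V"; cases "j = 0") (auto intro!: polyfun.add polyfun.const polyfun.var)
    moreover have "alpha x b j = (if (root b, j) \<in> W then x (root b, j) ^ (q ^ 0) else 0) + P x" for x
      using VW_disjoint True by (auto simp: alpha_rest[OF step.hyps] P_def D_eq root_Y)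
    ultimately show ?thesis by blast
  next
    case False
    obtain e P where P: "P \<in> polyfun (earlier j)"
      "\<And>x. alpha x (prev b) j = (if (root b, j) \<in> W then x (root b, j) ^ (q ^ e) else 0) + P x"
      using step.IH(1)[OF False] unfolding root_prev[OF step.hyps] by blast
    have nW: "(b, j) \<notin> W" using WD False by blast
    define P' where "P' x = P x ^ q + (\<Sum>i\<in>{i. (b, i) \<in> V \<and> i < j}. x (b, i) * alpha x (shift b (int i)) (j - i))
      + (if (b, j) \<in> V then x (b, j) else 0)" for x
    have "P' \<in> polyfun (earlier j)"
      unfolding P'_def using sum polyfun_power[OF P(1)]
      by (cases "(b, j) \<in> V") (auto intro!: polyfun.add polyfun.const polyfun.var)
    moreover have "alpha x b j = (if (root b, j) \<in> W then x (root b, j) ^ (q ^ Suc e) else 0) + P' x" for x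
      using False nW by (auto simp: alpha_rest[OF step.hyps] rest_def P(2) P'_def D_eq add_power_q power_mult[symmetric] mult.commute)
    ultimately show ?thesis by blast
  qed
qed

lemma alpha_poly: 
  assumes "b \<in> Ab"
  shows "(\<lambda>x. alpha x b j) \<in> polyfun (earlier (Suc j))"
proof -
  obtain e P where P: "P \<in> polyfun (earlier j)"
    "\<And>x. alpha x b j = (if (root b, j) \<in> W then x (root b, j) ^ (q ^ e) else 0) + P x"
    using alpha_structure[OF assms] by blast
  have "P \<in> polyfun (earlier (Suc j))" by (rule polyfun_mono[OF P(1)]) auto
  moreover have "(\<lambda>x. if (root b, j) \<in> W then x (root b, j) ^ (q ^ e) else 0) \<in> polyfun (earlier (Suc j))"
    by (cases "(root b, j) \<in> W") (auto intro!: polyfun_power polyfun.var polyfun.const)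
  ultimately show ?thesis unfolding P(2) by (rule polyfun.add[rotated])
qed

end

section \<open>The equations of the strata\<close>

context strata
begin

text \<open>\<open>z\<close> is reduced by the vectors v(a): \<open>e j\<close> is what is left at
  distance \<open>j\<close> after removing the contributions from smaller distances. The least
  \<open>j\<close> with \<open>e j\<close> nonzero at an index outside \<open>A\<close> would make
  \<open>s + j\<close> a leading index of \<Lambda>. If there is none, the remainders
  \<open>zz J\<close> end up so deep in the filtration that they lie in \<Lambda>.\<close>

lemma reduction:
  assumes L: "olattice n \<Lambda>" and leads: "leads n \<Lambda> = {i. (\<tau>, i) \<in> A}"
    and v: "\<And>a. a \<in> A \<Longrightarrow> fst a = \<tau> \<Longrightarrow> v a \<in> \<Lambda> \<and> lead n (v a) (snd a) \<and> ecoeff n (v a) (snd a) = 1"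
    and z: "low n z (s + 1)"
    and e: "\<And>j. 1 \<le> j \<Longrightarrow> ecoeff n z (s + int j) = e j +
      (\<Sum>i\<in>{i. 1 \<le> i \<and> i < j \<and> (\<tau>, s + int i) \<in> A}. e i * ecoeff n (v (\<tau>, s + int i)) (s + int j))"
  shows "z \<in> \<Lambda> \<longleftrightarrow> (\<forall>j\<ge>1. (\<tau>, s + int j) \<notin> A \<longrightarrow> e j = 0)"
proof -
  define I where "I J = {i. 1 \<le> i \<and> i < J \<and> (\<tau>, s + int i) \<in> A}" for J :: nat
  define zz where "zz J = z - vec n (\<lambda>l. \<Sum>i\<in>I J. (fls_const (e i) \<cdot>\<^sub>v v (\<tau>, s + int i)) $ l)" for J
  have finI: "finite (I J)" for J by (simp add: I_def)
  have vI: "v (\<tau>, s + int i) \<in> \<Lambda>" "lead n (v (\<tau>, s + int i)) (s + int i)"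
    "ecoeff n (v (\<tau>, s + int i)) (s + int i) = 1" if "i \<in> I J" for i J
    using v[of "(\<tau>, s + int i)"] that by (auto simp: I_def)
  have zc: "z \<in> carrier_vec n" using z by (simp add: low_def)
  have sumL: "vec n (\<lambda>l. \<Sum>i\<in>I J. (fls_const (e i) \<cdot>\<^sub>v v (\<tau>, s + int i)) $ l) \<in> \<Lambda>" for J
    using vI olatticeD(3)[OF L integers_L_const] by (intro olattice_vec_sum[OF n L finI]) auto
  have zz_c: "zz J \<in> carrier_vec n" for J using zc by (simp add: zz_def)
  have zz_iff: "zz J \<in> \<Lambda> \<longleftrightarrow> z \<in> \<Lambda>" for J
  proof
    assume "zz J \<in> \<Lambda>"
    then have "zz J + vec n (\<lambda>l. \<Sum>i\<in>I J. (fls_const (e i) \<cdot>\<^sub>v v (\<tau>, s + int i)) $ l) \<in> \<Lambda>"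
      using olatticeD(2)[OF L] sumL by blast
    moreover have "zz J + vec n (\<lambda>l. \<Sum>i\<in>I J. (fls_const (e i) \<cdot>\<^sub>v v (\<tau>, s + int i)) $ l) = z"
      using zc by (intro eq_vecI) (auto simp: zz_def)
    ultimately show "z \<in> \<Lambda>" by simp
  qed (use sumL olattice_minus[OF L] zz_def in auto)
  have ez: "ecoeff n (zz J) i = ecoeff n z i - (\<Sum>j\<in>I J. e j * ecoeff n (v (\<tau>, s + int j)) i)" for J i
  proof -
    have "(\<Sum>j\<in>I J. ecoeff n (fls_const (e j) \<cdot>\<^sub>v v (\<tau>, s + int j)) i) = (\<Sum>j\<in>I J. e j * ecoeff n (v (\<tau>, s + int j)) i)"
      using vI(1) olatticeD(1)[OF L] by (intro sum.cong refl ecoeff_const_smult[OF n]) auto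
    then show ?thesis using zc by (simp add: zz_def ecoeff_minus[OF n] ecoeff_vec_sum[OF n])
  qed
  have coeff: "ecoeff n (zz J) (s + int j) = (if j \<in> I J then 0 else e j)" if j: "1 \<le> j" "j \<le> J" for J j
  proof -
    have "(\<Sum>i\<in>I J. e i * ecoeff n (v (\<tau>, s + int i)) (s + int j))
        = (\<Sum>i\<in>I j \<union> (if j \<in> I J then {j} else {}). e i * ecoeff n (v (\<tau>, s + int i)) (s + int j))"
    proof (rule sum.mono_neutral_right[OF finI])
      show "I j \<union> (if j \<in> I J then {j} else {}) \<subseteq> I J" using j by (auto simp: I_def)
      show "\<forall>i\<in>I J - (I j \<union> (if j \<in> I J then {j} else {})). e i * ecoeff n (v (\<tau>, s + int i)) (s + int j) = 0"
      proof
        fix i assume i: "i \<in> I J - (I j \<union> (if j \<in> I J then {j} else {}))"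
        then have "j < i" by (cases "i = j") (auto simp: I_def)
        then show "e i * ecoeff n (v (\<tau>, s + int i)) (s + int j) = 0"
          using vI(2)[of i J] i by (auto simp: lead_def low_def)
      qed
    qed
    also have "\<dots> = (\<Sum>i\<in>I j. e i * ecoeff n (v (\<tau>, s + int i)) (s + int j)) + (if j \<in> I J then e j else 0)"
    proof -
      have "j \<notin> I j" by (simp add: I_def)
      then show ?thesis using finI vI(3)[of j J] by auto
    qed
    finally show ?thesis using e[OF j(1)] by (simp add: ez I_def)
  qed
  have low_zz: "low n (zz J) (s + int J)" if J: "1 \<le> J" and 0: "\<And>j. 1 \<le> j \<Longrightarrow> j < J \<Longrightarrow> (\<tau>, s + int j) \<notin> A \<Longrightarrow> e j = 0" for J
    unfolding low_def
  proof (intro conjI allI impI zz_c)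
    fix i assume i: "i < s + int J"
    show "ecoeff n (zz J) i = 0"
    proof (cases "i < s + 1")
      case True
      then have "ecoeff n (v (\<tau>, s + int j)) i = 0" if "j \<in> I J" for j
        using vI(2)[OF that] that by (auto simp: lead_def low_def I_def)
      then show ?thesis using z True by (auto simp: ez low_def)
    next
      case False
      define j where "j = nat (i - s)"
      have j: "i = s + int j" "1 \<le> j" "j < J" using False i by (auto simp: j_def)
      then show ?thesis using coeff[of j J] 0[of j] by (auto simp: I_def)
    qed
  qed
  show ?thesis
  proof
    assume "z \<in> \<Lambda>"
    have "(\<tau>, s + int j) \<notin> A \<longrightarrow> e j = 0" if "1 \<le> j" for j
      using that
    proof (induction j rule: less_induct)
      case (less j)
      have low: "low n (zz j) (s + int j)" using less by (intro low_zz) auto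
      show ?case
      proof (intro impI, rule ccontr)
        assume "(\<tau>, s + int j) \<notin> A" "e j \<noteq> 0"
        then have "lead n (zz j) (s + int j)" using low coeff[of j j] less.prems by (auto simp: lead_def I_def)
        then have "s + int j \<in> leads n \<Lambda>" using zz_iff \<open>z \<in> \<Lambda>\<close> by (auto simp: leads_def)
        then show False using leads \<open>(\<tau>, s + int j) \<notin> A\<close> by simp
      qed
    qed
    then show "\<forall>j\<ge>1. (\<tau>, s + int j) \<notin> A \<longrightarrow> e j = 0" by blast
  next
    assume 0: "\<forall>j\<ge>1. (\<tau>, s + int j) \<notin> A \<longrightarrow> e j = 0"
    obtain C where C: "\<And>w. low n w C \<Longrightarrow> w \<in> \<Lambda>" using olatticeD(4)[OF L] by blast
    define J where "J = Suc (nat (C - s))"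
    have "low n (zz J) (s + int J)" using 0 by (intro low_zz) (auto simp: J_def)
    then have "low n (zz J) C" by (rule low_mono[OF n]) (simp add: J_def)
    then show "z \<in> \<Lambda>" using C zz_iff by blast
  qed
qed

text \<open>The coefficient of t^(-\<phi>) \<gamma>\<sigma>(v(r^-1(y))) - v(y) at distance
  \<open>j\<close> from y; at distance 0 it vanishes.\<close>

definition diff :: "((nat \<times> int) \<times> nat \<Rightarrow> 'a) \<Rightarrow> nat \<times> int \<Rightarrow> nat \<Rightarrow> 'a" where
  "diff x y j = alpha x (prev y) j ^ q - alpha x y j"

text \<open>\<open>eps x y j\<close> are the coefficients of the reduction of
  \<open>t\<^sup>-\<^sup>\<phi> \<gamma>\<sigma>(v(r\<^sup>-\<^sup>1(y))) - v(y)\<close> modulo the vectors \<open>v(a)\<close>; it belongs to the lattice if and only if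
  those at the indices outside \<open>A\<close> vanish.\<close>

function eps :: "((nat \<times> int) \<times> nat \<Rightarrow> 'a) \<Rightarrow> nat \<times> int \<Rightarrow> nat \<Rightarrow> 'a" where
  "eps x y j = diff x y j -
    (\<Sum>i\<in>{i. 1 \<le> i \<and> i < j \<and> shift y (int i) \<in> A}. eps x y i * alpha x (res (shift y (int i))) (j - i))"
  by auto
termination by (relation "measure (\<lambda>(x, y, j). j)") auto

declare eps.simps [simp del]

lemma tgs_prev_in_Lam_iff:
  assumes y: "y \<in> Y"
  shows "tgs (prev y) (vv x (prev y)) \<in> Lam x (fst y) \<longleftrightarrow> (\<forall>j. (y, j) \<in> W \<longrightarrow> eps x y j = 0)"
proof -
  have yA: "y \<in> Ab" "y \<in> A" "fst y < d" using Y_Ab[OF y] Ab_A Ab_fst by auto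
  have p: "prev y \<in> Ab" "\<rho> (prev y) = y" using prev[OF yA(1)] by auto
  let ?u = "tgs (prev y) (vv x (prev y))"
  let ?z = "?u - vv x y"
  note L = olattice_Lam[OF yA(3), of x]
  have vy: "vv x y \<in> Lam x (fst y)" using vv_in_Lam[OF yA(2)] .
  have pc: "vv x (prev y) \<in> carrier_vec n" "vv x y \<in> carrier_vec n" using vv(1) Ab_A p(1) yA(2) by auto
  have "?u \<in> Lam x (fst y) \<longleftrightarrow> ?z \<in> Lam x (fst y)"
  proof
    assume "?z \<in> Lam x (fst y)"
    then have "?z + vv x y \<in> Lam x (fst y)" using olatticeD(2)[OF L] vy by blast
    moreover have "?z + vv x y = ?u" using pc tgs_carrier[of "prev y" "vv x (prev y)"] by (intro eq_vecI) auto
    ultimately show "?u \<in> Lam x (fst y)" by simp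
  qed (use olattice_minus[OF L] vy in blast)
  also have "\<dots> \<longleftrightarrow> (\<forall>j\<ge>1. (fst y, snd y + int j) \<notin> A \<longrightarrow> eps x y j = 0)"
  proof (rule reduction[OF L leads_Lam[OF yA(3)], of "vv x"])
    show "vv x a \<in> Lam x (fst y) \<and> lead n (vv x a) (snd a) \<and> ecoeff n (vv x a) (snd a) = 1"
      if "a \<in> A" "fst a = fst y" for a
      using vv_in_Lam[OF that(1)] lead_vv ecoeff_vv_snd that by auto
    have ec: "ecoeff n ?z (snd y + int j) = diff x y j" for j
      using pc tgs_carrier[of "prev y" "vv x (prev y)"] p ecoeff_vv_Ab[OF p(1), of x j] ecoeff_vv_Ab[OF yA(1), of x j]
      by (simp add: ecoeff_minus[OF n] ecoeff_tgs diff_def add.commute)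
    have "low n ?u (snd y)" "low n (vv x y) (snd y)"
      using low_tgs[OF p(1), of "vv x (prev y)" 0] lead_vv[OF Ab_A[OF p(1)]] lead_vv[OF yA(2)] p by (auto simp: lead_def)
    then have "low n ?z (snd y)" by (rule low_minus[OF n])
    moreover have "ecoeff n ?z (snd y) = 0" using ec[of 0] by (simp add: diff_def)
    ultimately show "low n ?z (snd y + 1)" by (rule low_Suc[OF n])
    fix j :: nat assume "1 \<le> j"
    have "eps x y i * alpha x (res (shift y (int i))) (j - i) = eps x y i * ecoeff n (vv x (fst y, snd y + int i)) (snd y + int j)"
      if "i < j" "shift y (int i) \<in> A" for i
    proof -
      have "shift y (int i) = (fst y, snd y + int i)" by (simp add: shift_def)
      then show ?thesis using vv(2)[OF that(2), of x "snd y + int j"] that(1) by (simp add: nat_diff_distrib)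
    qed
    then have "(\<Sum>i\<in>{i. 1 \<le> i \<and> i < j \<and> shift y (int i) \<in> A}. eps x y i * alpha x (res (shift y (int i))) (j - i))
      = (\<Sum>i\<in>{i. 1 \<le> i \<and> i < j \<and> (fst y, snd y + int i) \<in> A}. eps x y i * ecoeff n (vv x (fst y, snd y + int i)) (snd y + int j))"
      by (intro sum.cong) (auto simp: shift_def)
    then show "ecoeff n ?z (snd y + int j) = eps x y j +
      (\<Sum>i\<in>{i. 1 \<le> i \<and> i < j \<and> (fst y, snd y + int i) \<in> A}. eps x y i * ecoeff n (vv x (fst y, snd y + int i)) (snd y + int j))"
      unfolding ec eps.simps[of x y j] by simp
  qed
  also have "\<dots> \<longleftrightarrow> (\<forall>j. (y, j) \<in> W \<longrightarrow> eps x y j = 0)"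
    using y by (auto simp: Wset_def shift_def)
  finally show ?thesis .
qed

text \<open>Outside \<open>Y\<close> the transported vector and v(b) differ by a combination of the
  v(b + j) with (b, j) in \<open>V\<close>.\<close>

lemma tgs_prev_in_lattice_iff:
  assumes b: "b \<in> Ab" "b \<notin> Y" and L: "olattice n \<Lambda>" and v: "\<And>j. (b, j) \<in> V \<Longrightarrow> vv x (shift b (int j)) \<in> \<Lambda>"
  shows "tgs (prev b) (vv x (prev b)) \<in> \<Lambda> \<longleftrightarrow> vv x b \<in> \<Lambda>"
proof -
  let ?S = "vec n (\<lambda>l. \<Sum>j\<in>{j. (b, j) \<in> V}. (fls_const (x (b, j)) \<cdot>\<^sub>v vv x (shift b (int j))) $ l)"
  have S: "?S \<in> \<Lambda>" using v olatticeD(3)[OF L integers_L_const]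
    by (intro olattice_vec_sum[OF n L finite_V_at]) auto
  have vc: "vv x (shift b (int j)) \<in> carrier_vec n" if "(b, j) \<in> V" for j
    using VD[OF that] vv(1) Ab_A by blast
  have "vv x b = tgs (prev b) (vv x (prev b)) + ?S"
  proof (rule vec_eq_if_ecoeff[OF n])
    show "vv x b \<in> carrier_vec n" "tgs (prev b) (vv x (prev b)) + ?S \<in> carrier_vec n"
      using vv(1)[OF Ab_A[OF b(1)]] tgs_carrier[of "prev b" "vv x (prev b)"] by auto
    fix i
    have "ecoeff n (vv x b) i = ecoeff n (phi_gamma_sigma q d n m A (vv x) (prev b)) i
          + (\<Sum>j | (b, j) \<in> V. x (b, j) * ecoeff n (vv x (shift b (int j))) i)"
      using is_vfamily_vv[unfolded is_vfamily_iff] b by blast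
    also have "(\<Sum>j | (b, j) \<in> V. x (b, j) * ecoeff n (vv x (shift b (int j))) i) = ecoeff n ?S i"
      unfolding ecoeff_vec_sum[OF n] using ecoeff_const_smult[OF n vc] by (intro sum.cong) auto
    finally show "ecoeff n (vv x b) i = ecoeff n (tgs (prev b) (vv x (prev b)) + ?S) i"
      using tgs_carrier[of "prev b" "vv x (prev b)"] by (simp add: ecoeff_add[OF n] phi_gamma_sigma_eq)
  qed
  note eq1 = this
  have "u = u + w - w" if "u \<in> carrier_vec n" "w \<in> carrier_vec n" for u w :: "'a fls vec"
    using that by (intro eq_vecI) auto
  from this[OF tgs_carrier vec_carrier] have eq2: "tgs (prev b) (vv x (prev b)) = vv x b - ?S"
    unfolding eq1 .
  show ?thesis
  proof
    assume "tgs (prev b) (vv x (prev b)) \<in> \<Lambda>"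
    then show "vv x b \<in> \<Lambda>" unfolding eq1 by (rule olatticeD(2)[OF L _ S])
  next
    assume "vv x b \<in> \<Lambda>"
    then show "tgs (prev b) (vv x (prev b)) \<in> \<Lambda>" unfolding eq2 by (rule olattice_minus[OF L _ S])
  qed
qed

text \<open>The conditions are reindexed by r(b) in place of b. Those outside \<open>Y\<close> then
  hold for every \<open>x\<close>, and those at points of \<open>Y\<close> are the equations with
  \<open>eps\<close>.\<close>

lemma stratum_coords_eq:
  "stratum_coords q d n m A \<iota> = {x \<in> affine_space D. \<forall>(y, j)\<in>W. eps x y j = (0 :: 'a)}"
proof -
  have "(\<forall>b\<in>Ab. tgs b (vv x b) \<in> Lam x (fst (\<rho> b))) \<longleftrightarrow> (\<forall>(y, j)\<in>W. eps x y j = 0)" for x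
  proof -
    have "(\<forall>b\<in>Ab. tgs b (vv x b) \<in> Lam x (fst (\<rho> b))) \<longleftrightarrow> (\<forall>b\<in>Ab. tgs (prev b) (vv x (prev b)) \<in> Lam x (fst b))"
    proof (intro iffI ballI)
      fix b assume "\<forall>b\<in>Ab. tgs b (vv x b) \<in> Lam x (fst (\<rho> b))" "b \<in> Ab"
      then show "tgs (prev b) (vv x (prev b)) \<in> Lam x (fst b)" using prev[of b] by metis
    next
      fix b assume "\<forall>b\<in>Ab. tgs (prev b) (vv x (prev b)) \<in> Lam x (fst b)" "b \<in> Ab"
      moreover have "prev (\<rho> b) = b" using \<open>b \<in> Ab\<close> inj_rr by (simp add: prev_def)
      ultimately show "tgs b (vv x b) \<in> Lam x (fst (\<rho> b))" using rr_in_Ab[of b] by metis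
    qed
    also have "\<dots> \<longleftrightarrow> (\<forall>y\<in>Y. tgs (prev y) (vv x (prev y)) \<in> Lam x (fst y))"
    proof (intro iffI ballI)
      fix b assume Y: "\<forall>y\<in>Y. tgs (prev y) (vv x (prev y)) \<in> Lam x (fst y)" and b: "b \<in> Ab"
      show "tgs (prev b) (vv x (prev b)) \<in> Lam x (fst b)"
      proof (cases "b \<in> Y")
        case False
        have "vv x (shift b (int j)) \<in> Lam x (fst b)" if "(b, j) \<in> V" for j
          using vv_in_Lam[OF Ab_A, of "shift b (int j)" x] VD[OF that] by simp
        then show ?thesis
          using tgs_prev_in_lattice_iff[OF b False olattice_Lam[OF Ab_fst[OF b]]] vv_in_Lam[OF Ab_A[OF b]] by blast
      qed (use Y in blast)
    qed (use Y_Ab in blast)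
    also have "\<dots> \<longleftrightarrow> (\<forall>y\<in>Y. \<forall>j. (y, j) \<in> W \<longrightarrow> eps x y j = 0)"
      by (intro ball_cong refl tgs_prev_in_Lam_iff)
    also have "\<dots> \<longleftrightarrow> (\<forall>(y, j)\<in>W. eps x y j = 0)"
    proof (intro iffI ballI allI impI)
      fix p assume *: "\<forall>y\<in>Y. \<forall>j. (y, j) \<in> W \<longrightarrow> eps x y j = 0" and "p \<in> W"
      then show "case p of (y, j) \<Rightarrow> eps x y j = 0" using WD[of "fst p" "snd p"] by (cases p) simp
    qed auto
    finally show ?thesis .
  qed
  then show ?thesis by (auto simp: stratum_coords_iff)
qed

text \<open>Here the orbit closes up. \<open>prev y\<close> lies on the orbit of y, so its
  coefficient at distance \<open>j\<close> contains \<open>x (y, j)\<close> to a power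
  \<open>q ^ e\<close>, and \<gamma>\<sigma> applies one more Frobenius before v(y) with its own
  \<open>x (y, j)\<close> is subtracted. The exponent \<open>Suc e\<close> makes the power different
  from 1.\<close>

lemma eps_structure:
  assumes y: "y \<in> Y"
  shows "\<exists>e. \<exists>P\<in>polyfun (earlier j). \<forall>x. eps x y j = (if (y, j) \<in> W then x (y, j) ^ (q ^ Suc e) - x (y, j) else 0) + P x"
proof (induction j rule: less_induct)
  case (less j)
  have yA: "y \<in> Ab" using Y_Ab[OF y] .
  have p: "prev y \<in> Ab" "root (prev y) = y" using prev[OF yA] root_prev[OF yA] root_Y[OF y] by auto
  obtain e P where P: "P \<in> polyfun (earlier j)"
    "\<And>x. alpha x (prev y) j = (if (y, j) \<in> W then x (y, j) ^ (q ^ e) else 0) + P x"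
    using alpha_structure[OF p(1)] unfolding p(2) by blast
  define P1 where "P1 x = rest x y j + (if (y, j) \<in> V then x (y, j) else 0)" for x
  have "(\<lambda>x. \<Sum>i\<in>{i. (y, i) \<in> V \<and> i < j}. x (y, i) * alpha x (shift y (int i)) (j - i)) \<in> polyfun (earlier j)"
    using VD alpha_poly by (intro rest_alpha_poly_aux[OF yA]) blast
  then have P1: "P1 \<in> polyfun (earlier j)"
    unfolding P1_def rest_def using y
    by (cases "(y, j) \<in> V"; cases "j = 0") (auto intro!: polyfun.add polyfun.const polyfun.var)
  have alpha: "alpha x y j = (if (y, j) \<in> W then x (y, j) else 0) + P1 x" for x
    using VW_disjoint by (auto simp: alpha_rest[OF yA] P1_def D_eq)
  define P2 where "P2 x = P x ^ q - P1 x - (\<Sum>i\<in>{i. 1 \<le> i \<and> i < j \<and> shift y (int i) \<in> A}.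
    eps x y i * alpha x (res (shift y (int i))) (j - i))" for x
  have "P2 \<in> polyfun (earlier j)"
    unfolding P2_def
  proof (intro polyfun_diff polyfun_power P(1) P1 polyfun_sum polyfun.mult)
    fix i assume "i \<in> {i. 1 \<le> i \<and> i < j \<and> shift y (int i) \<in> A}"
    then have i: "1 \<le> i" "i < j" "shift y (int i) \<in> A" by auto
    obtain e' P' where P': "P' \<in> polyfun (earlier i)"
      "\<And>x. eps x y i = (if (y, i) \<in> W then x (y, i) ^ (q ^ Suc e') - x (y, i) else 0) + P' x"
      using less[OF i(2)] by blast
    have "P' \<in> polyfun (earlier j)" by (rule polyfun_mono[OF P'(1)]) (use i in auto)
    moreover have "(\<lambda>x. if (y, i) \<in> W then x (y, i) ^ (q ^ Suc e') - x (y, i) else 0) \<in> polyfun (earlier j)"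
      using i(2) by (cases "(y, i) \<in> W") (auto intro!: polyfun_diff polyfun_power polyfun.var polyfun.const)
    ultimately show "(\<lambda>x. eps x y i) \<in> polyfun (earlier j)" unfolding P'(2) by (rule polyfun.add[rotated])
    have "res (shift y (int i)) \<in> Ab" using res_in_Ab A_fst[OF i(3)] by blast
    from alpha_poly[OF this] show "(\<lambda>x. alpha x (res (shift y (int i))) (j - i)) \<in> polyfun (earlier j)"
      by (rule polyfun_mono) (use i in auto)
  qed
  moreover have "eps x y j = (if (y, j) \<in> W then x (y, j) ^ (q ^ Suc e) - x (y, j) else 0) + P2 x" for x
    unfolding eps.simps[of x y j] diff_def alpha P(2) P2_def
    by (simp add: add_power_q power_mult[symmetric] mult.commute)
  ultimately show ?case by blast
qed

end

section \<open>Strata and semi-modules of lattices\<close>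

context strata
begin

lemma tgs_add: "b \<in> Ab \<Longrightarrow> u \<in> carrier_vec n \<Longrightarrow> w \<in> carrier_vec n \<Longrightarrow> tgs b (u + w) = tgs b u + tgs b w"
  using gs_carrier[of "fst b" u] gs_carrier[of "fst b" w]
  by (simp add: tgs_def gs_add Ab_fst smult_add_distrib_vec)

lemma tgs_smult: "w \<in> carrier_vec n \<Longrightarrow> tgs b (f \<cdot>\<^sub>v w) = frob q f \<cdot>\<^sub>v tgs b w"
  by (simp add: tgs_def gs_smult smult_smult_assoc mult.commute)

lemma tgs_minus: 
  assumes "b \<in> Ab" "u \<in> carrier_vec n" "w \<in> carrier_vec n" 
  shows "tgs b (u - w) = tgs b u - tgs b w"
proof -
  have "u - w + w = u" using assms(2,3) by (intro eq_vecI) auto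
  then have "tgs b u = tgs b (u - w) + tgs b w"
    using tgs_add[OF assms(1), of "u - w" w] assms(2,3) by simp
  then show ?thesis using tgs_carrier[of b "u - w"] tgs_carrier[of b w] by auto
qed

lemma fst_rr_pred: "b \<in> Ab \<Longrightarrow> fst (\<rho> b) = pred_d (fst b)"
  by (simp add: fst_rr ff_eq Ab_fst)

lemma ecoeff_vv_cong:
  assumes b: "b \<in> Ab" and i: "i < snd b + int J" and eq: "\<And>j. j < J \<Longrightarrow> alpha x b j = alpha y b j"
  shows "ecoeff n (vv x b) i = ecoeff n (vv y b) i"
proof (cases "i < snd b")
  case True
  then show ?thesis using vv(2)[OF Ab_A[OF b]] by simp
next
  case False
  then have "nat (i - snd b) < J" using i by linarith
  then show ?thesis using eq False by (simp add: vv(2)[OF Ab_A[OF b]] res_Ab[OF b])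
qed

text \<open>At the first coordinate (b, J) where the points differ, the two vectors v(b) first
  differ at distance \<open>J\<close>. So b + J is a leading index, hence in \<open>A\<close>, and
  (b, J) is in \<open>V\<close>. Transporting the difference puts r(b) + J into \<open>A\<close> as
  well; but this is r(b + J) lowered by a positive multiple of \<open>n\<close>, because \<phi>
  drops from b to b + J.\<close>

lemma inj_on_Lambda: "inj_on Lam (stratum_coords q d n m A \<iota>)"
proof (rule inj_onI)
  fix x y :: "(nat \<times> int) \<times> nat \<Rightarrow> 'a"
  assume x: "x \<in> stratum_coords q d n m A \<iota>" and y: "y \<in> stratum_coords q d n m A \<iota>" and eq: "Lam x = Lam y"
  have "\<forall>b. b \<in> Ab \<longrightarrow> dep b = s \<longrightarrow> (b, J) \<in> D \<longrightarrow> x (b, J) = y (b, J)" for J s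
  proof (induction J arbitrary: s rule: less_induct)
    case (less J)
    note IHJ = this
    show ?case
    proof (induction s rule: less_induct)
      case (less s)
      show ?case
      proof (intro allI impI, rule ccontr)
        fix b assume b: "b \<in> Ab" "dep b = s" "(b, J) \<in> D" and ne: "x (b, J) \<noteq> y (b, J)"
        have D: "b' \<in> Ab" if "(b', j') \<in> D" for b' j'
          using that VD WD unfolding D_eq by blast
        have e: "x (b', j') = y (b', j')" if "(b', j') \<in> D" "j' < J \<or> j' = J \<and> dep b' < dep b" for b' j'
          using that D[OF that(1)] IHJ[of j' "dep b'"] less[of "dep b'"] b(2) by blast
        have alpha_eq: "alpha x b j = alpha y b j" if "j < J" for j
          using that by (intro alpha_cong[OF b(1)] e) auto
        have "rest x b J = rest y b J" by (rule rest_cong[OF b(1)]) (rule e)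
        then have alpha_ne: "alpha x b J \<noteq> alpha y b J"
          using ne b(3) by (simp add: alpha_rest[OF b(1)])
        let ?z = "vv x b - vv y b"
        have c: "vv x b \<in> carrier_vec n" "vv y b \<in> carrier_vec n" using vv(1)[OF Ab_A[OF b(1)]] by auto
        have lead: "lead n ?z (snd b + int J)"
          using c ecoeff_vv_cong[OF b(1) _ alpha_eq] alpha_ne
          by (auto simp: lead_def low_def ecoeff_minus[OF n] ecoeff_vv_Ab[OF b(1)])
        have "?z \<in> Lam x (fst b)"
          using olattice_minus[OF olattice_Lam[OF Ab_fst[OF b(1)]]] vv_in_Lam[OF Ab_A[OF b(1)]] eq by metis
        then have "(fst b, snd b + int J) \<in> A"
          using lead leads_Lam[OF Ab_fst[OF b(1)], of x] by (auto simp: leads_def)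
        then have "shift b (int J) \<in> A" by (simp add: shift_def)
        then have V: "(b, J) \<in> V" using b(3) WD unfolding D_eq by blast
        have \<rho>d: "fst (\<rho> b) < d" using Ab_fst[OF rr_in_Ab] .
        have "tgs b ?z \<in> Lam x (fst (\<rho> b))"
          unfolding tgs_minus[OF b(1) c]
          using olattice_minus[OF olattice_Lam[OF \<rho>d]] x y b(1) eq by (metis stratum_coords_iff)
        moreover have "lead n (tgs b ?z) (snd (\<rho> b) + int J)" by (rule lead_tgs[OF b(1) lead])
        ultimately have "(fst (\<rho> b), snd (\<rho> b) + int J) \<in> A"
          using leads_Lam[OF \<rho>d, of x] by (auto simp: leads_def)
        moreover define b1 where "b1 = shift b (int J)"
        have b1: "b1 \<in> Ab" "\<phi> b1 < \<phi> b" using VD[OF V] by (auto simp: b1_def)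
        have "(fst (\<rho> b), snd (\<rho> b) + int J) = shift (\<rho> b1) (int n * (\<phi> b1 - \<phi> b))"
          using fst_rr_pred[OF b(1)] fst_rr_pred[OF b1(1)] snd_rr[OF b(1)] snd_rr[OF b1(1)]
          by (simp add: shift_def b1_def algebra_simps)
        ultimately have "shift (\<rho> b1) (int n * (\<phi> b1 - \<phi> b)) \<in> A" by simp
        moreover have "nu (shift (\<rho> b1) (int n * (\<phi> b1 - \<phi> b))) = \<phi> b1 - \<phi> b"
          using rr_in_Ab[of b1] Ab_fst[OF rr_in_Ab[of b1]] by (intro nu_eqI) (auto simp: shift_def)
        ultimately show False
          using b1(2) Ab_fst[OF rr_in_Ab[of b1]] in_A_iff[of "shift (\<rho> b1) (int n * (\<phi> b1 - \<phi> b))"] by simp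
      qed
    qed
  qed
  then have "x w = y w" if "w \<in> D" for w
    using that VD[of "fst w" "snd w"] WD[of "fst w" "snd w"] unfolding D_eq by (cases w) auto
  moreover have "x w = y w" if "w \<notin> D" for w
  proof -
    have "x \<in> affine_space D" "y \<in> affine_space D" using x y by (simp_all only: stratum_coords_iff)
    then have "x w = 0" "y w = 0" using that unfolding affine_space_def by blast+
    then show ?thesis by simp
  qed
  ultimately show "x = y" by blast
qed

end

text \<open>A lattice with semi-module \<open>A\<close> whose coordinates are to be found.
  \<open>adapted\<close> makes every b the leading index of an element whose transport stays in the
  lattice, and \<open>phi_le\<close> is the trace of minusculity.\<close>

locale strata_lattice = strata q K d n m A \<iota>
  for q and K :: "'k::alg_closed_field itself" and d n m A \<iota> +
  fixes \<Lambda> :: "nat \<Rightarrow> 'k fls vec set"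
  assumes lattice: "\<And>\<tau>. \<tau> < d \<Longrightarrow> olattice n (\<Lambda> \<tau>)"
    and leads_lattice: "\<And>\<tau>. \<tau> < d \<Longrightarrow> leads n (\<Lambda> \<tau>) = {i. (\<tau>, i) \<in> A}"
    and adapted: "\<And>b. b \<in> Ab \<Longrightarrow> \<exists>w\<in>\<Lambda> (fst b). lead n w (snd b) \<and> tgs b w \<in> \<Lambda> (fst (\<rho> b))"
    and phi_le: "\<And>b b'. b \<in> Ab \<Longrightarrow> b' \<in> Ab \<Longrightarrow> fst b = fst b' \<Longrightarrow> \<phi> b \<le> \<phi> b' + 1"
begin

text \<open>The candidates for v(b): belonging to \<open>Lp b\<close> is what the stratum demands of
  v(b), with the given lattice in place of \<Lambda>(x).\<close>

definition Lp :: "nat \<times> int \<Rightarrow> 'k fls vec set" where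
  "Lp b = {w \<in> \<Lambda> (fst b). tgs b w \<in> \<Lambda> (fst (\<rho> b))}"

lemma lattice_b: "b \<in> Ab \<Longrightarrow> olattice n (\<Lambda> (fst b))"
  using lattice Ab_fst by blast

lemma Lp_carrier: "b \<in> Ab \<Longrightarrow> w \<in> Lp b \<Longrightarrow> w \<in> carrier_vec n"
  using olatticeD(1)[OF lattice_b] by (auto simp: Lp_def)

lemma Lp_minus: "b \<in> Ab \<Longrightarrow> u \<in> Lp b \<Longrightarrow> w \<in> Lp b \<Longrightarrow> u - w \<in> Lp b"
  using Lp_carrier olattice_minus[OF lattice_b] olattice_minus[OF lattice_b[OF rr_in_Ab]]
  by (auto simp: Lp_def tgs_minus)

lemma Lp_smult: "b \<in> Ab \<Longrightarrow> w \<in> Lp b \<Longrightarrow> f \<in> integers_L \<Longrightarrow> f \<cdot>\<^sub>v w \<in> Lp b"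
  using Lp_carrier olatticeD(3)[OF lattice_b] olatticeD(3)[OF lattice_b[OF rr_in_Ab]] frob_integral
  by (auto simp: Lp_def tgs_smult)

lemma Lp_low: "b \<in> Ab \<Longrightarrow> \<exists>C. \<forall>w. low n w C \<longrightarrow> w \<in> Lp b"
proof -
  assume b: "b \<in> Ab"
  obtain C1 where C1: "\<And>w. low n w C1 \<Longrightarrow> w \<in> \<Lambda> (fst b)" using olatticeD(4)[OF lattice_b[OF b]] by blast
  obtain C2 where C2: "\<And>w. low n w C2 \<Longrightarrow> w \<in> \<Lambda> (fst (\<rho> b))"
    using olatticeD(4)[OF lattice_b[OF rr_in_Ab]] by blast
  have "w \<in> Lp b" if w: "low n w (max C1 (snd b + (C2 - snd (\<rho> b))))" for w
  proof -
    have "low n (tgs b w) (snd (\<rho> b) + (C2 - snd (\<rho> b)))"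
      by (intro low_tgs[OF b] low_mono[OF n w]) simp
    then show ?thesis using C1[OF low_mono[OF n w]] C2 by (simp add: Lp_def)
  qed
  then show ?thesis by blast
qed

text \<open>Write b + j as \<open>b1\<close> moved up by \<open>n * k\<close> and take t^k w with
  \<open>w\<close> adapted to \<open>b1\<close>. Its transport stays in the lattice if
  \<open>k + \<phi> b1 - \<phi> b\<close> is nonnegative. For \<open>k = 0\<close> this is the
  assumption \<open>(b, j) \<notin> V\<close>; for \<open>k > 0\<close> it holds because \<phi>
  varies by at most 1 on a component.\<close>

lemma Lp_lead:
  assumes b: "b \<in> Ab" and a: "shift b (int j) \<in> A" and nV: "(b, j) \<notin> V" and j: "1 \<le> j"
  shows "\<exists>u\<in>Lp b. lead n u (snd b + int j)"
proof -
  let ?a = "shift b (int j)"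
  define b1 k where "b1 = res ?a" and "k = nu ?a"
  have ad: "fst ?a < d" using A_fst[OF a] .
  have b1: "b1 \<in> Ab" "fst b1 = fst b" using res_in_Ab[OF ad] by (auto simp: b1_def)
  have k: "0 \<le> k" using in_A_iff[OF ad] a by (simp add: k_def)
  obtain w where w: "w \<in> \<Lambda> (fst b)" "lead n w (snd b1)" "tgs b1 w \<in> \<Lambda> (fst (\<rho> b1))"
    using adapted[OF b1(1)] b1(2) by auto
  have wc: "w \<in> carrier_vec n" using w(2) by (rule lead_carrier[OF n])
  have "0 \<le> k + \<phi> b1 - \<phi> b"
  proof (cases "k = 0")
    case True
    then have "b1 = ?a" by (simp add: b1_def res_def k_def shift_def)
    then have "\<not> \<phi> b1 < \<phi> b" using nV b b1 j by (simp add: Vset_def)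
    then show ?thesis using True by simp
  next
    case False
    then show ?thesis using k phi_le[OF b b1(1)] b1(2) by simp
  qed
  then have "fls_X_intpow (k + \<phi> b1 - \<phi> b) \<cdot>\<^sub>v tgs b1 w \<in> \<Lambda> (fst (\<rho> b))"
    using olatticeD(3)[OF lattice_b[OF rr_in_Ab[of b1]] integers_L_X_intpow w(3)]
    unfolding fst_rr_pred[OF b] fst_rr_pred[OF b1(1)] b1(2) by blast
  moreover have "tgs b (fls_X_intpow k \<cdot>\<^sub>v w) = fls_X_intpow (k + \<phi> b1 - \<phi> b) \<cdot>\<^sub>v tgs b1 w"
    by (simp only: tgs_def gs_smult[OF wc] frob_X_intpow smult_smult_assoc fls_X_intpow_times_fls_X_intpow b1(2))
       (simp add: algebra_simps)
  moreover have "fls_X_intpow k \<cdot>\<^sub>v w \<in> \<Lambda> (fst b)"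
    using olatticeD(3)[OF lattice_b[OF b] integers_L_X_intpow[OF k] w(1)] .
  ultimately have "fls_X_intpow k \<cdot>\<^sub>v w \<in> Lp b" by (simp add: Lp_def)
  moreover have "lead n (fls_X_intpow k \<cdot>\<^sub>v w) (snd b + int j)"
    using lead_smult[OF n w(2), of "fls_X_intpow k"] snd_res[of ?a] by (simp add: b1_def k_def)
  ultimately show ?thesis by blast
qed

text \<open>Approximate membership of v(b) in \<open>Lp b\<close>. For large \<open>J\<close> it
  becomes membership, as \<open>Lp b\<close> contains a step of the filtration.\<close>

definition close :: "((nat \<times> int) \<times> nat \<Rightarrow> 'k) \<Rightarrow> nat \<times> int \<Rightarrow> nat \<Rightarrow> bool" where
  "close x b J \<longleftrightarrow> (\<exists>w\<in>Lp b. \<forall>i < snd b + int J. ecoeff n w i = ecoeff n (vv x b) i)"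

lemma close_0: "b \<in> Ab \<Longrightarrow> close x b 1"
proof -
  assume b: "b \<in> Ab"
  obtain w where w: "w \<in> Lp b" "lead n w (snd b)" using adapted[OF b] by (auto simp: Lp_def)
  define c where "c = inverse (ecoeff n w (snd b))"
  have wc: "w \<in> carrier_vec n" using Lp_carrier[OF b w(1)] .
  have "fls_const c \<cdot>\<^sub>v w \<in> Lp b" using Lp_smult[OF b w(1) integers_L_const] .
  moreover have "ecoeff n (fls_const c \<cdot>\<^sub>v w) i = ecoeff n (vv x b) i" if "i < snd b + 1" for i
  proof (cases "i = snd b")
    case True
    then show ?thesis using w(2) ecoeff_vv_snd[OF Ab_A[OF b]] wc
      by (simp add: ecoeff_const_smult[OF n] c_def lead_def)
  next
    case False
    then have "i < snd b" using that by simp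
    then show ?thesis using w(2) lead_vv[OF Ab_A[OF b], of x] wc
      by (simp add: ecoeff_const_smult[OF n] lead_def low_def)
  qed
  ultimately show ?thesis by (auto simp: close_def)
qed

text \<open>Where no coordinate is free the approximation improves by itself. If b + J is in
  \<open>A\<close>, an element from \<open>Lp_lead\<close> corrects the coefficient. Otherwise b is
  outside \<open>Y\<close>, and the approximants for \<open>prev b\<close> and for the b + i combine
  to a lattice vector \<open>z\<close> that agrees with v(b) one step further; a discrepancy between
  \<open>w\<close> and \<open>z\<close> would produce a leading index outside
  \<open>A\<close>.\<close>

lemma close_next:
  assumes b: "b \<in> Ab" and J: "1 \<le> J" and cl: "close x b J" and D: "(b, J) \<notin> D"
    and clp: "b \<notin> Y \<Longrightarrow> close x (prev b) (Suc J)"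
    and clV: "\<And>i. (b, i) \<in> V \<Longrightarrow> i < J \<Longrightarrow> close x (shift b (int i)) (Suc (J - i))"
  shows "close x b (Suc J)"
proof -
  obtain w where w: "w \<in> Lp b" "\<And>i. i < snd b + int J \<Longrightarrow> ecoeff n w i = ecoeff n (vv x b) i"
    using cl by (auto simp: close_def)
  have wc: "w \<in> carrier_vec n" using Lp_carrier[OF b w(1)] .
  define \<delta> where "\<delta> = ecoeff n w (snd b + int J) - ecoeff n (vv x b) (snd b + int J)"
  show ?thesis
  proof (cases "shift b (int J) \<in> A")
    case True
    obtain u where u: "u \<in> Lp b" "lead n u (snd b + int J)"
      using Lp_lead[OF b True _ J] D by (auto simp: D_eq)
    define c where "c = \<delta> / ecoeff n u (snd b + int J)"
    have uc: "u \<in> carrier_vec n" using Lp_carrier[OF b u(1)] .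
    let ?w = "w - fls_const c \<cdot>\<^sub>v u"
    have "?w \<in> Lp b" using Lp_minus[OF b w(1) Lp_smult[OF b u(1) integers_L_const]] .
    moreover have ec: "ecoeff n ?w i = ecoeff n w i - c * ecoeff n u i" for i
      using wc uc by (simp add: ecoeff_minus[OF n] ecoeff_const_smult[OF n])
    have "ecoeff n ?w i = ecoeff n (vv x b) i" if "i < snd b + int (Suc J)" for i
    proof (cases "i = snd b + int J")
      case True
      then show ?thesis using u(2) unfolding ec by (simp add: c_def lead_def \<delta>_def)
    next
      case False
      then have "i < snd b + int J" using that by simp
      then show ?thesis using u(2) w(2) unfolding ec by (simp add: lead_def low_def)
    qed
    ultimately show ?thesis unfolding close_def by blast
  next
    case False
    then have bY: "b \<notin> Y" using D J by (auto simp: D_eq Wset_def)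
    have p: "prev b \<in> Ab" "\<rho> (prev b) = b" using prev[OF b] by auto
    obtain w1 where w1: "w1 \<in> Lp (prev b)" "\<And>i. i < snd (prev b) + int (Suc J) \<Longrightarrow> ecoeff n w1 i = ecoeff n (vv x (prev b)) i"
      using clp[OF bY] by (auto simp: close_def)
    define I where "I = {i. (b, i) \<in> V \<and> i < J}"
    have I: "finite I" by (simp add: I_def)
    have "\<forall>i\<in>I. \<exists>u. u \<in> Lp (shift b (int i)) \<and>
        (\<forall>k < snd b + int (Suc J). ecoeff n u k = ecoeff n (vv x (shift b (int i))) k)"
    proof
      fix i assume i: "i \<in> I"
      then have "snd (shift b (int i)) + int (Suc (J - i)) = snd b + int (Suc J)" by (simp add: I_def)
      then show "\<exists>u. u \<in> Lp (shift b (int i)) \<and>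
          (\<forall>k < snd b + int (Suc J). ecoeff n u k = ecoeff n (vv x (shift b (int i))) k)"
        using clV[of i] i unfolding close_def I_def by auto
    qed
    from bchoice[OF this] obtain u where u: "\<And>i. i \<in> I \<Longrightarrow> u i \<in> Lp (shift b (int i))"
      "\<And>i k. i \<in> I \<Longrightarrow> k < snd b + int (Suc J) \<Longrightarrow> ecoeff n (u i) k = ecoeff n (vv x (shift b (int i))) k"
      by blast
    have bi: "shift b (int i) \<in> Ab" if "i \<in> I" for i using VD that by (auto simp: I_def)
    have uL: "u i \<in> \<Lambda> (fst b)" "u i \<in> carrier_vec n" if "i \<in> I" for i
      using u(1)[OF that] Lp_carrier[OF bi[OF that] u(1)[OF that]] by (auto simp: Lp_def)
    let ?S = "vec n (\<lambda>l. \<Sum>i\<in>I. (fls_const (x (b, i)) \<cdot>\<^sub>v u i) $ l)"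
    define z where "z = tgs (prev b) w1 + ?S"
    have SL: "?S \<in> \<Lambda> (fst b)"
      using uL olatticeD(3)[OF lattice_b[OF b] integers_L_const] by (intro olattice_vec_sum[OF n lattice_b[OF b] I]) auto
    have "tgs (prev b) w1 \<in> \<Lambda> (fst b)" using w1(1) p by (simp add: Lp_def)
    then have zL: "z \<in> \<Lambda> (fst b)" unfolding z_def using SL olatticeD(2)[OF lattice_b[OF b]] by blast
    have zeq: "ecoeff n z k = ecoeff n (vv x b) k" if k: "k < snd b + int (Suc J)" for k
    proof -
      have "ecoeff n (tgs (prev b) w1) k = ecoeff n (phi_gamma_sigma q d n m A (vv x) (prev b)) k"
        using k w1(2)[of "k - snd b + snd (prev b)"] Lp_carrier[OF p(1) w1(1)] p vv(1)[OF Ab_A[OF p(1)]]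
        by (simp add: phi_gamma_sigma_eq ecoeff_tgs)
      moreover have "ecoeff n ?S k = (\<Sum>i\<in>I. x (b, i) * ecoeff n (vv x (shift b (int i))) k)"
        unfolding ecoeff_vec_sum[OF n] using uL u(2) k by (intro sum.cong) (auto simp: ecoeff_const_smult[OF n])
      moreover have "(\<Sum>i\<in>I. x (b, i) * ecoeff n (vv x (shift b (int i))) k)
          = (\<Sum>i | (b, i) \<in> V. x (b, i) * ecoeff n (vv x (shift b (int i))) k)"
      proof (rule sum.mono_neutral_left[OF finite_V_at])
        show "\<forall>i\<in>{i. (b, i) \<in> V} - I. x (b, i) * ecoeff n (vv x (shift b (int i))) k = 0"
        proof
          fix i assume i: "i \<in> {i. (b, i) \<in> V} - I"
          then have iV: "(b, i) \<in> V" "J \<noteq> i" "J \<le> i" using D by (auto simp: I_def D_eq not_less)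
          then have "k < snd (shift b (int i))" using k by simp
          moreover have "shift b (int i) \<in> A" using VD[OF iV(1)] Ab_A by blast
          ultimately show "x (b, i) * ecoeff n (vv x (shift b (int i))) k = 0" by (simp add: vv(2))
        qed
      qed (auto simp: I_def)
      moreover have "ecoeff n (vv x b) k = ecoeff n (phi_gamma_sigma q d n m A (vv x) (prev b)) k
          + (\<Sum>i | (b, i) \<in> V. x (b, i) * ecoeff n (vv x (shift b (int i))) k)"
        using is_vfamily_vv[unfolded is_vfamily_iff] b bY by blast
      ultimately show ?thesis using tgs_carrier by (simp add: z_def ecoeff_add[OF n])
    qed
    have zc: "z \<in> carrier_vec n" using olatticeD(1)[OF lattice_b[OF b] zL] .
    have "\<delta> = 0"
    proof (rule ccontr)
      assume "\<delta> \<noteq> 0"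
      then have "lead n (w - z) (snd b + int J)"
        using wc zc zeq w(2) by (auto simp: lead_def low_def ecoeff_minus[OF n] \<delta>_def)
      moreover have "w - z \<in> \<Lambda> (fst b)" using olattice_minus[OF lattice_b[OF b] _ zL] w(1) by (simp add: Lp_def)
      ultimately have "(fst b, snd b + int J) \<in> A"
        using leads_lattice[OF Ab_fst[OF b]] by (auto simp: leads_def)
      then show False using False by (simp add: shift_def)
    qed
    then have "ecoeff n w i = ecoeff n (vv x b) i" if "i < snd b + int (Suc J)" for i
      using w(2)[of i] that by (cases "i = snd b + int J") (auto simp: \<delta>_def)
    then show ?thesis using w(1) unfolding close_def by blast
  qed
qed

lemma close_cong:
  assumes "b \<in> Ab" "close x b J" "\<And>j. j < J \<Longrightarrow> alpha x b j = alpha y b j"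
  shows "close y b J"
  using assms(2) ecoeff_vv_cong[OF assms(1) _ assms(3)] unfolding close_def by simp

text \<open>The pairs \<open>(J, dep b)\<close> are run through in lexicographic order, encoded as
  the number \<open>J * S + dep b\<close>. At each of them the coordinates (b, J) in
  \<open>D\<close> are chosen so that v(b) follows its approximant, and the other b are covered by
  \<open>close_next\<close>.\<close>

lemma ex_close: 
  assumes S: "\<And>b. b \<in> Ab \<Longrightarrow> dep b < S"
  shows "\<exists>x. \<forall>b\<in>Ab. \<forall>J. J * S + dep b < t \<longrightarrow> close x b (Suc J)"
proof (induction t)
  case 0
  then show ?case by simp
next
  case (Suc t)
  obtain x where x: "\<And>b J. b \<in> Ab \<Longrightarrow> J * S + dep b < t \<Longrightarrow> close x b (Suc J)" using Suc by blast
  show ?case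
  proof (cases "S = 0")
    case True
    then have "Ab = {}" using S by auto
    then show ?thesis by simp
  next
    case S0: False
    define J0 s0 where "J0 = t div S" and "s0 = t mod S"
    have t: "t = J0 * S + s0" "s0 < S" using S0 by (auto simp: J0_def s0_def)
    have lex: "J * S + r < t \<longleftrightarrow> J < J0 \<or> J = J0 \<and> r < s0" if "r < S" for J r
    proof -
      consider "J < J0" | "J = J0" | "J0 < J" by linarith
      then show ?thesis
      proof cases
        case 1
        then have "Suc J * S \<le> J0 * S" by (intro mult_right_mono) auto
        then show ?thesis using 1 that t by simp
      next
        case 3
        then have "Suc J0 * S \<le> J * S" by (intro mult_right_mono) auto
        then show ?thesis using 3 that t by simp
      qed (use t in simp)
    qed
    have ex_w: "close x b J0" if "b \<in> Ab" "dep b = s0" "1 \<le> J0" for b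
    proof -
      have "(J0 - 1) * S + dep b < t" using lex[OF S[OF that(1)], of "J0 - 1"] that(3) by simp
      then show ?thesis using x[OF that(1)] that(3) by fastforce
    qed
    define W' where "W' b = (SOME w. w \<in> Lp b \<and> (\<forall>i < snd b + int J0. ecoeff n w i = ecoeff n (vv x b) i))" for b
    have W': "W' b \<in> Lp b" "\<And>i. i < snd b + int J0 \<Longrightarrow> ecoeff n (W' b) i = ecoeff n (vv x b) i"
      if "b \<in> Ab" "dep b = s0" "1 \<le> J0" for b
      using someI_ex[of "\<lambda>w. w \<in> Lp b \<and> (\<forall>i < snd b + int J0. ecoeff n w i = ecoeff n (vv x b) i)"]
        ex_w[OF that] unfolding W'_def close_def by blast+
    \<comment> \<open>For (b, J0) in \<open>D\<close> the coefficient \<open>alpha\<close> is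
      \<open>rest\<close> plus this coordinate, and \<open>rest\<close> is already fixed, so the
      coefficient of the approximant \<open>W' b\<close> can be hit exactly.\<close>
    define x' where "x' p = (case p of (b, j) \<Rightarrow>
      if j = J0 \<and> b \<in> Ab \<and> dep b = s0 then ecoeff n (W' b) (snd b + int J0) - rest x b J0 else x (b, j))" for p
    have x': "x' (b, j) = x (b, j)" if "j < J0 \<or> j = J0 \<and> dep b < s0" for b j
      using that by (auto simp: x'_def)
    have alpha': "alpha x b j = alpha x' b j" if "b \<in> Ab" "j < J0 \<or> j = J0 \<and> dep b < s0" for b j
      using that by (intro alpha_cong x'[symmetric]) auto
    have old: "close x' b (Suc J)" if b: "b \<in> Ab" "J * S + dep b < t" for b J
    proof (rule close_cong[OF b(1) x[OF b]])
      fix j assume "j < Suc J"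
      then show "alpha x b j = alpha x' b j" using lex[OF S[OF b(1)], of J] b by (intro alpha') auto
    qed
    have "close x' b (Suc J)" if b: "b \<in> Ab" "J * S + dep b < Suc t" for b J
    proof (cases "J * S + dep b = t")
      case False
      then show ?thesis using old b by simp
    next
      case True
      then have Js: "J = J0" "dep b = s0"
        unfolding J0_def s0_def True[symmetric] using S[OF b(1)] by simp_all
      show ?thesis
      proof (cases "J0 = 0")
        case True
        then show ?thesis using close_0[OF b(1)] Js by simp
      next
        case J0: False
        have clJ: "close x' b J0"
        proof (rule close_cong[OF b(1)])
          show "close x b J0" using ex_w[OF b(1) Js(2)] J0 by simp
          show "alpha x b j = alpha x' b j" if "j < J0" for j using alpha'[OF b(1)] that by simp
        qed
        show ?thesis
        proof (cases "(b, J0) \<in> D")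
          case True
          have w: "W' b \<in> Lp b" "\<And>i. i < snd b + int J0 \<Longrightarrow> ecoeff n (W' b) i = ecoeff n (vv x b) i"
            using W'[OF b(1) Js(2)] J0 by auto
          have "ecoeff n (W' b) i = ecoeff n (vv x' b) i" if i: "i < snd b + int (Suc J0)" for i
          proof (cases "i = snd b + int J0")
            case True
            have "rest x b J0 = rest x' b J0"
              using Js by (intro rest_cong[OF b(1)] x'[symmetric]) auto
            then have "alpha x' b J0 = ecoeff n (W' b) (snd b + int J0)"
              using \<open>(b, J0) \<in> D\<close> b(1) Js by (simp add: alpha_rest[OF b(1)] x'_def)
            then show ?thesis using True by (simp add: ecoeff_vv_Ab[OF b(1)])
          next
            case False
            then have "i < snd b + int J0" using i by simp
            then show ?thesis using w(2) ecoeff_vv_cong[OF b(1) _ alpha'[OF b(1)], of i J0] by simp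
          qed
          then show ?thesis using w(1) Js unfolding close_def by blast
        next
          case False
          show ?thesis unfolding Js
          proof (rule close_next[OF b(1) _ clJ False])
            show "1 \<le> J0" using J0 by simp
            show "close x' (prev b) (Suc J0)" if "b \<notin> Y"
            proof (rule old)
              show "prev b \<in> Ab" using prev[OF b(1)] by simp
              then show "J0 * S + dep (prev b) < t"
                using dep_prev[OF b(1) that] Js lex[OF S, of "prev b" J0] by simp
            qed
            show "close x' (shift b (int i)) (Suc (J0 - i))" if "(b, i) \<in> V" "i < J0" for i
              using VD[OF that(1)] that(2) lex[OF S, of "shift b (int i)" "J0 - i"] by (intro old) auto
          qed
        qed
      qed
    qed
    then show ?thesis by blast
  qed
qed

lemma ex_stratum_coords: "\<exists>x\<in>stratum_coords q d n m A \<iota>. \<forall>\<tau><d. Lam x \<tau> = \<Lambda> \<tau>"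
proof -
  obtain S where S: "\<And>b. b \<in> Ab \<Longrightarrow> dep b < S" using dep_bound by blast
  have "\<forall>b\<in>Ab. \<exists>C. \<forall>w. low n w C \<longrightarrow> w \<in> Lp b" using Lp_low by blast
  from bchoice[OF this] obtain C where C: "\<And>b w. b \<in> Ab \<Longrightarrow> low n w (C b) \<Longrightarrow> w \<in> Lp b" by blast
  \<comment> \<open>For every b, vectors that start at a distance beyond \<open>T\<close> from b lie
    in \<open>Lp b\<close>, so agreement up to \<open>T\<close> is enough.\<close>
  define T where "T = Max (insert 0 ((\<lambda>b. nat (C b - snd b)) ` Ab))"
  have T: "C b \<le> snd b + int (Suc T)" if "b \<in> Ab" for b
  proof -
    have "nat (C b - snd b) \<le> T" unfolding T_def using that finite_Ab by (intro Max_ge) auto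
    then show ?thesis by simp
  qed
  obtain x where x: "\<And>b J. b \<in> Ab \<Longrightarrow> J * S + dep b < Suc T * S \<Longrightarrow> close x b (Suc J)"
    using ex_close[OF S, of "Suc T * S"] by blast
  have vLp: "vv x b \<in> Lp b" if b: "b \<in> Ab" for b
  proof -
    have "close x b (Suc T)" using x[OF b, of T] S[OF b] by simp
    then obtain w where w: "w \<in> Lp b" "\<And>i. i < snd b + int (Suc T) \<Longrightarrow> ecoeff n w i = ecoeff n (vv x b) i"
      unfolding close_def by blast
    have c: "w \<in> carrier_vec n" "vv x b \<in> carrier_vec n" using Lp_carrier[OF b w(1)] vv(1)[OF Ab_A[OF b]] by auto
    then have "low n (w - vv x b) (snd b + int (Suc T))" using w(2) by (simp add: low_def ecoeff_minus[OF n])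
    then have "w - vv x b \<in> Lp b" using C[OF b] low_mono[OF n _ T[OF b]] by blast
    then have "w - (w - vv x b) \<in> Lp b" using Lp_minus[OF b w(1)] by blast
    moreover have "w - (w - vv x b) = vv x b" using c by (intro eq_vecI) auto
    ultimately show ?thesis by simp
  qed
  \<comment> \<open>Points of the affine space vanish off \<open>D\<close>; the vectors do not
    change, as \<open>alpha\<close> sees only the coordinates in \<open>D\<close>.\<close>
  define x0 where "x0 p = (if p \<in> D then x p else 0)" for p
  have vv0: "vv x0 b = vv x b" if b: "b \<in> Ab" for b
  proof (rule vec_eq_if_ecoeff[OF n])
    have "alpha x0 b j = alpha x b j" for j
      using b by (intro alpha_cong) (auto simp: x0_def)
    then show "ecoeff n (vv x0 b) i = ecoeff n (vv x b) i" for i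
      by (simp add: vv(2)[OF Ab_A[OF b]] res_Ab[OF b])
  qed (use vv(1)[OF Ab_A[OF b]] in auto)
  have Lam: "Lam x0 \<tau> = \<Lambda> \<tau>" if "\<tau> < d" for \<tau>
  proof -
    have "\<Lambda> \<tau> = Lam x0 \<tau>"
      using leads_lattice[OF that] vLp vv0 by (intro Lam_eqI[OF that lattice[OF that]]) (auto simp: Lp_def)
    then show ?thesis by simp
  qed
  moreover have "x0 \<in> stratum_coords q d n m A \<iota>"
    unfolding stratum_coords_iff
  proof (intro conjI ballI)
    show "x0 \<in> affine_space D" by (simp add: affine_space_def x0_def)
    fix b assume b: "b \<in> Ab"
    show "tgs b (vv x0 b) \<in> Lam x0 (fst (\<rho> b))"
      using vLp[OF b] by (simp add: Lp_def vv0[OF b] Lam[OF Ab_fst[OF rr_in_Ab]])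
  qed
  ultimately show ?thesis by blast
qed

end

section \<open>Hodge types\<close>

text \<open>With \<open>c\<close> and \<open>c + 1\<close> as the only values, the sum fixes how
  often \<open>c + 1\<close> occurs.\<close>

lemma image_mset_eq_if_two_values:
  fixes f :: "'a \<Rightarrow> int" and g :: "'b \<Rightarrow> int"
  assumes fin: "finite A" "finite B" and card: "card A = card B"
    and f: "\<And>a. a \<in> A \<Longrightarrow> f a = c \<or> f a = c + 1" and g: "\<And>b. b \<in> B \<Longrightarrow> g b = c \<or> g b = c + 1"
    and sum: "(\<Sum>a\<in>A. f a) = (\<Sum>b\<in>B. g b)"
  shows "image_mset f (mset_set A) = image_mset g (mset_set B)"
proof -
  have *: "image_mset f (mset_set A) = replicate_mset (nat (sum f A - int (card A) * c)) (c + 1)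
      + replicate_mset (card A - nat (sum f A - int (card A) * c)) c"
    if fin: "finite A" and f: "\<And>a. a \<in> A \<Longrightarrow> f a = c \<or> f a = c + 1" for A :: "'x set" and f
  proof -
    have A: "A = {a \<in> A. f a = c + 1} \<union> {a \<in> A. f a = c}" using f by blast
    have disj: "{a \<in> A. f a = c + 1} \<inter> {a \<in> A. f a = c} = {}" by auto
    have cA: "card A = card {a \<in> A. f a = c + 1} + card {a \<in> A. f a = c}"
      using fin by (subst A, subst card_Un_disjoint[OF _ _ disj]) auto
    have "sum f A = (\<Sum>a\<in>{a \<in> A. f a = c + 1}. f a) + (\<Sum>a\<in>{a \<in> A. f a = c}. f a)"
      using fin by (subst A, subst sum.union_disjoint[OF _ _ disj]) auto
    also have "\<dots> = int (card {a \<in> A. f a = c + 1}) * (c + 1) + int (card {a \<in> A. f a = c}) * c"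
      by simp
    finally have "sum f A = int (card A) * c + int (card {a \<in> A. f a = c + 1})"
      unfolding cA by (simp add: algebra_simps)
    then have k: "nat (sum f A - int (card A) * c) = card {a \<in> A. f a = c + 1}" by simp
    have cnt: "count (image_mset f (mset_set A)) v = card {a \<in> A. f a = v}" for v
    proof -
      have "count (image_mset f (mset_set A)) v = (\<Sum>a\<in>f -` {v} \<inter> A. count (mset_set A) a)"
        using fin by (simp add: count_image_mset)
      also have "\<dots> = (\<Sum>a\<in>{a \<in> A. f a = v}. 1)" by (intro sum.cong) (auto simp: fin)
      finally show ?thesis by simp
    qed
    show ?thesis
      unfolding k
    proof (rule multiset_eqI)
      fix v
      have "card {a \<in> A. f a = v} = 0" if "v \<noteq> c" "v \<noteq> c + 1"
        using f that fin by (auto simp: card_eq_0_iff)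
      then show "count (image_mset f (mset_set A)) v
        = count (replicate_mset (card {a \<in> A. f a = c + 1}) (c + 1) + replicate_mset (card A - card {a \<in> A. f a = c + 1}) c) v"
        unfolding cnt using cA by auto
    qed
  qed
  show ?thesis using *[OF fin(1) f] *[OF fin(2) g] card sum by simp
qed

lemma det_mat_diag: "det (mat_diag n f) = (\<Prod>i<n. f i :: 'a::comm_ring_1)"
proof -
  have "upper_triangular (mat_diag n f)" by (auto simp: upper_triangular_def mat_diag_def)
  then have "det (mat_diag n f) = prod_list (diag_mat (mat_diag n f))"
    by (rule det_upper_triangular[OF _ mat_diag_dim])
  also have "\<dots> = (\<Prod>i<n. f i)"
    unfolding prod_list_diag_prod by (simp add: mat_diag_def atLeast0LessThan)
  finally show ?thesis .
qed

lemma fls_subdegree_prod_X_intpow: "fls_subdegree (\<Prod>i\<in>I. fls_X_intpow (k i) :: 'a::field fls) = (\<Sum>i\<in>I. k i)"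
  and prod_X_intpow_nonzero: "(\<Prod>i\<in>I. fls_X_intpow (k i) :: 'a::field fls) \<noteq> 0"
proof -
  have "(\<Prod>i\<in>I. fls_X_intpow (k i) :: 'a fls) \<noteq> 0 \<and> fls_subdegree (\<Prod>i\<in>I. fls_X_intpow (k i) :: 'a fls) = (\<Sum>i\<in>I. k i)"
    by (induction I rule: infinite_finite_induct) auto
  then show "fls_subdegree (\<Prod>i\<in>I. fls_X_intpow (k i) :: 'a fls) = (\<Sum>i\<in>I. k i)"
    "(\<Prod>i\<in>I. fls_X_intpow (k i) :: 'a fls) \<noteq> 0" by auto
qed

lemma mat_diag_mult_vec: "c \<in> carrier_vec n \<Longrightarrow> mat_diag n f *\<^sub>v c = vec n (\<lambda>l. f l * c $ l)"
proof (rule eq_vecI)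
  fix i assume c: "c \<in> carrier_vec n" and "i < dim_vec (vec n (\<lambda>l. f l * c $ l))"
  then have i: "i < n" by simp
  have "(mat_diag n f *\<^sub>v c) $ i = (\<Sum>j<n. (if i = j then f j else 0) * c $ j)"
    using c i by (simp add: mat_diag_def scalar_prod_def atLeast0LessThan)
  also have "\<dots> = (\<Sum>j\<in>{i}. (if i = j then f j else 0) * c $ j)"
    using i by (intro sum.mono_neutral_right) auto
  finally show "(mat_diag n f *\<^sub>v c) $ i = vec n (\<lambda>l. f l * c $ l) $ i" using i by simp
qed (simp add: mat_diag_def)

lemma KK_D:
  assumes "h \<in> KK d n" "\<tau> < d"
  shows "h \<tau> \<in> carrier_mat n n" "invertible_mat (h \<tau>)" "integral_mat (h \<tau>)" "integral_mat (minv (h \<tau>))"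
  using assms by (auto simp: KK_def GL_def integral_mat_def)

text \<open>The determinants of \<open>h \<tau>\<close> and of its inverse are integral, so their
  orders are nonnegative, and these add up to 0.\<close>

lemma KK_det:
  assumes "h \<in> KK d n" "\<tau> < d"
  shows "det (h \<tau>) \<noteq> 0" "fls_subdegree (det (h \<tau>)) = 0"
proof -
  note h = KK_D[OF assms]
  have 1: "det (h \<tau>) * det (minv (h \<tau>)) = 1" by (rule det_minv[OF h(1,2)])
  then show nz: "det (h \<tau>) \<noteq> 0" by auto
  have nz': "det (minv (h \<tau>)) \<noteq> 0" using 1 by auto
  have "fls_subdegree (det (h \<tau>)) + fls_subdegree (det (minv (h \<tau>))) = 0"
    using arg_cong[OF 1, of fls_subdegree] nz nz' by simp
  moreover have "0 \<le> fls_subdegree (det (h \<tau>))" "0 \<le> fls_subdegree (det (minv (h \<tau>)))"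
    using integral_mat_det[OF h(1,3)] integral_mat_det[OF minv(1)[OF h(1,2)] h(4)]
    by (auto intro!: fls_subdegree_ge0I simp: integers_L_iff)
  ultimately show "fls_subdegree (det (h \<tau>)) = 0" by linarith
qed

section \<open>Lattices in relative position \<mu> under \<gamma>\<sigma>\<close>

context gamma_sigma_setup
begin

lemma det_frob: 
  assumes "g \<in> carrier_mat n n" 
  shows "det (map_mat (frob q) g) = frob q (det g :: 'a fls)"
proof -
  interpret comm_ring_hom "frob q :: 'a fls \<Rightarrow> 'a fls" by (rule frob_hom)
  show ?thesis by (rule hom_det)
qed

lemma gs_eq: "\<tau> < d \<Longrightarrow> gs ((\<tau> + 1) mod d) w = gamma n m \<tau> *\<^sub>v map_vec (frob q) w"
  using pred_d_Suc[of \<tau>] by (simp add: gamma_sigma_def pred_d_def)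

context
  fixes \<mu> :: "nat \<Rightarrow> nat \<Rightarrow> int" and g h h' :: "nat \<Rightarrow> 'a fls mat"
  assumes g: "g \<in> GL d n" and h: "h \<in> KK d n" and h': "h' \<in> KK d n"
    and rel: "\<And>\<tau>. \<tau> < d \<Longrightarrow> minv (g \<tau>) * gamma n m \<tau> * sigma_G q d g \<tau> = h \<tau> * t_pow n \<mu> \<tau> * h' \<tau>"
begin

lemma g_carrier: "\<tau> < d \<Longrightarrow> g \<tau> \<in> carrier_mat n n" and g_inv: "\<tau> < d \<Longrightarrow> invertible_mat (g \<tau>)"
  using g by (auto simp: GL_def)

lemma Suc_less: "(\<tau> + 1) mod d < d" using d by simp

lemma gamma_frob_eq:
  assumes \<tau>: "\<tau> < d"
  shows "gamma n m \<tau> * map_mat (frob q) (g ((\<tau> + 1) mod d)) = g \<tau> * (h \<tau> * t_pow n \<mu> \<tau> * h' \<tau>)"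
proof -
  let ?s = "map_mat (frob q) (g ((\<tau> + 1) mod d))"
  have c: "g \<tau> \<in> carrier_mat n n" "minv (g \<tau>) \<in> carrier_mat n n" "gamma n m \<tau> \<in> carrier_mat n n" "?s \<in> carrier_mat n n"
    using g_carrier[OF \<tau>] g_carrier[OF Suc_less] minv(1)[OF g_carrier[OF \<tau>] g_inv[OF \<tau>]] gamma_carrier by auto
  have "g \<tau> * (minv (g \<tau>) * gamma n m \<tau> * ?s) = g \<tau> * (minv (g \<tau>) * (gamma n m \<tau> * ?s))"
    using c by (subst assoc_mult_mat[of "minv (g \<tau>)" n n "gamma n m \<tau>" n ?s n]) auto
  also have "\<dots> = (g \<tau> * minv (g \<tau>)) * (gamma n m \<tau> * ?s)"
    by (rule assoc_mult_mat[OF c(1,2) mult_carrier_mat[OF c(3,4)], symmetric])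
  also have "\<dots> = gamma n m \<tau> * ?s"
    unfolding minv(2)[OF g_carrier[OF \<tau>] g_inv[OF \<tau>]]
    by (rule left_mult_one_mat[OF mult_carrier_mat[OF c(3,4)]])
  finally show ?thesis using rel[OF \<tau>] by (simp add: sigma_G_def)
qed

lemma t_pow_carrier: "t_pow n \<mu> \<tau> \<in> carrier_mat n n" by (simp add: t_pow_def)

lemma gs_mult:
  assumes \<tau>: "\<tau> < d" and c: "c \<in> carrier_vec n"
  shows "gs ((\<tau> + 1) mod d) (g ((\<tau> + 1) mod d) *\<^sub>v c) = g \<tau> *\<^sub>v (h \<tau> *\<^sub>v (t_pow n \<mu> \<tau> *\<^sub>v (h' \<tau> *\<^sub>v map_vec (frob q) c)))"
proof -
  let ?s = "map_mat (frob q) (g ((\<tau> + 1) mod d))" and ?c = "map_vec (frob q) c"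
  note hc = KK_D(1)[OF h \<tau>] KK_D(1)[OF h' \<tau>] t_pow_carrier[of \<tau>] g_carrier[OF \<tau>] gamma_carrier[of \<tau>]
  have sc: "?s \<in> carrier_mat n n" "?c \<in> carrier_vec n" using g_carrier[OF Suc_less] c by auto
  have "gs ((\<tau> + 1) mod d) (g ((\<tau> + 1) mod d) *\<^sub>v c) = gamma n m \<tau> *\<^sub>v (?s *\<^sub>v ?c)"
    using frob_mult_mat_vec[OF g_carrier[OF Suc_less] c] by (simp add: gs_eq[OF \<tau>, simplified])
  also have "\<dots> = (gamma n m \<tau> * ?s) *\<^sub>v ?c"
    by (rule assoc_mult_mat_vec[OF hc(5) sc, symmetric])
  also have "\<dots> = (g \<tau> * (h \<tau> * t_pow n \<mu> \<tau> * h' \<tau>)) *\<^sub>v ?c" by (simp only: gamma_frob_eq[OF \<tau>])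
  also have "\<dots> = g \<tau> *\<^sub>v ((h \<tau> * t_pow n \<mu> \<tau> * h' \<tau>) *\<^sub>v ?c)"
    by (rule assoc_mult_mat_vec[OF hc(4) mult_carrier_mat[OF mult_carrier_mat[OF hc(1,3)] hc(2)] sc(2)])
  also have "(h \<tau> * t_pow n \<mu> \<tau> * h' \<tau>) *\<^sub>v ?c = (h \<tau> * t_pow n \<mu> \<tau>) *\<^sub>v (h' \<tau> *\<^sub>v ?c)"
    by (rule assoc_mult_mat_vec[OF mult_carrier_mat[OF hc(1,3)] hc(2) sc(2)])
  also have "\<dots> = h \<tau> *\<^sub>v (t_pow n \<mu> \<tau> *\<^sub>v (h' \<tau> *\<^sub>v ?c))"
    by (rule assoc_mult_mat_vec[OF hc(1,3) mult_mat_vec_carrier[OF hc(2) sc(2)]])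
  finally show ?thesis .
qed

text \<open>A lower bound \<open>c\<close> for \<mu> makes t^(-c) t^\<mu> integral, so
  \<gamma>\<sigma> maps each lattice into t^c times the one it is sent to. \<open>gs_surj\<close>
  gives the reverse kind of inclusion from an upper bound; for minuscule \<mu> the bounds can be
  chosen to differ by 1.\<close>

lemma gs_divisible:
  assumes \<tau>: "\<tau> < d" and c: "\<And>i. 1 \<le> i \<Longrightarrow> i \<le> n \<Longrightarrow> c \<le> \<mu> \<tau> i" and w: "w \<in> latt n (g ((\<tau> + 1) mod d))"
  shows "fls_X_intpow (- c) \<cdot>\<^sub>v gs ((\<tau> + 1) mod d) w \<in> latt n (g \<tau>)"
proof -
  note hc = KK_D(1)[OF h \<tau>] KK_D(1)[OF h' \<tau>] t_pow_carrier[of \<tau>] g_carrier[OF \<tau>]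
  obtain a where a: "w = g ((\<tau> + 1) mod d) *\<^sub>v a" "integral_vec n a" using w by (auto simp: latt_def)
  let ?e = "h' \<tau> *\<^sub>v map_vec (frob q) a"
  have "integral_vec n (map_vec (frob q) a)" using a(2) frob_integral by (auto simp: integral_vec_def)
  then have e: "integral_vec n ?e" using integral_mat_mult_vec[OF hc(2) KK_D(3)[OF h' \<tau>]] by blast
  then have ec: "?e \<in> carrier_vec n" by (simp add: integral_vec_def)
  let ?f = "fls_X_intpow (- c) \<cdot>\<^sub>v (t_pow n \<mu> \<tau> *\<^sub>v ?e)"
  have "?f $ l \<in> integers_L" if l: "l < n" for l
  proof -
    have "?f $ l = fls_X_intpow (- c) * (fls_X_intpow (\<mu> \<tau> (l + 1)) * ?e $ l)"
      using l ec by (simp add: t_pow_def mat_diag_mult_vec del: index_mult_mat_vec)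
    also have "\<dots> = fls_X_intpow (- c + \<mu> \<tau> (l + 1)) * ?e $ l"
      by (simp only: mult.assoc[symmetric] fls_X_intpow_times_fls_X_intpow)
    also have "\<dots> \<in> integers_L"
      using c[of "l + 1"] l e by (intro integers_L_mult integers_L_X_intpow) (auto simp: integral_vec_def)
    finally show ?thesis .
  qed
  moreover have tc: "t_pow n \<mu> \<tau> *\<^sub>v ?e \<in> carrier_vec n" using hc(3) ec by (rule mult_mat_vec_carrier)
  ultimately have f: "integral_vec n ?f" by (simp add: integral_vec_def)
  have "gs ((\<tau> + 1) mod d) w = g \<tau> *\<^sub>v (h \<tau> *\<^sub>v (t_pow n \<mu> \<tau> *\<^sub>v ?e))"
    using gs_mult[OF \<tau>, of a] a by (simp add: integral_vec_def)
  moreover have "fls_X_intpow (- c) \<cdot>\<^sub>v (g \<tau> *\<^sub>v (h \<tau> *\<^sub>v (t_pow n \<mu> \<tau> *\<^sub>v ?e))) = g \<tau> *\<^sub>v (h \<tau> *\<^sub>v ?f)"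
  proof -
    have "h \<tau> *\<^sub>v ?f = fls_X_intpow (- c) \<cdot>\<^sub>v (h \<tau> *\<^sub>v (t_pow n \<mu> \<tau> *\<^sub>v ?e))"
      by (rule mult_mat_vec[OF hc(1) tc])
    moreover have "h \<tau> *\<^sub>v (t_pow n \<mu> \<tau> *\<^sub>v ?e) \<in> carrier_vec n" using hc(1) tc by (rule mult_mat_vec_carrier)
    ultimately show ?thesis using mult_mat_vec[OF hc(4)] by simp
  qed
  moreover have "integral_vec n (h \<tau> *\<^sub>v ?f)" using integral_mat_mult_vec[OF hc(1) KK_D(3)[OF h \<tau>] f] .
  ultimately show ?thesis unfolding latt_def by (simp only: mem_Collect_eq) blast
qed

text \<open>The relation is solved backwards: \<open>h\<close> and \<open>h'\<close> are inverted
  over the integers, t^(c - \<mu>) is integral, and the Frobenius has preimages among the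
  integers.\<close>

lemma gs_surj:
  assumes \<tau>: "\<tau> < d" and c: "\<And>i. 1 \<le> i \<Longrightarrow> i \<le> n \<Longrightarrow> \<mu> \<tau> i \<le> c" and u: "u \<in> latt n (g \<tau>)"
  shows "\<exists>w\<in>latt n (g ((\<tau> + 1) mod d)). gs ((\<tau> + 1) mod d) w = fls_X_intpow c \<cdot>\<^sub>v u"
proof -
  note hc = KK_D(1)[OF h \<tau>] KK_D(1)[OF h' \<tau>] t_pow_carrier[of \<tau>] g_carrier[OF \<tau>]
  note hm = minv(1)[OF hc(1) KK_D(2)[OF h \<tau>]] minv(1)[OF hc(2) KK_D(2)[OF h' \<tau>]]
  obtain a where a: "u = g \<tau> *\<^sub>v a" "integral_vec n a" using u by (auto simp: latt_def)
  let ?e = "minv (h \<tau>) *\<^sub>v a"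
  have e: "integral_vec n ?e" using integral_mat_mult_vec[OF hm(1) KK_D(4)[OF h \<tau>] a(2)] .
  define f where "f = vec n (\<lambda>l. fls_X_intpow (c - \<mu> \<tau> (l + 1)) * ?e $ l)"
  have f: "integral_vec n f"
    unfolding f_def integral_vec_def
  proof (intro conjI allI impI vec_carrier)
    fix l assume l: "l < n"
    have "fls_X_intpow (c - \<mu> \<tau> (l + 1)) * ?e $ l \<in> integers_L"
      using e c[of "l + 1"] l by (intro integers_L_mult integers_L_X_intpow) (auto simp: integral_vec_def)
    then show "vec n (\<lambda>l. fls_X_intpow (c - \<mu> \<tau> (l + 1)) * ?e $ l) $ l \<in> integers_L" using l by simp
  qed
  let ?k = "minv (h' \<tau>) *\<^sub>v f"
  have k: "integral_vec n ?k" using integral_mat_mult_vec[OF hm(2) KK_D(4)[OF h' \<tau>] f] .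
  have "\<forall>l\<in>{..<n}. \<exists>r. r \<in> integers_L \<and> frob q r = ?k $ l"
    using k frob_surj_integral unfolding integral_vec_def by blast
  from bchoice[OF this] obtain r where r: "\<And>l. l < n \<Longrightarrow> r l \<in> integers_L" "\<And>l. l < n \<Longrightarrow> frob q (r l) = ?k $ l"
    by auto
  have rk: "map_vec (frob q) (vec n r) = ?k"
  proof (rule eq_vecI)
    have kc: "?k \<in> carrier_vec n" using k by (simp only: integral_vec_def)
    then show "dim_vec (map_vec (frob q) (vec n r)) = dim_vec ?k" by (simp only: carrier_vecD) simp
    fix l assume "l < dim_vec ?k"
    then have "l < n" by (simp only: carrier_vecD[OF kc])
    then show "map_vec (frob q) (vec n r) $ l = ?k $ l" using r(2) by (simp del: index_mult_mat_vec)
  qed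
  have ri: "integral_vec n (vec n r)" using r(1) by (simp add: integral_vec_def)
  have fc: "f \<in> carrier_vec n" and ec: "?e \<in> carrier_vec n" and ac: "a \<in> carrier_vec n"
    using f e a(2) by (auto simp: integral_vec_def)
  have tf: "t_pow n \<mu> \<tau> *\<^sub>v f = fls_X_intpow c \<cdot>\<^sub>v ?e"
  proof (rule eq_vecI)
    fix l assume "l < dim_vec (fls_X_intpow c \<cdot>\<^sub>v ?e)"
    then have l: "l < n" by (simp add: carrier_matD[OF hm(1)])
    have "(t_pow n \<mu> \<tau> *\<^sub>v f) $ l = fls_X_intpow (\<mu> \<tau> (l + 1)) * (fls_X_intpow (c - \<mu> \<tau> (l + 1)) * ?e $ l)"
      using l fc by (simp add: t_pow_def mat_diag_mult_vec f_def del: index_mult_mat_vec)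
    also have "\<dots> = fls_X_intpow c * ?e $ l"
      by (simp only: mult.assoc[symmetric] fls_X_intpow_times_fls_X_intpow) simp
    finally show "(t_pow n \<mu> \<tau> *\<^sub>v f) $ l = (fls_X_intpow c \<cdot>\<^sub>v ?e) $ l"
      using l by (simp add: carrier_matD[OF hm(1)])
  qed (simp add: t_pow_def mat_diag_def carrier_matD[OF hm(1)])
  have "gs ((\<tau> + 1) mod d) (g ((\<tau> + 1) mod d) *\<^sub>v vec n r) = g \<tau> *\<^sub>v (h \<tau> *\<^sub>v (t_pow n \<mu> \<tau> *\<^sub>v (h' \<tau> *\<^sub>v ?k)))"
    using gs_mult[OF \<tau>, of "vec n r"] by (simp add: rk)
  also have "h' \<tau> *\<^sub>v ?k = f" by (rule minv_mult_vec(2)[OF hc(2) KK_D(2)[OF h' \<tau>] fc])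
  also have "h \<tau> *\<^sub>v (t_pow n \<mu> \<tau> *\<^sub>v f) = fls_X_intpow c \<cdot>\<^sub>v a"
    unfolding tf mult_mat_vec[OF hc(1) ec] minv_mult_vec(2)[OF hc(1) KK_D(2)[OF h \<tau>] ac] ..
  also have "g \<tau> *\<^sub>v (fls_X_intpow c \<cdot>\<^sub>v a) = fls_X_intpow c \<cdot>\<^sub>v u"
    unfolding a(1) by (rule mult_mat_vec[OF hc(4) ac])
  finally show ?thesis using ri by (auto simp: latt_def)
qed

text \<open>The determinants of \<open>h\<close> and \<open>h'\<close> are units, and that of
  t^\<mu> has the sum of the entries of \<mu> as its order.\<close>

lemma fls_subdegree_det_gamma:
  assumes \<tau>: "\<tau> < d"
  shows "fls_subdegree (det (gamma n m \<tau>) * frob q (det (g ((\<tau> + 1) mod d))))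
    = fls_subdegree (det (g \<tau>)) + (\<Sum>i=1..n. \<mu> \<tau> i)"
proof -
  note hc = KK_D(1)[OF h \<tau>] KK_D(1)[OF h' \<tau>] t_pow_carrier[of \<tau>] g_carrier[OF \<tau>]
  have "det (gamma n m \<tau>) * frob q (det (g ((\<tau> + 1) mod d)))
      = det (gamma n m \<tau> * map_mat (frob q) (g ((\<tau> + 1) mod d)))"
    using det_mult[OF gamma_carrier[of \<tau>], of "map_mat (frob q) (g ((\<tau> + 1) mod d))"]
      det_frob[OF g_carrier[OF Suc_less]] g_carrier[OF Suc_less, of \<tau>] by simp
  also have "\<dots> = det (g \<tau>) * (det (h \<tau>) * det (t_pow n \<mu> \<tau>) * det (h' \<tau>))"
  proof -
    note c1 = mult_carrier_mat[OF hc(1) hc(3)]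
    show ?thesis
      unfolding gamma_frob_eq[OF \<tau>] det_mult[OF hc(4) mult_carrier_mat[OF c1 hc(2)]]
        det_mult[OF c1 hc(2)] det_mult[OF hc(1) hc(3)] ..
  qed
  finally have eq: "det (gamma n m \<tau>) * frob q (det (g ((\<tau> + 1) mod d)))
      = det (g \<tau>) * (det (h \<tau>) * det (t_pow n \<mu> \<tau>) * det (h' \<tau>))" .
  have "det (g \<tau>) \<noteq> 0" using det_minv[OF hc(4) g_inv[OF \<tau>]] by auto
  moreover have "det (t_pow n \<mu> \<tau>) \<noteq> (0 :: 'a fls)" "fls_subdegree (det (t_pow n \<mu> \<tau>) :: 'a fls) = (\<Sum>i<n. \<mu> \<tau> (i + 1))"
    unfolding t_pow_def det_mat_diag by (rule prod_X_intpow_nonzero, rule fls_subdegree_prod_X_intpow)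
  moreover have "(\<Sum>i<n. \<mu> \<tau> (i + 1)) = (\<Sum>i=1..n. \<mu> \<tau> i)"
    using sum.atLeast_Suc_atMost_Suc_shift[of "\<mu> \<tau>" 0 "n - 1"] n
    by (intro sum.reindex_bij_witness[of _ "\<lambda>i. i - 1" Suc]) auto
  ultimately show ?thesis unfolding eq using KK_det[OF h \<tau>] KK_det[OF h' \<tau>] by simp
qed

end

end

context strata
begin

definition cols_mat :: "(nat \<Rightarrow> 'a fls vec) \<Rightarrow> 'a fls mat" where
  "cols_mat w = mat n n (\<lambda>(i, l). w l $ i)"

lemma cols_mat_carrier: "cols_mat w \<in> carrier_mat n n"
  by (simp add: cols_mat_def)

lemma col_cols_mat: "l < n \<Longrightarrow> w l \<in> carrier_vec n \<Longrightarrow> col (cols_mat w) l = w l"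
  by (intro eq_vecI) (auto simp: cols_mat_def)

text \<open>r maps the elements of \<open>Ab\<close> in the component after \<tau> bijectively onto
  those in component \<tau>.\<close>

lemma rr_amin_multiples:
  assumes \<tau>: "\<tau> < d"
  shows "{snd (\<rho> (amin ((\<tau> + 1) mod d) l)) + int n * k | l k. l < n \<and> 0 \<le> k} = {i. (\<tau>, i) \<in> A}"
proof (intro equalityI subsetI)
  have sd: "(\<tau> + 1) mod d < d" using d by simp
  have fst_b: "fst (\<rho> (amin ((\<tau> + 1) mod d) l)) = \<tau>" for l
    using fst_rr_pred[OF amin_in[OF sd]] pred_d_Suc[OF \<tau>] by simp
  {
    fix i assume "i \<in> {snd (\<rho> (amin ((\<tau> + 1) mod d) l)) + int n * k | l k. l < n \<and> 0 \<le> k}"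
    then obtain l k where lk: "i = snd (\<rho> (amin ((\<tau> + 1) mod d) l)) + int n * k" "0 \<le> k" by blast
    then have "(\<tau>, i) = shift (\<rho> (amin ((\<tau> + 1) mod d) l)) (int n * k)" using fst_b[of l] by (simp add: shift_def)
    then show "i \<in> {i. (\<tau>, i) \<in> A}" using A_shift[OF Ab_A[OF rr_in_Ab] lk(2)] by simp
  }
  fix i assume "i \<in> {i. (\<tau>, i) \<in> A}"
  then have i: "(\<tau>, i) \<in> A" by simp
  define b where "b = prev (res (\<tau>, i))"
  have r: "res (\<tau>, i) \<in> Ab" using res_in_Ab[of "(\<tau>, i)"] \<tau> by simp
  have b: "b \<in> Ab" "\<rho> b = res (\<tau>, i)" using prev[OF r] by (auto simp: b_def)
  have "pred_d (fst b) = \<tau>" using fst_rr_pred[OF b(1)] b(2) by simp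
  then have "fst b = (\<tau> + 1) mod d" using Suc_pred_d[OF Ab_fst[OF b(1)]] by simp
  then obtain l where l: "l < n" "b = amin ((\<tau> + 1) mod d) l" using amin_surj[OF b(1)] by auto
  moreover have "0 \<le> nu (\<tau>, i)" using i in_A_iff[of "(\<tau>, i)"] \<tau> by simp
  moreover have "i = snd (res (\<tau>, i)) + int n * nu (\<tau>, i)" by (simp add: snd_res)
  ultimately show "i \<in> {snd (\<rho> (amin ((\<tau> + 1) mod d) l)) + int n * k | l k. l < n \<and> 0 \<le> k}"
    using b(2) by (intro CollectI exI[of _ l] exI[of _ "nu (\<tau>, i)"]) simp
qed

context
  fixes \<tau> and w :: "nat \<Rightarrow> 'a fls vec"
  assumes \<tau>: "\<tau> < d" and w: "\<And>l. l < n \<Longrightarrow> lead n (w l) (snd (amin ((\<tau> + 1) mod d) l))"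
begin

lemma Suc_\<tau>: "(\<tau> + 1) mod d < d" using d by simp

lemma w_carrier: "l < n \<Longrightarrow> w l \<in> carrier_vec n" using w lead_carrier[OF n] by blast

text \<open>The transported vectors. Their leading indices are the r(b), so they are again a basis
  of the kind required by \<open>lead_basis\<close>, now in component \<tau>.\<close>

definition tw :: "nat \<Rightarrow> 'a fls vec" where "tw l = tgs (amin ((\<tau> + 1) mod d) l) (w l)"

lemma tw_carrier: "tw l \<in> carrier_vec n" by (simp add: tw_def tgs_carrier)

lemma lead_basis_w: "lead_basis n (cols_mat w) (\<lambda>l. snd (amin ((\<tau> + 1) mod d) l))"
  using w w_carrier by (intro lead_basis_amin Suc_\<tau> cols_mat_carrier) (simp_all add: col_cols_mat)

lemma lead_basis_tw: "lead_basis n (cols_mat tw) (\<lambda>l. snd (\<rho> (amin ((\<tau> + 1) mod d) l)))"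
  unfolding lead_basis_def
proof (intro conjI allI impI cols_mat_carrier inj_onI)
  fix l assume l: "l < n"
  show "lead n (col (cols_mat tw) l) (snd (\<rho> (amin ((\<tau> + 1) mod d) l)))"
    using lead_tgs[OF amin_in[OF Suc_\<tau>], of "w l" l 0] w[OF l] l
    by (simp add: col_cols_mat tw_carrier) (simp add: tw_def)
next
  fix l l' assume l: "l \<in> {..<n}" "l' \<in> {..<n}"
    and eq: "snd (\<rho> (amin ((\<tau> + 1) mod d) l)) mod int n = snd (\<rho> (amin ((\<tau> + 1) mod d) l')) mod int n"
  have a: "amin ((\<tau> + 1) mod d) l \<in> Ab" "amin ((\<tau> + 1) mod d) l' \<in> Ab" using amin_in[OF Suc_\<tau>] by auto
  have "\<rho> (amin ((\<tau> + 1) mod d) l) = \<rho> (amin ((\<tau> + 1) mod d) l')"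
    using eq fst_rr_pred[OF a(1)] fst_rr_pred[OF a(2)] by (intro Ab_eqI rr_in_Ab) simp_all
  then have "amin ((\<tau> + 1) mod d) l = amin ((\<tau> + 1) mod d) l'" using inj_rr a by (auto simp: inj_on_def)
  then show "l = l'" using l by (intro amin_inj[where \<tau> = "(\<tau> + 1) mod d"]) auto
qed

text \<open>Between the bases \<open>w\<close> and \<open>tw\<close> the operator \<gamma>\<sigma>
  is the diagonal matrix t^\<phi>. This exhibits the relative position and, through determinants,
  the sum of \<phi>.\<close>

lemma gamma_frob_cols:
  "gamma n m \<tau> * map_mat (frob q) (cols_mat w)
    = cols_mat tw * mat_diag n (\<lambda>l. fls_X_intpow (\<phi> (amin ((\<tau> + 1) mod d) l)))"
proof (rule mat_col_eqI)
  note g = gamma_carrier[of \<tau>]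
  have fc: "map_mat (frob q) (cols_mat w) \<in> carrier_mat n n" using cols_mat_carrier by simp
  fix l assume "l < dim_col (cols_mat tw * mat_diag n (\<lambda>l. fls_X_intpow (\<phi> (amin ((\<tau> + 1) mod d) l))))"
  then have l: "l < n" by (simp add: mat_diag_def)
  let ?b = "amin ((\<tau> + 1) mod d) l"
  have "col (gamma n m \<tau> * map_mat (frob q) (cols_mat w)) l = gamma n m \<tau> *\<^sub>v col (map_mat (frob q) (cols_mat w)) l"
    by (rule col_mult2[OF g fc l])
  also have "col (map_mat (frob q) (cols_mat w)) l = map_vec (frob q) (w l)"
    using l w_carrier[OF l] by (intro eq_vecI) (auto simp: cols_mat_def)
  also have "gamma n m \<tau> *\<^sub>v map_vec (frob q) (w l) = gs ((\<tau> + 1) mod d) (w l)" by (rule gs_eq[OF \<tau>, symmetric])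
  also have "\<dots> = fls_X_intpow (\<phi> ?b) \<cdot>\<^sub>v tw l"
  proof -
    have "fls_X_intpow (\<phi> ?b) * fls_X_intpow (- \<phi> ?b) = (1 :: 'a fls)"
      unfolding fls_X_intpow_times_fls_X_intpow by (intro fls_eqI) simp
    then show ?thesis unfolding tw_def tgs_def smult_smult_assoc by simp
  qed
  also have "\<dots> = col (cols_mat tw * mat_diag n (\<lambda>l. fls_X_intpow (\<phi> (amin ((\<tau> + 1) mod d) l)))) l"
    unfolding mat_diag_mult_right[OF cols_mat_carrier] using l carrier_vecD[OF tw_carrier[of l]]
    by (intro eq_vecI) (auto simp: cols_mat_def mult.commute)
  finally show "col (gamma n m \<tau> * map_mat (frob q) (cols_mat w)) l
    = col (cols_mat tw * mat_diag n (\<lambda>l. fls_X_intpow (\<phi> (amin ((\<tau> + 1) mod d) l)))) l" .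
qed (use gamma_carrier[of \<tau>] in \<open>auto simp: cols_mat_def mat_diag_def\<close>)

lemma latt_cols_w:
  "olattice n \<Lambda> \<Longrightarrow> leads n \<Lambda> = {i. ((\<tau> + 1) mod d, i) \<in> A} \<Longrightarrow> (\<And>l. l < n \<Longrightarrow> w l \<in> \<Lambda>) \<Longrightarrow> \<Lambda> = latt n (cols_mat w)"
  using w_carrier amin_multiples[OF Suc_\<tau>]
  by (intro olattice_eq_latt[OF n _ lead_basis_w]) (simp_all add: col_cols_mat)

lemma latt_cols_tw:
  "olattice n \<Lambda> \<Longrightarrow> leads n \<Lambda> = {i. (\<tau>, i) \<in> A} \<Longrightarrow> (\<And>l. l < n \<Longrightarrow> tw l \<in> \<Lambda>) \<Longrightarrow> \<Lambda> = latt n (cols_mat tw)"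
  using tw_carrier rr_amin_multiples[OF \<tau>]
  by (intro olattice_eq_latt[OF n _ lead_basis_tw]) (simp_all add: col_cols_mat)

text \<open>The determinants of \<open>w\<close> and \<open>tw\<close> have the same orders as those
  of any other bases of the two lattices, here \<open>g1\<close> and \<open>g2\<close>.\<close>

lemma sum_phi:
  assumes g1: "g1 \<in> carrier_mat n n" "invertible_mat g1" "latt n g1 = latt n (cols_mat w)"
    and g2: "g2 \<in> carrier_mat n n" "invertible_mat g2" "latt n g2 = latt n (cols_mat tw)"
  shows "fls_subdegree (det (gamma n m \<tau>) * frob q (det g1))
    = fls_subdegree (det g2) + (\<Sum>l<n. \<phi> (amin ((\<tau> + 1) mod d) l))"
proof -
  note wi = lead_basis_invertible[OF n lead_basis_w] and twi = lead_basis_invertible[OF n lead_basis_tw]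
  have nz: "det g1 \<noteq> 0" "det g2 \<noteq> 0" "det (cols_mat w) \<noteq> 0" "det (cols_mat tw) \<noteq> 0"
    using det_minv[OF g1(1,2)] det_minv[OF g2(1,2)] det_minv[OF cols_mat_carrier wi] det_minv[OF cols_mat_carrier twi] by auto
  have 1: "fls_subdegree (det g1) = fls_subdegree (det (cols_mat w))"
    using fls_subdegree_det_le[OF n g1(1,2) cols_mat_carrier wi] fls_subdegree_det_le[OF n cols_mat_carrier wi g1(1,2)] g1(3)
    by auto
  have 2: "fls_subdegree (det g2) = fls_subdegree (det (cols_mat tw))"
    using fls_subdegree_det_le[OF n g2(1,2) cols_mat_carrier twi] fls_subdegree_det_le[OF n cols_mat_carrier twi g2(1,2)] g2(3)
    by auto
  have fc: "map_mat (frob q) (cols_mat w) \<in> carrier_mat n n" using cols_mat_carrier by simp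
  have eq: "det (gamma n m \<tau>) * frob q (det (cols_mat w))
      = det (cols_mat tw) * (\<Prod>l<n. fls_X_intpow (\<phi> (amin ((\<tau> + 1) mod d) l)))"
    using arg_cong[OF gamma_frob_cols, of det]
    unfolding det_mult[OF gamma_carrier fc] det_mult[OF cols_mat_carrier mat_diag_dim] det_mat_diag det_frob[OF cols_mat_carrier] .
  have "det (gamma n m \<tau>) \<noteq> (0 :: 'a fls)"
  proof
    assume "det (gamma n m \<tau>) = (0 :: 'a fls)"
    then have "det (cols_mat tw) * (\<Prod>l<n. fls_X_intpow (\<phi> (amin ((\<tau> + 1) mod d) l))) = 0"
      unfolding eq[symmetric] by simp
    then show False
      using nz(4) by (simp add: prod_X_intpow_nonzero)
  qed
  then have "fls_subdegree (det (gamma n m \<tau>) * frob q (det g1))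
      = fls_subdegree (det (gamma n m \<tau>) * frob q (det (cols_mat w)))"
    using nz 1 by (simp add: frob_eq_0_iff fls_subdegree_frob)
  also have "\<dots> = fls_subdegree (det g2) + (\<Sum>l<n. \<phi> (amin ((\<tau> + 1) mod d) l))"
    unfolding eq using nz 2 prod_X_intpow_nonzero[of "\<lambda>l. \<phi> (amin ((\<tau> + 1) mod d) l)" "{..<n}"]
    by (simp add: fls_subdegree_prod_X_intpow)
  finally show ?thesis .
qed

end

lemma Lam_cols:
  assumes x: "x \<in> stratum_coords q d n m A \<iota>" and \<tau>: "\<tau> < d"
  defines "w \<equiv> \<lambda>l. vv x (amin ((\<tau> + 1) mod d) l)"
  shows "cols_mat w = basis_mat x ((\<tau> + 1) mod d)" "latt n (basis_mat x \<tau>) = latt n (cols_mat (tw \<tau> w))"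
    "invertible_mat (cols_mat (tw \<tau> w))"
    "gamma n m \<tau> * map_mat (frob q) (basis_mat x ((\<tau> + 1) mod d))
      = cols_mat (tw \<tau> w) * mat_diag n (\<lambda>l. fls_X_intpow (\<phi> (amin ((\<tau> + 1) mod d) l)))"
proof -
  have sd: "(\<tau> + 1) mod d < d" using d by simp
  have lw: "lead n (w l) (snd (amin ((\<tau> + 1) mod d) l))" for l
    unfolding w_def using lead_vv[OF Ab_A[OF amin_in[OF sd]]] .
  show 1: "cols_mat w = basis_mat x ((\<tau> + 1) mod d)" by (simp add: cols_mat_def basis_mat_def w_def)
  have "tw \<tau> w l \<in> Lam x \<tau>" for l
  proof -
    have fst: "fst (\<rho> (amin ((\<tau> + 1) mod d) l)) = \<tau>"
      using fst_rr_pred[OF amin_in[OF sd]] pred_d_Suc[OF \<tau>] by simp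
    have "\<forall>b\<in>Ab. tgs b (vv x b) \<in> Lam x (fst (\<rho> b))" using x unfolding stratum_coords_iff by (rule conjunct2)
    from bspec[OF this amin_in[OF sd, of l]]
    have "tgs (amin ((\<tau> + 1) mod d) l) (w l) \<in> Lam x \<tau>" unfolding fst w_def .
    then show ?thesis unfolding tw_def[OF \<tau> lw] .
  qed
  then show "latt n (basis_mat x \<tau>) = latt n (cols_mat (tw \<tau> w))"
    using latt_cols_tw[OF \<tau> lw olattice_Lam[OF \<tau>] leads_Lam[OF \<tau>]] Lam_eq[OF \<tau>] by metis
  show "invertible_mat (cols_mat (tw \<tau> w))" by (rule lead_basis_invertible[OF n lead_basis_tw[OF \<tau> lw]])
  show "gamma n m \<tau> * map_mat (frob q) (basis_mat x ((\<tau> + 1) mod d))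
      = cols_mat (tw \<tau> w) * mat_diag n (\<lambda>l. fls_X_intpow (\<phi> (amin ((\<tau> + 1) mod d) l)))"
    using gamma_frob_cols[OF \<tau> lw] unfolding 1 .
qed

end

lemma lead_X_intpow:
  fixes w :: "'k::field fls vec"
  assumes "1 \<le> n" "lead n w i"
  shows "lead n (fls_X_intpow k \<cdot>\<^sub>v w) (i + int n * k)"
proof -
  have nz: "fls_X_intpow k \<noteq> (0 :: 'k fls)" by (rule fls_X_intpow_nonzero)
  show ?thesis using lead_smult[OF assms nz] by (simp only: fls_subdegree_fls_X_intpow)
qed

lemma integral_mat_mult:
  "g \<in> carrier_mat n n \<Longrightarrow> h \<in> carrier_mat n n \<Longrightarrow> integral_mat g \<Longrightarrow> integral_mat h \<Longrightarrow> integral_mat (g * h)"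
  by (subst integral_mat_iff[of _ n])
     (auto simp: integral_mat_iff scalar_prod_def intro!: integers_L_sum integers_L_mult)

lemma KK_I:
  assumes "\<And>\<tau>. \<tau> < d \<Longrightarrow> h \<tau> \<in> carrier_mat n n" "\<And>\<tau>. \<tau> < d \<Longrightarrow> k \<tau> \<in> carrier_mat n n"
    "\<And>\<tau>. \<tau> < d \<Longrightarrow> h \<tau> * k \<tau> = 1\<^sub>m n" "\<And>\<tau>. \<tau> < d \<Longrightarrow> k \<tau> * h \<tau> = 1\<^sub>m n"
    "\<And>\<tau>. \<tau> < d \<Longrightarrow> integral_mat (h \<tau>)" "\<And>\<tau>. \<tau> < d \<Longrightarrow> integral_mat (k \<tau>)"
  shows "h \<in> KK d n"
proof -
  have "minv (h \<tau>) = k \<tau>" "invertible_mat (h \<tau>)" if "\<tau> < d" for \<tau>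
    using minv_eqI[OF assms(1-4)[OF that]] invertible_matI[OF assms(1-4)[OF that]] by auto
  then show ?thesis using assms by (auto simp: KK_def GL_def integral_mat_def)
qed

text \<open>Permutation matrices lie in K, so the double coset of a diagonal matrix of powers of t
  depends only on the multiset of exponents.\<close>

definition perm_mat :: "nat \<Rightarrow> (nat \<Rightarrow> nat) \<Rightarrow> 'a::{zero,one} mat" where
  "perm_mat n p = mat n n (\<lambda>(i, j). if j = p i then 1 else 0)"

lemma perm_mat_carrier: "perm_mat n p \<in> carrier_mat n n"
  by (simp add: perm_mat_def)

lemma integral_perm_mat: "integral_mat (perm_mat n p)"
  by (subst integral_mat_iff[OF perm_mat_carrier]) (auto simp: perm_mat_def integers_L_0 integers_L_1)

lemma perm_mat_mult_right:
  fixes A :: "'a::semiring_1 mat"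
  assumes A: "A \<in> carrier_mat n n" and p: "p permutes {..<n}"
  shows "A * perm_mat n (inv_into UNIV p) = mat n n (\<lambda>(i, j). A $$ (i, p j))"
proof (rule eq_matI)
  fix i j assume "i < dim_row (mat n n (\<lambda>(i, j). A $$ (i, p j)))" "j < dim_col (mat n n (\<lambda>(i, j). A $$ (i, p j)))"
  then have ij: "i < n" "j < n" by auto
  have pj: "p j < n" using permutes_in_image[OF p, of j] ij by simp
  have "(A * perm_mat n (inv_into UNIV p)) $$ (i, j) = (\<Sum>k<n. A $$ (i, k) * (if j = inv_into UNIV p k then 1 else 0))"
    using A ij by (simp add: perm_mat_def scalar_prod_def atLeast0LessThan)
  also have "\<dots> = (\<Sum>k\<in>{p j}. A $$ (i, k) * (if j = inv_into UNIV p k then 1 else 0))"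
    using pj permutes_inverses[OF p] by (intro sum.mono_neutral_right) auto
  also have "\<dots> = A $$ (i, p j)" using permutes_inverses[OF p] by simp
  finally show "(A * perm_mat n (inv_into UNIV p)) $$ (i, j) = mat n n (\<lambda>(i, j). A $$ (i, p j)) $$ (i, j)" using ij by simp
qed (use A in \<open>auto simp: perm_mat_def\<close>)

lemma perm_mat_inverse: 
  assumes p: "p permutes {..<n}" 
  shows "perm_mat n p * perm_mat n (inv_into UNIV p) = (1\<^sub>m n :: 'a::semiring_1 mat)"
  unfolding perm_mat_mult_right[OF perm_mat_carrier p]
proof (rule eq_matI)
  fix i j assume "i < dim_row (1\<^sub>m n :: 'a mat)" "j < dim_col (1\<^sub>m n :: 'a mat)"
  then have ij: "i < n" "j < n" by auto
  moreover have "p j < n" using permutes_in_image[OF p, of j] ij by simp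
  moreover have "p j = p i \<longleftrightarrow> i = j" using permutes_inj[OF p] by (auto simp: inj_def)
  ultimately show "mat n n (\<lambda>(i, j). perm_mat n p $$ (i, p j)) $$ (i, j) = (1\<^sub>m n :: 'a mat) $$ (i, j)"
    by (simp add: perm_mat_def)
qed auto

lemma mat_diag_permute:
  assumes p: "p permutes {..<n}"
  shows "perm_mat n p * mat_diag n f * perm_mat n (inv_into UNIV p) = mat_diag n (\<lambda>l. f (p l) :: 'a::comm_ring_1)"
proof -
  have c: "perm_mat n p * mat_diag n f \<in> carrier_mat n n"
    by (rule mult_carrier_mat[OF perm_mat_carrier mat_diag_dim])
  show ?thesis
    unfolding perm_mat_mult_right[OF c p]
  proof (rule eq_matI)
    fix i j assume "i < dim_row (mat_diag n (\<lambda>l. f (p l)))" "j < dim_col (mat_diag n (\<lambda>l. f (p l)))"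
    then have ij: "i < n" "j < n" by (auto simp: mat_diag_def)
    moreover have "p j < n" using permutes_in_image[OF p, of j] ij by simp
    moreover have "p j = p i \<longleftrightarrow> i = j" using permutes_inj[OF p] by (auto simp: inj_def)
    ultimately show "mat n n (\<lambda>(i, j). (perm_mat n p * mat_diag n f) $$ (i, p j)) $$ (i, j) = mat_diag n (\<lambda>l. f (p l)) $$ (i, j)"
      unfolding mat_diag_mult_right[OF perm_mat_carrier] by (simp add: perm_mat_def mat_diag_def)
  qed (auto simp: mat_diag_def)
qed

context strata
begin

lemma Hodge_type_permutation:
  assumes H: "Hodge_type d n m \<mu> A" and \<tau>: "\<tau> < d"
  shows "\<exists>p. p permutes {..<n} \<and> (\<forall>l<n. \<phi> (amin ((\<tau> + 1) mod d) l) = \<mu> \<tau> (p l + 1))"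
proof -
  have sd: "(\<tau> + 1) mod d < d" using d by simp
  have "mset_set {b \<in> Ab. fst b = (\<tau> + 1) mod d} = image_mset (amin ((\<tau> + 1) mod d)) (mset_set {..<n})"
    using bij_amin[OF sd] by (simp add: bij_betw_def image_mset_mset_set)
  moreover have "mset_set {1..n} = image_mset Suc (mset_set {..<n})"
    by (simp add: image_mset_mset_set image_Suc_lessThan)
  moreover have "image_mset (\<mu> \<tau>) (mset_set {1..n}) = image_mset \<phi> (mset_set {b \<in> Ab. fst b = (\<tau> + 1) mod d})"
    using H \<tau> unfolding Hodge_type_def by blast
  ultimately have "image_mset (\<lambda>l. \<phi> (amin ((\<tau> + 1) mod d) l)) (mset_set {..<n}) = image_mset (\<lambda>l. \<mu> \<tau> (l + 1)) (mset_set {..<n})"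
    by (simp add: image_mset.compositionality o_def)
  from image_mset_eq_implies_permutes[OF finite_lessThan this] show ?thesis by (metis lessThan_iff)
qed

text \<open>With B the basis of \<Lambda>(x) and U the matrix of transported vectors, B^(-1)
  \<gamma> \<sigma>(B) equals B^(-1) U t^\<phi>. As B and U span the same lattice, B^(-1) U lies in
  K, and a permutation turns t^\<phi> into t^\<mu>.\<close>

lemma Lam_in_ADLV:
  assumes x: "x \<in> stratum_coords q d n m A \<iota>" and H: "Hodge_type d n m \<mu> A"
  shows "Lam x \<in> ADLV q d n m \<mu>"
proof -
  define U where "U \<tau> = cols_mat (tw \<tau> (\<lambda>l. vv x (amin ((\<tau> + 1) mod d) l)))" for \<tau>
  note U = Lam_cols[OF x, folded U_def]
  have Uc: "U \<tau> \<in> carrier_mat n n" for \<tau> by (simp add: U_def cols_mat_carrier)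
  have B: "basis_mat x \<tau> \<in> carrier_mat n n" "invertible_mat (basis_mat x \<tau>)" if "\<tau> < d" for \<tau>
    using basis_mat_GL[of x] that by (auto simp: GL_def)
  have "\<forall>\<tau>\<in>{..<d}. \<exists>p. p permutes {..<n} \<and> (\<forall>l<n. \<phi> (amin ((\<tau> + 1) mod d) l) = \<mu> \<tau> (p l + 1))"
    using Hodge_type_permutation[OF H] by simp
  from bchoice[OF this] obtain p where
    p: "\<And>\<tau>. \<tau> < d \<Longrightarrow> p \<tau> permutes {..<n}" "\<And>\<tau> l. \<tau> < d \<Longrightarrow> l < n \<Longrightarrow> \<phi> (amin ((\<tau> + 1) mod d) l) = \<mu> \<tau> (p \<tau> l + 1)"
    by auto
  have pinv: "inv_into UNIV (p \<tau>) permutes {..<n}" "inv_into UNIV (inv_into UNIV (p \<tau>)) = p \<tau>" if "\<tau> < d" for \<tau>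
    using permutes_inv[OF p(1)[OF that]] permutes_inv_inv[OF p(1)[OF that]] by auto
  define h where "h \<tau> = minv (basis_mat x \<tau>) * U \<tau> * perm_mat n (p \<tau>)" for \<tau>
  define k where "k \<tau> = perm_mat n (inv_into UNIV (p \<tau>)) * (minv (U \<tau>) * basis_mat x \<tau>)" for \<tau>
  define h' :: "nat \<Rightarrow> 'a fls mat" where "h' \<tau> = perm_mat n (inv_into UNIV (p \<tau>))" for \<tau>
  have P1: "perm_mat n (p \<tau>) * perm_mat n (inv_into UNIV (p \<tau>)) = (1\<^sub>m n :: 'a fls mat)"
    "perm_mat n (inv_into UNIV (p \<tau>)) * perm_mat n (p \<tau>) = (1\<^sub>m n :: 'a fls mat)" if "\<tau> < d" for \<tau>
    using perm_mat_inverse[OF p(1)[OF that]] perm_mat_inverse[OF pinv(1)[OF that]] pinv(2)[OF that] by auto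
  have Pc: "perm_mat n q \<in> carrier_mat n n" for q by (rule perm_mat_carrier)
  have "h \<in> KK d n"
  proof (rule KK_I[of d h n k])
    fix \<tau> assume \<tau>: "\<tau> < d"
    note b = B[OF \<tau>] minv[OF B[OF \<tau>]] and u = Uc[of \<tau>] minv[OF Uc U(3)[OF \<tau>]]
    show "h \<tau> \<in> carrier_mat n n" unfolding h_def by (intro mult_carrier_mat[of _ n n] b u Pc)
    show "k \<tau> \<in> carrier_mat n n" unfolding k_def by (intro mult_carrier_mat[of _ n n] b u Pc)
    have c1: "minv (basis_mat x \<tau>) * U \<tau> \<in> carrier_mat n n" "minv (U \<tau>) * basis_mat x \<tau> \<in> carrier_mat n n"
      by (intro mult_carrier_mat[of _ n n] b u)+
    have cancel: "(a * y) * (z * b) = 1\<^sub>m n"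
      if "a \<in> carrier_mat n n" "b \<in> carrier_mat n n" "y \<in> carrier_mat n n" "z \<in> carrier_mat n n"
        "y * z = 1\<^sub>m n" "a * b = 1\<^sub>m n" for a b y z :: "'a fls mat"
    proof -
      have "(a * y) * (z * b) = a * (y * (z * b))"
        by (rule assoc_mult_mat[OF that(1,3) mult_carrier_mat[OF that(4,2)]])
      also have "y * (z * b) = (y * z) * b" by (rule assoc_mult_mat[OF that(3,4,2), symmetric])
      finally show ?thesis using that by simp
    qed
    have i1: "(minv (basis_mat x \<tau>) * U \<tau>) * (minv (U \<tau>) * basis_mat x \<tau>) = 1\<^sub>m n"
      by (rule cancel[OF b(3,1) u(1,2,3) b(5)])
    have i2: "(minv (U \<tau>) * basis_mat x \<tau>) * (minv (basis_mat x \<tau>) * U \<tau>) = 1\<^sub>m n"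
      by (rule cancel[OF u(2,1) b(1,3,4) u(4)])
    show "h \<tau> * k \<tau> = 1\<^sub>m n" unfolding h_def k_def
      by (rule cancel[OF c1 Pc Pc P1(1)[OF \<tau>] i1])
    show "k \<tau> * h \<tau> = 1\<^sub>m n" unfolding h_def k_def
      by (rule cancel[OF Pc Pc c1(2,1) i2 P1(2)[OF \<tau>]])
    have "integral_mat (minv (basis_mat x \<tau>) * U \<tau>)" "integral_mat (minv (U \<tau>) * basis_mat x \<tau>)"
      using latt_eq_integral[OF n b(1,2) u(1)] latt_eq_integral[OF n u(1) U(3)[OF \<tau>] b(1)] U(2)[OF \<tau>] by auto
    then show "integral_mat (h \<tau>)" "integral_mat (k \<tau>)" unfolding h_def k_def
      by (auto intro!: integral_mat_mult[OF c1(1) Pc] integral_mat_mult[OF Pc c1(2)] integral_perm_mat)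
  qed
  moreover have "h' \<in> KK d n"
    by (rule KK_I[of d h' n "\<lambda>\<tau>. perm_mat n (p \<tau>)"])
       (simp_all add: h'_def perm_mat_carrier P1 integral_perm_mat)
  moreover have "minv (basis_mat x \<tau>) * gamma n m \<tau> * sigma_G q d (basis_mat x) \<tau> = h \<tau> * t_pow n \<mu> \<tau> * h' \<tau>"
    if \<tau>: "\<tau> < d" for \<tau>
  proof -
    note b = B[OF \<tau>] minv[OF B[OF \<tau>]]
    let ?D = "mat_diag n (\<lambda>l. fls_X_intpow (\<phi> (amin ((\<tau> + 1) mod d) l)))"
    let ?P = "perm_mat n (p \<tau>)" and ?P' = "perm_mat n (inv_into UNIV (p \<tau>))"
    have tc: "t_pow n \<mu> \<tau> \<in> carrier_mat n n" by (simp add: t_pow_def)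
    have D: "?D = ?P * t_pow n \<mu> \<tau> * ?P'"
      unfolding t_pow_def mat_diag_permute[OF p(1)[OF \<tau>]]
      by (rule eq_matI) (auto simp: mat_diag_def p(2)[OF \<tau>, simplified])
    have Fc: "map_mat (frob q) (basis_mat x ((\<tau> + 1) mod d)) \<in> carrier_mat n n" using basis_mat_carrier by simp
    have bU: "minv (basis_mat x \<tau>) * U \<tau> \<in> carrier_mat n n" by (rule mult_carrier_mat[OF b(3) Uc])
    have "minv (basis_mat x \<tau>) * gamma n m \<tau> * sigma_G q d (basis_mat x) \<tau>
        = minv (basis_mat x \<tau>) * (gamma n m \<tau> * map_mat (frob q) (basis_mat x ((\<tau> + 1) mod d)))"
      unfolding sigma_G_def by (rule assoc_mult_mat[OF b(3) gamma_carrier Fc])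
    also have "\<dots> = minv (basis_mat x \<tau>) * U \<tau> * ?D"
      unfolding U(4)[OF \<tau>] by (rule assoc_mult_mat[OF b(3) Uc mat_diag_dim, symmetric])
    also have "\<dots> = (minv (basis_mat x \<tau>) * U \<tau> * (?P * t_pow n \<mu> \<tau>)) * ?P'"
      unfolding D by (rule assoc_mult_mat[OF bU mult_carrier_mat[OF Pc tc] Pc, symmetric])
    also have "minv (basis_mat x \<tau>) * U \<tau> * (?P * t_pow n \<mu> \<tau>) = h \<tau> * t_pow n \<mu> \<tau>"
      unfolding h_def by (rule assoc_mult_mat[OF bU Pc tc, symmetric])
    finally show ?thesis by (simp add: h'_def)
  qed
  ultimately show ?thesis
    unfolding ADLV_def using basis_mat_GL Lam_lattice_of by blast
qed

end

text \<open>Minusculity of the relative position as two inclusions: \<gamma>\<sigma> maps the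
  lattice into t^c \<Lambda>, and its image contains t^(c+1) \<Lambda>. It is interpreted with
  \<open>c\<close> the smallest entry of \<mu> at each component.\<close>

locale hodge_lattice = gamma_sigma_setup q K d n m
  for q and K :: "'k::alg_closed_field itself" and d n m +
  fixes \<Lambda> :: "nat \<Rightarrow> 'k fls vec set" and c :: "nat \<Rightarrow> int"
  assumes lattice: "\<And>\<tau>. \<tau> < d \<Longrightarrow> olattice n (\<Lambda> \<tau>)"
    and c_nonneg: "\<And>\<tau>. \<tau> < d \<Longrightarrow> 0 \<le> c \<tau>"
    and divisible: "\<And>\<tau> w. \<tau> < d \<Longrightarrow> w \<in> \<Lambda> ((\<tau> + 1) mod d) \<Longrightarrow>
      fls_X_intpow (- c \<tau>) \<cdot>\<^sub>v gs ((\<tau> + 1) mod d) w \<in> \<Lambda> \<tau>"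
    and surjective: "\<And>\<tau> u. \<tau> < d \<Longrightarrow> u \<in> \<Lambda> \<tau> \<Longrightarrow>
      \<exists>w\<in>\<Lambda> ((\<tau> + 1) mod d). gs ((\<tau> + 1) mod d) w = fls_X_intpow (c \<tau> + 1) \<cdot>\<^sub>v u"
begin

definition SM :: "(nat \<times> int) set" where "SM = {a. fst a < d \<and> snd a \<in> leads n (\<Lambda> (fst a))}"

text \<open>Stability under \<open>f\<close> comes from \<open>c_nonneg\<close>, by which
  \<gamma>\<sigma> preserves the lattices. Every class modulo \<open>n\<close> is met because the
  basis vectors of large index belong to the lattice.\<close>

lemma semi_module_SM: "semi_module d n m SM"
  unfolding semi_module_def
proof (intro conjI)
  show "SM \<subseteq> Oset d" by (auto simp: SM_def Oset_def)
  have "\<forall>\<tau>\<in>{..<d}. \<exists>e. \<forall>w\<in>\<Lambda> \<tau>. low n w e" using olatticeD(5)[OF lattice] by blast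
  from bchoice[OF this] obtain e where e: "\<And>\<tau> w. \<tau> < d \<Longrightarrow> w \<in> \<Lambda> \<tau> \<Longrightarrow> low n w (e \<tau>)" by blast
  have "Min (e ` {..<d}) \<le> snd a" if a: "a \<in> SM" for a
  proof -
    obtain w where "w \<in> \<Lambda> (fst a)" "lead n w (snd a)" "fst a < d" using a by (auto simp: SM_def leads_def)
    then have "e (fst a) \<le> snd a" using lead_ge[OF n \<open>lead n w (snd a)\<close> e] by blast
    moreover have "e (fst a) \<in> e ` {..<d}" using \<open>fst a < d\<close> by simp
    ultimately show ?thesis by (meson Min_le finite_imageI finite_lessThan order.trans)
  qed
  then show "\<exists>e. \<forall>a\<in>SM. e \<le> snd a" by blast
  show "(\<lambda>a. shift a (int n)) ` SM \<subseteq> SM"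
  proof (rule image_subsetI)
    fix a assume "a \<in> SM"
    then obtain w where w: "w \<in> \<Lambda> (fst a)" "lead n w (snd a)" "fst a < d" by (auto simp: SM_def leads_def)
    have "lead n (fls_X_intpow 1 \<cdot>\<^sub>v w) (snd a + int n)" using lead_X_intpow[OF n w(2), of 1] by simp
    moreover have "fls_X_intpow 1 \<cdot>\<^sub>v w \<in> \<Lambda> (fst a)"
      using olatticeD(3)[OF lattice[OF w(3)] integers_L_X_intpow w(1), of 1] by simp
    ultimately have "snd a + int n \<in> leads n (\<Lambda> (fst a))" unfolding leads_def by blast
    then show "shift a (int n) \<in> SM" using w(3) by (simp add: SM_def shift_def)
  qed
  show "ff d m ` SM \<subseteq> SM"
  proof (rule image_subsetI)
    fix a assume "a \<in> SM"
    then obtain w where w: "w \<in> \<Lambda> (fst a)" "lead n w (snd a)" "fst a < d" by (auto simp: SM_def leads_def)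
    let ?\<tau> = "pred_d (fst a)"
    have \<tau>: "?\<tau> < d" by (rule pred_d_less)
    have "fls_X_intpow (- c ?\<tau>) \<cdot>\<^sub>v gs (fst a) w \<in> \<Lambda> ?\<tau>"
      using divisible[OF \<tau>, of w] w(1) Suc_pred_d[OF w(3)] by simp
    from olatticeD(3)[OF lattice[OF \<tau>] integers_L_X_intpow[OF c_nonneg[OF \<tau>]] this]
    have "gs (fst a) w \<in> \<Lambda> ?\<tau>"
    proof -
      have "fls_X_intpow (c ?\<tau>) * fls_X_intpow (- c ?\<tau>) = (1 :: 'k fls)"
        unfolding fls_X_intpow_times_fls_X_intpow by (intro fls_eqI) simp
      then show ?thesis
        using \<open>fls_X_intpow (c ?\<tau>) \<cdot>\<^sub>v (fls_X_intpow (- c ?\<tau>) \<cdot>\<^sub>v gs (fst a) w) \<in> \<Lambda> ?\<tau>\<close>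
        by (simp only: smult_smult_assoc one_smult_vec)
    qed
    moreover have "lead n (gs (fst a) w) (snd a + offset (fst a))"
      using lead_gs_iff[OF lead_carrier[OF n w(2)] w(3)] w(2) by blast
    ultimately have "snd a + offset (fst a) \<in> leads n (\<Lambda> ?\<tau>)" unfolding leads_def by blast
    then show "ff d m a \<in> SM" using w(3) \<tau> by (simp add: SM_def ff_eq)
  qed
  show "{shift a (int n * k) | a k. a \<in> SM} = Oset d"
  proof (intro equalityI subsetI)
    fix a assume "a \<in> Oset d"
    then have a: "fst a < d" by (auto simp: Oset_def)
    obtain C where C: "\<And>w. low n w C \<Longrightarrow> w \<in> \<Lambda> (fst a)" using olatticeD(4)[OF lattice[OF a]] by blast
    define k where "k = \<bar>C\<bar> + \<bar>snd a\<bar>"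
    have "1 * k \<le> int n * k" using n by (intro mult_right_mono) (auto simp: k_def)
    then have i: "C \<le> snd a + int n * k" by (simp add: k_def)
    have "low n (evec n (snd a + int n * k)) C" using i evec_carrier[OF n] by (auto simp: low_def ecoeff_evec[OF n])
    then have "evec n (snd a + int n * k) \<in> \<Lambda> (fst a)" by (rule C)
    moreover have "lead n (evec n (snd a + int n * k)) (snd a + int n * k)"
      using evec_carrier[OF n] by (auto simp: lead_def low_def ecoeff_evec[OF n])
    ultimately have "snd a + int n * k \<in> leads n (\<Lambda> (fst a))" unfolding leads_def by blast
    then have "shift a (int n * k) \<in> SM" using a by (simp add: SM_def shift_def)
    moreover have "a = shift (shift a (int n * k)) (int n * (- k))" by (simp add: shift_def)
    ultimately show "a \<in> {shift a (int n * k) | a k. a \<in> SM}" by blast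
  qed (auto simp: SM_def Oset_def shift_def)
qed

end

locale hodge_strata = hodge_lattice +
  fixes \<iota> :: nat
  assumes iota_less: "\<iota> < d"

sublocale hodge_strata \<subseteq> strata q K d n m SM \<iota>
  by unfold_locales (rule d, rule n, rule semi_module_SM, rule iota_less)

context hodge_strata
begin

lemma leads_SM: "\<tau> < d \<Longrightarrow> leads n (\<Lambda> \<tau>) = {i. (\<tau>, i) \<in> SM}"
  by (simp add: SM_def)

text \<open>The lattice vector t^(-c) \<gamma>\<sigma>(w) has leading index r(b) + n (\<phi>(b) -
  c), and nothing below r(b) in its class modulo \<open>n\<close> belongs to the
  semi-module.\<close>

lemma phi_ge:
  assumes b: "b \<in> Ab"
  shows "c (pred_d (fst b)) \<le> \<phi> b"
proof -
  let ?\<tau> = "pred_d (fst b)"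
  have \<tau>: "?\<tau> < d" by (rule pred_d_less)
  note bd = Ab_fst[OF b]
  obtain w where w: "w \<in> \<Lambda> (fst b)" "lead n w (snd b)" using Ab_A[OF b] by (auto simp: SM_def leads_def)
  have "fls_X_intpow (- c ?\<tau>) \<cdot>\<^sub>v gs (fst b) w \<in> \<Lambda> ?\<tau>"
    using divisible[OF \<tau>, of w] w(1) Suc_pred_d[OF bd] by simp
  moreover have "lead n (fls_X_intpow (- c ?\<tau>) \<cdot>\<^sub>v gs (fst b) w) (snd b + offset (fst b) - int n * c ?\<tau>)"
    using lead_X_intpow[OF n, of "gs (fst b) w" "snd b + offset (fst b)" "- c ?\<tau>"]
      lead_gs_iff[OF lead_carrier[OF n w(2)] bd, of "snd b"] w(2) by simp
  ultimately have "(?\<tau>, snd b + offset (fst b) - int n * c ?\<tau>) \<in> SM"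
    using \<tau> by (auto simp: SM_def leads_def)
  then have "shift (\<rho> b) (int n * (\<phi> b - c ?\<tau>)) \<in> SM"
    using fst_rr_pred[OF b] snd_rr[OF b] by (simp add: shift_def algebra_simps)
  moreover have "nu (shift (\<rho> b) (int n * (\<phi> b - c ?\<tau>))) = \<phi> b - c ?\<tau>"
    using rr_in_Ab[of b] Ab_fst[OF rr_in_Ab[of b]] by (intro nu_eqI) (auto simp: shift_def)
  ultimately show ?thesis
    using Ab_fst[OF rr_in_Ab[of b]] in_A_iff[of "shift (\<rho> b) (int n * (\<phi> b - c ?\<tau>))"] by simp
qed

text \<open>For \<open>u\<close> with leading index r(b), the vector t^(c+1) u has a preimage
  \<open>w\<close> under \<gamma>\<sigma>, with leading index b + n (c + 1 - \<phi>(b)); this cannot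
  lie below b. If \<phi>(b) = c + 1, then \<open>w\<close> is adapted to b. Otherwise \<phi>(b) = c,
  and every lattice vector with leading index b is adapted.\<close>

lemma phi_le_and_adapted:
  assumes b: "b \<in> Ab"
  shows "\<phi> b \<le> c (pred_d (fst b)) + 1" and "\<exists>w\<in>\<Lambda> (fst b). lead n w (snd b) \<and> tgs b w \<in> \<Lambda> (fst (\<rho> b))"
proof -
  let ?\<tau> = "pred_d (fst b)"
  have \<tau>: "?\<tau> < d" by (rule pred_d_less)
  note bd = Ab_fst[OF b]
  obtain u where u: "u \<in> \<Lambda> ?\<tau>" "lead n u (snd (\<rho> b))"
    using Ab_A[OF rr_in_Ab[of b]] fst_rr_pred[OF b] by (auto simp: SM_def leads_def)
  obtain w where w: "w \<in> \<Lambda> (fst b)" "gs (fst b) w = fls_X_intpow (c ?\<tau> + 1) \<cdot>\<^sub>v u"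
    using surjective[OF \<tau> u(1)] Suc_pred_d[OF bd] by auto
  have wc: "w \<in> carrier_vec n" using olatticeD(1)[OF lattice[OF bd] w(1)] .
  have "lead n (gs (fst b) w) (snd (\<rho> b) + int n * (c ?\<tau> + 1))"
    unfolding w(2) by (rule lead_X_intpow[OF n u(2)])
  then have "lead n (gs (fst b) w) (snd b + int n * (c ?\<tau> + 1 - \<phi> b) + offset (fst b))"
    unfolding snd_rr[OF b] by (simp add: algebra_simps)
  then have lw: "lead n w (snd b + int n * (c ?\<tau> + 1 - \<phi> b))" by (simp only: lead_gs_iff[OF wc bd])
  then have "shift b (int n * (c ?\<tau> + 1 - \<phi> b)) \<in> SM"
    using w(1) bd by (auto simp: SM_def leads_def shift_def)
  moreover have "nu (shift b (int n * (c ?\<tau> + 1 - \<phi> b))) = c ?\<tau> + 1 - \<phi> b"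
    using b bd by (intro nu_eqI) (auto simp: shift_def)
  ultimately show le: "\<phi> b \<le> c ?\<tau> + 1"
    using bd in_A_iff[of "shift b (int n * (c ?\<tau> + 1 - \<phi> b))"] by simp
  show "\<exists>w\<in>\<Lambda> (fst b). lead n w (snd b) \<and> tgs b w \<in> \<Lambda> (fst (\<rho> b))"
  proof (cases "\<phi> b = c ?\<tau> + 1")
    case True
    have "fls_X_intpow (- \<phi> b) * fls_X_intpow (c ?\<tau> + 1) = (1 :: 'a fls)"
      unfolding fls_X_intpow_times_fls_X_intpow True by (intro fls_eqI) simp
    then have "tgs b w = u" unfolding tgs_def w(2) smult_smult_assoc by simp
    then show ?thesis using lw w(1) u(1) True fst_rr_pred[OF b] by auto
  next
    case False
    then have phi: "\<phi> b = c ?\<tau>" using phi_ge[OF b] le by simp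
    obtain w' where w': "w' \<in> \<Lambda> (fst b)" "lead n w' (snd b)" using Ab_A[OF b] by (auto simp: SM_def leads_def)
    have "tgs b w' \<in> \<Lambda> ?\<tau>"
      using divisible[OF \<tau>, of w'] w'(1) Suc_pred_d[OF bd] by (simp add: tgs_def phi)
    then show ?thesis using w' fst_rr_pred[OF b] by auto
  qed
qed

end

sublocale hodge_strata \<subseteq> strata_lattice q K d n m SM \<iota> \<Lambda>
proof unfold_locales
  show "\<phi> b \<le> \<phi> b' + 1" if "b \<in> Ab" "b' \<in> Ab" "fst b = fst b'" for b b'
    using phi_le_and_adapted(1)[OF that(1)] phi_ge[OF that(2)] that(3) by simp
  show "\<exists>w\<in>\<Lambda> (fst b). lead n w (snd b) \<and> tgs b w \<in> \<Lambda> (fst (\<rho> b))" if "b \<in> Ab" for b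
    by (rule phi_le_and_adapted(2)[OF that])
  show "leads n (\<Lambda> \<tau>) = {i. (\<tau>, i) \<in> SM}" if "\<tau> < d" for \<tau> by (rule leads_SM[OF that])
qed (rule lattice)

section \<open>Local closedness\<close>

text \<open>With poles bounded by \<open>N\<close> the range of summation is independent of
  \<open>f\<close>, so a coefficient of the product is a polynomial in the coefficients of
  \<open>f\<close>.\<close>

lemma fls_nth_mult_bounded:
  fixes f g :: "'k::field fls"
  assumes f: "\<And>k. k < - int N \<Longrightarrow> fls_nth f k = 0" and g: "g \<in> integers_L"
  shows "fls_nth (f * g) K = (\<Sum>k\<in>{- int N..K}. fls_nth f k * fls_nth g (K - k))"
proof (cases "f = 0 \<or> g = 0")
  case False
  then have sd: "- int N \<le> fls_subdegree f" "0 \<le> fls_subdegree g"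
    using f g by (auto intro!: fls_subdegree_geI simp: integers_L_iff)
  have "fls_nth (f * g) K = (\<Sum>k=fls_subdegree f..K - fls_subdegree g. fls_nth f k * fls_nth g (K - k))"
    by (rule fls_times_nth(2))
  also have "\<dots> = (\<Sum>k\<in>{- int N..K}. fls_nth f k * fls_nth g (K - k))"
    using sd by (intro sum.mono_neutral_left) auto
  finally show ?thesis .
qed auto

definition lead_set :: "nat \<Rightarrow> nat \<Rightarrow> (nat \<Rightarrow> 'k::field fls vec set) \<Rightarrow> (nat \<times> int) set" where
  "lead_set d n \<Lambda> = {a. fst a < d \<and> snd a \<in> leads n (\<Lambda> (fst a))}"

context
  fixes n :: nat
  assumes n: "n \<ge> 1"
begin

lemma finite_leads:
  assumes L: "olattice n \<Lambda>"
  shows "finite {i \<in> leads n \<Lambda>. i < I}"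
proof -
  obtain c where "\<And>w. w \<in> \<Lambda> \<Longrightarrow> low n w c" using olatticeD(5)[OF L] by blast
  then have "c \<le> i" if "i \<in> leads n \<Lambda>" for i
    using that lead_ge[OF n, of _ i c] by (auto simp: leads_def)
  then have "{i \<in> leads n \<Lambda>. i < I} \<subseteq> {c..<I}" by auto
  then show ?thesis using finite_subset by blast
qed

text \<open>The leading indices below \<open>I\<close> are the pivots of the coefficients at indices
  below \<open>I\<close>. So their number is the rank of \<Lambda> in these coefficients, and a rank
  is bounded by minors.\<close>

lemma card_leads_le_iff:
  fixes \<Lambda> :: "'k::field fls vec set"
  assumes L: "olattice n \<Lambda>"
  shows "card {i \<in> leads n \<Lambda>. i < I} \<le> r \<longleftrightarrow> (\<forall>u i. (\<forall>a\<le>r. u a \<in> \<Lambda>) \<longrightarrow> (\<forall>b\<le>r. i b < I) \<longrightarrow>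
    det (mat (Suc r) (Suc r) (\<lambda>(b, a). ecoeff n (u a) (i b))) = 0)"
proof
  assume card: "card {i \<in> leads n \<Lambda>. i < I} \<le> r"
  show "\<forall>u i. (\<forall>a\<le>r. u a \<in> \<Lambda>) \<longrightarrow> (\<forall>b\<le>r. i b < I) \<longrightarrow>
    det (mat (Suc r) (Suc r) (\<lambda>(b, a). ecoeff n (u a) (i b))) = 0"
  proof (intro allI impI)
    fix u and i :: "nat \<Rightarrow> int" assume u: "\<forall>a\<le>r. u a \<in> \<Lambda>" and i: "\<forall>b\<le>r. i b < I"
    obtain s where s: "set s = {i \<in> leads n \<Lambda>. i < I}" "distinct s"
      using finite_distinct_list[OF finite_leads[OF L]] by blast
    then have len: "length s \<le> r" using card distinct_card[OF s(2)] by simp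
    \<comment> \<open>The coefficients at the leading indices below \<open>I\<close>, filled up with
      zero rows to a square matrix. A kernel vector combines the \<open>u a\<close> to an element
      without a leading index below \<open>I\<close>, so all its coefficients below \<open>I\<close>
      vanish.\<close>
    define M where "M = mat (Suc r) (Suc r) (\<lambda>(b, a). if b < length s then ecoeff n (u a) (s ! b) else 0)"
    have Mc: "M \<in> carrier_mat (Suc r) (Suc r)" by (simp add: M_def)
    have "det M = 0"
      unfolding det_def'[OF Mc]
    proof (rule sum.neutral, rule ballI)
      fix p assume "p \<in> {p. p permutes {0..<Suc r}}"
      then have p: "p permutes {0..<Suc r}" by simp
      have "p r < Suc r" using permutes_in_image[OF p, of r] by simp
      then have "M $$ (r, p r) = 0" using len by (simp add: M_def)
      then have "(\<Prod>i = 0..<Suc r. M $$ (i, p i)) = 0" by (intro prod_zero) auto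
      then show "signof p * (\<Prod>i = 0..<Suc r. M $$ (i, p i)) = 0" by simp
    qed
    then obtain c where c: "c \<in> carrier_vec (Suc r)" "c \<noteq> 0\<^sub>v (Suc r)" "M *\<^sub>v c = 0\<^sub>v (Suc r)"
      using det_0_iff_vec_prod_zero_field[OF Mc] by blast
    define v where "v = vec n (\<lambda>l. \<Sum>a\<in>{..r}. (fls_const (c $ a) \<cdot>\<^sub>v u a) $ l)"
    have vL: "v \<in> \<Lambda>" unfolding v_def
      using u olatticeD(3)[OF L integers_L_const] by (intro olattice_vec_sum[OF n L]) auto
    have ev: "ecoeff n v j = (\<Sum>a\<le>r. c $ a * ecoeff n (u a) j)" for j
      unfolding v_def ecoeff_vec_sum[OF n]
      using u olatticeD(1)[OF L] by (intro sum.cong refl ecoeff_const_smult[OF n]) auto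
    have v0: "ecoeff n v (s ! b) = 0" if b: "b < length s" for b
    proof -
      have "(M *\<^sub>v c) $ b = 0" using c(3) b len by simp
      moreover have "(M *\<^sub>v c) $ b = (\<Sum>a\<in>{0..<Suc r}. ecoeff n (u a) (s ! b) * c $ a)"
        using b len c(1) by (simp add: M_def scalar_prod_def)
      moreover have "{0..<Suc r} = {..r}" by auto
      ultimately show ?thesis unfolding ev by (simp add: mult.commute)
    qed
    have vI: "ecoeff n v j = 0" if j: "j < I" for j
    proof (cases "v = 0\<^sub>v n")
      case True
      then show ?thesis by (simp add: ecoeff_0[OF n])
    next
      case False
      then obtain k where k: "lead n v k" using ex_lead[OF n olatticeD(1)[OF L vL]] by blast
      have "I \<le> k"
      proof (rule ccontr)
        assume "\<not> I \<le> k"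
        then have "k \<in> set s" using k vL by (auto simp: s leads_def)
        then obtain b where "b < length s" "s ! b = k" by (auto simp: in_set_conv_nth)
        then show False using v0 k by (auto simp: lead_def)
      qed
      then show ?thesis using k j by (auto simp: lead_def low_def)
    qed
    let ?N = "mat (Suc r) (Suc r) (\<lambda>(b, a). ecoeff n (u a) (i b))"
    have "?N *\<^sub>v c = 0\<^sub>v (Suc r)"
    proof (rule eq_vecI)
      fix b assume "b < dim_vec (0\<^sub>v (Suc r) :: 'k vec)"
      then have b: "b \<le> r" by simp
      have "(?N *\<^sub>v c) $ b = (\<Sum>a\<in>{0..<Suc r}. ecoeff n (u a) (i b) * c $ a)"
        using b c(1) by (simp add: scalar_prod_def)
      also have "\<dots> = ecoeff n v (i b)" unfolding ev by (intro sum.cong) (auto simp: mult.commute)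
      also have "\<dots> = 0" using vI i b by blast
      finally show "(?N *\<^sub>v c) $ b = (0\<^sub>v (Suc r)) $ b" using b by simp
    qed simp
    moreover have "?N \<in> carrier_mat (Suc r) (Suc r)" by simp
    ultimately show "det ?N = 0" using det_0_iff_vec_prod_zero_field c(1,2) by blast
  qed
next
  assume *: "\<forall>u i. (\<forall>a\<le>r. u a \<in> \<Lambda>) \<longrightarrow> (\<forall>b\<le>r. i b < I) \<longrightarrow>
    det (mat (Suc r) (Suc r) (\<lambda>(b, a). ecoeff n (u a) (i b))) = 0"
  show "card {i \<in> leads n \<Lambda>. i < I} \<le> r"
  proof (rule ccontr)
    assume "\<not> card {i \<in> leads n \<Lambda>. i < I} \<le> r"
    then have "Suc r \<le> card {i \<in> leads n \<Lambda>. i < I}" by simp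
    then obtain T where T: "T \<subseteq> {i \<in> leads n \<Lambda>. i < I}" "card T = Suc r" "finite T"
      by (rule obtain_subset_with_card_n) blast
    \<comment> \<open>In increasing order the chosen leading indices make the matrix triangular with
      nonzero diagonal.\<close>
    define i where "i b = sorted_list_of_set T ! b" for b
    have len: "length (sorted_list_of_set T) = Suc r" using T(2) by simp
    have iT: "i b \<in> T" if "b \<le> r" for b
      using that len nth_mem[of b "sorted_list_of_set T"] T(3) by (simp add: i_def)
    have less: "i b < i a" if "b < a" "a \<le> r" for a b
      using that len strict_sorted_list_of_set[of T] unfolding i_def sorted_wrt_iff_nth_less by simp
    have "\<forall>a\<in>{..r}. \<exists>w. w \<in> \<Lambda> \<and> lead n w (i a)" using iT T(1) by (fastforce simp: leads_def)
    from bchoice[OF this] obtain u where u: "\<And>a. a \<le> r \<Longrightarrow> u a \<in> \<Lambda>" "\<And>a. a \<le> r \<Longrightarrow> lead n (u a) (i a)" by auto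
    let ?N = "mat (Suc r) (Suc r) (\<lambda>(b, a). ecoeff n (u a) (i b))"
    have "det ?N = prod_list (diag_mat ?N)"
    proof (rule det_lower_triangular)
      fix b a assume "b < a" "a < Suc r"
      then show "?N $$ (b, a) = 0" using less[of b a] u(2)[of a] by (auto simp: lead_def low_def)
    qed simp
    also have "\<dots> \<noteq> 0" using u(2) by (simp add: prod_list_diag_prod lead_def)
    finally have "det ?N \<noteq> 0" .
    moreover have "i b < I" if "b \<le> r" for b using iT[OF that] T(1) by auto
    ultimately show False using * u(1) by blast
  qed
qed

text \<open>The minors are taken for the vectors g w with fixed integral \<open>w\<close>; as long
  as the poles of \<open>g\<close> are bounded, their coefficients are polynomials in the
  coordinates of \<open>g\<close>.\<close>

lemma Grass_closed_card_leads:
  assumes \<tau>: "\<tau> < d"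
  shows "Grass_closed d n {\<Lambda> \<in> Grass d n. card {i \<in> leads n (\<Lambda> \<tau> :: 'k::field fls vec set). i < I} \<le> r}"
  unfolding Grass_closed_def
proof (intro conjI allI)
  fix N :: nat
  define P :: "'k fls vec \<Rightarrow> int \<Rightarrow> (bool \<times> nat \<times> nat \<times> nat \<times> int \<Rightarrow> 'k) \<Rightarrow> 'k" where
    "P w i y = (\<Sum>l<n. \<Sum>k\<in>{- int N..(i - 1) div int n}.
      y (True, \<tau>, nat ((i - 1) mod int n), l, k) * fls_nth (w $ l) ((i - 1) div int n - k))" for w i y
  have P_poly: "P w i \<in> polyfun (LG_index d n)" for w i
    unfolding P_def using \<tau> index_mod_less[OF n, of i]
    by (intro polyfun_sum polyfun.mult polyfun.const polyfun.var) (auto simp: LG_index_def)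
  have P: "P w i (LG_coord g) = ecoeff n (g \<tau> *\<^sub>v w) i" if g: "g \<in> LG_bounded d n N" and w: "integral_vec n w" for g w i
  proof -
    let ?row = "nat ((i - 1) mod int n)" and ?K = "(i - 1) div int n"
    have gc: "g \<tau> \<in> carrier_mat n n" using g \<tau> by (auto simp: LG_bounded_def GL_def)
    have wc: "w \<in> carrier_vec n" using w by (simp add: integral_vec_def)
    have "(g \<tau> *\<^sub>v w) $ ?row = (\<Sum>l<n. g \<tau> $$ (?row, l) * w $ l)"
      using carrier_matD[OF gc] carrier_vecD[OF wc] index_mod_less[OF n, of i]
      by (auto simp: scalar_prod_def atLeast0LessThan intro!: sum.cong)
    then have "ecoeff n (g \<tau> *\<^sub>v w) i = fls_nth (\<Sum>l<n. g \<tau> $$ (?row, l) * w $ l) ?K"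
      by (simp add: ecoeff_def)
    also have "\<dots> = (\<Sum>l<n. \<Sum>k\<in>{- int N..?K}. fls_nth (g \<tau> $$ (?row, l)) k * fls_nth (w $ l) (?K - k))"
      unfolding fls_nth_sum using g w \<tau> index_mod_less[OF n, of i]
      by (intro sum.cong refl fls_nth_mult_bounded) (auto simp: LG_bounded_def integral_vec_def)
    finally show ?thesis by (simp add: P_def LG_coord_def)
  qed
  define S where "S = {(\<lambda>y. det (mat (Suc r) (Suc r) (\<lambda>(b, a). P (w a) (i b) y))) | w i.
    (\<forall>a\<le>r. integral_vec n (w a)) \<and> (\<forall>b\<le>r. i b < I)}"
  have "(\<lambda>y. det (mat (Suc r) (Suc r) (\<lambda>(b, a). P (w a) (i b) y))) \<in> polyfun (LG_index d n)" for w i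
    by (intro polyfun_det P_poly)
  then have S_poly: "S \<subseteq> polyfun (LG_index d n)" unfolding S_def by blast
  have S_iff: "lattice_of d n g \<in> {\<Lambda> \<in> Grass d n. card {i \<in> leads n (\<Lambda> \<tau>). i < I} \<le> r} \<longleftrightarrow> (\<forall>Q\<in>S. Q (LG_coord g) = 0)"
    if g: "g \<in> LG_bounded d n N" for g
  proof -
    have gc: "g \<tau> \<in> carrier_mat n n" "invertible_mat (g \<tau>)" using g \<tau> by (auto simp: LG_bounded_def GL_def)
    have L: "lattice_of d n g \<tau> = latt n (g \<tau>)" by (rule lattice_of_eq[OF \<tau>])
    have "lattice_of d n g \<in> {\<Lambda> \<in> Grass d n. card {i \<in> leads n (\<Lambda> \<tau>). i < I} \<le> r} \<longleftrightarrow>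
      (\<forall>u i. (\<forall>a\<le>r. u a \<in> latt n (g \<tau>)) \<longrightarrow> (\<forall>b\<le>r. i b < I) \<longrightarrow>
        det (mat (Suc r) (Suc r) (\<lambda>(b, a). ecoeff n (u a) (i b))) = 0)"
      using LG_bounded_lattice_of[OF g] card_leads_le_iff[OF olattice_latt[OF n gc]] by (simp add: L)
    also have "\<dots> \<longleftrightarrow> (\<forall>w i. (\<forall>a\<le>r. integral_vec n (w a)) \<longrightarrow> (\<forall>b\<le>r. i b < I) \<longrightarrow>
        det (mat (Suc r) (Suc r) (\<lambda>(b, a). ecoeff n (g \<tau> *\<^sub>v w a) (i b))) = 0)"
    proof (intro iffI allI impI)
      fix w :: "nat \<Rightarrow> 'k fls vec" and i
      assume *: "\<forall>u i. (\<forall>a\<le>r. u a \<in> latt n (g \<tau>)) \<longrightarrow> (\<forall>b\<le>r. i b < I) \<longrightarrow>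
          det (mat (Suc r) (Suc r) (\<lambda>(b, a). ecoeff n (u a) (i b))) = 0"
        and "\<forall>a\<le>r. integral_vec n (w a)" "\<forall>b\<le>r. i b < I"
      then have "\<forall>a\<le>r. g \<tau> *\<^sub>v w a \<in> latt n (g \<tau>)" by (auto simp: latt_def)
      then show "det (mat (Suc r) (Suc r) (\<lambda>(b, a). ecoeff n (g \<tau> *\<^sub>v w a) (i b))) = 0"
        using *[rule_format, of "\<lambda>a. g \<tau> *\<^sub>v w a" i] \<open>\<forall>b\<le>r. i b < I\<close> by blast
    next
      fix u :: "nat \<Rightarrow> 'k fls vec" and i
      assume *: "\<forall>w i. (\<forall>a\<le>r. integral_vec n (w a)) \<longrightarrow> (\<forall>b\<le>r. i b < I) \<longrightarrow>
        det (mat (Suc r) (Suc r) (\<lambda>(b, a). ecoeff n (g \<tau> *\<^sub>v w a) (i b))) = 0"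
        and u: "\<forall>a\<le>r. u a \<in> latt n (g \<tau>)" and i: "\<forall>b\<le>r. i b < I"
      have "\<forall>a\<in>{..r}. \<exists>w. integral_vec n w \<and> u a = g \<tau> *\<^sub>v w" using u by (auto simp: latt_def)
      from bchoice[OF this] obtain w where w: "\<forall>a\<le>r. integral_vec n (w a)" "\<And>a. a \<le> r \<Longrightarrow> u a = g \<tau> *\<^sub>v w a"
        by auto
      have "mat (Suc r) (Suc r) (\<lambda>(b, a). ecoeff n (u a) (i b)) = mat (Suc r) (Suc r) (\<lambda>(b, a). ecoeff n (g \<tau> *\<^sub>v w a) (i b))"
        using w(2) by (intro eq_matI) auto
      then show "det (mat (Suc r) (Suc r) (\<lambda>(b, a). ecoeff n (u a) (i b))) = 0" using * w(1) i by simp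
    qed
    also have "\<dots> \<longleftrightarrow> (\<forall>w i. (\<forall>a\<le>r. integral_vec n (w a)) \<longrightarrow> (\<forall>b\<le>r. i b < I) \<longrightarrow>
        det (mat (Suc r) (Suc r) (\<lambda>(b, a). P (w a) (i b) (LG_coord g))) = 0)"
    proof -
      have "mat (Suc r) (Suc r) (\<lambda>(b, a). ecoeff n (g \<tau> *\<^sub>v w a) (i b)) = mat (Suc r) (Suc r) (\<lambda>(b, a). P (w a) (i b) (LG_coord g))"
        if "\<forall>a\<le>r. integral_vec n (w a)" for w i
        using that P[OF g] by (intro eq_matI) auto
      then show ?thesis by metis
    qed
    also have "\<dots> \<longleftrightarrow> (\<forall>Q\<in>S. Q (LG_coord g) = 0)" unfolding S_def by auto
    finally show ?thesis .
  qed
  show "\<exists>S \<subseteq> polyfun (LG_index d n). \<forall>g \<in> LG_bounded d n N.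
      lattice_of d n g \<in> {\<Lambda> \<in> Grass d n. card {i \<in> leads n (\<Lambda> \<tau> :: 'k fls vec set). i < I} \<le> r} \<longleftrightarrow> (\<forall>P\<in>S. P (LG_coord g) = 0)"
  proof (rule exI[of _ S], rule conjI, rule S_poly, rule ballI)
    fix g :: "nat \<Rightarrow> 'k fls mat" assume g: "g \<in> LG_bounded d n N"
    show "lattice_of d n g \<in> {\<Lambda> \<in> Grass d n. card {i \<in> leads n (\<Lambda> \<tau>). i < I} \<le> r} \<longleftrightarrow> (\<forall>P\<in>S. P (LG_coord g) = 0)"
      by (rule S_iff[OF g])
  qed
qed auto

lemma leads_add_mult:
  assumes L: "olattice n \<Lambda>" and "i \<in> leads n \<Lambda>" "0 \<le> k"
  shows "i + int n * k \<in> leads n \<Lambda>"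
proof -
  obtain w where w: "w \<in> \<Lambda>" "lead n w i" using assms(2) by (auto simp: leads_def)
  have "fls_X_intpow k \<cdot>\<^sub>v w \<in> \<Lambda>" using olatticeD(3)[OF L integers_L_X_intpow[OF assms(3)] w(1)] .
  moreover have "lead n (fls_X_intpow k \<cdot>\<^sub>v w) (i + int n * k)" by (rule lead_X_intpow[OF n w(2)])
  ultimately show ?thesis unfolding leads_def by blast
qed

lemma olattice_Grass: "\<Lambda> \<in> Grass d n \<Longrightarrow> \<tau> < d \<Longrightarrow> olattice n (\<Lambda> \<tau>)"
  using olattice_latt[OF n] by (fastforce simp: Grass_def GL_def lattice_of_eq)

end

context semimod
begin

lemma finite_A_below: "finite {i. (\<tau>, i) \<in> A \<and> i < I}"
proof -
  note sm = semi_module[unfolded semi_module_def]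
  from conjunct1[OF conjunct2[OF sm]] obtain c where "\<forall>a\<in>A. c \<le> snd a" ..
  then have "{i. (\<tau>, i) \<in> A \<and> i < I} \<subseteq> {c..<I}" by force
  then show ?thesis using finite_subset by blast
qed

text \<open>The upper bounds are closed conditions. Lower bounds are open ones, of which only
  finitely many may be imposed, and those at the elements of \<open>Ab\<close> suffice: with the
  upper bounds they force each of these to be a leading index, and adding multiples of
  \<open>n\<close> gives all of \<open>A\<close>. The counts at elements of \<open>Ab\<close> are
  positive, so subtracting 1 is a true subtraction.\<close>

lemma lead_set_eq_iff:
  assumes \<Lambda>: "\<Lambda> \<in> Grass d n"
  shows "lead_set d n \<Lambda> = A \<longleftrightarrow>
    (\<forall>\<tau><d. \<forall>I. card {i \<in> leads n (\<Lambda> \<tau>). i < I} \<le> card {i. (\<tau>, i) \<in> A \<and> i < I}) \<and>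
    (\<forall>b\<in>Ab. \<not> card {i \<in> leads n (\<Lambda> (fst b)). i < snd b + 1} \<le> card {i. (fst b, i) \<in> A \<and> i < snd b + 1} - 1)"
proof
  assume eq: "lead_set d n \<Lambda> = A"
  have leads: "leads n (\<Lambda> \<tau>) = {i. (\<tau>, i) \<in> A}" if "\<tau> < d" for \<tau>
    using that unfolding eq[symmetric] by (simp add: lead_set_def)
  have "0 < card {i. (fst b, i) \<in> A \<and> i < snd b + 1}" if "b \<in> Ab" for b
  proof -
    have "snd b \<in> {i. (fst b, i) \<in> A \<and> i < snd b + 1}" using Ab_A[OF that] by simp
    then show ?thesis unfolding card_gt_0_iff using finite_A_below by blast
  qed
  then show "(\<forall>\<tau><d. \<forall>I. card {i \<in> leads n (\<Lambda> \<tau>). i < I} \<le> card {i. (\<tau>, i) \<in> A \<and> i < I}) \<and>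
    (\<forall>b\<in>Ab. \<not> card {i \<in> leads n (\<Lambda> (fst b)). i < snd b + 1} \<le> card {i. (fst b, i) \<in> A \<and> i < snd b + 1} - 1)"
    using Ab_fst by (auto simp: leads not_le)
next
  assume *: "(\<forall>\<tau><d. \<forall>I. card {i \<in> leads n (\<Lambda> \<tau>). i < I} \<le> card {i. (\<tau>, i) \<in> A \<and> i < I}) \<and>
    (\<forall>b\<in>Ab. \<not> card {i \<in> leads n (\<Lambda> (fst b)). i < snd b + 1} \<le> card {i. (fst b, i) \<in> A \<and> i < snd b + 1} - 1)"
  have fin: "finite {i \<in> leads n (\<Lambda> \<tau>). i < I}" if "\<tau> < d" for \<tau> I
    by (rule finite_leads[OF n olattice_Grass[OF n \<Lambda> that]])
  have Ab: "snd b \<in> leads n (\<Lambda> (fst b))" if b: "b \<in> Ab" for b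
  proof (rule ccontr)
    assume "snd b \<notin> leads n (\<Lambda> (fst b))"
    then have "{i \<in> leads n (\<Lambda> (fst b)). i < snd b + 1} = {i \<in> leads n (\<Lambda> (fst b)). i < snd b}"
      by (auto simp: zless_add1_eq order.order_iff_strict)
    moreover have "{i. (fst b, i) \<in> A \<and> i < snd b + 1} = insert (snd b) {i. (fst b, i) \<in> A \<and> i < snd b}"
      using Ab_A[OF b] by (auto simp: zless_add1_eq)
    then have "card {i. (fst b, i) \<in> A \<and> i < snd b + 1} - 1 = card {i. (fst b, i) \<in> A \<and> i < snd b}"
      using finite_A_below by simp
    ultimately show False using * b Ab_fst[OF b] by auto
  qed
  have A: "i \<in> leads n (\<Lambda> \<tau>)" if "(\<tau>, i) \<in> A" for \<tau> i
  proof -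
    have \<tau>: "\<tau> < d" using A_fst[OF that] by simp
    have "res (\<tau>, i) \<in> Ab" using res_in_Ab[of "(\<tau>, i)"] \<tau> by simp
    moreover have "0 \<le> nu (\<tau>, i)" using in_A_iff[of "(\<tau>, i)"] \<tau> that by simp
    ultimately have "snd (res (\<tau>, i)) + int n * nu (\<tau>, i) \<in> leads n (\<Lambda> \<tau>)"
      using leads_add_mult[OF n olattice_Grass[OF n \<Lambda> \<tau>]] Ab by fastforce
    then show ?thesis by (simp add: snd_res)
  qed
  have "{i \<in> leads n (\<Lambda> \<tau>). i < I} = {i. (\<tau>, i) \<in> A \<and> i < I}" if "\<tau> < d" for \<tau> I
    using * A that by (intro card_seteq[symmetric] fin) auto
  then have "i \<in> leads n (\<Lambda> \<tau>) \<longleftrightarrow> (\<tau>, i) \<in> A" if "\<tau> < d" for \<tau> i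
    using that by (metis (mono_tags, lifting) mem_Collect_eq less_add_one)
  then show "lead_set d n \<Lambda> = A" using A_fst by (auto simp: lead_set_def) 
qed

lemma locally_closedin_lead_set:
  fixes T :: "(nat \<Rightarrow> 'k::field fls vec set) set"
  assumes T: "T \<subseteq> Grass d n"
  shows "locally_closedin (subtopology (Grass_topology d n) T) {\<Lambda> \<in> T. lead_set d n \<Lambda> = A}"
proof -
  define Z :: "nat \<Rightarrow> int \<Rightarrow> nat \<Rightarrow> (nat \<Rightarrow> 'k fls vec set) set" where
    "Z \<tau> I r = {\<Lambda> \<in> Grass d n. card {i \<in> leads n (\<Lambda> \<tau>). i < I} \<le> r}" for \<tau> I r
  have Z: "closedin (Grass_topology d n) (Z \<tau> I r)" if "\<tau> < d" for \<tau> I r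
    unfolding closedin_Grass_topology Z_def by (rule Grass_closed_card_leads[OF n that])
  define C where "C = Grass d n \<inter> \<Inter>{Z \<tau> I (card {i. (\<tau>, i) \<in> A \<and> i < I}) | \<tau> I. \<tau> < d}"
  define B where "B = (\<Union>b\<in>Ab. Z (fst b) (snd b + 1) (card {i. (fst b, i) \<in> A \<and> i < snd b + 1} - 1))"
  have C: "closedin (Grass_topology d n) C"
    unfolding C_def closedin_Grass_topology using Z[unfolded closedin_Grass_topology]
    by (intro Grass_closed_Inter) auto
  have "closedin (Grass_topology d n) B"
    unfolding B_def using finite_Ab Z Ab_fst by (intro closedin_Union) auto
  then have U: "openin (Grass_topology d n) (Grass d n - B)"
    by (simp add: closedin_def topspace_Grass_topology)
  have "{\<Lambda> \<in> T. lead_set d n \<Lambda> = A} = (T \<inter> (Grass d n - B)) \<inter> (T \<inter> C)"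
  proof (intro equalityI subsetI)
    fix \<Lambda> assume "\<Lambda> \<in> {\<Lambda> \<in> T. lead_set d n \<Lambda> = A}"
    then have "\<Lambda> \<in> T" "\<Lambda> \<in> Grass d n" "lead_set d n \<Lambda> = A" using T by auto
    then show "\<Lambda> \<in> (T \<inter> (Grass d n - B)) \<inter> (T \<inter> C)"
      using lead_set_eq_iff[of \<Lambda>] by (auto simp: B_def C_def Z_def)
  next
    fix \<Lambda> assume "\<Lambda> \<in> (T \<inter> (Grass d n - B)) \<inter> (T \<inter> C)"
    then have \<Lambda>: "\<Lambda> \<in> T" "\<Lambda> \<in> Grass d n" "\<Lambda> \<notin> B" "\<Lambda> \<in> C" by auto
    have "card {i \<in> leads n (\<Lambda> \<tau>). i < I} \<le> card {i. (\<tau>, i) \<in> A \<and> i < I}" if "\<tau> < d" for \<tau> I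
    proof -
      have "\<Lambda> \<in> Z \<tau> I (card {i. (\<tau>, i) \<in> A \<and> i < I})" using \<Lambda>(4) that unfolding C_def by blast
      then show ?thesis by (simp add: Z_def)
    qed
    moreover have "\<not> card {i \<in> leads n (\<Lambda> (fst b)). i < snd b + 1} \<le> card {i. (fst b, i) \<in> A \<and> i < snd b + 1} - 1"
      if "b \<in> Ab" for b
      using \<Lambda>(2,3) that by (auto simp: B_def Z_def)
    ultimately show "\<Lambda> \<in> {\<Lambda> \<in> T. lead_set d n \<Lambda> = A}" using lead_set_eq_iff[OF \<Lambda>(2)] \<Lambda>(1) by blast
  qed
  moreover have "openin (subtopology (Grass_topology d n) T) (T \<inter> (Grass d n - B))"
    using U by (auto simp: openin_subtopology)
  moreover have "closedin (subtopology (Grass_topology d n) T) (T \<inter> C)"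
    using C by (auto simp: closedin_subtopology)
  ultimately show ?thesis unfolding locally_closedin_def by blast
qed

end

section \<open>The decomposition\<close>

context strata
begin

lemma lead_set_Lam: "lead_set d n (Lam x) = A"
  using leads_Lam A_fst by (auto simp: lead_set_def)

lemma finite_smooth_stratum_coords:
  "finite_smooth_over_affine_space D (stratum_coords q d n m A \<iota> :: ((nat \<times> int) \<times> nat \<Rightarrow> 'a) set)"
proof -
  have "\<forall>w\<in>W. \<exists>eP. snd eP \<in> polyfun (earlier (snd w)) \<and>
      (\<forall>x. eps x (fst w) (snd w) = x w ^ (q ^ Suc (fst eP)) - x w + snd eP x)"
  proof
    fix w assume w: "w \<in> W"
    then have "fst w \<in> Y" using WD[of "fst w" "snd w"] by simp
    from eps_structure[OF this, of "snd w"] obtain e P where "P \<in> polyfun (earlier (snd w))"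
      "\<forall>x. eps x (fst w) (snd w) = (if (fst w, snd w) \<in> W then x (fst w, snd w) ^ (q ^ Suc e) - x (fst w, snd w) else 0) + P x"
      by blast
    then show "\<exists>eP. snd eP \<in> polyfun (earlier (snd w)) \<and>
      (\<forall>x. eps x (fst w) (snd w) = x w ^ (q ^ Suc (fst eP)) - x w + snd eP x)"
      using w by (intro exI[of _ "(e, P)"]) simp
  qed
  from bchoice[OF this] obtain eP where
    eP: "\<And>w. w \<in> W \<Longrightarrow> snd (eP w) \<in> polyfun (earlier (snd w))"
      "\<And>w x. w \<in> W \<Longrightarrow> eps x (fst w) (snd w) = x w ^ (q ^ Suc (fst (eP w))) - x w + snd (eP w) x"
    by blast
  have "finite_smooth_over_affine_space (V \<union> W)
      {x \<in> affine_space (V \<union> W). \<forall>w\<in>W. x w ^ (q ^ Suc (fst (eP w))) - x w + snd (eP w) x = 0}"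
  proof (rule finite_smooth_over_affine_space_triangular[OF finite_V finite_W VW_disjoint, of _ snd])
    fix w assume w: "w \<in> W"
    show "snd (eP w) \<in> polyfun (V \<union> {w' \<in> W. snd w' < snd w})" using eP(1)[OF w] .
    have "2 * 1 \<le> q * q ^ fst (eP w)" using q_ge_2 by (intro mult_le_mono) auto
    then show "2 \<le> q ^ Suc (fst (eP w))" by simp
    show "of_nat (q ^ Suc (fst (eP w))) = (0 :: 'a)" using of_nat_q by simp
  qed
  moreover have "{x \<in> affine_space (V \<union> W). \<forall>w\<in>W. x w ^ (q ^ Suc (fst (eP w))) - x w + snd (eP w) x = 0}
      = stratum_coords q d n m A \<iota>"
    unfolding stratum_coords_eq D_eq using eP(2) by (auto simp: split_beta)
  ultimately show ?thesis by (simp add: D_eq)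
qed

end

text \<open>\<open>\<mu> \<tau> n\<close> serves as \<open>c\<close>. For the Hodge type, \<phi> and
  \<mu> take only this value and its successor, and both have as their sum the change of the order
  of the determinant under \<gamma>\<sigma>.\<close>

lemma (in gamma_sigma_setup) ADLV_in_stratum:
  assumes \<mu>: "minuscule d n \<mu>" "\<And>\<tau>. \<tau> < d \<Longrightarrow> 0 \<le> \<mu> \<tau> n" and \<iota>: "\<iota> < d"
    and \<Lambda>: "\<Lambda> \<in> (ADLV q d n m \<mu> :: (nat \<Rightarrow> 'a fls vec set) set)"
  shows "semi_module d n m (lead_set d n \<Lambda>) \<and> Hodge_type d n m \<mu> (lead_set d n \<Lambda>)
    \<and> \<Lambda> \<in> stratum q d n m (lead_set d n \<Lambda>) \<iota>"
proof -
  obtain g h h' where g: "\<Lambda> = lattice_of d n g" "g \<in> GL d n" and h: "h \<in> KK d n" "h' \<in> KK d n"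
    and rel: "\<And>\<tau>. \<tau> < d \<Longrightarrow> minv (g \<tau>) * gamma n m \<tau> * sigma_G q d g \<tau> = h \<tau> * t_pow n \<mu> \<tau> * h' \<tau>"
    using \<Lambda> unfolding ADLV_def by blast
  have gc: "g \<tau> \<in> carrier_mat n n" "invertible_mat (g \<tau>)" if "\<tau> < d" for \<tau>
    using g(2) that by (auto simp: GL_def)
  have \<Lambda>_eq: "\<Lambda> \<tau> = latt n (g \<tau>)" if "\<tau> < d" for \<tau> using lattice_of_eq[OF that] g(1) by simp
  have dom: "\<mu> \<tau> n \<le> \<mu> \<tau> i" "\<mu> \<tau> i \<le> \<mu> \<tau> n + 1" if "\<tau> < d" "1 \<le> i" "i \<le> n" for \<tau> i
  proof -
    show "\<mu> \<tau> n \<le> \<mu> \<tau> i" using \<mu>(1) that by (auto simp: minuscule_def dominant_def)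
    have "\<mu> \<tau> i \<le> \<mu> \<tau> 1" using \<mu>(1) that by (auto simp: minuscule_def dominant_def)
    moreover have "\<mu> \<tau> 1 - \<mu> \<tau> n \<le> 1" using \<mu>(1) that by (simp only: minuscule_def)
    ultimately show "\<mu> \<tau> i \<le> \<mu> \<tau> n + 1" by simp
  qed
  have sd: "(\<tau> + 1) mod d < d" for \<tau> using d by simp
  interpret hs: hodge_strata q K d n m \<Lambda> "\<lambda>\<tau>. \<mu> \<tau> n" \<iota>
  proof
    show "olattice n (\<Lambda> \<tau>)" if "\<tau> < d" for \<tau> using olattice_latt[OF n gc[OF that]] \<Lambda>_eq[OF that] by simp
    show "0 \<le> \<mu> \<tau> n" if "\<tau> < d" for \<tau> using \<mu>(2) that .
    show "fls_X_intpow (- \<mu> \<tau> n) \<cdot>\<^sub>v gs ((\<tau> + 1) mod d) w \<in> \<Lambda> \<tau>" if "\<tau> < d" "w \<in> \<Lambda> ((\<tau> + 1) mod d)" for \<tau> w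
      using gs_divisible[OF g(2) h rel that(1), of "\<mu> \<tau> n" w] dom(1)[OF that(1)] that
      by (simp only: \<Lambda>_eq[OF that(1)] \<Lambda>_eq[OF sd])
    show "\<exists>w\<in>\<Lambda> ((\<tau> + 1) mod d). gs ((\<tau> + 1) mod d) w = fls_X_intpow (\<mu> \<tau> n + 1) \<cdot>\<^sub>v u"
      if "\<tau> < d" "u \<in> \<Lambda> \<tau>" for \<tau> u
      using gs_surj[OF g(2) h rel that(1), of "\<mu> \<tau> n + 1" u] dom(2)[OF that(1)] that
      by (simp only: \<Lambda>_eq[OF that(1)] \<Lambda>_eq[OF sd])
    show "\<iota> < d" by (rule \<iota>)
  qed
  have SM: "hs.SM = lead_set d n \<Lambda>" by (simp add: hs.SM_def lead_set_def)
  obtain x where x: "x \<in> stratum_coords q d n m hs.SM \<iota>" "\<And>\<tau>. \<tau> < d \<Longrightarrow> hs.Lam x \<tau> = \<Lambda> \<tau>"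
    using hs.ex_stratum_coords by blast
  have "hs.Lam x = \<Lambda>"
  proof
    fix \<tau>
    show "hs.Lam x \<tau> = \<Lambda> \<tau>"
      using x(2)[of \<tau>] by (cases "\<tau> < d") (simp_all add: g(1) Lambda_def lattice_of_def)
  qed
  then have "\<Lambda> \<in> stratum q d n m hs.SM \<iota>" 
    unfolding stratum_def using x(1) by (metis image_eqI)
  moreover have "Hodge_type d n m \<mu> hs.SM"
    unfolding Hodge_type_def
  proof (intro allI impI)
    fix \<tau> assume \<tau>: "\<tau> < d"
    let ?b = "hs.amin ((\<tau> + 1) mod d)"
    have b: "?b l \<in> hs.Ab" "fst (?b l) = (\<tau> + 1) mod d" "pred_d (fst (?b l)) = \<tau>" for l
      using hs.amin_in[OF sd] pred_d_Suc[OF \<tau>] by auto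
    have "\<exists>w. w \<in> \<Lambda> ((\<tau> + 1) mod d) \<and> lead n w (snd (?b l)) \<and> hs.tgs (?b l) w \<in> \<Lambda> \<tau>" for l
      using hs.phi_le_and_adapted(2)[OF b(1), of l] hs.fst_rr_pred[OF b(1), of l] b(2,3)[of l] by auto
    then obtain w where w: "\<And>l. w l \<in> \<Lambda> ((\<tau> + 1) mod d)" "\<And>l. lead n (w l) (snd (?b l))" "\<And>l. hs.tgs (?b l) (w l) \<in> \<Lambda> \<tau>"
      by metis
    have tw: "hs.tw \<tau> w l \<in> \<Lambda> \<tau>" for l using w(3) by (simp add: hs.tw_def[OF \<tau> w(2)])
    have "latt n (g ((\<tau> + 1) mod d)) = latt n (hs.cols_mat w)"
      using hs.latt_cols_w[OF \<tau> w(2) hs.lattice[OF sd] hs.leads_SM[OF sd] w(1)] \<Lambda>_eq[OF sd] by metis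
    moreover have "latt n (g \<tau>) = latt n (hs.cols_mat (hs.tw \<tau> w))"
      using hs.latt_cols_tw[OF \<tau> w(2) hs.lattice[OF \<tau>] hs.leads_SM[OF \<tau>] tw] \<Lambda>_eq[OF \<tau>] by metis
    ultimately have "fls_subdegree (det (gamma n m \<tau>) * frob q (det (g ((\<tau> + 1) mod d))))
        = fls_subdegree (det (g \<tau>)) + (\<Sum>l<n. hs.\<phi> (?b l))"
      using hs.sum_phi[OF \<tau> w(2) gc[OF sd] _ gc[OF \<tau>]] by blast
    then have "(\<Sum>i=1..n. \<mu> \<tau> i) = (\<Sum>l<n. hs.\<phi> (?b l))"
      using fls_subdegree_det_gamma[OF g(2) h rel \<tau>] by simp
    also have "\<dots> = (\<Sum>b | b \<in> hs.Ab \<and> fst b = (\<tau> + 1) mod d. hs.\<phi> b)"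
      by (rule sum.reindex_bij_betw[OF hs.bij_amin[OF sd]])
    finally have sum: "(\<Sum>i\<in>{1..n}. \<mu> \<tau> i) = (\<Sum>b | b \<in> hs.Ab \<and> fst b = (\<tau> + 1) mod d. hs.\<phi> b)" .
    show "image_mset (\<mu> \<tau>) (mset_set {1..n}) = image_mset hs.\<phi> (mset_set {b \<in> hs.Ab. fst b = (\<tau> + 1) mod d})"
    proof (rule image_mset_eq_if_two_values[of _ _ _ "\<mu> \<tau> n", OF _ _ _ _ _ sum])
      show "finite {b \<in> hs.Ab. fst b = (\<tau> + 1) mod d}" using hs.finite_Ab by simp
      show "card {1..n} = card {b \<in> hs.Ab. fst b = (\<tau> + 1) mod d}"
        using bij_betw_same_card[OF hs.bij_amin[OF sd]] by simp
      show "\<mu> \<tau> i = \<mu> \<tau> n \<or> \<mu> \<tau> i = \<mu> \<tau> n + 1" if "i \<in> {1..n}" for i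
        using dom[OF \<tau>, of i] that by auto
      show "hs.\<phi> b = \<mu> \<tau> n \<or> hs.\<phi> b = \<mu> \<tau> n + 1" if "b \<in> {b \<in> hs.Ab. fst b = (\<tau> + 1) mod d}" for b
        using hs.phi_ge[of b] hs.phi_le_and_adapted(1)[of b] that pred_d_Suc[OF \<tau>] by auto
    qed simp
  qed
  ultimately show ?thesis using hs.semi_module_SM by (simp add: SM)
qed

section \<open>The Frobenius on the algebraic closure of a finite field\<close>

lemma power_card_eq_self: "(a :: 'f::{field, finite}) ^ CARD('f) = a"
proof (cases "a = 0")
  case True
  then show ?thesis by (simp add: zero_power card_gt_0_iff)
next
  case False
  let ?U = "UNIV - {0 :: 'f}"
  \<comment> \<open>Multiplication by \<open>a\<close> permutes the nonzero elements.\<close>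
  have "(\<Prod>x\<in>?U. x) = (\<Prod>x\<in>?U. a * x)"
    using False by (intro prod.reindex_bij_witness[of _ "\<lambda>x. a * x" "\<lambda>x. x / a"]) auto
  also have "\<dots> = a ^ card ?U * (\<Prod>x\<in>?U. x)" by (simp add: prod.distrib)
  finally have "a ^ card ?U = 1" by simp
  moreover have "CARD('f) = Suc (card ?U)" by (rule card.remove) simp_all
  ultimately show ?thesis by (simp only: power_Suc mult_1_right)
qed

text \<open>The polynomial (X + 1)^q - X^q - 1 vanishes at every element of the field and has degree
  below q, so it is 0; the binomial coefficients are its coefficients. The argument avoids writing q
  as a power of a prime.\<close>

lemma of_nat_choose_card_eq_0:
  assumes i: "0 < i" "i < CARD('f::{field, finite})"
  shows "of_nat (CARD('f) choose i) = (0 :: 'f)"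
proof -
  let ?q = "CARD('f)"
  define p :: "'f poly" where "p = (\<Sum>k\<in>{0<..<?q}. monom (of_nat (?q choose k)) k)"
  have "poly p a = 0" for a
  proof -
    have "{..?q} = insert 0 (insert ?q {0<..<?q})" using i by auto
    then have "(a + 1) ^ ?q = (\<Sum>k\<in>{0<..<?q}. of_nat (?q choose k) * a ^ k) + a ^ ?q + 1"
      using i by (simp add: binomial_ring[of a 1])
    then show ?thesis by (simp add: p_def poly_sum poly_monom power_card_eq_self)
  qed
  moreover have "degree p < ?q"
    unfolding p_def using i by (intro degree_sum_less) (auto intro: le_less_trans[OF degree_monom_le])
  ultimately have "p = 0"
    using card_poly_roots_bound[of p] by fastforce
  then have "coeff p i = 0" by simp
  moreover have "coeff p i = of_nat (?q choose i)"
    using i by (simp add: p_def coeff_sum)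
  ultimately show ?thesis by simp
qed

lemma card_field_ge_2: "2 \<le> CARD('f::{field, finite})"
proof -
  have "card {0, 1 :: 'f} \<le> CARD('f)" by (rule card_mono) auto
  then show ?thesis by simp
qed

text \<open>The embedding \<open>to_ac\<close> carries the vanishing of the inner binomial
  coefficients to the closure; the first of them is q itself.\<close>

lemma of_nat_card_alg_closure: "of_nat CARD('f) = (0 :: 'f::{field, finite} alg_closure)"
  and add_power_card_alg_closure:
    "(x + y :: 'f alg_closure) ^ CARD('f) = x ^ CARD('f) + y ^ CARD('f)"
proof -
  let ?q = "CARD('f)"
  have q: "2 \<le> ?q" by (rule card_field_ge_2)
  have ch: "of_nat (?q choose k) = (0 :: 'f alg_closure)" if "0 < k" "k < ?q" for k
    using arg_cong[OF of_nat_choose_card_eq_0[OF that], of to_ac] by simp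
  show "of_nat ?q = (0 :: 'f alg_closure)" using ch[of 1] q by simp
  have "(x + y) ^ ?q = (\<Sum>k\<le>?q. of_nat (?q choose k) * x ^ k * y ^ (?q - k))" by (rule binomial_ring)
  also have "\<dots> = (\<Sum>k\<in>{0, ?q}. of_nat (?q choose k) * x ^ k * y ^ (?q - k))"
    using ch by (intro sum.mono_neutral_right) (auto simp: le_less)
  also have "\<dots> = x ^ ?q + y ^ ?q" using q by simp
  finally show "(x + y) ^ ?q = x ^ ?q + y ^ ?q" .
qed

theorem theorem0p1:
  fixes d n m \<iota> q :: nat
    and \<mu> :: "nat \<Rightarrow> nat \<Rightarrow> int"
    and Xmu :: "(nat \<Rightarrow> 'f::{field, finite} alg_closure fls vec set) set"
  assumes "q = CARD('f)"
    and "d \<ge> 1" and "n \<ge> 1" and "\<iota> < d"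
    and "Xmu = ADLV q d n m \<mu>"
    and "minuscule d n \<mu>"
    and "\<forall>\<tau><d. \<mu> \<tau> n \<ge> 0"
  shows "Xmu = (\<Union>A \<in> {A. semi_module d n m A \<and> Hodge_type d n m \<mu> A}. stratum q d n m A \<iota>)
    \<and> disjoint_family_on (\<lambda>A. stratum q d n m A \<iota> :: (nat \<Rightarrow> 'f alg_closure fls vec set) set)
        {A. semi_module d n m A \<and> Hodge_type d n m \<mu> A}
    \<and> (\<forall>A. semi_module d n m A \<and> Hodge_type d n m \<mu> A \<longrightarrow>
        locally_closedin (subtopology (Grass_topology d n) Xmu) (stratum q d n m A \<iota>)
        \<and> inj_on (Lambda q d n m A \<iota>)
            (stratum_coords q d n m A \<iota> :: ((nat \<times> int) \<times> nat \<Rightarrow> 'f alg_closure) set)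
        \<and> finite_smooth_over_affine_space (Dset d n m A \<iota>)
            (stratum_coords q d n m A \<iota> :: ((nat \<times> int) \<times> nat \<Rightarrow> 'f alg_closure) set))"
proof -
  interpret gamma_sigma_setup q "TYPE('f alg_closure)" d n m
    using card_field_ge_2[where 'f = 'f] assms(1-3)
    by unfold_locales (simp_all add: of_nat_card_alg_closure add_power_card_alg_closure)
  let ?S = "\<lambda>A. stratum q d n m A \<iota> :: (nat \<Rightarrow> 'f alg_closure fls vec set) set"
  let ?T = "{A. semi_module d n m A \<and> Hodge_type d n m \<mu> A}"
  have in_stratum: "lead_set d n \<Lambda> \<in> ?T \<and> \<Lambda> \<in> ?S (lead_set d n \<Lambda>)" if "\<Lambda> \<in> Xmu" for \<Lambda>
    using ADLV_in_stratum[OF assms(6) _ assms(4), of \<Lambda>] assms(5,7) that by auto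
  have stratum: "\<Lambda> \<in> Xmu \<and> lead_set d n \<Lambda> = A" if A: "A \<in> ?T" and \<Lambda>: "\<Lambda> \<in> ?S A" for A \<Lambda>
  proof -
    interpret strata q "TYPE('f alg_closure)" d n m A \<iota>
      using A assms(2-4) by unfold_locales auto
    obtain x where "x \<in> stratum_coords q d n m A \<iota>" "\<Lambda> = Lam x" using \<Lambda> by (auto simp: stratum_def)
    then show ?thesis using Lam_in_ADLV A lead_set_Lam assms(5) by auto
  qed
  \<comment> \<open>Each stratum is a fibre of \<open>lead_set\<close> on \<open>Xmu\<close>, which
    reduces its local closedness to a statement on leading indices.\<close>
  have eq: "?S A = {\<Lambda> \<in> Xmu. lead_set d n \<Lambda> = A}" if "A \<in> ?T" for A
    using stratum[OF that] in_stratum by blast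
  have "Xmu \<subseteq> Grass d n" unfolding assms(5) ADLV_def Grass_def by blast
  then have "locally_closedin (subtopology (Grass_topology d n) Xmu) (?S A)" if "A \<in> ?T" for A
  proof -
    interpret strata q "TYPE('f alg_closure)" d n m A \<iota>
      using that assms(2-4) by unfold_locales auto
    show ?thesis unfolding eq[OF that] by (rule locally_closedin_lead_set[OF \<open>Xmu \<subseteq> Grass d n\<close>])
  qed
  moreover have "inj_on (Lambda q d n m A \<iota>)
        (stratum_coords q d n m A \<iota> :: ((nat \<times> int) \<times> nat \<Rightarrow> 'f alg_closure) set)
      \<and> finite_smooth_over_affine_space (Dset d n m A \<iota>)
        (stratum_coords q d n m A \<iota> :: ((nat \<times> int) \<times> nat \<Rightarrow> 'f alg_closure) set)" if "A \<in> ?T" for A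
  proof -
    interpret strata q "TYPE('f alg_closure)" d n m A \<iota>
      using that assms(2-4) by unfold_locales auto
    show ?thesis using inj_on_Lambda finite_smooth_stratum_coords by blast
  qed
  moreover have "disjoint_family_on ?S ?T"
    unfolding disjoint_family_on_def using stratum by blast
  moreover have "Xmu = (\<Union>A\<in>?T. ?S A)" using stratum in_stratum by blast
  ultimately show ?thesis by blast
qed

end
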